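(* Let $f$ be a positive probability density on $\mathbb{R}$ which is $C^3$, write $g=\log f$, and assume $g'$ is Lipschitz, $\mathbb{E}_f[(f'(X)/f(X))^8]<\infty$ and $\mathbb{E}_f[(f''(X)/f(X))^4]<\infty$. Suppose $c_d\to c$ as $d\to\infty$ for some $0<c\le 1$, and fix $l>0$. Let $\mathbf{X}^d$ be the RWM-within-Gibbs chain targeting $\pi_d$ with proposal standard deviation $\sigma_d=l/\sqrt{d-1}$, started from $X^d_{0,i}=X_{0,i}$ ($1\le i\le d$), where $X_{0,1},X_{0,2},\dots$ are i.i.d. with density $f$. Let $U^d_t=X^d_{\lfloor dt\rfloor,1}$. Then, as $d\to\infty$, $U^d\Rightarrow U$ weakly in the Skorokhod space $D[0,\infty)$, where $U_0$ has density $f$ and $U$ solves the Langevin SDE $$dU_t=(h_c(l))^{1/2}\,dB_t+\tfrac12 h_c(l)\,g'(U_t)\,dt,$$ with $B$ a standard Brownian motion and $h_c(l)=2cl^2\,\Phi\!\left(-\tfrac{l\sqrt{cI}}{2}\right)$.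
   Context: $\Phi$ is the standard normal c.d.f. and $I=\mathbb{E}_f[(f'(X)/f(X))^2]=\mathbb{E}_f[g'(X)^2]$. The target is the product density $\pi_d(\mathbf{x})=\prod_{i=1}^d f(x_i)$ on $\mathbb{R}^d$. For each $d$, $c_d\in(0,1]$ with $dc_d$ an integer. RWM-within-Gibbs with proposal standard deviation $\sigma_d$: from current state $\mathbf{x}\in\mathbb{R}^d$, choose a uniformly random subset $A\subseteq\{1,\dots,d\}$ of size $dc_d$, set $\chi_i=1$ if $i\in A$ and $\chi_i=0$ otherwise, draw $Z_1,\dots,Z_d$ i.i.d. $N(0,1)$ independent of $A$, propose $Y_i=x_i+\chi_i\sigma_d Z_i$, and accept $\mathbf{Y}$ with probability $1\wedge \pi_d(\mathbf{Y})/\pi_d(\mathbf{x})$; otherwise stay at $\mathbf{x}$. $X^d_{m,i}$ denotes the $i$-th coordinate of the chain at step $m$. *)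

theory Defs
  imports "HOL-Probability.Probability"
begin

definition Phi :: "real \<Rightarrow> real" where
  "Phi x = measure (density lborel std_normal_density) {..x}"

section \<open>Skorokhod space D[0,infinity) with the Skorokhod (J1) metric (Ethier--Kurtz, Sec. 3.5)\<close>

text \<open>Paths are functions real to real; only their values on [0,infinity) matter.\<close>

definition cadlag :: "(real \<Rightarrow> real) \<Rightarrow> bool" where
  "cadlag x \<longleftrightarrow> (\<forall>t\<ge>0. continuous (at_right t) x \<and> (t > 0 \<longrightarrow> (\<exists>L. (x \<longlongrightarrow> L) (at_left t))))"

definition skor_gamma :: "(real \<Rightarrow> real) \<Rightarrow> real" where
  "skor_gamma lam = Sup {\<bar>ln ((lam s - lam t) / (s - t))\<bar> | s t. 0 \<le> t \<and> t < s}"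

text \<open>Time changes: strictly increasing continuous maps of [0,infinity) onto itself with finite gamma
  (they are then automatically Lipschitz).\<close>
definition skor_Lambda :: "(real \<Rightarrow> real) set" where
  "skor_Lambda = {lam. strict_mono_on {0..} lam \<and> continuous_on {0..} lam \<and> lam ` {0..} = {0..}
      \<and> bdd_above {\<bar>ln ((lam s - lam t) / (s - t))\<bar> | s t. 0 \<le> t \<and> t < s}}"

definition skor_du :: "(real \<Rightarrow> real) \<Rightarrow> (real \<Rightarrow> real) \<Rightarrow> (real \<Rightarrow> real) \<Rightarrow> real \<Rightarrow> real" where
  "skor_du x y lam u = Sup {min 1 \<bar>x (min t u) - y (min (lam t) u)\<bar> | t. t \<ge> 0}"

definition skor_dist :: "(real \<Rightarrow> real) \<Rightarrow> (real \<Rightarrow> real) \<Rightarrow> real" where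
  "skor_dist x y = Inf ((\<lambda>lam. max (skor_gamma lam)
        (LINT u:{0..}|lborel. exp (- u) * skor_du x y lam u)) ` skor_Lambda)"

definition skor_bounded_continuous :: "((real \<Rightarrow> real) \<Rightarrow> real) \<Rightarrow> bool" where
  "skor_bounded_continuous F \<longleftrightarrow>
     (\<exists>K. \<forall>x. cadlag x \<longrightarrow> \<bar>F x\<bar> \<le> K) \<and>
     (\<forall>x. cadlag x \<longrightarrow> (\<forall>e>0. \<exists>\<delta>>0. \<forall>y. cadlag y \<longrightarrow> skor_dist x y < \<delta> \<longrightarrow> \<bar>F y - F x\<bar> < e))"

text \<open>Coordinates are indexed 0..d-1 (coordinate 0 is the paper's coordinate 1).
  The noise for one step is (A, Z, V): A a uniform random subset of size k of {0..<d},
  Z an i.i.d. N(0,1) sequence, V uniform on [0,1] (used for the accept/reject decision).\<close>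

definition pi_d :: "(real \<Rightarrow> real) \<Rightarrow> nat \<Rightarrow> (nat \<Rightarrow> real) \<Rightarrow> real" where
  "pi_d f d x = (\<Prod>i<d. f (x i))"

definition rwg_step :: "(real \<Rightarrow> real) \<Rightarrow> nat \<Rightarrow> real \<Rightarrow> (nat \<Rightarrow> real)
     \<Rightarrow> (nat set \<times> (nat \<Rightarrow> real)) \<times> real \<Rightarrow> (nat \<Rightarrow> real)" where
  "rwg_step f d \<sigma> x noise =
     (let A = fst (fst noise); Z = snd (fst noise); V = snd noise;
          y = (\<lambda>i. if i \<in> A then x i + \<sigma> * Z i else x i)
      in if V < pi_d f d y / pi_d f d x then y else x)"

primrec rwg_chain :: "(real \<Rightarrow> real) \<Rightarrow> nat \<Rightarrow> real
     \<Rightarrow> (nat \<Rightarrow> real) \<times> (nat \<Rightarrow> (nat set \<times> (nat \<Rightarrow> real)) \<times> real) \<Rightarrow> nat \<Rightarrow> (nat \<Rightarrow> real)" where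
  "rwg_chain f d \<sigma> \<omega> 0 = fst \<omega>"
| "rwg_chain f d \<sigma> \<omega> (Suc m) = rwg_step f d \<sigma> (rwg_chain f d \<sigma> \<omega> m) (snd \<omega> m)"

definition step_noise :: "nat \<Rightarrow> nat \<Rightarrow> ((nat set \<times> (nat \<Rightarrow> real)) \<times> real) measure" where
  "step_noise d k =
     (measure_pmf (pmf_of_set {A. A \<subseteq> {..<d} \<and> card A = k})
        \<Otimes>\<^sub>M (PiM UNIV (\<lambda>i::nat. density lborel std_normal_density)))
     \<Otimes>\<^sub>M uniform_measure lborel {0..1}"

definition rwg_space :: "(real \<Rightarrow> real) \<Rightarrow> nat \<Rightarrow> nat
     \<Rightarrow> ((nat \<Rightarrow> real) \<times> (nat \<Rightarrow> (nat set \<times> (nat \<Rightarrow> real)) \<times> real)) measure" where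
  "rwg_space f d k = PiM UNIV (\<lambda>i::nat. density lborel f) \<Otimes>\<^sub>M PiM UNIV (\<lambda>m::nat. step_noise d k)"

definition U_proc :: "(real \<Rightarrow> real) \<Rightarrow> nat \<Rightarrow> real
     \<Rightarrow> (nat \<Rightarrow> real) \<times> (nat \<Rightarrow> (nat set \<times> (nat \<Rightarrow> real)) \<times> real) \<Rightarrow> real \<Rightarrow> real" where
  "U_proc f d \<sigma> \<omega> t = rwg_chain f d \<sigma> \<omega> (nat \<lfloor>real d * t\<rfloor>) 0"

definition std_BM :: "'b measure \<Rightarrow> ('b \<Rightarrow> real \<Rightarrow> real) \<Rightarrow> bool" where
  "std_BM N B \<longleftrightarrow>
     (\<forall>\<omega>. B \<omega> 0 = 0) \<and> (\<forall>\<omega>. continuous_on {0..} (B \<omega>)) \<and>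
     (\<forall>s t. 0 \<le> s \<longrightarrow> s < t \<longrightarrow>
        distributed N lborel (\<lambda>\<omega>. B \<omega> t - B \<omega> s) (normal_density 0 (sqrt (t - s)))) \<and>
     (\<forall>(n::nat) (ts::nat \<Rightarrow> real). 0 \<le> ts 0 \<longrightarrow> strict_mono ts \<longrightarrow>
        prob_space.indep_vars N (\<lambda>_. borel) (\<lambda>k \<omega>. B \<omega> (ts (Suc k)) - B \<omega> (ts k)) {..<n})"

end

theory Submission
  imports Defs
begin

text \<open>
  Every bounded continuous functional on the Skorokhod space is an increasing limit of functionals
  that are Lipschitz for the supremum norm on a compact time interval, so it suffices to treat
  those; tightness and the martingale problem are not needed. For such functionals the coordinate
  process is decomposed into its conditional drift and a martingale. The chain is stationary, hence
  all error terms may be averaged under the product density: there the log acceptance ratio of the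
  other moved coordinates is close in law to \<open>N(- S\<^sup>2 / 2, S\<^sup>2)\<close> with \<open>S\<^sup>2 = c l\<^sup>2 I\<close>, which gives the drift \<open>h g' / (2 d)\<close>
  and the conditional variance \<open>h / d\<close> up to \<open>o(1/d)\<close> in mean. On a coarse time grid, Gronwall's
  inequality compares the chain with the Euler scheme driven by the block increments of the
  martingale, and Lindeberg's replacement argument exchanges those increments for Gaussian ones.
  The noise of the diffusion being additive, the Euler scheme driven by Brownian increments
  converges to \<open>U\<close> path by path as the grid is refined.
\<close>

section \<open>Lipschitz functionals of cadlag paths\<close>

text \<open>The first coordinate alone is not a Markov chain: its drift and variance in one step
  depend on all coordinates and approach their limits only in mean under the product law. This
  suffices, since about d T steps with errors o(1/d) add up to o(1). Given the current point, the
  linear part of the log acceptance ratio is exactly Gaussian in the proposal noise, so laws of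
  large numbers replace a central limit theorem; the Taylor remainder averages to -S^2/2 because E
  g'' = -I. For the limiting law the mean of min(1, exp r) is 2 Phi(-S/2), twice the mean of its
  derivative: hence speed h for the variance but h/2 for the drift. That derivative jumps at 0, so
  the drift needs a mollification of width eta. In the replacement argument the functionals are
  merely Lipschitz; adding a Gaussian of small scale e makes them smooth, and the powers of 1/e are
  harmless because e is fixed before d grows. The order of choices is theta small, the number n of
  grid cells per unit time large, e small, and d to infinity last.\<close>

lemma has_bochner_integral_exp_minus:
  "has_bochner_integral lborel (\<lambda>u::real. indicator {T..} u * exp (- u)) (exp (- T))"
proof -
  have lim: "((\<lambda>u::real. - exp (- u)) \<longlongrightarrow> 0) at_top"
    by (rule tendsto_eq_intros filterlim_compose[OF exp_at_bot] filterlim_uminus_at_bot_at_top)+ auto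
  have "(\<integral>\<^sup>+u. ennreal (exp (- u)) * indicator {T..} u \<partial>lborel) = ennreal (0 - (- exp (- T)))"
    by (rule nn_integral_FTC_atLeast[where F="\<lambda>u. - exp (- u)", OF _ _ _ lim])
      (auto intro!: derivative_eq_intros)
  then have "(\<integral>\<^sup>+u. ennreal (indicator {T..} u * exp (- u)) \<partial>lborel) = ennreal (exp (- T))"
    by (simp add: ennreal_mult' ennreal_indicator mult.commute)
  then show ?thesis
    by (intro has_bochner_integral_nn_integral) auto
qed

lemma id_in_skor_Lambda: "(\<lambda>t. t) \<in> skor_Lambda" and skor_gamma_id: "skor_gamma (\<lambda>t. t) = 0"
proof -
  have *: "{\<bar>ln ((s - t) / (s - t))\<bar> | s t. 0 \<le> t \<and> t < (s::real)} = {0}"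
    by (auto, rule exI[of _ 1], rule exI[of _ 0], auto)
  show "(\<lambda>t. t) \<in> skor_Lambda"
    unfolding skor_Lambda_def mem_Collect_eq * by (auto simp: strict_mono_on_def)
  show "skor_gamma (\<lambda>t. t) = 0" unfolding skor_gamma_def * by simp
qed

lemma skor_du_le:
  assumes "\<And>t. t \<ge> 0 \<Longrightarrow> min 1 \<bar>x (min t u) - y (min (lam t) u)\<bar> \<le> b"
  shows "skor_du x y lam u \<le> b"
  unfolding skor_du_def by (rule cSup_least) (use assms in \<open>auto intro: exI[of _ 0]\<close>)

lemma skor_du_nonneg: "0 \<le> skor_du x y lam u"
proof -
  have "min 1 \<bar>x (min 0 u) - y (min (lam 0) u)\<bar> \<le> skor_du x y lam u"
    unfolding skor_du_def by (rule cSup_upper) (auto intro!: bdd_aboveI[of _ 1])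
  moreover have "0 \<le> min 1 \<bar>x (min 0 u) - y (min (lam 0) u)\<bar>" by simp
  ultimately show ?thesis by linarith
qed

text \<open>The identity, whose \<open>skor_gamma\<close> is 0, is the only time change tried in the
  infimum. Before time \<open>T\<close> the truncated distance is at most \<open>r\<close>; after it
  the truncation at 1 leaves at most the weight \<open>exp (- T)\<close>.\<close>

lemma skor_dist_le:
  assumes "0 \<le> T" "0 \<le> r" and xy: "\<And>t. t \<in> {0..T} \<Longrightarrow> \<bar>x t - y t\<bar> \<le> r"
  shows "skor_dist x y \<le> r + exp (- T)"
proof -
  let ?I = "\<lambda>lam. LINT u:{0..}|lborel. exp (- u) * skor_du x y lam u"
  have nonneg: "0 \<le> ?I lam" for lam
    unfolding set_lebesgue_integral_def
    by (rule Bochner_Integration.integral_nonneg) (simp add: skor_du_nonneg indicator_def)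
  have "skor_dist x y \<le> max (skor_gamma (\<lambda>t. t)) (?I (\<lambda>t. t))"
    unfolding skor_dist_def
    by (rule cInf_lower) (use id_in_skor_Lambda nonneg in
      \<open>auto intro!: bdd_belowI[of _ 0] simp: le_max_iff_disj\<close>)
  also have "\<dots> = ?I (\<lambda>t. t)" using nonneg by (simp add: skor_gamma_id)
  also have "\<dots> \<le> r + exp (- T)"
  proof (cases "integrable lborel (\<lambda>u::real. indicator {0..} u *\<^sub>R (exp (- u) * skor_du x y (\<lambda>t. t) u))")
    \<comment> \<open>A non-integrable function has integral 0 by convention, so this case is
      trivial and no measurability of \<open>skor_du\<close> in \<open>u\<close> has to be
      proved.\<close>
    case False
    then show ?thesis
      using assms by (simp add: set_lebesgue_integral_def not_integrable_integral_eq)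
  next
    case True
    let ?b = "\<lambda>u::real. r * (indicator {0..} u * exp (- u)) + indicator {T..} u * exp (- u)"
    have b: "has_bochner_integral lborel ?b (r * exp (- 0) + exp (- T))"
      by (intro has_bochner_integral_add has_bochner_integral_mult_right has_bochner_integral_exp_minus)
    have du: "skor_du x y (\<lambda>t. t) u \<le> r + indicator {T..} u" if "u \<ge> 0" for u
    proof (rule skor_du_le)
      fix t :: real assume t: "0 \<le> t"
      show "min 1 \<bar>x (min t u) - y (min t u)\<bar> \<le> r + indicator {T..} u"
      proof (cases "u < T")
        case True
        then have "\<bar>x (min t u) - y (min t u)\<bar> \<le> r" using t that by (intro xy) auto
        then show ?thesis using True by simp
      qed (use assms in auto)
    qed
    have "?I (\<lambda>t. t) \<le> (\<integral>u. ?b u \<partial>lborel)"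
      unfolding set_lebesgue_integral_def
    proof (rule integral_mono[OF True])
      show "integrable lborel ?b" using b by (rule integrable.intros)
      fix u :: real
      have "exp (- u) * skor_du x y (\<lambda>t. t) u \<le> exp (- u) * (r + indicator {T..} u)" if "u \<ge> 0"
        by (intro mult_left_mono du that) auto
      then show "indicator {0..} u *\<^sub>R (exp (- u) * skor_du x y (\<lambda>t. t) u) \<le> ?b u"
        using assms by (cases "u \<ge> 0") (auto simp: indicator_def algebra_simps split: if_splits)
    qed
    also have "\<dots> = r + exp (- T)" using has_bochner_integral_integral_eq[OF b] by simp
    finally show ?thesis .
  qed
  finally show ?thesis .
qed

text \<open>Locally uniform closeness implies Skorokhod closeness. This is the only consequence of
  Skorokhod continuity used below; genuine time changes do not occur again.\<close>

lemma skor_bounded_continuous_locally_uniform: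
  assumes "skor_bounded_continuous F" "cadlag x" "0 < e"
  obtains \<delta> and k :: nat where "\<delta> > 0"
    "\<And>y r. cadlag y \<Longrightarrow> 0 \<le> r \<Longrightarrow> r < \<delta> \<Longrightarrow> (\<And>t. t \<in> {0..real k} \<Longrightarrow> \<bar>x t - y t\<bar> \<le> r) \<Longrightarrow> \<bar>F y - F x\<bar> < e"
proof -
  obtain \<delta> where \<delta>: "\<delta> > 0" "\<And>y. cadlag y \<Longrightarrow> skor_dist x y < \<delta> \<Longrightarrow> \<bar>F y - F x\<bar> < e"
    using assms unfolding skor_bounded_continuous_def by blast
  have "((\<lambda>k::nat. exp (- real k)) \<longlongrightarrow> 0) sequentially"
    by (intro filterlim_compose[OF exp_at_bot] filterlim_compose[OF filterlim_uminus_at_bot_at_top]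
        filterlim_real_sequentially)
  then have "\<forall>\<^sub>F k in sequentially. exp (- real k) < \<delta> / 2"
    using \<delta>(1) by (intro order_tendstoD(2)) auto
  then obtain k where k: "exp (- real k) < \<delta> / 2" by (auto simp: eventually_sequentially)
  show thesis
  proof (rule that[of "\<delta> / 2" k])
    fix y r assume y: "cadlag y" "0 \<le> r" "r < \<delta> / 2" "\<And>t. t \<in> {0..real k} \<Longrightarrow> \<bar>x t - y t\<bar> \<le> r"
    have "skor_dist x y \<le> r + exp (- real k)" using y by (intro skor_dist_le) auto
    then show "\<bar>F y - F x\<bar> < e" using \<delta>(2) y k by fastforce
  qed (use \<delta> in auto)
qed

section \<open>Lipschitz minorants of a continuous functional\<close>

text \<open>Quantifying over every upper bound \<open>r\<close> of the difference avoids a supremum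
  over [0, T].\<close>

definition lip_func :: "real \<Rightarrow> real \<Rightarrow> nat \<Rightarrow> ((real \<Rightarrow> real) \<Rightarrow> real) \<Rightarrow> bool" where
  "lip_func K C T G \<longleftrightarrow> 0 \<le> K \<and> 0 \<le> C \<and> (\<forall>x. cadlag x \<longrightarrow> \<bar>G x\<bar> \<le> K) \<and>
     (\<forall>x y r. cadlag x \<longrightarrow> cadlag y \<longrightarrow> 0 \<le> r \<longrightarrow> (\<forall>t\<in>{0..real T}. \<bar>x t - y t\<bar> \<le> r)
        \<longrightarrow> \<bar>G x - G y\<bar> \<le> C * r)"

text \<open>The Lipschitz (Pasch-Hausdorff) envelope: the inf-convolution of \<open>F\<close> with
  \<open>k\<close> times the uniform distance on [0, k]. Slope and time window grow
  together.\<close>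

definition inf_conv :: "((real \<Rightarrow> real) \<Rightarrow> real) \<Rightarrow> nat \<Rightarrow> (real \<Rightarrow> real) \<Rightarrow> real" where
  "inf_conv F k x = Inf {F y + real k * r | y r. cadlag y \<and> 0 \<le> r \<and> (\<forall>t\<in>{0..real k}. \<bar>x t - y t\<bar> \<le> r)}"

context
  fixes F :: "(real \<Rightarrow> real) \<Rightarrow> real" and K :: real
  assumes bound: "\<And>x. cadlag x \<Longrightarrow> \<bar>F x\<bar> \<le> K"
begin

private abbreviation cand :: "nat \<Rightarrow> (real \<Rightarrow> real) \<Rightarrow> real set" where
  "cand k x \<equiv> {F y + real k * r | y r. cadlag y \<and> 0 \<le> r \<and> (\<forall>t\<in>{0..real k}. \<bar>x t - y t\<bar> \<le> r)}"

lemma cand_ge: "z \<in> cand k x \<Longrightarrow> - K \<le> z"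
proof -
  assume "z \<in> cand k x"
  then obtain y r where "z = F y + real k * r" "cadlag y" "0 \<le> r" by blast
  moreover from this have "0 \<le> real k * r" by simp
  ultimately show "- K \<le> z" using bound[of y] by linarith
qed

lemma cand_self: "cadlag x \<Longrightarrow> F x \<in> cand k x"
  by (intro CollectI exI[of _ x] exI[of _ 0]) auto

lemma bdd_below_cand: "bdd_below (cand k x)"
  by (rule bdd_belowI[of _ "- K"]) (rule cand_ge)

lemma inf_conv_le: "cadlag x \<Longrightarrow> inf_conv F k x \<le> F x"
  unfolding inf_conv_def by (intro cInf_lower bdd_below_cand cand_self)

lemma inf_conv_ge: "cadlag x \<Longrightarrow> - K \<le> inf_conv F k x"
  unfolding inf_conv_def using cand_self[of x k] by (intro cInf_greatest) (blast, rule cand_ge)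

lemma inf_conv_lip_aux:
  assumes "cadlag x" "cadlag x'" "0 \<le> s" "\<And>t. t \<in> {0..real k} \<Longrightarrow> \<bar>x t - x' t\<bar> \<le> s"
  shows "inf_conv F k x - real k * s \<le> inf_conv F k x'"
  unfolding inf_conv_def[of F k x']
proof (rule cInf_greatest)
  show "cand k x' \<noteq> {}" using cand_self assms by blast
  fix z assume "z \<in> cand k x'"
  then obtain y r where z: "z = F y + real k * r" "cadlag y" "0 \<le> r"
    "\<And>t. t \<in> {0..real k} \<Longrightarrow> \<bar>x' t - y t\<bar> \<le> r" by blast
  have "\<bar>x t - y t\<bar> \<le> r + s" if "t \<in> {0..real k}" for t
    using z(4)[OF that] assms(4)[OF that] by linarith
  then have "F y + real k * (r + s) \<in> cand k x" using z(2,3) assms(3)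
    by (intro CollectI exI[of _ y] exI[of _ "r + s"]) auto
  then have "inf_conv F k x \<le> F y + real k * (r + s)"
    unfolding inf_conv_def by (intro cInf_lower bdd_below_cand)
  then show "inf_conv F k x - real k * s \<le> z" using z by (simp add: algebra_simps)
qed

lemma lip_func_inf_conv: "lip_func K (real k) k (inf_conv F k)"
  unfolding lip_func_def
proof (intro conjI allI impI)
  have c0: "cadlag (\<lambda>t. 0)" unfolding cadlag_def by auto
  show "0 \<le> K" using bound[OF c0] by linarith
  fix x assume "cadlag x"
  then show "\<bar>inf_conv F k x\<bar> \<le> K"
    using inf_conv_le[of x k] inf_conv_ge[of x k] bound[of x] by linarith
next
  fix x y r assume "cadlag x" "cadlag y" "0 \<le> r" "\<forall>t\<in>{0..real k}. \<bar>x t - y t\<bar> \<le> r"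
  then show "\<bar>inf_conv F k x - inf_conv F k y\<bar> \<le> real k * r"
    using inf_conv_lip_aux[of x y r k] inf_conv_lip_aux[of y x r k]
    by (simp add: abs_minus_commute)
qed simp

text \<open>A candidate \<open>y\<close> close to \<open>x\<close> has nearly the value
  \<open>F x\<close> by continuity. A distant one pays a penalty \<open>k * r\<close> that exceeds
  the oscillation \<open>2 * K\<close> of \<open>F\<close> once \<open>k\<close> is large.\<close>

lemma inf_conv_tendsto:
  assumes F: "skor_bounded_continuous F" and x: "cadlag x"
  shows "(\<lambda>k. inf_conv F k x) \<longlonglongrightarrow> F x"
proof (rule LIMSEQ_I)
  fix e :: real assume "0 < e"
  then obtain \<delta> k0 where \<delta>: "\<delta> > 0"
    "\<And>y r. cadlag y \<Longrightarrow> 0 \<le> r \<Longrightarrow> r < \<delta> \<Longrightarrow> (\<And>t. t \<in> {0..real k0} \<Longrightarrow> \<bar>x t - y t\<bar> \<le> r) \<Longrightarrow> \<bar>F y - F x\<bar> < e / 2"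
    using skor_bounded_continuous_locally_uniform[OF F x, of "e / 2"] by (metis half_gt_zero)
  obtain k1 :: nat where k1: "2 * K / \<delta> \<le> real k1" using real_arch_simple by blast
  have "\<bar>inf_conv F k x - F x\<bar> < e" if k: "k \<ge> max k0 k1" for k
  proof -
    have "F x - e / 2 \<le> inf_conv F k x" unfolding inf_conv_def
    proof (rule cInf_greatest)
      show "cand k x \<noteq> {}" using cand_self x by blast
      fix z assume "z \<in> cand k x"
      then obtain y r where z: "z = F y + real k * r" "cadlag y" "0 \<le> r"
        "\<And>t. t \<in> {0..real k} \<Longrightarrow> \<bar>x t - y t\<bar> \<le> r" by blast
      show "F x - e / 2 \<le> z"
      proof (cases "r < \<delta>")
        case True
        have "\<bar>F y - F x\<bar> < e / 2" using z k True by (intro \<delta>(2)) auto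
        moreover have "0 \<le> real k * r" using z by simp
        ultimately show ?thesis using z by linarith
      next
        case False
        have "2 * K = 2 * K / \<delta> * \<delta>" using \<delta> by simp
        also have "\<dots> \<le> real k * r" using k1 k False \<delta> by (intro mult_mono) auto
        finally show ?thesis using bound[of x] bound[of y] x z \<open>0 < e\<close> by linarith
      qed
    qed
    then show ?thesis using inf_conv_le[OF x, of k] \<open>0 < e\<close> by linarith
  qed
  then show "\<exists>no. \<forall>n\<ge>no. norm (inf_conv F n x - F x) < e" unfolding real_norm_def by blast
qed

end

lemma skor_bounded_continuous_uminus:
  assumes "skor_bounded_continuous F" shows "skor_bounded_continuous (\<lambda>x. - F x)"
proof -
  have "\<bar>- a - - b\<bar> = \<bar>a - b\<bar>" for a b :: real by simp
  then show ?thesis using assms unfolding skor_bounded_continuous_def by simp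
qed

text \<open>The minorants \<open>inf_conv F k\<close> bound the limit inferior of the expectations
  from below; applied to \<open>- F\<close> the same bound controls the limit superior. So
  approximation from one side is enough, and \<open>k\<close> is fixed before \<open>d\<close>
  grows.\<close>

proposition weak_convergence_lip_func:
  fixes M :: "nat \<Rightarrow> 'a measure" and N :: "'b measure"
    and Y :: "nat \<Rightarrow> 'a \<Rightarrow> real \<Rightarrow> real" and U :: "'b \<Rightarrow> real \<Rightarrow> real"
  assumes M: "\<forall>\<^sub>F d in sequentially. prob_space (M d)" and N: "prob_space N"
    and Y: "\<And>d \<omega>. cadlag (Y d \<omega>)" and U: "\<And>\<omega>. cadlag (U \<omega>)"
    and Y_meas: "\<And>K C T G. lip_func K C T G \<Longrightarrow>
      \<forall>\<^sub>F d in sequentially. (\<lambda>\<omega>. G (Y d \<omega>)) \<in> borel_measurable (M d)"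
    and Y_meas': "\<And>F. skor_bounded_continuous F \<Longrightarrow>
      \<forall>\<^sub>F d in sequentially. (\<lambda>\<omega>. F (Y d \<omega>)) \<in> borel_measurable (M d)"
    and U_meas: "\<And>K C T G. lip_func K C T G \<Longrightarrow> (\<lambda>\<omega>. G (U \<omega>)) \<in> borel_measurable N"
    and conv: "\<And>K C T G. lip_func K C T G \<Longrightarrow>
      (\<lambda>d. \<integral>\<omega>. G (Y d \<omega>) \<partial>M d) \<longlonglongrightarrow> (\<integral>\<omega>. G (U \<omega>) \<partial>N)"
    and F: "skor_bounded_continuous F"
  shows "(\<lambda>d. \<integral>\<omega>. F (Y d \<omega>) \<partial>M d) \<longlonglongrightarrow> (\<integral>\<omega>. F (U \<omega>) \<partial>N)"
proof -
  interpret N: prob_space N by (rule N)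
  have lower: "\<forall>\<^sub>F d in sequentially. (\<integral>\<omega>. F (U \<omega>) \<partial>N) - e < (\<integral>\<omega>. F (Y d \<omega>) \<partial>M d)"
    if F: "skor_bounded_continuous F" and e: "e > 0" for F e
  proof -
    obtain K where K: "\<And>x. cadlag x \<Longrightarrow> \<bar>F x\<bar> \<le> K"
      using F unfolding skor_bounded_continuous_def by blast
    have lip: "lip_func K (real k) k (inf_conv F k)" for k by (rule lip_func_inf_conv) (rule K)
    have absb: "\<bar>inf_conv F k x\<bar> \<le> K" if "cadlag x" for k x
      using lip[of k] that unfolding lip_func_def by blast
    have "(\<lambda>k. \<integral>\<omega>. inf_conv F k (U \<omega>) \<partial>N) \<longlonglongrightarrow> (\<integral>\<omega>. F (U \<omega>) \<partial>N)"
    proof (rule integral_dominated_convergence[where w="\<lambda>_. K"])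
      have *: "(\<lambda>k. inf_conv F k (U \<omega>)) \<longlonglongrightarrow> F (U \<omega>)" for \<omega>
        by (rule inf_conv_tendsto[OF _ F U], rule K)
      then show "AE \<omega> in N. (\<lambda>k. inf_conv F k (U \<omega>)) \<longlonglongrightarrow> F (U \<omega>)" by simp
      show "(\<lambda>\<omega>. inf_conv F k (U \<omega>)) \<in> borel_measurable N" for k by (rule U_meas[OF lip])
      then show "(\<lambda>\<omega>. F (U \<omega>)) \<in> borel_measurable N"
        by (rule borel_measurable_LIMSEQ_real[rotated]) (rule *)
    qed (use absb U in auto)
    then have "\<forall>\<^sub>F k in sequentially. (\<integral>\<omega>. F (U \<omega>) \<partial>N) - e < (\<integral>\<omega>. inf_conv F k (U \<omega>) \<partial>N)"
      using e by (intro order_tendstoD(1)) auto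
    then obtain k where k: "(\<integral>\<omega>. F (U \<omega>) \<partial>N) - e < (\<integral>\<omega>. inf_conv F k (U \<omega>) \<partial>N)"
      by (auto simp: eventually_sequentially)
    have "\<forall>\<^sub>F d in sequentially. (\<integral>\<omega>. F (U \<omega>) \<partial>N) - e < (\<integral>\<omega>. inf_conv F k (Y d \<omega>) \<partial>M d)"
      using conv[OF lip[of k]] k by (rule order_tendstoD(1))
    then show ?thesis
      using M Y_meas[OF lip[of k]] Y_meas'[OF F]
    proof eventually_elim
      case (elim d)
      interpret prob_space "M d" by (rule elim)
      have "(\<integral>\<omega>. inf_conv F k (Y d \<omega>) \<partial>M d) \<le> (\<integral>\<omega>. F (Y d \<omega>) \<partial>M d)"
        by (rule integral_mono)
          (use elim absb K Y inf_conv_le[of F K, OF K Y] in \<open>auto intro!: integrable_const_bound[where B=K]\<close>)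
      then show ?case using elim by linarith
    qed
  qed
  show ?thesis
  proof (rule LIMSEQ_I)
    fix e :: real assume e: "0 < e"
    have "\<forall>\<^sub>F d in sequentially. norm ((\<integral>\<omega>. F (Y d \<omega>) \<partial>M d) - (\<integral>\<omega>. F (U \<omega>) \<partial>N)) < e"
      using lower[OF F e] lower[OF skor_bounded_continuous_uminus[OF F] e] by eventually_elim auto
    then show "\<exists>no. \<forall>n\<ge>no. norm ((\<integral>\<omega>. F (Y n \<omega>) \<partial>M n) - (\<integral>\<omega>. F (U \<omega>) \<partial>N)) < e"
      by (simp add: eventually_sequentially)
  qed
qed

section \<open>Step paths and measurability of functionals of them\<close>

definition pth :: "nat \<Rightarrow> (nat \<Rightarrow> real) \<Rightarrow> real \<Rightarrow> real" where
  "pth n e t = e (nat \<lfloor>real n * t\<rfloor>)"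

lemma cadlag_pth: "cadlag (pth n e)"
proof (cases "n = 0")
  case True
  then show ?thesis unfolding cadlag_def pth_def by auto
next
  case False
  then have n: "real n > 0" by simp
  show ?thesis unfolding cadlag_def
  proof (intro allI impI conjI)
    fix t :: real assume t: "0 \<le> t"
    have "pth n e s = pth n e t" if "t < s" "s < (real_of_int \<lfloor>real n * t\<rfloor> + 1) / real n" for s
    proof -
      have "real n * s < real_of_int \<lfloor>real n * t\<rfloor> + 1" using that n by (simp add: field_simps)
      moreover have "real n * t < real n * s" using that n by simp
      ultimately have "\<lfloor>real n * s\<rfloor> = \<lfloor>real n * t\<rfloor>" by linarith
      then show ?thesis by (simp add: pth_def)
    qed
    moreover have "t < (real_of_int \<lfloor>real n * t\<rfloor> + 1) / real n"
      using n by (simp add: pos_less_divide_eq) (metis mult.commute real_of_int_floor_add_one_gt)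
    ultimately have "\<forall>\<^sub>F s in at_right t. pth n e s = pth n e t"
      by (auto simp: eventually_at_right_field)
    then show "continuous (at_right t) (pth n e)"
      unfolding continuous_within by (rule tendsto_eventually)
    assume "0 < t"
    let ?L = "e (nat (\<lceil>real n * t\<rceil> - 1))"
    have "pth n e s = ?L" if "s < t" "(real_of_int \<lceil>real n * t\<rceil> - 1) / real n < s" for s
    proof -
      have "real_of_int \<lceil>real n * t\<rceil> - 1 < real n * s" using that n by (simp add: field_simps)
      moreover have "real n * s < real n * t" using that n by simp
      ultimately have "\<lfloor>real n * s\<rfloor> = \<lceil>real n * t\<rceil> - 1" by linarith
      then show ?thesis by (simp add: pth_def)
    qed
    moreover have "(real_of_int \<lceil>real n * t\<rceil> - 1) / real n < t"
      using n by (simp add: pos_divide_less_eq mult.commute) linarith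
    ultimately have "\<forall>\<^sub>F s in at_left t. pth n e s = ?L"
      by (auto simp: eventually_at_left_field)
    then show "\<exists>L. (pth n e \<longlongrightarrow> L) (at_left t)"
      by (blast intro: tendsto_eventually)
  qed
qed

lemma cadlag_continuous_on: "continuous_on {0..} x \<Longrightarrow> cadlag x"
  unfolding cadlag_def
proof (intro allI impI conjI)
  fix t :: real assume c: "continuous_on {0..} x" and t: "0 \<le> t"
  then have lim: "(x \<longlongrightarrow> x t) (at t within {0..})" by (simp add: continuous_on)
  show "continuous (at_right t) x"
    unfolding continuous_within by (rule tendsto_within_subset[OF lim]) (use t in auto)
  assume "0 < t"
  then have "at t within {0..} = at t" by (intro at_within_interior) (simp add: interior_Ici[of "-1"])
  with lim show "\<exists>L. (x \<longlongrightarrow> L) (at_left t)"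
    by (auto intro!: exI[of _ "x t"] simp: filterlim_at_split)
qed

lemma eventually_nhds_fun_coords:
  fixes e :: "nat \<Rightarrow> real"
  assumes "0 < \<delta>"
  shows "\<forall>\<^sub>F e' in nhds e. \<forall>i\<le>m. \<bar>e' i - e i\<bar> < \<delta>"
proof -
  have "open ((\<lambda>e'. e' i) -` ball (e i) \<delta> :: (nat \<Rightarrow> real) set)" for i
    by (intro open_vimage continuous_on_product_coordinates) auto
  then have "open (\<Inter>i\<in>{..m}. (\<lambda>e'. e' i) -` ball (e i) \<delta> :: (nat \<Rightarrow> real) set)"
    by (intro open_INT) auto
  then show ?thesis
    unfolding eventually_nhds using assms
    by (intro exI[of _ "\<Inter>i\<in>{..m}. (\<lambda>e'. e' i) -` ball (e i) \<delta>"]) (auto simp: dist_real_def abs_minus_commute)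
qed

lemma pth_close:
  assumes "\<And>i. i \<le> n * T \<Longrightarrow> \<bar>e i - e' i\<bar> \<le> r" "t \<in> {0..real T}"
  shows "\<bar>pth n e t - pth n e' t\<bar> \<le> r"
proof -
  have "real n * t \<le> real n * real T" using assms(2) by (intro mult_left_mono) auto
  then have "nat \<lfloor>real n * t\<rfloor> \<le> n * T"
    by (metis floor_mono floor_of_nat nat_int nat_mono of_nat_mult)
  then show ?thesis unfolding pth_def by (rule assms(1))
qed

text \<open>On [0, k] a step path depends on finitely many terms of its sequence, so
  \<open>F\<close> composed with \<open>pth n\<close> is continuous for the product topology, whose
  Borel sets are those of the countable product. This avoids a sigma-algebra on the path
  space.\<close>

lemma borel_measurable_pth:
  fixes F :: "(real \<Rightarrow> real) \<Rightarrow> real"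
  assumes "\<And>x e. cadlag x \<Longrightarrow> 0 < e \<Longrightarrow> \<exists>\<delta>>0. \<exists>k::nat. \<forall>y. cadlag y \<longrightarrow> (\<forall>t\<in>{0..real k}. \<bar>x t - y t\<bar> \<le> \<delta>) \<longrightarrow> \<bar>F y - F x\<bar> < e"
  shows "(\<lambda>e. F (pth n e)) \<in> borel_measurable (PiM UNIV (\<lambda>_::nat. borel))"
proof -
  have "isCont (\<lambda>e. F (pth n e)) e" for e
    unfolding isCont_def
  proof (rule tendstoI)
    fix \<epsilon> :: real assume "0 < \<epsilon>"
    then obtain \<delta> k where \<delta>: "\<delta> > 0"
      "\<And>y. cadlag y \<Longrightarrow> (\<forall>t\<in>{0..real k}. \<bar>pth n e t - y t\<bar> \<le> \<delta>) \<Longrightarrow> \<bar>F y - F (pth n e)\<bar> < \<epsilon>"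
      using assms[OF cadlag_pth] by metis
    have "\<forall>\<^sub>F e' in nhds e. dist (F (pth n e')) (F (pth n e)) < \<epsilon>"
      using eventually_nhds_fun_coords[OF \<delta>(1), of "n * k" e]
    proof eventually_elim
      case (elim e')
      have "\<bar>F (pth n e') - F (pth n e)\<bar> < \<epsilon>"
        by (rule \<delta>(2)[OF cadlag_pth], rule ballI, rule pth_close[of n k])
          (use elim in \<open>auto simp: abs_minus_commute less_imp_le\<close>)
      then show ?case by (simp add: dist_real_def)
    qed
    then show "\<forall>\<^sub>F e' in at e. dist (F (pth n e')) (F (pth n e)) < \<epsilon>"
      by (simp add: eventually_at_filter eventually_mono)
  qed
  then have "(\<lambda>e. F (pth n e)) \<in> borel_measurable borel"
    by (intro borel_measurable_continuous_onI) (simp add: continuous_on_eq_continuous_at)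
  then show ?thesis using measurable_cong_sets[OF sets_PiM_equal_borel refl] by blast
qed

lemma borel_measurable_lip_func_pth:
  assumes G: "lip_func K C T G"
  shows "(\<lambda>e. G (pth n e)) \<in> borel_measurable (PiM UNIV (\<lambda>_::nat. borel))"
proof (rule borel_measurable_pth)
  fix x :: "real \<Rightarrow> real" and e :: real assume x: "cadlag x" "0 < e"
  have C: "0 \<le> C" using G by (simp add: lip_func_def)
  show "\<exists>\<delta>>0. \<exists>k::nat. \<forall>y. cadlag y \<longrightarrow> (\<forall>t\<in>{0..real k}. \<bar>x t - y t\<bar> \<le> \<delta>) \<longrightarrow> \<bar>G y - G x\<bar> < e"
  proof (intro exI[of _ "e / (C + 1)"] exI[of _ T] conjI allI impI)
    show pos: "0 < e / (C + 1)" using C x by simp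
    fix y assume "cadlag y" "\<forall>t\<in>{0..real T}. \<bar>x t - y t\<bar> \<le> e / (C + 1)"
    then have "\<bar>G x - G y\<bar> \<le> C * (e / (C + 1))" using G x pos unfolding lip_func_def by (meson less_imp_le)
    also have "\<dots> < e" using C x by (simp add: field_simps)
    finally show "\<bar>G y - G x\<bar> < e" by simp
  qed
qed

lemma borel_measurable_skor_pth:
  assumes F: "skor_bounded_continuous F"
  shows "(\<lambda>e. F (pth n e)) \<in> borel_measurable (PiM UNIV (\<lambda>_::nat. borel))"
proof (rule borel_measurable_pth)
  fix x :: "real \<Rightarrow> real" and e :: real assume x: "cadlag x" "0 < e"
  obtain \<delta> k where \<delta>: "\<delta> > 0"
    "\<And>y r. cadlag y \<Longrightarrow> 0 \<le> r \<Longrightarrow> r < \<delta> \<Longrightarrow> (\<And>t. t \<in> {0..real k} \<Longrightarrow> \<bar>x t - y t\<bar> \<le> r) \<Longrightarrow> \<bar>F y - F x\<bar> < e"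
    using skor_bounded_continuous_locally_uniform[OF F x] by metis
  show "\<exists>\<delta>>0. \<exists>k::nat. \<forall>y. cadlag y \<longrightarrow> (\<forall>t\<in>{0..real k}. \<bar>x t - y t\<bar> \<le> \<delta>) \<longrightarrow> \<bar>F y - F x\<bar> < e"
    by (intro exI[of _ "\<delta> / 2"] exI[of _ k] conjI allI impI \<delta>(2)[of _ "\<delta> / 2"]) (use \<delta>(1) in auto)
qed

section \<open>Gaussian integrals\<close>

abbreviation gauss :: "real measure" where "gauss \<equiv> std_normal_distribution"

interpretation std_normal: real_distribution gauss
  by (rule real_dist_normal_dist)

lemma integral_std_normal_shift:
  fixes H :: "real \<Rightarrow> real"
  assumes [measurable]: "H \<in> borel_measurable borel"
  shows "(\<integral>z. H (z + a) \<partial>gauss) = (\<integral>z. H z * exp (a * z - a\<^sup>2 / 2) \<partial>gauss)"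
    and "integrable gauss (\<lambda>z. H (z + a)) \<longleftrightarrow>
      integrable gauss (\<lambda>z. H z * exp (a * z - a\<^sup>2 / 2))"
proof -
  have *: "std_normal_density (z - a) = std_normal_density z * exp (a * z - a\<^sup>2 / 2)" for z
    by (simp add: std_normal_density_def power2_eq_square algebra_simps diff_divide_distrib add_divide_distrib flip: exp_add)
  show "(\<integral>z. H (z + a) \<partial>gauss) = (\<integral>z. H z * exp (a * z - a\<^sup>2 / 2) \<partial>gauss)"
    using lborel_integral_real_affine[of 1 "\<lambda>z. std_normal_density (z - a) * H z" a]
    by (simp add: integral_density normal_density_nonneg * ac_simps)
  show "integrable gauss (\<lambda>z. H (z + a)) \<longleftrightarrow>
      integrable gauss (\<lambda>z. H z * exp (a * z - a\<^sup>2 / 2))"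
    using lborel_integrable_real_affine_iff[of 1 "\<lambda>z. std_normal_density (z - a) * H z" a]
    by (simp add: integrable_density normal_density_nonneg * ac_simps)
qed

lemma integrable_std_normal_exp: "integrable gauss (\<lambda>z. exp (a * z))"
proof -
  have "integrable gauss (\<lambda>z. 1 * exp (a * z - a\<^sup>2 / 2))"
    using integral_std_normal_shift(2)[of "\<lambda>_. 1" a] by simp
  then have "integrable gauss (\<lambda>z. exp (a\<^sup>2 / 2) * (1 * exp (a * z - a\<^sup>2 / 2)))"
    by (rule integrable_mult_right)
  then show ?thesis by (simp flip: exp_add)
qed

lemma integral_std_normal_exp: "(\<integral>z. exp (a * z) \<partial>gauss) = exp (a\<^sup>2 / 2)"
proof -
  have "(\<integral>z. 1 * exp (a * z - a\<^sup>2 / 2) \<partial>gauss) = 1"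
    using integral_std_normal_shift(1)[of "\<lambda>_. 1" a] std_normal.prob_space by simp
  then have "exp (a\<^sup>2 / 2) * (\<integral>z. 1 * exp (a * z - a\<^sup>2 / 2) \<partial>gauss) = exp (a\<^sup>2 / 2)" by simp
  then show ?thesis by (simp flip: exp_add integral_mult_right_zero)
qed

lemma integrable_std_normal_abs_moment: "integrable gauss (\<lambda>z. \<bar>z\<bar> ^ k)"
  by (auto simp: integrable_density normal_density_nonneg integrable_std_normal_moment_abs)

lemma std_normal_moments:
  "(\<integral>z. z \<partial>gauss) = 0"
  "(\<integral>z. z\<^sup>2 \<partial>gauss) = 1"
  "integrable gauss (\<lambda>z. z)"
  "integrable gauss (\<lambda>z. z\<^sup>2)"
  "(\<integral>z. \<bar>z\<bar> \<partial>gauss) \<le> 1"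
proof -
  show "(\<integral>z. z \<partial>gauss) = 0"
    using integral_std_normal_distribution_moment_odd[of 1] by simp
  show sq: "(\<integral>z. z\<^sup>2 \<partial>gauss) = 1"
    using std_normal_distribution_even_moments(1)[of 1] by simp
  show "integrable gauss (\<lambda>z. z)"
    using integrable_std_normal_distribution_moment[of 1] by simp
  show i2: "integrable gauss (\<lambda>z. z\<^sup>2)"
    by (rule integrable_std_normal_distribution_moment)
  have "(\<integral>z. \<bar>z\<bar> \<partial>gauss) \<le> (\<integral>z. (1 + z\<^sup>2) / 2 \<partial>gauss)"
  proof (rule integral_mono)
    fix z :: real
    have "0 \<le> (\<bar>z\<bar> - 1)\<^sup>2" by simp
    then show "\<bar>z\<bar> \<le> (1 + z\<^sup>2) / 2" by (simp add: power2_eq_square algebra_simps)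
  qed (use integrable_std_normal_abs_moment[of 1] i2 in auto)
  also have "\<dots> = 1" using i2 sq std_normal.prob_space by simp
  finally show "(\<integral>z. \<bar>z\<bar> \<partial>gauss) \<le> 1" .
qed

section \<open>Gaussian smoothing of bounded functions\<close>

text \<open>The exponential generates the Hermite polynomials in \<open>a\<close> and is expanded
  here to second order. Its third derivative at \<open>t\<close> is the exponential times
  \<open>(z - t)^3 - 3 * (z - t)\<close>, which stays below 24 exp(2 |z|) for |t| at most 1;
  division by 3! leaves the factor 4. The envelope has explicit Gaussian integrals.\<close>

lemma exp_quadratic_taylor:
  fixes a z :: real
  assumes "\<bar>a\<bar> \<le> 1"
  shows "\<bar>exp (a * z - a\<^sup>2 / 2) - 1 - a * z - a\<^sup>2 / 2 * (z\<^sup>2 - 1)\<bar> \<le> \<bar>a\<bar>^3 * (4 * (exp (2 * z) + exp (- 2 * z)))"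
proof -
  let ?p = "\<lambda>t. exp (t * z - t\<^sup>2 / 2)"
  define diff :: "nat \<Rightarrow> real \<Rightarrow> real" where "diff m = (if m = 0 then ?p else if m = 1 then (\<lambda>t. (z - t) * ?p t)
    else if m = 2 then (\<lambda>t. ((z - t)\<^sup>2 - 1) * ?p t) else (\<lambda>t. ((z - t)^3 - 3 * (z - t)) * ?p t))" for m
  have D: "(diff m has_real_derivative diff (Suc m) x) (at x)" if "m < 3" for m x
  proof -
    consider "m = 0" | "m = 1" | "m = 2" using \<open>m < 3\<close> by linarith
    then show ?thesis
    proof cases
      case 1
      then show ?thesis unfolding diff_def by (auto intro!: derivative_eq_intros simp: algebra_simps)
    next
      case 2
      then show ?thesis unfolding diff_def
        by (auto intro!: derivative_eq_intros simp: algebra_simps power2_eq_square)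
    next
      case 3
      then show ?thesis unfolding diff_def
        by (auto intro!: derivative_eq_intros simp: algebra_simps power2_eq_square power3_eq_cube)
    qed
  qed
  have "\<exists>t. \<bar>t\<bar> \<le> \<bar>a\<bar> \<and> ?p a = (\<Sum>m<3. diff m 0 / fact m * a ^ m) + diff 3 t / fact 3 * a ^ 3"
    using Maclaurin_bi_le[of diff ?p 3 a] D by (auto simp: diff_def)
  then obtain t where t: "\<bar>t\<bar> \<le> \<bar>a\<bar>"
    and eq: "?p a = (\<Sum>m<3. diff m 0 / fact m * a ^ m) + diff 3 t / fact 3 * a ^ 3" by blast
  have "(\<Sum>m<3. diff m 0 / fact m * a ^ m) = 1 + a * z + a\<^sup>2 / 2 * (z\<^sup>2 - 1)"
    by (simp add: numeral_3_eq_3 diff_def power2_eq_square)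
  then have "?p a - 1 - a * z - a\<^sup>2 / 2 * (z\<^sup>2 - 1) = diff 3 t / 6 * a ^ 3"
    using eq by (simp add: fact_numeral)
  moreover have "\<bar>diff 3 t\<bar> \<le> 6 * (4 * (exp (2 * z) + exp (- 2 * z)))"
  proof -
    define x where "x = \<bar>z\<bar>"
    have x: "0 \<le> x" "\<bar>z - t\<bar> \<le> 1 + x" using t assms by (auto simp: x_def)
    have e1: "1 + x \<le> exp x" by (rule exp_ge_add_one_self)
    have "exp (1 + x) = exp 1 * exp x" by (simp add: exp_add)
    also have "\<dots> \<le> 3 * exp x" using exp_le by (intro mult_right_mono) auto
    finally have e2: "exp (1 + x) \<le> 3 * exp x" .
    have cube: "(1 + x)^3 \<le> 6 * exp (1 + x)"
    proof -
      have "(\<Sum>n<4. (1 + x)^n /\<^sub>R fact n) \<le> exp (1 + x)"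
        using x unfolding exp_def by (intro sum_le_suminf summable_exp_generic) auto
      then have "1 + (1 + x) + (1 + x)\<^sup>2 / 2 + (1 + x)^3 / 6 \<le> exp (1 + x)"
        by (simp add: eval_nat_numeral fact_numeral)
      moreover have "0 \<le> (1 + x)\<^sup>2 / 2" by simp
      ultimately show ?thesis using x by linarith
    qed
    have "\<bar>(z - t)^3 - 3 * (z - t)\<bar> \<le> \<bar>z - t\<bar>^3 + 3 * \<bar>z - t\<bar>"
      using abs_triangle_ineq4[of "(z - t)^3" "3 * (z - t)"] by (simp only: abs_mult power_abs abs_numeral)
    also have "\<dots> \<le> (1 + x)^3 + 3 * (1 + x)"
      using x by (intro add_mono power_mono mult_left_mono) auto
    also have "\<dots> \<le> 21 * exp x"
    proof -
      have "(1 + x)^3 \<le> 18 * exp x" by (rule order_trans[OF cube]) (use e2 in simp)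
      moreover have "3 * (1 + x) \<le> 3 * exp x" by (rule mult_left_mono[OF e1]) simp
      ultimately show ?thesis by linarith
    qed
    finally have f1: "\<bar>(z - t)^3 - 3 * (z - t)\<bar> \<le> 21 * exp x" .
    have "t * z \<le> \<bar>t\<bar> * \<bar>z\<bar>" by (metis abs_ge_self abs_mult)
    also have "\<dots> \<le> 1 * x" unfolding x_def using t assms by (intro mult_right_mono) auto
    finally have f2: "?p t \<le> exp x" unfolding exp_le_cancel_iff using zero_le_power2[of t] by linarith
    have "\<bar>diff 3 t\<bar> \<le> 21 * exp x * exp x"
      unfolding diff_def using f1 f2 by (simp add: abs_mult mult_mono)
    also have "\<dots> \<le> 24 * exp (2 * x)" by (simp add: mult_exp_exp)
    also have "exp (2 * x) \<le> exp (2 * z) + exp (- 2 * z)"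
      by (cases "z \<ge> 0") (auto simp: x_def)
    finally show ?thesis by simp
  qed
  ultimately have le: "\<bar>?p a - 1 - a * z - a\<^sup>2 / 2 * (z\<^sup>2 - 1)\<bar> \<le> (6 * E) / 6 * \<bar>a\<bar>^3"
    if "E = 4 * (exp (2 * z) + exp (- 2 * z))" for E
    unfolding that by (simp only: abs_mult abs_divide power_abs) (intro mult_right_mono divide_right_mono, auto)
  have "\<bar>?p a - 1 - a * z - a\<^sup>2 / 2 * (z\<^sup>2 - 1)\<bar> \<le> \<bar>a\<bar>^3 * E"
    if "E = 4 * (exp (2 * z) + exp (- 2 * z))" for E
    using le[OF that] by (simp add: mult.commute)
  then show ?thesis by blast
qed

lemma integrable_std_normal_bounded_mult:
  fixes H w :: "real \<Rightarrow> real"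
  assumes [measurable]: "H \<in> borel_measurable borel" "integrable gauss w"
    and "\<And>y. \<bar>H y\<bar> \<le> K"
  shows "integrable gauss (\<lambda>z. H (y + z) * w z)"
    and "\<bar>\<integral>z. H (y + z) * w z \<partial>gauss\<bar> \<le> K * (\<integral>z. \<bar>w z\<bar> \<partial>gauss)"
proof -
  have [measurable]: "w \<in> borel_measurable borel" using assms(2) borel_measurable_integrable by fastforce
  have le: "\<bar>H (y + z) * w z\<bar> \<le> K * \<bar>w z\<bar>" for z
    by (simp add: abs_mult assms mult_right_mono)
  show int: "integrable gauss (\<lambda>z. H (y + z) * w z)"
    by (rule Bochner_Integration.integrable_bound[where f="\<lambda>z. K * \<bar>w z\<bar>"])
      (use assms le in \<open>auto intro!: AE_I2 order_trans[OF le]\<close>)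
  have "\<bar>\<integral>z. H (y + z) * w z \<partial>gauss\<bar> \<le> (\<integral>z. \<bar>H (y + z) * w z\<bar> \<partial>gauss)"
    by (rule integral_abs_bound)
  also have "\<dots> \<le> (\<integral>z. K * \<bar>w z\<bar> \<partial>gauss)"
    by (intro integral_mono) (use int assms le in auto)
  finally show "\<bar>\<integral>z. H (y + z) * w z \<partial>gauss\<bar> \<le> K * (\<integral>z. \<bar>w z\<bar> \<partial>gauss)"
    by simp
qed

text \<open>Shifting the argument of \<open>H\<close> can be moved onto the Gaussian density (Cameron--Martin), so the smoothing of a
  merely bounded \<open>H\<close> is smooth, with the Hermite polynomials giving its derivatives.\<close>

definition gauss_smooth :: "(real \<Rightarrow> real) \<Rightarrow> real \<Rightarrow> real" where
  "gauss_smooth H y = (\<integral>z. H (y + z) \<partial>gauss)"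
definition gauss_smooth1 :: "(real \<Rightarrow> real) \<Rightarrow> real \<Rightarrow> real" where
  "gauss_smooth1 H y = (\<integral>z. H (y + z) * z \<partial>gauss)"
definition gauss_smooth2 :: "(real \<Rightarrow> real) \<Rightarrow> real \<Rightarrow> real" where
  "gauss_smooth2 H y = (\<integral>z. H (y + z) * (z\<^sup>2 - 1) \<partial>gauss)"

text \<open>Only the density is expanded, so a bounded measurable \<open>H\<close> suffices. The
  constant \<open>8 * exp 2\<close> is the Gaussian integral of
  \<open>4 * (exp (2 * z) + exp (- 2 * z))\<close>.\<close>

lemma gauss_smooth_taylor:
  assumes H[measurable]: "H \<in> borel_measurable borel" and K: "\<And>y. \<bar>H y\<bar> \<le> K"
  shows "\<bar>gauss_smooth H y\<bar> \<le> K" "\<bar>gauss_smooth1 H y\<bar> \<le> K" "\<bar>gauss_smooth2 H y\<bar> \<le> 2 * K"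
    and "\<bar>gauss_smooth H (y + a) - gauss_smooth H y - a * gauss_smooth1 H y - a\<^sup>2 / 2 * gauss_smooth2 H y\<bar>
      \<le> 8 * exp 2 * K * \<bar>a\<bar>^3"
proof -
  note m = std_normal_moments and bm = integrable_std_normal_bounded_mult[OF H _ K]
  have K0: "0 \<le> K" using K[of 0] by linarith
  have c1: "integrable gauss (\<lambda>_. 1)" by simp
  have c3: "integrable gauss (\<lambda>z. z\<^sup>2 - 1)" using m(4) by simp
  show b0: "\<bar>gauss_smooth H y\<bar> \<le> K" for y
    using bm(2)[OF c1, of y] std_normal.prob_space by (simp add: gauss_smooth_def)
  have "\<bar>gauss_smooth1 H y\<bar> \<le> K * (\<integral>z. \<bar>z\<bar> \<partial>gauss)"
    unfolding gauss_smooth1_def by (rule bm(2)[OF m(3)])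
  also have "\<dots> \<le> K * 1" using m(5) K0 by (intro mult_left_mono) auto
  finally show b1: "\<bar>gauss_smooth1 H y\<bar> \<le> K" by simp
  have "\<bar>gauss_smooth2 H y\<bar> \<le> K * (\<integral>z. \<bar>z\<^sup>2 - 1\<bar> \<partial>gauss)"
    unfolding gauss_smooth2_def by (rule bm(2)[OF c3])
  also have "(\<integral>z. \<bar>z\<^sup>2 - 1\<bar> \<partial>gauss) \<le> (\<integral>z. z\<^sup>2 + 1 \<partial>gauss)"
    by (intro integral_mono) (use c3 m(4) in \<open>auto simp: abs_le_iff\<close>)
  also have "\<dots> = 2" using m std_normal.prob_space by simp
  finally show b2: "\<bar>gauss_smooth2 H y\<bar> \<le> 2 * K" using K0 by (simp add: mult_left_mono)
  let ?a3 = "\<bar>a\<bar>^3"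
  show "\<bar>gauss_smooth H (y + a) - gauss_smooth H y - a * gauss_smooth1 H y - a\<^sup>2 / 2 * gauss_smooth2 H y\<bar>
      \<le> 8 * exp 2 * K * ?a3"
  \<comment> \<open>The expansion of the density covers |a| at most 1. For larger |a| all lower
    powers are below |a|^3 and the crude bounds on the single terms suffice.\<close>
  proof (cases "\<bar>a\<bar> \<le> 1")
    case False
    have "\<bar>gauss_smooth H (y + a) - gauss_smooth H y - a * gauss_smooth1 H y - a\<^sup>2 / 2 * gauss_smooth2 H y\<bar>
      \<le> K + K + \<bar>a * gauss_smooth1 H y\<bar> + \<bar>a\<^sup>2 / 2 * gauss_smooth2 H y\<bar>"
      using b0[of y] b0[of "y + a"] by linarith
    also have "\<bar>a * gauss_smooth1 H y\<bar> \<le> \<bar>a\<bar> * K" unfolding abs_mult by (intro mult_left_mono b1) auto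
    also have "\<bar>a\<^sup>2 / 2 * gauss_smooth2 H y\<bar> \<le> a\<^sup>2 / 2 * (2 * K)"
      unfolding abs_mult by (rule mult_mono) (use b2 in auto)
    also have "K + K + \<bar>a\<bar> * K + a\<^sup>2 / 2 * (2 * K) = K * (2 + \<bar>a\<bar> + \<bar>a\<bar>^2)" by (simp add: algebra_simps)
    also have "\<dots> \<le> K * (4 * ?a3)"
    proof (rule mult_left_mono[OF _ K0])
      have "1 \<le> ?a3" "\<bar>a\<bar>^1 \<le> ?a3" "\<bar>a\<bar>^2 \<le> ?a3"
        using False power_increasing[of 0 3 "\<bar>a\<bar>"] power_increasing[of 1 3 "\<bar>a\<bar>"]
          power_increasing[of 2 3 "\<bar>a\<bar>"] by (simp_all del: power2_abs)
      then show "2 + \<bar>a\<bar> + \<bar>a\<bar>^2 \<le> 4 * ?a3" by simp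
    qed
    also have "\<dots> = 4 * (K * ?a3)" by simp
    also have "\<dots> \<le> (8 * exp 2) * (K * ?a3)"
      by (intro mult_right_mono) (use K0 exp_ge_add_one_self[of "2::real"] in auto)
    finally show ?thesis by (simp add: mult.assoc)
  next
    case True
    let ?e = "\<lambda>z. 4 * (exp (2 * z) + exp (- 2 * z))"
    let ?r = "\<lambda>z. exp (a * z - a\<^sup>2 / 2) - 1 - a * z - a\<^sup>2 / 2 * (z\<^sup>2 - 1)"
    have ie: "integrable gauss ?e"
      by (intro integrable_mult_right Bochner_Integration.integrable_add integrable_std_normal_exp)
    have ip: "integrable gauss (\<lambda>z. exp (a * z - a\<^sup>2 / 2))"
      unfolding exp_diff by (intro integrable_divide_zero integrable_std_normal_exp)
    have ir: "integrable gauss ?r" using ip m c3 by simp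
    have "gauss_smooth H (y + a) = (\<integral>z. H (y + z) * exp (a * z - a\<^sup>2 / 2) \<partial>gauss)"
      using integral_std_normal_shift(1)[of "\<lambda>z. H (y + z)" a] by (simp add: gauss_smooth_def ac_simps)
    then have "gauss_smooth H (y + a) - gauss_smooth H y - a * gauss_smooth1 H y - a\<^sup>2 / 2 * gauss_smooth2 H y
      = (\<integral>z. H (y + z) * exp (a * z - a\<^sup>2 / 2) \<partial>gauss) - (\<integral>z. H (y + z) * 1 \<partial>gauss)
       - (\<integral>z. a * (H (y + z) * z) \<partial>gauss)
       - (\<integral>z. a\<^sup>2 / 2 * (H (y + z) * (z\<^sup>2 - 1)) \<partial>gauss)"
      by (simp add: gauss_smooth_def gauss_smooth1_def gauss_smooth2_def)
    also have "\<dots> = (\<integral>z. H (y + z) * exp (a * z - a\<^sup>2 / 2) - H (y + z) * 1 - a * (H (y + z) * z)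
        - a\<^sup>2 / 2 * (H (y + z) * (z\<^sup>2 - 1)) \<partial>gauss)"
      by (subst Bochner_Integration.integral_diff Bochner_Integration.integral_diff,
          intro Bochner_Integration.integrable_diff integrable_mult_right bm(1) ip c1 m c3,
          intro integrable_mult_right bm(1) ip c1 m c3)+ simp
    also have "\<dots> = (\<integral>z. H (y + z) * ?r z \<partial>gauss)"
      by (intro Bochner_Integration.integral_cong) (auto simp: field_simps)
    finally have "\<bar>gauss_smooth H (y + a) - gauss_smooth H y - a * gauss_smooth1 H y - a\<^sup>2 / 2 * gauss_smooth2 H y\<bar>
      \<le> K * (\<integral>z. \<bar>?r z\<bar> \<partial>gauss)"
      using bm(2)[OF ir] by simp
    also have "\<dots> \<le> K * (\<integral>z. ?a3 * ?e z \<partial>gauss)"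
      by (intro mult_left_mono K0 integral_mono integrable_mult_right ie integrable_abs ir exp_quadratic_taylor True)
    also have "(\<integral>z. ?a3 * ?e z \<partial>gauss) = ?a3 * (4 * (exp 2 + exp 2))"
      using integrable_std_normal_exp[of 2] integrable_std_normal_exp[of "-2"]
        integral_std_normal_exp[of 2] integral_std_normal_exp[of "-2"] by simp
    finally show ?thesis by (simp add: ac_simps)
  qed
qed

text \<open>Smoothing at scale \<open>e\<close> is unit smoothing of \<open>H (e * z)\<close> read
  at \<open>y / e\<close>; the three orders therefore cost 1/e, 1/e^2 and 1/e^3.\<close>

lemma gauss_smooth_scaled_taylor:
  fixes H :: "real \<Rightarrow> real"
  assumes H[measurable]: "H \<in> borel_measurable borel" and K: "\<And>y. \<bar>H y\<bar> \<le> K" and e: "0 < e"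
  shows "\<bar>(\<integral>z. H (y + a + e * z) \<partial>gauss) - (\<integral>z. H (y + e * z) \<partial>gauss)
      - a * (gauss_smooth1 (\<lambda>z. H (e * z)) (y / e) / e) - a\<^sup>2 / 2 * (gauss_smooth2 (\<lambda>z. H (e * z)) (y / e) / e\<^sup>2)\<bar>
      \<le> 8 * exp 2 * K / e^3 * \<bar>a\<bar>^3"
proof -
  have *: "gauss_smooth (\<lambda>z. H (e * z)) (x / e) = (\<integral>z. H (x + e * z) \<partial>gauss)" for x
    using e by (simp add: gauss_smooth_def distrib_left)
  have "\<bar>gauss_smooth (\<lambda>z. H (e * z)) (y / e + a / e) - gauss_smooth (\<lambda>z. H (e * z)) (y / e)
     - a / e * gauss_smooth1 (\<lambda>z. H (e * z)) (y / e) - (a / e)\<^sup>2 / 2 * gauss_smooth2 (\<lambda>z. H (e * z)) (y / e)\<bar>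
     \<le> 8 * exp 2 * K * \<bar>a / e\<bar>^3"
    by (rule gauss_smooth_taylor(4)) (use K in auto)
  then show ?thesis
    using e by (simp add: * power_divide abs_divide flip: add_divide_distrib)
qed

section \<open>Sums of independent Gaussians\<close>

lemma distr_std_normal_add:
  "distr (gauss \<Otimes>\<^sub>M gauss) borel (\<lambda>(x, y). a * x + b * y)
    = distr gauss borel (\<lambda>z. sqrt (a\<^sup>2 + b\<^sup>2) * z)"
  (is "distr ?P _ _ = ?R")
proof (rule Levy_uniqueness)
  interpret P: pair_prob_space gauss gauss ..
  show "real_distribution (distr ?P borel (\<lambda>(x, y). a * x + b * y))"
    by (intro P.real_distribution_distr) auto
  show "real_distribution ?R" by (intro std_normal.real_distribution_distr) auto
  have ch: "char (distr gauss borel (\<lambda>z. c * z)) t = exp (- (t * c)\<^sup>2 / 2)" for c t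
  proof -
    have "char (distr gauss borel (\<lambda>z. c * z)) t = char gauss (t * c)"
      by (simp add: char_def integral_distr ac_simps)
    then show ?thesis by (simp add: char_std_normal_distribution)
  qed
  show "char (distr ?P borel (\<lambda>(x, y). a * x + b * y)) = char ?R"
  proof
    fix t
    have "char (distr ?P borel (\<lambda>(x, y). a * x + b * y)) t
      = (CLINT w|?P. iexp ((t * a) * fst w) * iexp ((t * b) * snd w))"
      by (simp add: char_def integral_distr split_beta mult_exp_exp algebra_simps)
    also have "\<dots> = (CLINT x|gauss. CLINT y|gauss. iexp ((t * a) * x) * iexp ((t * b) * y))"
      by (subst P.integral_fst'[symmetric]) (auto intro!: P.integrable_const_bound[where B=1] simp: norm_mult)
    also have "\<dots> = char gauss (t * a) * char gauss (t * b)"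
      by (simp add: char_def)
    also have "\<dots> = exp (- (t * sqrt (a\<^sup>2 + b\<^sup>2))\<^sup>2 / 2)"
      unfolding char_std_normal_distribution
      by (simp add: power_mult_distrib exp_of_real[symmetric] algebra_simps add_divide_distrib diff_divide_distrib
        del: exp_of_real flip: of_real_mult exp_add)
    also have "\<dots> = char ?R t" by (simp add: ch)
    finally show "char (distr ?P borel (\<lambda>(x, y). a * x + b * y)) t = char ?R t" .
  qed
qed

lemma integral_std_normal_add:
  fixes H :: "real \<Rightarrow> real"
  assumes H[measurable]: "H \<in> borel_measurable borel" and K: "\<And>y. \<bar>H y\<bar> \<le> K"
  shows "(\<integral>x. \<integral>y. H (a * x + b * y) \<partial>gauss \<partial>gauss)
    = (\<integral>z. H (sqrt (a\<^sup>2 + b\<^sup>2) * z) \<partial>gauss)"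
proof -
  interpret P: pair_prob_space gauss gauss ..
  have "(\<integral>x. \<integral>y. H (a * x + b * y) \<partial>gauss \<partial>gauss)
    = (\<integral>w. H (case w of (x, y) \<Rightarrow> a * x + b * y) \<partial>(gauss \<Otimes>\<^sub>M gauss))"
    by (subst P.integral_fst'[symmetric]) (use K in \<open>auto intro!: P.integrable_const_bound[where B=K]\<close>)
  also have "\<dots> = (\<integral>z. H z \<partial>distr (gauss \<Otimes>\<^sub>M gauss) borel (\<lambda>(x, y). a * x + b * y))"
    by (subst integral_distr) auto
  also have "\<dots> = (\<integral>z. H (sqrt (a\<^sup>2 + b\<^sup>2) * z) \<partial>gauss)"
    unfolding distr_std_normal_add by (subst integral_distr) auto
  finally show ?thesis .
qed

text \<open>Used throughout in place of splitting an infinite product into one factor and the rest: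
  inductions over coordinates, independence of one coordinate from the others and conditioning on
  the past all reduce to redrawing a coordinate.\<close>

lemma PiM_resample:
  assumes "prob_space M"
  shows "distr (M \<Otimes>\<^sub>M PiM UNIV (\<lambda>_. M)) (PiM UNIV (\<lambda>_. M)) (\<lambda>(x, X). X(i := x)) = PiM UNIV (\<lambda>_. M)"
  using distr_pair_PiM_eq_PiM[of UNIV "\<lambda>_. M" i] assms by (simp add: insert_UNIV)

lemma integral_std_normal_sum:
  fixes H :: "real \<Rightarrow> real"
  assumes H[measurable]: "H \<in> borel_measurable borel" and K: "\<And>y. \<bar>H y\<bar> \<le> K" and "finite A"
  shows "(\<integral>Z. H (c + (\<Sum>i\<in>A. a i * Z i)) \<partial>PiM UNIV (\<lambda>i::nat. gauss))
    = (\<integral>z. H (c + sqrt (\<Sum>i\<in>A. (a i)\<^sup>2) * z) \<partial>gauss)"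
  using \<open>finite A\<close> H K
proof (induction A arbitrary: H c)
  case empty
  interpret prob_space "PiM UNIV (\<lambda>i::nat. gauss)"
    by (intro prob_space_PiM) (simp add: std_normal.prob_space_axioms)
  show ?case using prob_space std_normal.prob_space by simp
next
  case (insert j A)
  note [measurable] = insert.prems(1)
  let ?G = "PiM UNIV (\<lambda>i::nat. gauss)"
  interpret G: prob_space ?G
    by (intro prob_space_PiM) (simp add: std_normal.prob_space_axioms)
  interpret P: pair_prob_space gauss ?G ..
  have [measurable]: "(\<lambda>(x, X). X(j := x)) \<in> gauss \<Otimes>\<^sub>M ?G \<rightarrow>\<^sub>M ?G"
    unfolding split_beta by (rule measurable_fun_upd[where J=UNIV]) auto
  have "(\<integral>Z. H (c + (\<Sum>i\<in>insert j A. a i * Z i)) \<partial>?G)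
     = (\<integral>Z. H (c + (\<Sum>i\<in>insert j A. a i * Z i)) \<partial>distr (gauss \<Otimes>\<^sub>M ?G) ?G (\<lambda>(x, X). X(j := x)))"
    by (simp add: PiM_resample std_normal.prob_space_axioms)
  also have "\<dots> = (\<integral>w. H (c + (\<Sum>i\<in>insert j A. a i * ((snd w)(j := fst w)) i)) \<partial>(gauss \<Otimes>\<^sub>M ?G))"
    by (subst integral_distr) (auto simp: split_beta intro!: Bochner_Integration.integral_cong)
  also have "\<dots> = (\<integral>w. H (c + a j * fst w + (\<Sum>i\<in>A. a i * snd w i)) \<partial>(gauss \<Otimes>\<^sub>M ?G))"
  proof (intro Bochner_Integration.integral_cong refl arg_cong[where f=H])
    fix w :: "real \<times> (nat \<Rightarrow> real)"
    have "(\<Sum>i\<in>A. a i * ((snd w)(j := fst w)) i) = (\<Sum>i\<in>A. a i * snd w i)"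
      using insert.hyps by (intro sum.cong) auto
    then show "c + (\<Sum>i\<in>insert j A. a i * ((snd w)(j := fst w)) i) = c + a j * fst w + (\<Sum>i\<in>A. a i * snd w i)"
      using insert.hyps by simp
  qed
  also have "\<dots> = (\<integral>x. \<integral>Z. H (c + a j * x + (\<Sum>i\<in>A. a i * Z i)) \<partial>?G \<partial>gauss)"
    by (subst P.integral_fst'[symmetric])
      (use insert.prems in \<open>auto intro!: P.integrable_const_bound[where B=K]\<close>)
  also have "\<dots> = (\<integral>x. \<integral>z. H (c + (a j * x + sqrt (\<Sum>i\<in>A. (a i)\<^sup>2) * z)) \<partial>gauss \<partial>gauss)"
    by (subst insert.IH[OF insert.prems]) (simp add: add.assoc)
  also have "\<dots> = (\<integral>z. H (c + sqrt ((a j)\<^sup>2 + (sqrt (\<Sum>i\<in>A. (a i)\<^sup>2))\<^sup>2) * z) \<partial>gauss)"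
    by (rule integral_std_normal_add[where K=K and H="\<lambda>x. H (c + x)"]) (use insert.prems in auto)
  also have "(a j)\<^sup>2 + (sqrt (\<Sum>i\<in>A. (a i)\<^sup>2))\<^sup>2 = (\<Sum>i\<in>insert j A. (a i)\<^sup>2)"
    using insert.hyps by (simp add: sum_nonneg)
  finally show ?case .
qed

lemma measure_std_normal_uminus:
  assumes [measurable]: "A \<in> sets borel"
  shows "std_normal.prob {z. - z \<in> A} = std_normal.prob A"
proof -
  have sym: "std_normal_density (- z) = std_normal_density z" for z by (simp add: std_normal_density_def)
  have "(\<integral>z. indicator A (- z) \<partial>gauss) = (\<integral>z. std_normal_density z *\<^sub>R indicat_real A (- z) \<partial>lborel)"
    by (rule integral_density) (auto simp: normal_density_nonneg)
  also have "\<dots> = (\<integral>z. std_normal_density z *\<^sub>R indicat_real A z \<partial>lborel)"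
    using lborel_integral_real_affine[of "-1" "\<lambda>z. std_normal_density z * indicat_real A z" 0] by (simp add: sym)
  also have "\<dots> = (\<integral>z. indicat_real A z \<partial>gauss)"
    by (rule integral_density[symmetric]) (auto simp: normal_density_nonneg)
  finally have *: "(\<integral>z. indicator A (- z) \<partial>gauss) = (\<integral>z. indicat_real A z \<partial>gauss)" .
  have **: "(\<lambda>z. indicat_real A (- z)) = indicator {z. - z \<in> A}" by (auto simp: indicator_def)
  have "std_normal.prob {z. - z \<in> A} = (\<integral>z. indicator {z. - z \<in> A} z \<partial>gauss)" by simp
  also have "\<dots> = (\<integral>z. indicat_real A z \<partial>gauss)" using * by (simp only: **)
  also have "\<dots> = std_normal.prob A" by simp
  finally show ?thesis .
qed

lemma measure_std_normal_Iio: "std_normal.prob {..<x} = Phi x"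
proof -
  have "AE z in gauss. z \<noteq> x"
    by (subst AE_density) (auto intro: AE_mp[OF AE_lborel_singleton])
  then have "std_normal.prob {..<x} = std_normal.prob {..x}"
    by (intro std_normal.finite_measure_eq_AE) auto
  then show ?thesis by (simp add: Phi_def)
qed

lemma Phi_nonneg: "0 \<le> Phi x" by (simp add: Phi_def)

section \<open>The acceptance function and its derivative\<close>

text \<open>The argument is the log acceptance ratio; \<open>acc'\<close> is the derivative of
  \<open>acc\<close> away from the kink at 0.\<close>

definition acc :: "real \<Rightarrow> real" where "acc r = min 1 (exp r)"
definition acc' :: "real \<Rightarrow> real" where "acc' r = (if r \<le> 0 then exp r else 0)"

lemma acc_measurable[measurable]: "acc \<in> borel_measurable borel" "acc' \<in> borel_measurable borel"
  unfolding acc_def[abs_def] acc'_def[abs_def] by measurable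

lemma acc_bounds: "0 \<le> acc r" "acc r \<le> 1" "\<bar>acc r\<bar> \<le> 1" "0 \<le> acc' r" "acc' r \<le> 1" "\<bar>acc' r\<bar> \<le> 1"
  by (auto simp: acc_def acc'_def)

text \<open>Exponential tilting: the factor exp(S z - S^2/2) shifts the standard normal law by S,
  which turns the event z <= S/2 into z <= -S/2.\<close>

lemma integral_acc':
  assumes "S > 0"
  shows "(\<integral>z. acc' (S * z - S\<^sup>2 / 2) \<partial>gauss) = Phi (- S / 2)"
proof -
  have "(\<integral>z. acc' (S * z - S\<^sup>2 / 2) \<partial>gauss)
    = (\<integral>z. indicator {.. S / 2} z * exp (S * z - S\<^sup>2 / 2) \<partial>gauss)"
    using assms by (intro Bochner_Integration.integral_cong)
      (auto simp: acc'_def indicator_def field_simps power2_eq_square)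
  also have "\<dots> = (\<integral>z. indicator {.. S / 2} (z + S) \<partial>gauss)"
    by (subst integral_std_normal_shift(1)) auto
  also have "\<dots> = (\<integral>z. indicator {.. - S / 2} z \<partial>gauss)"
    by (intro Bochner_Integration.integral_cong) (auto simp: indicator_def field_simps)
  also have "\<dots> = Phi (- S / 2)" by (simp add: Phi_def)
  finally show ?thesis .
qed

text \<open>\<open>acc\<close> exceeds \<open>acc'\<close> by the indicator of a positive log ratio,
  whose probability is Phi(-S/2) again by symmetry. So the mean of \<open>acc\<close> is twice that
  of \<open>acc'\<close>, which is the balance between drift and variance in a Langevin
  diffusion.\<close>

lemma integral_acc:
  assumes "S > 0"
  shows "(\<integral>z. acc (S * z - S\<^sup>2 / 2) \<partial>gauss) = 2 * Phi (- S / 2)"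
proof -
  have "(\<integral>z. acc (S * z - S\<^sup>2 / 2) \<partial>gauss)
    = (\<integral>z. acc' (S * z - S\<^sup>2 / 2) + indicator {z. - z \<in> {..< - S / 2}} z \<partial>gauss)"
    using assms by (intro Bochner_Integration.integral_cong)
      (auto simp: acc_def acc'_def indicator_def field_simps power2_eq_square min_def)
  also have "\<dots> = Phi (- S / 2) + std_normal.prob {z. - z \<in> {..< - S / 2}}"
    by (subst Bochner_Integration.integral_add)
      (auto simp: integral_acc'[OF assms] intro!: std_normal.integrable_const_bound[where B=1] simp: acc_bounds)
  also have "std_normal.prob {z. - z \<in> {..< - S / 2}} = Phi (- S / 2)"
    by (subst measure_std_normal_uminus) (auto simp: measure_std_normal_Iio)
  finally show ?thesis by simp
qed

lemma measure_std_normal_Icc_le: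
  assumes "a \<le> b" shows "std_normal.prob {a..b} \<le> b - a"
proof -
  have "std_normal.prob {a..b} = (\<integral>z. std_normal_density z * indicator {a..b} z \<partial>lborel)"
    using integral_density[of "indicat_real {a..b}" lborel std_normal_density]
    by (simp add: normal_density_nonneg)
  also have "\<dots> \<le> (\<integral>z. indicator {a..b} z \<partial>lborel)"
  proof (rule integral_mono_AE')
    have "std_normal_density z \<le> 1" for z
    proof -
      have "1 / sqrt (2 * pi) \<le> 1" using pi_ge_two by (simp add: real_le_lsqrt)
      then have "1 / sqrt (2 * pi) * exp (- z\<^sup>2 / 2) \<le> 1 * 1" by (intro mult_mono) auto
      then show ?thesis by (simp add: std_normal_density_def)
    qed
    then show "AE z in lborel. std_normal_density z * indicator {a..b} z \<le> (indicator {a..b} z :: real)"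
      by (auto simp: indicator_def)
    have "emeasure lborel {a..b} < \<infinity>" using assms by simp
    then show "integrable lborel (indicat_real {a..b})" by (intro integrable_real_indicator) auto
  qed (auto simp: normal_density_nonneg)
  also have "\<dots> = b - a" using assms by simp
  finally show ?thesis .
qed

lemma acc_lipschitz: "\<bar>acc r - acc s\<bar> \<le> \<bar>r - s\<bar>"
proof -
  have *: "acc s - acc r \<le> s - r \<and> 0 \<le> acc s - acc r" if "r \<le> s" for r s :: real
  proof -
    have e: "exp s - exp r \<le> s - r" if "r \<le> s" "s \<le> 0" for r s :: real
    proof -
      have "exp s - exp r = exp s * (1 - exp (r - s))" by (simp add: algebra_simps flip: exp_add)
      also have "\<dots> \<le> 1 * (s - r)"
        using that exp_ge_add_one_self[of "r - s"] by (intro mult_mono) (auto simp: algebra_simps)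
      finally show ?thesis by simp
    qed
    show ?thesis using that e[of r s] e[of r 0] unfolding acc_def min_def by auto
  qed
  show ?thesis using *[of r s] *[of s r] by (cases "r \<le> s") auto
qed

lemma exp_minus_linear_bound:
  fixes x :: real shows "\<bar>exp x - 1 - x\<bar> \<le> x\<^sup>2 * exp \<bar>x\<bar>"
proof -
  have *: "exp x - 1 \<le> x * exp x" for x :: real
  proof -
    have "exp x * (1 + - x) \<le> exp x * exp (- x)" by (intro mult_left_mono exp_ge_add_one_self) auto
    also have "\<dots> = 1" by (simp add: exp_minus)
    finally show ?thesis by (simp add: algebra_simps)
  qed
  have "0 \<le> exp x - 1 - x" using exp_ge_add_one_self[of x] by linarith
  moreover have "exp x - 1 - x \<le> x\<^sup>2 * exp \<bar>x\<bar>"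
  proof (cases "x \<ge> 0")
    case True
    have "exp x - 1 - x \<le> x * (exp x - 1)" using *[of x] by (simp add: algebra_simps)
    also have "\<dots> \<le> x * (x * exp x)" using True * by (intro mult_left_mono) auto
    finally show ?thesis using True by (simp add: power2_eq_square)
  next
    case False
    have "exp x - 1 - x \<le> (- x) * (1 - exp x)" using *[of x] by (simp add: algebra_simps)
    also have "\<dots> \<le> (- x) * (- x)" using False exp_ge_add_one_self[of x] by (intro mult_left_mono; linarith)
    also have "\<dots> \<le> x\<^sup>2 * exp \<bar>x\<bar>" by (simp add: power2_eq_square mult_le_cancel_left1)
    finally show ?thesis .
  qed
  ultimately show ?thesis by simp
qed

text \<open>Linearization has a quadratic error as long as the segment from \<open>r\<close> to
  \<open>r + e\<close> avoids the kink, which |r| > |e| ensures. Nearer to 0 only the Lipschitz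
  bound is left, whence the indicator.\<close>

lemma acc_expansion:
  "\<bar>acc (r + e) - acc r - e * acc' r\<bar> \<le> e\<^sup>2 + 2 * \<bar>e\<bar> * indicator {-\<bar>e\<bar>..\<bar>e\<bar>} r"
proof -
  consider "\<bar>r\<bar> \<le> \<bar>e\<bar>" | "r < - \<bar>e\<bar>" | "r > \<bar>e\<bar>" by linarith
  then show ?thesis
  proof cases
    case 1
    have "\<bar>acc (r + e) - acc r\<bar> \<le> \<bar>e\<bar>" using acc_lipschitz[of "r + e" r] by simp
    moreover have "\<bar>e * acc' r\<bar> \<le> \<bar>e\<bar> * 1" unfolding abs_mult by (intro mult_left_mono acc_bounds) auto
    moreover have "r \<in> {-\<bar>e\<bar>..\<bar>e\<bar>}" using 1 by auto
    ultimately show ?thesis using zero_le_power2[of e] by (simp; linarith)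
  next
    case 2
    have "acc (r + e) = exp (r + e)" "acc r = exp r" "acc' r = exp r"
      using 2 by (auto simp: acc_def acc'_def)
    then have "acc (r + e) - acc r - e * acc' r = exp r * (exp e - 1 - e)"
      by (simp add: exp_add algebra_simps)
    then have "\<bar>acc (r + e) - acc r - e * acc' r\<bar> = exp r * \<bar>exp e - 1 - e\<bar>" by (simp add: abs_mult)
    \<comment> \<open>As \<open>r\<close> lies below -|e|, the factor exp r absorbs the exponential
      in the Taylor remainder.\<close>
    also have "\<dots> \<le> exp (- \<bar>e\<bar>) * (e\<^sup>2 * exp \<bar>e\<bar>)"
      using 2 by (intro mult_mono exp_minus_linear_bound) auto
    also have "\<dots> = e\<^sup>2" by (simp add: algebra_simps flip: exp_add)
    finally show ?thesis by (auto simp: indicator_def intro: order_trans)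
  next
    case 3
    then have "acc (r + e) - acc r - e * acc' r = 0" by (auto simp: acc_def acc'_def min_def)
    then show ?thesis by simp
  qed
qed

text \<open>The a.e. derivative \<open>acc'\<close> of \<open>acc\<close> jumps at 0. Its approximation \<open>acc'_lip \<eta>\<close> is Lipschitz and differs from it by at most \<open>bump \<eta>\<close>,
  which is Lipschitz too and small in mean.\<close>

definition bump :: "real \<Rightarrow> real \<Rightarrow> real" where "bump \<eta> r = max 0 (2 - \<bar>r\<bar> / \<eta>)"
definition acc'_lip :: "real \<Rightarrow> real \<Rightarrow> real" where "acc'_lip \<eta> r = min (acc r) (max 0 (- r / \<eta>))"

lemma bump_measurable[measurable]: "bump \<eta> \<in> borel_measurable borel" "acc'_lip \<eta> \<in> borel_measurable borel"
  unfolding bump_def[abs_def] acc'_lip_def[abs_def] by measurable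

lemma bump_props:
  assumes "\<eta> > 0"
  shows "0 \<le> bump \<eta> r" "\<bar>bump \<eta> r\<bar> \<le> 2" "\<bar>r\<bar> \<le> \<eta> \<Longrightarrow> 1 \<le> bump \<eta> r"
    "bump \<eta> r \<le> 2 * indicator {-2 * \<eta>..2 * \<eta>} r"
    "\<bar>bump \<eta> r - bump \<eta> s\<bar> \<le> (1 / \<eta>) * \<bar>r - s\<bar>"
    "\<bar>acc'_lip \<eta> r\<bar> \<le> 1" "\<bar>acc' r - acc'_lip \<eta> r\<bar> \<le> bump \<eta> r"
    "\<bar>acc'_lip \<eta> r - acc'_lip \<eta> s\<bar> \<le> (1 + 1 / \<eta>) * \<bar>r - s\<bar>"
proof -
  show "0 \<le> bump \<eta> r" by (simp add: bump_def)
  show "\<bar>bump \<eta> r\<bar> \<le> 2" using assms by (auto simp: bump_def)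
  show b1: "1 \<le> bump \<eta> r" if "\<bar>r\<bar> \<le> \<eta>" for r using assms that by (auto simp: bump_def field_simps max_def)
  show "bump \<eta> r \<le> 2 * indicator {-2 * \<eta>..2 * \<eta>} r"
    using assms by (auto simp: bump_def indicator_def field_simps max_def abs_if)
  have d: "\<bar>\<bar>r\<bar> / \<eta> - \<bar>s\<bar> / \<eta>\<bar> \<le> (1 / \<eta>) * \<bar>r - s\<bar>" for r s
  proof -
    have "\<bar>\<bar>r\<bar> / \<eta> - \<bar>s\<bar> / \<eta>\<bar> = \<bar>\<bar>r\<bar> - \<bar>s\<bar>\<bar> / \<eta>"
      using assms by (simp add: abs_divide flip: diff_divide_distrib)
    also have "\<dots> \<le> \<bar>r - s\<bar> / \<eta>" using assms by (intro divide_right_mono abs_triangle_ineq3) auto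
    finally show ?thesis by simp
  qed
  then show "\<bar>bump \<eta> r - bump \<eta> s\<bar> \<le> (1 / \<eta>) * \<bar>r - s\<bar>"
  proof -
    have "\<bar>max 0 (2 - a) - max 0 (2 - b)\<bar> \<le> \<bar>a - b\<bar>" for a b :: real by linarith
    then show ?thesis unfolding bump_def using d[of r s] by (rule order_trans)
  qed
  show "\<bar>acc'_lip \<eta> r\<bar> \<le> 1" using acc_bounds[of r] by (auto simp: acc'_lip_def)
  show "\<bar>acc' r - acc'_lip \<eta> r\<bar> \<le> bump \<eta> r"
  proof -
    consider "r \<le> - \<eta>" | "- \<eta> < r" "r \<le> 0" | "0 < r" by linarith
    then show ?thesis
    proof cases
      case 1
      then have "1 \<le> - r / \<eta>" using assms by (simp add: field_simps)
      then have "acc'_lip \<eta> r = acc r" using acc_bounds[of r] by (simp add: acc'_lip_def)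
      moreover have "acc r = acc' r" using 1 assms by (simp add: acc_def acc'_def)
      ultimately show ?thesis by (simp add: bump_def)
    next
      case 2
      have "0 \<le> acc'_lip \<eta> r" "acc'_lip \<eta> r \<le> 1" using acc_bounds[of r] by (auto simp: acc'_lip_def)
      then have "\<bar>acc' r - acc'_lip \<eta> r\<bar> \<le> 1" using acc_bounds[of r] by linarith
      then show ?thesis using b1[of r] 2 by linarith
    next
      case 3
      then have "- r / \<eta> \<le> 0" using assms by (simp add: field_simps)
      then have "acc'_lip \<eta> r = 0" using acc_bounds[of r] by (simp add: acc'_lip_def)
      then show ?thesis using 3 by (simp add: acc'_def bump_def)
    qed
  qed
  have "\<bar>- r / \<eta> - (- s / \<eta>)\<bar> = \<bar>s - r\<bar> / \<eta>"
    using assms by (simp add: abs_divide flip: diff_divide_distrib)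
  then have "\<bar>- r / \<eta> - (- s / \<eta>)\<bar> = (1 / \<eta>) * \<bar>r - s\<bar>" by (simp add: abs_minus_commute)
  moreover have "\<bar>acc'_lip \<eta> r - acc'_lip \<eta> s\<bar> \<le> \<bar>acc r - acc s\<bar> + \<bar>- r / \<eta> - (- s / \<eta>)\<bar>"
    unfolding acc'_lip_def by linarith
  moreover have "(1 + 1 / \<eta>) * \<bar>r - s\<bar> = \<bar>r - s\<bar> + (1 / \<eta>) * \<bar>r - s\<bar>" by (simp add: algebra_simps)
  ultimately show "\<bar>acc'_lip \<eta> r - acc'_lip \<eta> s\<bar> \<le> (1 + 1 / \<eta>) * \<bar>r - s\<bar>"
    using acc_lipschitz[of r s] by linarith
qed

text \<open>The bump is at most 2 and lives on an interval of \<open>z\<close> of length 4 eta / S,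
  where the normal density is below 1. This smallness in eta pays for replacing \<open>acc'\<close>
  by a Lipschitz function.\<close>

lemma integral_bump_le:
  assumes "\<eta> > 0" "S > 0"
  shows "(\<integral>z. bump \<eta> (S * z - S\<^sup>2 / 2) \<partial>gauss) \<le> 8 * \<eta> / S"
proof -
  let ?I = "{S / 2 - 2 * \<eta> / S..S / 2 + 2 * \<eta> / S}"
  have "(\<integral>z. bump \<eta> (S * z - S\<^sup>2 / 2) \<partial>gauss) \<le> (\<integral>z. 2 * indicator ?I z \<partial>gauss)"
  proof (rule integral_mono)
    show "integrable gauss (\<lambda>z. bump \<eta> (S * z - S\<^sup>2 / 2))"
      using bump_props[OF assms(1)] by (intro std_normal.integrable_const_bound[where B=2]) auto
    fix z
    have "S * z - S\<^sup>2 / 2 \<in> {-2 * \<eta>..2 * \<eta>} \<longleftrightarrow> z \<in> ?I"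
      using assms by (auto simp: field_simps power2_eq_square)
    then show "bump \<eta> (S * z - S\<^sup>2 / 2) \<le> 2 * indicator ?I z"
      using bump_props(4)[OF assms(1), of "S * z - S\<^sup>2 / 2"] by (simp add: indicator_def)
  next
    show "integrable gauss (\<lambda>z. 2 * indicat_real ?I z)"
      by (rule std_normal.integrable_const_bound[where B=2]) (auto simp: indicator_def)
  qed
  also have "\<dots> = 2 * std_normal.prob ?I" by simp
  also have "\<dots> \<le> 2 * ((S / 2 + 2 * \<eta> / S) - (S / 2 - 2 * \<eta> / S))"
    using assms by (intro mult_left_mono measure_std_normal_Icc_le) auto
  also have "\<dots> = 8 * \<eta> / S" by simp
  finally show ?thesis .
qed

lemma integral_std_normal_lipschitz_scale:
  fixes q :: "real \<Rightarrow> real"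
  assumes [measurable]: "q \<in> borel_measurable borel" and K: "\<And>r. \<bar>q r\<bar> \<le> K"
    and L: "\<And>r s. \<bar>q r - q s\<bar> \<le> L * \<bar>r - s\<bar>"
  shows "\<bar>(\<integral>z. q (b + s * z) \<partial>gauss) - (\<integral>z. q (b + t * z) \<partial>gauss)\<bar> \<le> L * \<bar>s - t\<bar>"
proof -
  have L0: "0 \<le> L" using L[of 1 0] by simp
  have int: "integrable gauss (\<lambda>z. q (b + s * z))" for s
    using K by (intro std_normal.integrable_const_bound[where B=K]) auto
  have "\<bar>(\<integral>z. q (b + s * z) \<partial>gauss) - (\<integral>z. q (b + t * z) \<partial>gauss)\<bar>
    = \<bar>\<integral>z. q (b + s * z) - q (b + t * z) \<partial>gauss\<bar>"
    using int by simp
  also have "\<dots> \<le> (\<integral>z. \<bar>q (b + s * z) - q (b + t * z)\<bar> \<partial>gauss)"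
    by (rule integral_abs_bound)
  also have "\<dots> \<le> (\<integral>z. L * \<bar>s - t\<bar> * \<bar>z\<bar> \<partial>gauss)"
  proof (rule integral_mono)
    fix z
    have "\<bar>q (b + s * z) - q (b + t * z)\<bar> \<le> L * \<bar>(b + s * z) - (b + t * z)\<bar>" by (rule L)
    also have "(b + s * z) - (b + t * z) = (s - t) * z" by (simp add: algebra_simps)
    finally show "\<bar>q (b + s * z) - q (b + t * z)\<bar> \<le> L * \<bar>s - t\<bar> * \<bar>z\<bar>" by (simp add: abs_mult)
  qed (use int integrable_std_normal_abs_moment[of 1] in auto)
  also have "\<dots> \<le> L * \<bar>s - t\<bar> * 1"
    using std_normal_moments(5) L0 by (simp add: mult_left_le)
  finally show ?thesis by simp
qed

section \<open>Stationary chains and Lindeberg replacement\<close>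

lemma measurable_uncurry_compose:
  assumes "(\<lambda>(a, b). H a b) \<in> A \<Otimes>\<^sub>M B \<rightarrow>\<^sub>M C" "f \<in> M \<rightarrow>\<^sub>M A" "g \<in> M \<rightarrow>\<^sub>M B"
  shows "(\<lambda>w. H (f w) (g w)) \<in> M \<rightarrow>\<^sub>M C"
  using measurable_compose[OF measurable_Pair[OF assms(2,3)] assms(1)] by simp

lemma measurable_to_PiM_UNIV:
  assumes "\<And>i. (\<lambda>w. F w i) \<in> borel_measurable M"
  shows "F \<in> M \<rightarrow>\<^sub>M PiM UNIV (\<lambda>_. borel)"
  by (rule measurable_PiM_single') (use assms in auto)

text \<open>Measurability is not asked for: a non-integrable function has integral 0 by convention,
  and the bound at one point already gives \<open>0 \<le> K\<close>.\<close>

lemma (in prob_space) abs_integral_le: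
  fixes f :: "'a \<Rightarrow> real"
  assumes "\<And>x. \<bar>f x\<bar> \<le> K"
  shows "\<bar>\<integral>x. f x \<partial>M\<bar> \<le> K"
proof (cases "integrable M f")
  case True
  have "\<bar>\<integral>x. f x \<partial>M\<bar> \<le> (\<integral>x. \<bar>f x\<bar> \<partial>M)" by (rule integral_abs_bound)
  also have "\<dots> \<le> (\<integral>x. K \<partial>M)" by (rule integral_mono) (use True assms in auto)
  finally show ?thesis using prob_space by simp
next
  case False
  have "\<bar>f undefined\<bar> \<le> K" by (rule assms)
  then show ?thesis using False by (simp add: not_integrable_integral_eq)
qed

lemma (in prob_space) abs_integral_diff_le:
  fixes f g h :: "'a \<Rightarrow> real"
  assumes "integrable M f" "integrable M g" "integrable M h"
    and "\<And>x. x \<in> space M \<Longrightarrow> \<bar>f x - g x\<bar> \<le> h x"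
  shows "\<bar>(\<integral>x. f x \<partial>M) - (\<integral>x. g x \<partial>M)\<bar> \<le> (\<integral>x. h x \<partial>M)"
proof -
  have "(\<integral>x. f x \<partial>M) - (\<integral>x. g x \<partial>M) = (\<integral>x. f x - g x \<partial>M)" using assms by simp
  then have "\<bar>(\<integral>x. f x \<partial>M) - (\<integral>x. g x \<partial>M)\<bar> \<le> (\<integral>x. \<bar>f x - g x\<bar> \<partial>M)"
    by (simp only: integral_abs_bound)
  also have "\<dots> \<le> (\<integral>x. h x \<partial>M)"
    by (rule integral_mono) (use assms in \<open>auto intro!: integrable_abs Bochner_Integration.integrable_diff simp del: integrable_abs_cancel\<close>)
  finally show ?thesis .
qed

lemma (in pair_prob_space) bounded_Fubini:
  fixes f :: "'a \<Rightarrow> 'b \<Rightarrow> real"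
  assumes f: "(\<lambda>(a, b). f a b) \<in> borel_measurable (M1 \<Otimes>\<^sub>M M2)" and K: "\<And>a b. \<bar>f a b\<bar> \<le> K"
  shows "(\<integral>a. \<integral>b. f a b \<partial>M2 \<partial>M1) = (\<integral>b. \<integral>a. f a b \<partial>M1 \<partial>M2)"
    and "(\<integral>a. \<integral>b. f a b \<partial>M2 \<partial>M1) = (\<integral>w. f (fst w) (snd w) \<partial>(M1 \<Otimes>\<^sub>M M2))"
proof -
  have int: "integrable (M1 \<Otimes>\<^sub>M M2) (\<lambda>(a, b). f a b)"
    by (rule integrable_const_bound[where B=K, OF AE_I2 f]) (use K in \<open>simp add: split_beta'\<close>)
  show "(\<integral>a. \<integral>b. f a b \<partial>M2 \<partial>M1) = (\<integral>b. \<integral>a. f a b \<partial>M1 \<partial>M2)"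
    using Fubini_integral[OF int] by simp
  show "(\<integral>a. \<integral>b. f a b \<partial>M2 \<partial>M1) = (\<integral>w. f (fst w) (snd w) \<partial>(M1 \<Otimes>\<^sub>M M2))"
    using integral_fst'[OF int] by (simp add: split_beta')
qed

lemma emeasure_distr_nn_integral:
  assumes [measurable]: "g \<in> M \<rightarrow>\<^sub>M N" "A \<in> sets N"
  shows "emeasure (distr M N g) A = (\<integral>\<^sup>+x. indicator A (g x) \<partial>M)"
  by (subst nn_integral_distr[symmetric, of g M N "indicator A"]) auto

section \<open>Chains driven by independent noise\<close>

locale stationary_chain =
  fixes P0 :: "'s measure" and V :: "'n measure" and step :: "'s \<Rightarrow> 'n \<Rightarrow> 's"
  assumes prob_P0: "prob_space P0" and prob_V: "prob_space V"
    and step_measurable[measurable]: "(\<lambda>(x, n). step x n) \<in> P0 \<Otimes>\<^sub>M V \<rightarrow>\<^sub>M P0"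
    and stationary: "distr (P0 \<Otimes>\<^sub>M V) P0 (\<lambda>(x, n). step x n) = P0"
begin

sublocale P0: prob_space P0 by (rule prob_P0)
sublocale V: prob_space V by (rule prob_V)

abbreviation noise_space :: "(nat \<Rightarrow> 'n) measure" where "noise_space \<equiv> PiM UNIV (\<lambda>_::nat. V)"

sublocale Noise: prob_space noise_space by (intro prob_space_PiM prob_V)

definition Q :: "('s \<times> (nat \<Rightarrow> 'n)) measure" where "Q = P0 \<Otimes>\<^sub>M noise_space"

sublocale PN: pair_prob_space P0 noise_space ..
sublocale Q: prob_space Q unfolding Q_def by (rule PN.prob_space_axioms)
sublocale QV: pair_prob_space Q V ..
sublocale QS: pair_prob_space Q gauss ..

primrec X :: "'s \<times> (nat \<Rightarrow> 'n) \<Rightarrow> nat \<Rightarrow> 's" where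
  "X \<omega> 0 = fst \<omega>"
| "X \<omega> (Suc k) = step (X \<omega> k) (snd \<omega> k)"

definition upd :: "'s \<times> (nat \<Rightarrow> 'n) \<Rightarrow> nat \<Rightarrow> 'n \<Rightarrow> 's \<times> (nat \<Rightarrow> 'n)" where
  "upd \<omega> k n = (fst \<omega>, (snd \<omega>)(k := n))"

text \<open>Stands in for a filtration: \<open>Y\<close> is insensitive to a change of any single
  noise variable from index \<open>k\<close> on. Such changes are all that redrawing a noise
  variable requires.\<close>

definition adapted :: "nat \<Rightarrow> ('s \<times> (nat \<Rightarrow> 'n) \<Rightarrow> 'c) \<Rightarrow> bool" where
  "adapted k Y \<longleftrightarrow> (\<forall>\<omega> n j. k \<le> j \<longrightarrow> Y (upd \<omega> j n) = Y \<omega>)"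

lemma adaptedD: "adapted k Y \<Longrightarrow> k \<le> j \<Longrightarrow> Y (upd \<omega> j n) = Y \<omega>"
  unfolding adapted_def by blast

lemma adapted_mono: "adapted k Y \<Longrightarrow> k \<le> k' \<Longrightarrow> adapted k' Y"
  by (simp add: adapted_def)

lemma snd_upd: "snd (upd \<omega> j n) i = (if i = j then n else snd \<omega> i)"
  by (simp add: upd_def)

lemma adapted_X: "adapted k (\<lambda>\<omega>. X \<omega> k)"
proof (induction k)
  case 0
  then show ?case by (simp add: adapted_def upd_def)
next
  case (Suc k)
  then show ?case by (auto simp: adapted_def snd_upd)
qed

lemma adapted_snd: "i < k \<Longrightarrow> adapted k (\<lambda>\<omega>. snd \<omega> i)"
  by (auto simp: adapted_def snd_upd)

lemma measurable_snd_Q[measurable]: "(\<lambda>\<omega>. snd \<omega> k) \<in> Q \<rightarrow>\<^sub>M V"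
  unfolding Q_def by measurable

lemma measurable_fst_Q[measurable]: "fst \<in> Q \<rightarrow>\<^sub>M P0"
  unfolding Q_def by measurable

lemma measurable_X[measurable]: "(\<lambda>\<omega>. X \<omega> k) \<in> Q \<rightarrow>\<^sub>M P0"
proof (induction k)
  case (Suc k)
  note [measurable] = Suc
  have "(\<lambda>\<omega>. (\<lambda>(x, n). step x n) (X \<omega> k, snd \<omega> k)) \<in> Q \<rightarrow>\<^sub>M P0" by measurable
  then show ?case by simp
qed simp

lemma X_in_space: "\<omega> \<in> space Q \<Longrightarrow> X \<omega> k \<in> space P0"
  using measurable_space[OF measurable_X] .

lemma measurable_upd[measurable]: "(\<lambda>(\<omega>, n). upd \<omega> k n) \<in> Q \<Otimes>\<^sub>M V \<rightarrow>\<^sub>M Q"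
proof -
  have "(\<lambda>w. (snd (fst w))(k := snd w)) \<in> Q \<Otimes>\<^sub>M V \<rightarrow>\<^sub>M noise_space"
    by (rule measurable_fun_upd[where J=UNIV]) (auto simp: Q_def)
  then show ?thesis unfolding upd_def split_beta Q_def by measurable
qed

lemma distr_upd: "distr (Q \<Otimes>\<^sub>M V) Q (\<lambda>(\<omega>, n). upd \<omega> k n) = Q"
proof (rule measure_eqI)
  fix A assume "A \<in> sets (distr (Q \<Otimes>\<^sub>M V) Q (\<lambda>(\<omega>, n). upd \<omega> k n))"
  then have A[measurable]: "A \<in> sets Q" by simp
  interpret VN: pair_prob_space V noise_space ..
  have [measurable]: "(\<lambda>(n, ns). ns(k := n)) \<in> V \<Otimes>\<^sub>M noise_space \<rightarrow>\<^sub>M noise_space"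
    unfolding split_beta by (rule measurable_fun_upd[where J=UNIV]) auto
  have "(\<lambda>(\<omega>, n). indicator A (upd \<omega> k n) :: ennreal) \<in> borel_measurable (Q \<Otimes>\<^sub>M V)" by measurable
  then have mu[measurable]: "(\<lambda>(\<omega>, n). indicator A (fst \<omega>, (snd \<omega>)(k := n)) :: ennreal) \<in> borel_measurable (Q \<Otimes>\<^sub>M V)"
    by (simp add: upd_def)
  have AQ[measurable]: "A \<in> sets (P0 \<Otimes>\<^sub>M noise_space)" using A by (simp add: Q_def)
  have "emeasure (distr (Q \<Otimes>\<^sub>M V) Q (\<lambda>(\<omega>, n). upd \<omega> k n)) A
     = (\<integral>\<^sup>+w. indicator A (upd (fst w) k (snd w)) \<partial>(Q \<Otimes>\<^sub>M V))"
    by (subst emeasure_distr_nn_integral) (auto simp: split_beta')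
  also have "\<dots> = (\<integral>\<^sup>+\<omega>. \<integral>\<^sup>+n. indicator A (upd \<omega> k n) \<partial>V \<partial>Q)"
    by (subst V.nn_integral_fst[symmetric]) (auto simp: split_beta')
  also have "\<dots> = (\<integral>\<^sup>+x. \<integral>\<^sup>+ns. \<integral>\<^sup>+n. indicator A (x, ns(k := n)) \<partial>V \<partial>noise_space \<partial>P0)"
    unfolding Q_def by (subst Noise.nn_integral_fst[symmetric])
      (auto simp: upd_def Q_def[symmetric] intro!: V.borel_measurable_nn_integral)
  also have "\<dots> = (\<integral>\<^sup>+x. \<integral>\<^sup>+ns. indicator A (x, ns) \<partial>noise_space \<partial>P0)"
  proof (rule nn_integral_cong)
    fix x assume [measurable]: "x \<in> space P0"
    have "(\<integral>\<^sup>+ns. \<integral>\<^sup>+n. indicator A (x, ns(k := n)) \<partial>V \<partial>noise_space)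
       = (\<integral>\<^sup>+w. indicator A (x, (snd w)(k := fst w)) \<partial>(V \<Otimes>\<^sub>M noise_space))"
      by (subst VN.nn_integral_snd[symmetric]) (auto simp: split_beta')
    also have "\<dots> = (\<integral>\<^sup>+ns. indicator A (x, ns) \<partial>distr (V \<Otimes>\<^sub>M noise_space) noise_space (\<lambda>(n, ns). ns(k := n)))"
      by (subst nn_integral_distr) (auto simp: split_beta')
    finally show "(\<integral>\<^sup>+ns. \<integral>\<^sup>+n. indicator A (x, ns(k := n)) \<partial>V \<partial>noise_space) = (\<integral>\<^sup>+ns. indicator A (x, ns) \<partial>noise_space)"
      by (simp add: PiM_resample prob_V)
  qed
  also have "\<dots> = emeasure Q A"
    unfolding Q_def by (subst Noise.nn_integral_fst) auto
  finally show "emeasure (distr (Q \<Otimes>\<^sub>M V) Q (\<lambda>(\<omega>, n). upd \<omega> k n)) A = emeasure Q A" .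
qed simp

text \<open>Conditioning on the past without conditional expectations. Redrawing noise
  \<open>k\<close> preserves \<open>Q\<close> by \<open>distr_upd\<close> and leaves the adapted
  part of the integrand alone, so that noise can be integrated out as an independent
  variable.\<close>

lemma
  fixes H :: "'s \<times> (nat \<Rightarrow> 'n) \<Rightarrow> 'n \<Rightarrow> real"
  assumes H[measurable]: "(\<lambda>(\<omega>, n). H \<omega> n) \<in> borel_measurable (Q \<Otimes>\<^sub>M V)" and ad: "adapted k H"
  shows measurable_step_fun: "(\<lambda>\<omega>. H \<omega> (snd \<omega> k)) \<in> borel_measurable Q"
    and integrable_step: "integrable Q (\<lambda>\<omega>. H \<omega> (snd \<omega> k)) \<longleftrightarrow> integrable (Q \<Otimes>\<^sub>M V) (\<lambda>(\<omega>, n). H \<omega> n)"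
    and integral_step: "(\<integral>\<omega>. H \<omega> (snd \<omega> k) \<partial>Q) = (\<integral>w. H (fst w) (snd w) \<partial>(Q \<Otimes>\<^sub>M V))"
    and nn_integral_step: "(\<integral>\<^sup>+\<omega>. ennreal (H \<omega> (snd \<omega> k)) \<partial>Q) = (\<integral>\<^sup>+\<omega>. \<integral>\<^sup>+n. ennreal (H \<omega> n) \<partial>V \<partial>Q)"
proof -
  have eq: "H (upd \<omega> k n) (snd (upd \<omega> k n) k) = H \<omega> n" for \<omega> n
    using adaptedD[OF ad, of k] by (simp add: snd_upd)
  show m[measurable]: "(\<lambda>\<omega>. H \<omega> (snd \<omega> k)) \<in> borel_measurable Q"
    using measurable_compose[OF _ H, of "\<lambda>\<omega>. (\<omega>, snd \<omega> k)" Q] by simp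
  show "integrable Q (\<lambda>\<omega>. H \<omega> (snd \<omega> k)) \<longleftrightarrow> integrable (Q \<Otimes>\<^sub>M V) (\<lambda>(\<omega>, n). H \<omega> n)"
    by (subst distr_upd[of k, symmetric], subst integrable_distr_eq) (auto simp: split_beta' eq)
  show "(\<integral>\<omega>. H \<omega> (snd \<omega> k) \<partial>Q) = (\<integral>w. H (fst w) (snd w) \<partial>(Q \<Otimes>\<^sub>M V))"
    by (subst distr_upd[of k, symmetric], subst integral_distr) (auto simp: split_beta eq)
  have "(\<integral>\<^sup>+\<omega>. ennreal (H \<omega> (snd \<omega> k)) \<partial>Q) = (\<integral>\<^sup>+w. ennreal (H (fst w) (snd w)) \<partial>(Q \<Otimes>\<^sub>M V))"
    by (subst distr_upd[of k, symmetric], subst nn_integral_distr) (auto simp: split_beta eq)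
  also have "\<dots> = (\<integral>\<^sup>+\<omega>. \<integral>\<^sup>+n. ennreal (H \<omega> n) \<partial>V \<partial>Q)"
    by (subst V.nn_integral_fst[symmetric]) (auto simp: split_beta')
  finally show "(\<integral>\<^sup>+\<omega>. ennreal (H \<omega> (snd \<omega> k)) \<partial>Q) = (\<integral>\<^sup>+\<omega>. \<integral>\<^sup>+n. ennreal (H \<omega> n) \<partial>V \<partial>Q)" .
qed

lemma distr_X: "distr Q P0 (\<lambda>\<omega>. X \<omega> k) = P0"
proof (induction k)
  case 0
  show ?case
  proof (rule measure_eqI)
    fix A assume "A \<in> sets (distr Q P0 (\<lambda>\<omega>. X \<omega> 0))"
    then have A: "A \<in> sets P0" by simp
    then have "emeasure (distr Q P0 (\<lambda>\<omega>. X \<omega> 0)) A = emeasure (P0 \<Otimes>\<^sub>M noise_space) (A \<times> space noise_space)"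
      using sets.sets_into_space[OF A]
      by (subst emeasure_distr) (auto simp: Q_def space_pair_measure intro!: arg_cong2[where f=emeasure])
    also have "\<dots> = emeasure P0 A"
      using A by (subst Noise.emeasure_pair_measure_Times) (auto simp: Noise.emeasure_space_1)
    finally show "emeasure (distr Q P0 (\<lambda>\<omega>. X \<omega> 0)) A = emeasure P0 A" .
  qed simp
next
  case (Suc k)
  show ?case
  proof (rule measure_eqI)
    fix A assume "A \<in> sets (distr Q P0 (\<lambda>\<omega>. X \<omega> (Suc k)))"
    then have A[measurable]: "A \<in> sets P0" by simp
    have [measurable]: "(\<lambda>w. step (X (fst w) k) (snd w)) \<in> Q \<Otimes>\<^sub>M V \<rightarrow>\<^sub>M P0"
      using measurable_compose[OF _ step_measurable, of "\<lambda>w. (X (fst w) k, snd w)" "Q \<Otimes>\<^sub>M V"] by simp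
    have "emeasure (distr Q P0 (\<lambda>\<omega>. X \<omega> (Suc k))) A = (\<integral>\<^sup>+\<omega>. ennreal (indicator A (step (X \<omega> k) (snd \<omega> k))) \<partial>Q)"
      using measurable_X[of "Suc k"]
      by (subst emeasure_distr_nn_integral) (auto simp: ennreal_indicator)
    also have "\<dots> = (\<integral>\<^sup>+\<omega>. \<integral>\<^sup>+n. ennreal (indicator A (step (X \<omega> k) n)) \<partial>V \<partial>Q)"
      using adapted_X[of k] by (intro nn_integral_step) (auto simp: adapted_def split_beta')
    also have "\<dots> = (\<integral>\<^sup>+x. \<integral>\<^sup>+n. ennreal (indicator A (step x n)) \<partial>V \<partial>distr Q P0 (\<lambda>\<omega>. X \<omega> k))"
      by (subst nn_integral_distr) (auto intro!: V.borel_measurable_nn_integral)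
    also have "\<dots> = (\<integral>\<^sup>+w. indicator A (step (fst w) (snd w)) \<partial>(P0 \<Otimes>\<^sub>M V))"
      unfolding Suc by (subst V.nn_integral_fst[symmetric]) (auto simp: split_beta' ennreal_indicator)
    also have "\<dots> = emeasure (distr (P0 \<Otimes>\<^sub>M V) P0 (\<lambda>(x, n). step x n)) A"
      by (subst emeasure_distr_nn_integral) (auto simp: split_beta')
    finally show "emeasure (distr Q P0 (\<lambda>\<omega>. X \<omega> (Suc k))) A = emeasure P0 A" by (simp add: stationary)
  qed simp
qed

lemma
  fixes \<phi> :: "'s \<Rightarrow> real"
  assumes [measurable]: "\<phi> \<in> borel_measurable P0"
  shows integral_X: "(\<integral>\<omega>. \<phi> (X \<omega> k) \<partial>Q) = (\<integral>x. \<phi> x \<partial>P0)"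
    and integrable_X: "integrable Q (\<lambda>\<omega>. \<phi> (X \<omega> k)) \<longleftrightarrow> integrable P0 \<phi>"
  by (subst distr_X[of k, symmetric], subst integral_distr, simp_all)
    (subst distr_X[of k, symmetric], subst integrable_distr_eq, simp_all)

end

lemma (in prob_space) integral_taylor_le:
  fixes u :: "real \<Rightarrow> real"
  assumes [measurable]: "u \<in> borel_measurable borel" "X \<in> borel_measurable M"
    and K: "\<And>y. \<bar>u y\<bar> \<le> K"
    and T: "\<And>a. \<bar>u (y + a) - u y - a * u1 - a\<^sup>2 / 2 * u2\<bar> \<le> C * \<bar>a\<bar>^3"
    and X: "integrable M (\<lambda>\<omega>. \<bar>X \<omega>\<bar>^3)" "integrable M (\<lambda>\<omega>. (X \<omega>)\<^sup>2)" "integrable M X" "expectation X = 0"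
  shows "\<bar>(\<integral>\<omega>. u (y + X \<omega>) \<partial>M) - u y - (\<integral>\<omega>. (X \<omega>)\<^sup>2 \<partial>M) / 2 * u2\<bar> \<le> C * (\<integral>\<omega>. \<bar>X \<omega>\<bar>^3 \<partial>M)"
proof -
  have int: "integrable M (\<lambda>\<omega>. u (y + X \<omega>))" by (rule integrable_const_bound[where B=K]) (use K in auto)
  have i1: "integrable M (\<lambda>\<omega>. X \<omega> * u1)" "integrable M (\<lambda>\<omega>. (X \<omega>)\<^sup>2 / 2 * u2)" using X by auto
  have "\<bar>(\<integral>\<omega>. u (y + X \<omega>) \<partial>M) - u y - (\<integral>\<omega>. (X \<omega>)\<^sup>2 \<partial>M) / 2 * u2\<bar>
    = \<bar>(\<integral>\<omega>. u (y + X \<omega>) - u y - X \<omega> * u1 - (X \<omega>)\<^sup>2 / 2 * u2 \<partial>M)\<bar>"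
    using int i1 X prob_space by simp
  also have "\<dots> \<le> (\<integral>\<omega>. \<bar>u (y + X \<omega>) - u y - X \<omega> * u1 - (X \<omega>)\<^sup>2 / 2 * u2\<bar> \<partial>M)"
    by (rule integral_abs_bound)
  also have "\<dots> \<le> (\<integral>\<omega>. C * \<bar>X \<omega>\<bar>^3 \<partial>M)"
  proof (rule integral_mono)
    show "integrable M (\<lambda>\<omega>. \<bar>u (y + X \<omega>) - u y - X \<omega> * u1 - (X \<omega>)\<^sup>2 / 2 * u2\<bar>)"
      by (intro integrable_abs Bochner_Integration.integrable_diff int i1 integrable_const)
    show "integrable M (\<lambda>\<omega>. C * \<bar>X \<omega>\<bar>^3)" by (rule integrable_mult_right[OF X(1)])
  qed (rule T)
  finally show ?thesis by simp
qed

section \<open>Lindeberg replacement for martingale increments\<close>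

text \<open>The envelope \<open>\<rho>\<close> depends on the noise only, which makes the moments of
  the increments bounded uniformly in the state. The fourth moment serves the maximal
  inequality.\<close>

locale stationary_martingale = stationary_chain P0 V step
  for P0 :: "'s measure" and V :: "'n measure" and step :: "'s \<Rightarrow> 'n \<Rightarrow> 's" +
  fixes m :: "'s \<Rightarrow> 'n \<Rightarrow> real" and \<rho> :: "'n \<Rightarrow> real"
  assumes m_measurable[measurable]: "(\<lambda>(x, n). m x n) \<in> borel_measurable (P0 \<Otimes>\<^sub>M V)"
    and rho_measurable[measurable]: "\<rho> \<in> borel_measurable V"
    and m_le: "\<And>x n. \<bar>m x n\<bar> \<le> \<rho> n"
    and rho4: "integrable V (\<lambda>n. \<rho> n ^ 4)"
    and m_centered: "\<And>x. x \<in> space P0 \<Longrightarrow> (\<integral>n. m x n \<partial>V) = 0"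
begin

definition S :: "'s \<times> (nat \<Rightarrow> 'n) \<Rightarrow> nat \<Rightarrow> real" where
  "S \<omega> k = (\<Sum>i<k. m (X \<omega> i) (snd \<omega> i))"

definition v :: "'s \<Rightarrow> real" where "v x = (\<integral>n. (m x n)\<^sup>2 \<partial>V)"

lemma rho_nonneg: "0 \<le> \<rho> n" using m_le[of undefined n] by linarith

lemma integrable_rho: "j \<le> 4 \<Longrightarrow> integrable V (\<lambda>n. \<rho> n ^ j)"
proof (rule Bochner_Integration.integrable_bound[where f="\<lambda>n. 1 + \<rho> n ^ 4"])
  assume "j \<le> 4"
  have "\<rho> n ^ j \<le> 1 + \<rho> n ^ 4" for n
  proof (cases "\<rho> n \<le> 1")
    case True
    then have "\<rho> n ^ j \<le> 1" using rho_nonneg by (simp add: power_le_one)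
    then show ?thesis using rho_nonneg[of n] by (simp add: add_increasing2)
  next
    case False
    then have "\<rho> n ^ j \<le> \<rho> n ^ 4" using \<open>j \<le> 4\<close> by (intro power_increasing) auto
    then show ?thesis by simp
  qed
  then show "AE n in V. norm (\<rho> n ^ j) \<le> norm (1 + \<rho> n ^ 4)"
    using rho_nonneg by (simp add: power_abs)
qed (use rho4 in auto)

lemma m_sect[measurable]: "x \<in> space P0 \<Longrightarrow> m x \<in> borel_measurable V"
  using measurable_compose_Pair1[OF _ m_measurable] by simp

lemma
  assumes x: "x \<in> space P0"
  shows integrable_m_abs: "j \<le> 4 \<Longrightarrow> integrable V (\<lambda>n. \<bar>m x n\<bar> ^ j)"
    and integrable_m: "integrable V (m x)" and integrable_m2: "integrable V (\<lambda>n. (m x n)\<^sup>2)"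
    and integral_m_abs_le: "j \<le> 4 \<Longrightarrow> (\<integral>n. \<bar>m x n\<bar> ^ j \<partial>V) \<le> (\<integral>n. \<rho> n ^ j \<partial>V)"
proof -
  note [measurable] = m_sect[OF x]
  show *: "integrable V (\<lambda>n. \<bar>m x n\<bar> ^ j)" if "j \<le> 4" for j
    by (rule Bochner_Integration.integrable_bound[OF integrable_rho[OF that]])
      (auto intro!: power_mono m_le simp: rho_nonneg)
  show "integrable V (m x)" using *[of 1] by (simp add: integrable_abs_iff)
  show "integrable V (\<lambda>n. (m x n)\<^sup>2)" using *[of 2] by simp
  show "(\<integral>n. \<bar>m x n\<bar> ^ j \<partial>V) \<le> (\<integral>n. \<rho> n ^ j \<partial>V)" if "j \<le> 4" for j
    by (intro integral_mono * integrable_rho that power_mono m_le) auto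
qed

lemma v_measurable[measurable]: "v \<in> borel_measurable P0"
  unfolding v_def[abs_def] by (rule V.borel_measurable_lebesgue_integral) measurable

lemma v_bounds: "x \<in> space P0 \<Longrightarrow> 0 \<le> v x" "x \<in> space P0 \<Longrightarrow> v x \<le> (\<integral>n. \<rho> n ^ 2 \<partial>V)"
  using integral_m_abs_le[of x 2] by (auto simp: v_def)

lemma m_X_measurable[measurable]:
  "(\<lambda>w. m (X (fst w) k) (snd w)) \<in> borel_measurable (Q \<Otimes>\<^sub>M V)"
  "(\<lambda>\<omega>. m (X \<omega> k) (snd \<omega> k)) \<in> borel_measurable Q"
  using measurable_compose[OF _ m_measurable, of "\<lambda>w. (X (fst w) k, snd w)" "Q \<Otimes>\<^sub>M V"]
    measurable_compose[OF _ m_measurable, of "\<lambda>\<omega>. (X \<omega> k, snd \<omega> k)" Q] by simp_all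

lemma S_measurable[measurable]: "(\<lambda>\<omega>. S \<omega> k) \<in> borel_measurable Q"
  unfolding S_def by measurable

lemma adapted_S: "k \<le> k' \<Longrightarrow> adapted k' (\<lambda>\<omega>. S \<omega> k)"
  unfolding S_def adapted_def
proof (intro allI impI sum.cong refl)
  fix \<omega> n j i assume "k \<le> k'" "k' \<le> j" "i \<in> {..<k}"
  then have i: "i < j" by simp
  then have "X (upd \<omega> j n) i = X \<omega> i" using adaptedD[OF adapted_X, of i j \<omega> n] by simp
  then show "m (X (upd \<omega> j n) i) (snd (upd \<omega> j n) i) = m (X \<omega> i) (snd \<omega> i)"
    using i by (simp add: snd_upd)
qed

text \<open>The price of exchanging one increment for a centered Gaussian of variance
  \<open>h\<close> under smoothing at scale \<open>e\<close>: the cubic Taylor remainders of both,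
  and half the bound \<open>2 * K / e\<^sup>2\<close> on the second derivative times the mean
  distance of the conditional variance from \<open>h\<close>.\<close>

definition lindeberg_error :: "real \<Rightarrow> real \<Rightarrow> real \<Rightarrow> real" where
  "lindeberg_error K e h = 8 * exp 2 * K / e^3 * ((\<integral>n. \<rho> n ^ 3 \<partial>V) + sqrt h ^ 3 * (\<integral>x. \<bar>x\<bar>^3 \<partial>gauss))
     + K / e\<^sup>2 * (\<integral>x. \<bar>v x - h\<bar> \<partial>P0)"

text \<open>Both expectations are compared with one second-order expansion of the smoothed function
  \<open>u\<close> at \<open>Y\<close>. The linear terms vanish because both increments are centered
  given the past. The quadratic terms differ by the variance defect, which is small in mean only and
  is therefore averaged under \<open>P0\<close> at the end.\<close>

lemma one_step:
  fixes H :: "'s \<times> (nat \<Rightarrow> 'n) \<Rightarrow> real \<Rightarrow> real"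
  assumes H[measurable]: "(\<lambda>(\<omega>, y). H \<omega> y) \<in> borel_measurable (Q \<Otimes>\<^sub>M borel)"
    and K: "\<And>\<omega> y. \<bar>H \<omega> y\<bar> \<le> K" and adH: "adapted k H"
    and Y[measurable]: "Y \<in> borel_measurable Q" and adY: "adapted k Y" and e: "0 < e" and h: "0 \<le> h"
  shows "\<bar>(\<integral>\<omega>. \<integral>z. H \<omega> (Y \<omega> + m (X \<omega> k) (snd \<omega> k) + e * z) \<partial>gauss \<partial>Q)
     - (\<integral>\<omega>. \<integral>x. \<integral>z. H \<omega> (Y \<omega> + sqrt h * x + e * z) \<partial>gauss \<partial>gauss \<partial>Q)\<bar>
     \<le> lindeberg_error K e h"
proof -
  have "\<bar>H undefined 0\<bar> \<le> K" by (rule K)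
  then have K0: "0 \<le> K" by linarith
  define u where "u \<omega> y = (\<integral>z. H \<omega> (y + e * z) \<partial>gauss)" for \<omega> y
  note HQ = measurable_uncurry_compose[OF H]
  have u_meas[measurable]: "(\<lambda>(\<omega>, y). u \<omega> y) \<in> borel_measurable (Q \<Otimes>\<^sub>M borel)"
    unfolding u_def[abs_def] split_beta'
    by (rule std_normal.borel_measurable_lebesgue_integral) (auto simp: split_beta' intro!: HQ)
  have Hs[measurable]: "H \<omega> \<in> borel_measurable borel" if "\<omega> \<in> space Q" for \<omega>
    using measurable_compose_Pair1[OF that H] by simp
  have us[measurable]: "u \<omega> \<in> borel_measurable borel" if "\<omega> \<in> space Q" for \<omega>
    using measurable_compose_Pair1[OF that u_meas] by simp
  note uQ = measurable_uncurry_compose[OF u_meas]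
  have uK: "\<bar>u \<omega> y\<bar> \<le> K" for \<omega> y
    unfolding u_def by (rule std_normal.abs_integral_le) (rule K)
  define I1 where "I1 \<omega> = (\<integral>n. u \<omega> (Y \<omega> + m (X \<omega> k) n) \<partial>V)" for \<omega>
  define I2 where "I2 \<omega> = (\<integral>x. u \<omega> (Y \<omega> + sqrt h * x) \<partial>gauss)" for \<omega>
  have I1_meas[measurable]: "I1 \<in> borel_measurable Q"
    unfolding I1_def[abs_def] by (rule V.borel_measurable_lebesgue_integral)
      (auto simp: split_beta' intro!: uQ borel_measurable_add)
  have I2_meas[measurable]: "I2 \<in> borel_measurable Q"
    unfolding I2_def[abs_def] by (rule std_normal.borel_measurable_lebesgue_integral)
      (auto simp: split_beta' intro!: uQ)
  have step_meas: "(\<lambda>(\<omega>, n). u \<omega> (Y \<omega> + m (X \<omega> k) n)) \<in> borel_measurable (Q \<Otimes>\<^sub>M V)"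
    by (auto simp: split_beta' intro!: uQ borel_measurable_add)
  let ?C = "8 * exp 2 * K / e^3"
  let ?\<rho>3 = "\<integral>n. \<rho> n ^ 3 \<partial>V" and ?\<gamma>3 = "sqrt h ^ 3 * (\<integral>x. \<bar>x\<bar>^3 \<partial>gauss)"
  have C0: "0 \<le> ?C" using K0 e by simp
  have bound: "\<bar>I1 \<omega> - I2 \<omega>\<bar> \<le> ?C * (?\<rho>3 + ?\<gamma>3) + K / e\<^sup>2 * \<bar>v (X \<omega> k) - h\<bar>"
    if \<omega>: "\<omega> \<in> space Q" for \<omega>
  proof -
    note [measurable] = us[OF \<omega>] Hs[OF \<omega>]
    have x: "X \<omega> k \<in> space P0" by (rule X_in_space[OF \<omega>])
    note [measurable] = m_sect[OF x]
    define u2 where "u2 = gauss_smooth2 (\<lambda>z. H \<omega> (e * z)) (Y \<omega> / e) / e\<^sup>2"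
    have T: "\<bar>u \<omega> (Y \<omega> + a) - u \<omega> (Y \<omega>) - a * (gauss_smooth1 (\<lambda>z. H \<omega> (e * z)) (Y \<omega> / e) / e) - a\<^sup>2 / 2 * u2\<bar>
      \<le> ?C * \<bar>a\<bar>^3" for a
      unfolding u_def u2_def by (rule gauss_smooth_scaled_taylor) (use K e in auto)
    have "\<bar>gauss_smooth2 (\<lambda>z. H \<omega> (e * z)) (Y \<omega> / e)\<bar> \<le> 2 * K"
      by (rule gauss_smooth_taylor(3)) (use K K0 in auto)
    then have u2: "\<bar>u2\<bar> \<le> 2 * K / e\<^sup>2" using e by (simp add: u2_def divide_right_mono)
    have "\<bar>I1 \<omega> - u \<omega> (Y \<omega>) - v (X \<omega> k) / 2 * u2\<bar> \<le> ?C * (\<integral>n. \<bar>m (X \<omega> k) n\<bar>^3 \<partial>V)"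
      unfolding I1_def v_def
      by (rule V.integral_taylor_le[OF _ _ uK T])
        (rule us[OF \<omega>] m_sect[OF x] integrable_m_abs[OF x] integrable_m2[OF x] integrable_m[OF x] m_centered[OF x] | simp)+
    also have "\<dots> \<le> ?C * ?\<rho>3" by (intro mult_left_mono C0 integral_m_abs_le x) auto
    finally have 1: "\<bar>I1 \<omega> - u \<omega> (Y \<omega>) - v (X \<omega> k) / 2 * u2\<bar> \<le> ?C * ?\<rho>3" .
    have g: "(\<integral>x. (sqrt h * x)\<^sup>2 \<partial>gauss) = h" "(\<integral>x. \<bar>sqrt h * x\<bar>^3 \<partial>gauss) = ?\<gamma>3"
      using h std_normal_moments by (simp_all add: power_mult_distrib abs_mult)
    have "\<bar>I2 \<omega> - u \<omega> (Y \<omega>) - (\<integral>x. (sqrt h * x)\<^sup>2 \<partial>gauss) / 2 * u2\<bar>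
       \<le> ?C * (\<integral>x. \<bar>sqrt h * x\<bar>^3 \<partial>gauss)"
      unfolding I2_def
    proof (rule std_normal.integral_taylor_le[OF _ _ uK T])
      show "integrable gauss (\<lambda>x. \<bar>sqrt h * x\<bar> ^ 3)"
        unfolding abs_mult power_mult_distrib by (rule integrable_mult_right) (rule integrable_std_normal_abs_moment)
      show "integrable gauss (\<lambda>x. (sqrt h * x)\<^sup>2)"
        unfolding power_mult_distrib by (rule integrable_mult_right) (rule std_normal_moments(4))
      show "integrable gauss (\<lambda>x. sqrt h * x)"
        by (rule integrable_mult_right) (rule std_normal_moments(3))
      show "std_normal.expectation (\<lambda>x. sqrt h * x) = 0"
        by (simp only: integral_mult_right_zero std_normal_moments(1) mult_zero_right)
    qed measurable
    then have 2: "\<bar>I2 \<omega> - u \<omega> (Y \<omega>) - h / 2 * u2\<bar> \<le> ?C * ?\<gamma>3" by (simp only: g)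
    have "v (X \<omega> k) / 2 * u2 - h / 2 * u2 = u2 / 2 * (v (X \<omega> k) - h)"
      by (simp add: algebra_simps)
    then have "\<bar>v (X \<omega> k) / 2 * u2 - h / 2 * u2\<bar> = \<bar>u2\<bar> / 2 * \<bar>v (X \<omega> k) - h\<bar>"
      by (simp only: abs_mult abs_divide abs_numeral)
    also have "\<dots> \<le> (2 * K / e\<^sup>2) / 2 * \<bar>v (X \<omega> k) - h\<bar>"
      by (intro mult_right_mono divide_right_mono u2) auto
    finally have 3: "\<bar>v (X \<omega> k) / 2 * u2 - h / 2 * u2\<bar> \<le> K / e\<^sup>2 * \<bar>v (X \<omega> k) - h\<bar>" by simp
    show "\<bar>I1 \<omega> - I2 \<omega>\<bar> \<le> ?C * (?\<rho>3 + ?\<gamma>3) + K / e\<^sup>2 * \<bar>v (X \<omega> k) - h\<bar>"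
      using 1 2 3 unfolding distrib_left by linarith
  qed
  have "\<bar>I1 \<omega>\<bar> \<le> K" "\<bar>I2 \<omega>\<bar> \<le> K" for \<omega>
    unfolding I1_def I2_def by (rule V.abs_integral_le std_normal.abs_integral_le, rule uK)+
  then have int1: "integrable Q I1" and int2: "integrable Q I2"
    by (auto intro!: Q.integrable_const_bound[where B=K])
  have intv: "integrable Q (\<lambda>\<omega>. \<bar>v (X \<omega> k) - h\<bar>)"
  proof (subst integrable_X)
    show "integrable P0 (\<lambda>x. \<bar>v x - h\<bar>)"
    proof (rule P0.integrable_const_bound[where B="(\<integral>n. \<rho> n ^ 2 \<partial>V) + h"])
      show "AE x in P0. norm \<bar>v x - h\<bar> \<le> (\<integral>n. \<rho> n ^ 2 \<partial>V) + h"
      proof (rule AE_I2)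
        fix x assume "x \<in> space P0"
        from v_bounds[OF this] h show "norm \<bar>v x - h\<bar> \<le> (\<integral>n. \<rho> n ^ 2 \<partial>V) + h" by simp
      qed
    qed measurable
  qed auto
  have "(\<integral>\<omega>. \<integral>z. H \<omega> (Y \<omega> + m (X \<omega> k) (snd \<omega> k) + e * z) \<partial>gauss \<partial>Q)
     = (\<integral>\<omega>. u \<omega> (Y \<omega> + m (X \<omega> k) (snd \<omega> k)) \<partial>Q)" by (simp add: u_def)
  also have "\<dots> = (\<integral>w. u (fst w) (Y (fst w) + m (X (fst w) k) (snd w)) \<partial>(Q \<Otimes>\<^sub>M V))"
  proof (rule integral_step[OF step_meas])
    show "adapted k (\<lambda>\<omega> n. u \<omega> (Y \<omega> + m (X \<omega> k) n))"
      using adH adY adapted_X[of k] unfolding u_def adapted_def by simp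
  qed
  also have "\<dots> = (\<integral>\<omega>. I1 \<omega> \<partial>Q)"
    unfolding I1_def using step_meas uK
    by (subst QV.integral_fst'[symmetric]) (auto simp: split_beta' intro!: QV.integrable_const_bound[where B=K])
  finally have e1: "(\<integral>\<omega>. \<integral>z. H \<omega> (Y \<omega> + m (X \<omega> k) (snd \<omega> k) + e * z) \<partial>gauss \<partial>Q) = (\<integral>\<omega>. I1 \<omega> \<partial>Q)" .
  have e2: "(\<integral>\<omega>. \<integral>x. \<integral>z. H \<omega> (Y \<omega> + sqrt h * x + e * z) \<partial>gauss \<partial>gauss \<partial>Q) = (\<integral>\<omega>. I2 \<omega> \<partial>Q)"
    by (simp add: I2_def u_def)
  have "\<bar>(\<integral>\<omega>. I1 \<omega> \<partial>Q) - (\<integral>\<omega>. I2 \<omega> \<partial>Q)\<bar>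
      \<le> (\<integral>\<omega>. ?C * (?\<rho>3 + ?\<gamma>3) + K / e\<^sup>2 * \<bar>v (X \<omega> k) - h\<bar> \<partial>Q)"
    by (rule Q.abs_integral_diff_le[OF int1 int2 _ bound]) (use intv in auto)
  also have "\<dots> = ?C * (?\<rho>3 + ?\<gamma>3) + K / e\<^sup>2 * (\<integral>\<omega>. \<bar>v (X \<omega> k) - h\<bar> \<partial>Q)"
    using intv Q.prob_space by simp
  also have "(\<integral>\<omega>. \<bar>v (X \<omega> k) - h\<bar> \<partial>Q) = (\<integral>x. \<bar>v x - h\<bar> \<partial>P0)"
    by (rule integral_X) measurable
  finally show ?thesis unfolding e1 e2 lindeberg_error_def .
qed

end

abbreviation gauss_seq :: "(nat \<Rightarrow> real) measure" where
  "gauss_seq \<equiv> PiM UNIV (\<lambda>_::nat. gauss)"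

interpretation gauss_seq: prob_space gauss_seq
  by (intro prob_space_PiM) (simp add: std_normal.prob_space_axioms)

lemma PiM_resample_integral:
  fixes g :: "(nat \<Rightarrow> 'a) \<Rightarrow> real"
  assumes M: "prob_space M" and g[measurable]: "g \<in> borel_measurable (PiM UNIV (\<lambda>_. M))" and K: "\<And>\<xi>. \<bar>g \<xi>\<bar> \<le> K"
  shows "(\<integral>\<xi>. \<integral>x. g (\<xi>(j := x)) \<partial>M \<partial>PiM UNIV (\<lambda>_. M)) = (\<integral>\<xi>. g \<xi> \<partial>PiM UNIV (\<lambda>_. M))"
proof -
  interpret M: prob_space M by (rule M)
  interpret PM: prob_space "PiM UNIV (\<lambda>_::nat. M)" by (intro prob_space_PiM M)
  interpret pair_prob_space M "PiM UNIV (\<lambda>_::nat. M)" ..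
  have [measurable]: "(\<lambda>(x, \<xi>). \<xi>(j := x)) \<in> M \<Otimes>\<^sub>M PiM UNIV (\<lambda>_. M) \<rightarrow>\<^sub>M PiM UNIV (\<lambda>_. M)"
    unfolding split_beta by (rule measurable_fun_upd[where J=UNIV]) auto
  have gm: "(\<lambda>(x, \<xi>). g (\<xi>(j := x))) \<in> borel_measurable (M \<Otimes>\<^sub>M PiM UNIV (\<lambda>_. M))"
    by measurable
  have "(\<integral>\<xi>. \<integral>x. g (\<xi>(j := x)) \<partial>M \<partial>PiM UNIV (\<lambda>_. M)) = (\<integral>w. g ((snd w)(j := fst w)) \<partial>(M \<Otimes>\<^sub>M PiM UNIV (\<lambda>_. M)))"
    using bounded_Fubini[OF gm, of K] K by simp
  also have "\<dots> = (\<integral>\<xi>. g \<xi> \<partial>distr (M \<Otimes>\<^sub>M PiM UNIV (\<lambda>_. M)) (PiM UNIV (\<lambda>_. M)) (\<lambda>(x, \<xi>). \<xi>(j := x)))"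
    by (subst integral_distr) (auto simp: split_beta')
  finally show ?thesis by (simp add: PiM_resample M)
qed

context stationary_martingale
begin

text \<open>Swapping inside one block. \<open>\<Theta> i\<close> uses the first \<open>i\<close>
  true increments, one Gaussian of variance \<open>\<tau> i\<close> in place of the others, and an
  auxiliary term \<open>e * z\<close> that supplies the smoothness. Inserting and removing this term
  costs \<open>C * e\<close> each.\<close>

lemma block:
  fixes H :: "'s \<times> (nat \<Rightarrow> 'n) \<Rightarrow> real \<Rightarrow> real"
  assumes H: "(\<lambda>(\<omega>, y). H \<omega> y) \<in> borel_measurable (Q \<Otimes>\<^sub>M borel)"
    and K: "\<And>\<omega> y. \<bar>H \<omega> y\<bar> \<le> K" and adH: "adapted r H"
    and C: "\<And>\<omega> y y'. \<bar>H \<omega> y - H \<omega> y'\<bar> \<le> C * \<bar>y - y'\<bar>"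
    and e: "0 < e" and h: "0 \<le> h" and r: "r \<le> r'"
  shows "\<bar>(\<integral>\<omega>. H \<omega> (S \<omega> r' - S \<omega> r) \<partial>Q)
     - (\<integral>\<omega>. \<integral>x. H \<omega> (sqrt (h * real (r' - r)) * x) \<partial>gauss \<partial>Q)\<bar>
     \<le> 2 * C * e + real (r' - r) * lindeberg_error K e h"
proof -
  have C0: "0 \<le> C" using C[of undefined 1 0] by simp
  note Hc = measurable_uncurry_compose[OF H]
  define D where "D = r' - r"
  define \<tau> where "\<tau> i = h * real (D - i)" for i
  define Hs where "Hs t \<omega> y = (\<integral>x. H \<omega> (y + sqrt t * x) \<partial>gauss)" for t \<omega> y
  have Hs_meas: "(\<lambda>(\<omega>, y). Hs t \<omega> y) \<in> borel_measurable (Q \<Otimes>\<^sub>M borel)" for t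
    unfolding Hs_def split_beta'
    by (rule std_normal.borel_measurable_lebesgue_integral) (auto simp: split_beta' intro!: Hc)
  note Hsc = measurable_uncurry_compose[OF Hs_meas]
  have HsK: "\<bar>Hs t \<omega> y\<bar> \<le> K" for t \<omega> y
    unfolding Hs_def by (rule std_normal.abs_integral_le) (rule K)
  have Hm: "H \<omega> \<in> borel_measurable borel" if "\<omega> \<in> space Q" for \<omega>
    using measurable_compose_Pair1[OF that H] by simp
  have Hsm: "Hs t \<omega> \<in> borel_measurable borel" if "\<omega> \<in> space Q" for t \<omega>
    using measurable_compose_Pair1[OF that Hs_meas] by simp
  interpret NN: pair_prob_space gauss gauss ..
  define \<Theta> where "\<Theta> i = (\<integral>\<omega>. \<integral>z. Hs (\<tau> i) \<omega> (S \<omega> (r + i) - S \<omega> r + e * z) \<partial>gauss \<partial>Q)" for i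
  have step: "\<bar>\<Theta> (Suc i) - \<Theta> i\<bar> \<le> lindeberg_error K e h" if "i < D" for i
  proof -
    define Y where "Y \<omega> = S \<omega> (r + i) - S \<omega> r" for \<omega>
    have adY: "adapted (r + i) Y"
      using adapted_S[of "r + i" "r + i"] adapted_S[of r "r + i"] by (auto simp: Y_def adapted_def)
    have "\<Theta> (Suc i) = (\<integral>\<omega>. \<integral>z. Hs (\<tau> (Suc i)) \<omega> (Y \<omega> + m (X \<omega> (r + i)) (snd \<omega> (r + i)) + e * z) \<partial>gauss \<partial>Q)"
      by (simp add: \<Theta>_def Y_def S_def algebra_simps)
    moreover have "\<Theta> i = (\<integral>\<omega>. \<integral>x. \<integral>z. Hs (\<tau> (Suc i)) \<omega> (Y \<omega> + sqrt h * x + e * z) \<partial>gauss \<partial>gauss \<partial>Q)"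
      unfolding \<Theta>_def
    proof (rule Bochner_Integration.integral_cong[OF refl])
      fix \<omega> assume \<omega>: "\<omega> \<in> space Q"
      note [measurable] = Hm[OF \<omega>] Hsm[OF \<omega>]
      \<comment> \<open>A Gaussian of variance \<open>h\<close> is split off the one of variance
        \<open>\<tau> i\<close>; it is the one exchanged for the next true increment.\<close>
      have "(\<integral>x. \<integral>z. Hs (\<tau> (Suc i)) \<omega> (Y \<omega> + sqrt h * x + e * z) \<partial>gauss \<partial>gauss)
        = (\<integral>z. \<integral>x. Hs (\<tau> (Suc i)) \<omega> (Y \<omega> + sqrt h * x + e * z) \<partial>gauss \<partial>gauss)"
        by (rule NN.bounded_Fubini(1)[OF _ HsK]) measurable
      also have "\<dots> = (\<integral>z. \<integral>x. \<integral>x'. H \<omega> (Y \<omega> + e * z + (sqrt h * x + sqrt (\<tau> (Suc i)) * x')) \<partial>gauss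
          \<partial>gauss \<partial>gauss)"
        by (simp add: Hs_def ac_simps)
      also have "\<dots> = (\<integral>z. \<integral>x. H \<omega> (Y \<omega> + e * z + sqrt ((sqrt h)\<^sup>2 + (sqrt (\<tau> (Suc i)))\<^sup>2) * x) \<partial>gauss
          \<partial>gauss)"
        by (subst integral_std_normal_add[where K=K]) (auto intro: K)
      also have "(sqrt h)\<^sup>2 + (sqrt (\<tau> (Suc i)))\<^sup>2 = \<tau> i"
      proof -
        have "real (D - i) = real (D - Suc i) + 1" using that by linarith
        moreover have "(sqrt h)\<^sup>2 = h" "(sqrt (\<tau> (Suc i)))\<^sup>2 = \<tau> (Suc i)" using h by (simp_all add: \<tau>_def)
        ultimately show ?thesis by (simp only: \<tau>_def distrib_left mult_1_right add.commute)
      qed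
      finally show "(\<integral>z. Hs (\<tau> i) \<omega> (S \<omega> (r + i) - S \<omega> r + e * z) \<partial>gauss)
        = (\<integral>x. \<integral>z. Hs (\<tau> (Suc i)) \<omega> (Y \<omega> + sqrt h * x + e * z) \<partial>gauss \<partial>gauss)"
        by (simp add: Hs_def Y_def)
    qed
    moreover have "adapted (r + i) (Hs (\<tau> (Suc i)))"
      using adapted_mono[OF adH, of "r + i"] by (simp add: Hs_def[abs_def] adapted_def)
    moreover have "Y \<in> borel_measurable Q" unfolding Y_def[abs_def] by measurable
    ultimately show ?thesis using one_step[OF Hs_meas HsK _ _ adY e h] by simp
  qed
  have tele: "\<bar>\<Theta> i - \<Theta> 0\<bar> \<le> real i * lindeberg_error K e h" if "i \<le> D" for i
    using that
  proof (induction i)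
    case (Suc i)
    then show ?case using step[of i] by (simp add: algebra_simps)
  qed simp
  have int_z: "integrable gauss (\<lambda>z. C * (e * \<bar>z\<bar>))"
    using integrable_std_normal_abs_moment[of 1] by simp
  have "(\<integral>z. C * (e * \<bar>z\<bar>) \<partial>gauss) = C * e * (\<integral>z. \<bar>z\<bar> \<partial>gauss)"
    by simp
  also have "\<dots> \<le> C * e * 1" using C0 e std_normal_moments(5) by (intro mult_left_mono) auto
  finally have z_le: "(\<integral>z. C * (e * \<bar>z\<bar>) \<partial>gauss) \<le> C * e" by simp
  have HsC: "\<bar>Hs t \<omega> y - Hs t \<omega> y'\<bar> \<le> C * \<bar>y - y'\<bar>" if "\<omega> \<in> space Q" for t \<omega> y y'
  proof -
    note [measurable] = Hm[OF that]
    have int: "integrable gauss (\<lambda>x. H \<omega> (y + sqrt t * x))" for y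
      by (rule std_normal.integrable_const_bound[where B=K]) (use K in auto)
    have "\<bar>Hs t \<omega> y - Hs t \<omega> y'\<bar> \<le> (\<integral>x. C * \<bar>y - y'\<bar> \<partial>gauss)"
      unfolding Hs_def
    proof (rule std_normal.abs_integral_diff_le[OF int int])
      fix x
      show "\<bar>H \<omega> (y + sqrt t * x) - H \<omega> (y' + sqrt t * x)\<bar> \<le> C * \<bar>y - y'\<bar>"
        using C[of \<omega> "y + sqrt t * x" "y' + sqrt t * x"] by simp
    qed auto
    then show ?thesis using std_normal.prob_space by simp
  qed
  have smooth: "\<bar>(\<integral>\<omega>. \<integral>z. Hs t \<omega> (Z \<omega> + e * z) \<partial>gauss \<partial>Q) - (\<integral>\<omega>. Hs t \<omega> (Z \<omega>) \<partial>Q)\<bar> \<le> C * e"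
    if Z[measurable]: "Z \<in> borel_measurable Q" for t Z
  proof -
    have inner: "\<bar>(\<integral>z. Hs t \<omega> (Z \<omega> + e * z) \<partial>gauss) - Hs t \<omega> (Z \<omega>)\<bar> \<le> C * e" if \<omega>: "\<omega> \<in> space Q" for \<omega>
    proof -
      note [measurable] = Hsm[OF \<omega>]
      have "\<bar>(\<integral>z. Hs t \<omega> (Z \<omega> + e * z) \<partial>gauss) - (\<integral>z. Hs t \<omega> (Z \<omega>) \<partial>gauss)\<bar>
        \<le> (\<integral>z. C * (e * \<bar>z\<bar>) \<partial>gauss)"
      proof (rule std_normal.abs_integral_diff_le[OF _ _ int_z])
        show "integrable gauss (\<lambda>z. Hs t \<omega> (Z \<omega> + e * z))"
          by (rule std_normal.integrable_const_bound[where B=K]) (use HsK in auto)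
        fix z
        show "\<bar>Hs t \<omega> (Z \<omega> + e * z) - Hs t \<omega> (Z \<omega>)\<bar> \<le> C * (e * \<bar>z\<bar>)"
          using HsC[OF \<omega>, of t "Z \<omega> + e * z" "Z \<omega>"] e by (simp add: abs_mult)
      qed auto
      then show ?thesis using z_le std_normal.prob_space by simp
    qed
    have "\<bar>(\<integral>\<omega>. \<integral>z. Hs t \<omega> (Z \<omega> + e * z) \<partial>gauss \<partial>Q) - (\<integral>\<omega>. Hs t \<omega> (Z \<omega>) \<partial>Q)\<bar> \<le> (\<integral>\<omega>. C * e \<partial>Q)"
    proof (rule Q.abs_integral_diff_le)
      have "(\<lambda>\<omega>. \<integral>z. Hs t \<omega> (Z \<omega> + e * z) \<partial>gauss) \<in> borel_measurable Q"
        by (rule std_normal.borel_measurable_lebesgue_integral) (auto simp: split_beta' intro!: Hsc)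
      then show "integrable Q (\<lambda>\<omega>. \<integral>z. Hs t \<omega> (Z \<omega> + e * z) \<partial>gauss)"
        by (intro Q.integrable_const_bound[where B=K]) (auto intro!: std_normal.abs_integral_le HsK)
      have "(\<lambda>\<omega>. Hs t \<omega> (Z \<omega>)) \<in> borel_measurable Q" by (rule Hsc) auto
      then show "integrable Q (\<lambda>\<omega>. Hs t \<omega> (Z \<omega>))"
        by (intro Q.integrable_const_bound[where B=K]) (auto intro!: HsK)
    qed (auto intro: inner)
    then show ?thesis using Q.prob_space by simp
  qed
  have "\<Theta> 0 = (\<integral>\<omega>. \<integral>z. Hs (h * real D) \<omega> (0 + e * z) \<partial>gauss \<partial>Q)" by (simp add: \<Theta>_def \<tau>_def)
  moreover have "(\<integral>\<omega>. Hs (h * real D) \<omega> 0 \<partial>Q) = (\<integral>\<omega>. \<integral>x. H \<omega> (sqrt (h * real (r' - r)) * x) \<partial>gauss \<partial>Q)"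
    by (simp add: Hs_def D_def)
  ultimately have b0: "\<bar>\<Theta> 0 - (\<integral>\<omega>. \<integral>x. H \<omega> (sqrt (h * real (r' - r)) * x) \<partial>gauss \<partial>Q)\<bar> \<le> C * e"
    using smooth[of "\<lambda>_. 0" "h * real D"] by simp
  have "Hs 0 \<omega> y = H \<omega> y" for \<omega> y using std_normal.prob_space by (simp add: Hs_def)
  then have b1: "\<bar>\<Theta> D - (\<integral>\<omega>. H \<omega> (S \<omega> r' - S \<omega> r) \<partial>Q)\<bar> \<le> C * e"
    using smooth[of "\<lambda>\<omega>. S \<omega> r' - S \<omega> r" 0] r by (simp add: \<Theta>_def \<tau>_def D_def)
  show ?thesis using b0 b1 tele[of D] unfolding D_def[symmetric] by linarith
qed

text \<open>The blocks are exchanged one at a time: \<open>W j\<close> has true increments before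
  block \<open>j\<close> and Gaussian ones from \<open>j\<close> on. When block \<open>j\<close> is
  exchanged, the later Gaussians are frozen parameters and the earlier increments belong to the
  past, so \<open>block\<close> applies for each fixed \<open>\<xi>\<close>.\<close>

lemma hybrid:
  fixes G :: "'s \<times> (nat \<Rightarrow> 'n) \<Rightarrow> (nat \<Rightarrow> real) \<Rightarrow> real" and \<kappa> :: "nat \<Rightarrow> nat"
  assumes G: "(\<lambda>(\<omega>, a). G \<omega> a) \<in> borel_measurable (Q \<Otimes>\<^sub>M PiM UNIV (\<lambda>_. borel))"
    and K: "\<And>\<omega> a. \<bar>G \<omega> a\<bar> \<le> K" and adG: "adapted 0 G"
    and C: "\<And>\<omega> a b. \<bar>G \<omega> a - G \<omega> b\<bar> \<le> C * (\<Sum>j<J. \<bar>a j - b j\<bar>)" and C0: "0 \<le> C"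
    and \<kappa>: "mono \<kappa>" and e: "0 < e" and h: "0 \<le> h"
  shows "\<bar>(\<integral>\<omega>. G \<omega> (\<lambda>j. S \<omega> (\<kappa> (Suc j)) - S \<omega> (\<kappa> j)) \<partial>Q)
     - (\<integral>\<omega>. \<integral>\<xi>. G \<omega> (\<lambda>j. sqrt (h * real (\<kappa> (Suc j) - \<kappa> j)) * \<xi> j) \<partial>gauss_seq \<partial>Q)\<bar>
     \<le> real J * (2 * C * e) + real (\<kappa> J - \<kappa> 0) * lindeberg_error K e h"
proof -
  note Gc = measurable_uncurry_compose[OF G]
  define \<Delta> where "\<Delta> \<omega> j = S \<omega> (\<kappa> (Suc j)) - S \<omega> (\<kappa> j)" for \<omega> j
  define s where "s j = sqrt (h * real (\<kappa> (Suc j) - \<kappa> j))" for j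
  define W where "W j \<omega> \<xi> = (\<lambda>i. if i < j then \<Delta> \<omega> i else s i * \<xi> i)" for j \<omega> and \<xi> :: "nat \<Rightarrow> real"
  interpret QX: pair_prob_space Q gauss_seq ..
  interpret QN: pair_prob_space Q gauss ..
  have [measurable]: "(\<lambda>\<omega>. \<Delta> \<omega> j) \<in> borel_measurable Q" for j unfolding \<Delta>_def by measurable
  have W_meas: "(\<lambda>(\<omega>, \<xi>). G \<omega> (W j \<omega> \<xi>)) \<in> borel_measurable (Q \<Otimes>\<^sub>M gauss_seq)" for j
    unfolding split_beta' by (rule Gc, measurable, rule measurable_to_PiM_UNIV) (auto simp: W_def)
  define Hyb where "Hyb j = (\<integral>\<omega>. \<integral>\<xi>. G \<omega> (W j \<omega> \<xi>) \<partial>gauss_seq \<partial>Q)" for j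
  have step: "\<bar>Hyb (Suc j) - Hyb j\<bar> \<le> 2 * C * e + real (\<kappa> (Suc j) - \<kappa> j) * lindeberg_error K e h" if "j < J" for j
  proof -
    let ?B = "2 * C * e + real (\<kappa> (Suc j) - \<kappa> j) * lindeberg_error K e h"
    define H where "H \<xi> \<omega> y = G \<omega> ((W j \<omega> \<xi>)(j := y))" for \<xi> \<omega> y
    have H_meas: "(\<lambda>w. H (f w) (g w) (k w)) \<in> borel_measurable M"
      if "f \<in> M \<rightarrow>\<^sub>M gauss_seq" "g \<in> M \<rightarrow>\<^sub>M Q" "k \<in> borel_measurable M" for f g k and M :: "'z measure"
      unfolding H_def
    proof (rule Gc[OF that(2)], rule measurable_to_PiM_UNIV)
      fix i
      note [measurable] = that
      have [measurable]: "(\<lambda>w. f w i) \<in> borel_measurable M"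
        using measurable_compose[OF that(1), of "\<lambda>\<xi>. \<xi> i" borel] by simp
      show "(\<lambda>w. ((W j (g w) (f w))(j := k w)) i) \<in> borel_measurable M"
        by (cases "i = j"; cases "i < j") (simp_all add: W_def)
    qed
    have Hy: "(\<lambda>(\<omega>, y). H \<xi> \<omega> y) \<in> borel_measurable (Q \<Otimes>\<^sub>M borel)" for \<xi>
      unfolding split_beta' by (rule H_meas) (auto simp: space_PiM)
    have HC: "\<bar>H \<xi> \<omega> y - H \<xi> \<omega> y'\<bar> \<le> C * \<bar>y - y'\<bar>" for \<xi> \<omega> y y'
    proof -
      have "(\<Sum>i<J. \<bar>((W j \<omega> \<xi>)(j := y)) i - ((W j \<omega> \<xi>)(j := y')) i\<bar>) = (\<Sum>i\<in>{j}. \<bar>y - y'\<bar>)"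
        using that by (intro sum.mono_neutral_cong_right) auto
      then show ?thesis using C[of \<omega> "(W j \<omega> \<xi>)(j := y)" "(W j \<omega> \<xi>)(j := y')"] by (simp add: H_def)
    qed
    have adH: "adapted (\<kappa> j) (H \<xi>)" for \<xi>
      unfolding adapted_def H_def
    proof (intro allI impI ext)
      fix \<omega> n j' y assume j': "\<kappa> j \<le> j'"
      have "\<Delta> (upd \<omega> j' n) i = \<Delta> \<omega> i" if "i < j" for i
      proof -
        have "\<kappa> (Suc i) \<le> j'" "\<kappa> i \<le> j'" using monoD[OF \<kappa>, of "Suc i" j] monoD[OF \<kappa>, of i j] that j' by auto
        then show ?thesis unfolding \<Delta>_def
          using adaptedD[OF adapted_S[of "\<kappa> (Suc i)" j'] order_refl] adaptedD[OF adapted_S[of "\<kappa> i" j'] order_refl] by simp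
      qed
      then have "W j (upd \<omega> j' n) \<xi> = W j \<omega> \<xi>" by (auto simp: W_def)
      then show "G (upd \<omega> j' n) ((W j (upd \<omega> j' n) \<xi>)(j := y)) = G \<omega> ((W j \<omega> \<xi>)(j := y))"
        using adaptedD[OF adG] by simp
    qed
    have Wsuc: "W (Suc j) \<omega> \<xi> = (W j \<omega> \<xi>)(j := \<Delta> \<omega> j)" for \<omega> \<xi>
      by (auto simp: W_def less_Suc_eq)
    have blk: "\<bar>(\<integral>\<omega>. G \<omega> (W (Suc j) \<omega> \<xi>) \<partial>Q) - (\<integral>\<omega>. \<integral>x. H \<xi> \<omega> (s j * x) \<partial>gauss \<partial>Q)\<bar> \<le> ?B" for \<xi>
      using block[OF Hy[of \<xi>] _ adH HC e h, of K "\<kappa> (Suc j)"] monoD[OF \<kappa>, of j "Suc j"] K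
      by (simp add: Wsuc H_def \<Delta>_def s_def)
    have m1: "(\<lambda>\<xi>. \<integral>\<omega>. G \<omega> (W (Suc j) \<omega> \<xi>) \<partial>Q) \<in> borel_measurable gauss_seq"
      by (rule Q.borel_measurable_lebesgue_integral)
        (use measurable_compose[OF measurable_pair_swap' W_meas[of "Suc j"]] in \<open>simp add: split_beta'\<close>)
    have m2: "(\<lambda>(\<omega>, \<xi>). \<integral>x. H \<xi> \<omega> (s j * x) \<partial>gauss) \<in> borel_measurable (Q \<Otimes>\<^sub>M gauss_seq)"
      unfolding split_beta' by (rule std_normal.borel_measurable_lebesgue_integral)
        (auto simp: split_beta' intro!: H_meas)
    have m3: "(\<lambda>\<xi>. \<integral>\<omega>. \<integral>x. H \<xi> \<omega> (s j * x) \<partial>gauss \<partial>Q) \<in> borel_measurable gauss_seq"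
      by (rule Q.borel_measurable_lebesgue_integral)
        (use measurable_compose[OF measurable_pair_swap' m2] in \<open>simp add: split_beta'\<close>)
    have HK: "\<bar>\<integral>x. H \<xi> \<omega> (s j * x) \<partial>gauss\<bar> \<le> K" for \<xi> \<omega>
      by (rule std_normal.abs_integral_le) (simp add: H_def K)
    have "Hyb (Suc j) = (\<integral>\<xi>. \<integral>\<omega>. G \<omega> (W (Suc j) \<omega> \<xi>) \<partial>Q \<partial>gauss_seq)"
      unfolding Hyb_def by (rule QX.bounded_Fubini(1)[OF W_meas K])
    moreover have "Hyb j = (\<integral>\<xi>. \<integral>\<omega>. \<integral>x. H \<xi> \<omega> (s j * x) \<partial>gauss \<partial>Q \<partial>gauss_seq)"
    proof -
      have "Hyb j = (\<integral>\<omega>. \<integral>\<xi>. \<integral>x. H \<xi> \<omega> (s j * x) \<partial>gauss \<partial>gauss_seq \<partial>Q)"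
        unfolding Hyb_def
      proof (rule Bochner_Integration.integral_cong[OF refl])
        fix \<omega> assume \<omega>: "\<omega> \<in> space Q"
        \<comment> \<open>The Gaussian that \<open>block\<close> integrates separately is put back
          as coordinate \<open>j\<close> of \<open>\<xi>\<close>, by redrawing that
          coordinate.\<close>
        have "(W j \<omega> \<xi>)(j := s j * x) = W j \<omega> (\<xi>(j := x))" for \<xi> x by (auto simp: W_def)
        then have "(\<integral>\<xi>. \<integral>x. H \<xi> \<omega> (s j * x) \<partial>gauss \<partial>gauss_seq)
          = (\<integral>\<xi>. \<integral>x. (\<lambda>\<xi>. G \<omega> (W j \<omega> \<xi>)) (\<xi>(j := x)) \<partial>gauss \<partial>gauss_seq)"
          by (simp add: H_def)
        also have "\<dots> = (\<integral>\<xi>. G \<omega> (W j \<omega> \<xi>) \<partial>gauss_seq)"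
          using measurable_compose_Pair1[OF \<omega> W_meas[of j]]
          by (intro PiM_resample_integral[OF std_normal.prob_space_axioms _ K]) simp
        finally show "(\<integral>\<xi>. G \<omega> (W j \<omega> \<xi>) \<partial>gauss_seq)
          = (\<integral>\<xi>. \<integral>x. H \<xi> \<omega> (s j * x) \<partial>gauss \<partial>gauss_seq)" by simp
      qed
      also have "\<dots> = (\<integral>\<xi>. \<integral>\<omega>. \<integral>x. H \<xi> \<omega> (s j * x) \<partial>gauss \<partial>Q \<partial>gauss_seq)"
        by (rule QX.bounded_Fubini(1)[OF m2 HK])
      finally show ?thesis .
    qed
    moreover have "\<bar>(\<integral>\<xi>. \<integral>\<omega>. G \<omega> (W (Suc j) \<omega> \<xi>) \<partial>Q \<partial>gauss_seq)
      - (\<integral>\<xi>. \<integral>\<omega>. \<integral>x. H \<xi> \<omega> (s j * x) \<partial>gauss \<partial>Q \<partial>gauss_seq)\<bar> \<le> (\<integral>\<xi>. ?B \<partial>gauss_seq)"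
    proof (rule gauss_seq.abs_integral_diff_le)
      show "integrable gauss_seq (\<lambda>\<xi>. \<integral>\<omega>. G \<omega> (W (Suc j) \<omega> \<xi>) \<partial>Q)"
        by (rule gauss_seq.integrable_const_bound[where B=K, OF AE_I2 m1]) (simp, rule Q.abs_integral_le, rule K)
      show "integrable gauss_seq (\<lambda>\<xi>. \<integral>\<omega>. \<integral>x. H \<xi> \<omega> (s j * x) \<partial>gauss \<partial>Q)"
        by (rule gauss_seq.integrable_const_bound[where B=K, OF AE_I2 m3]) (simp, rule Q.abs_integral_le, rule HK)
    qed (simp, rule blk)
    ultimately show ?thesis using gauss_seq.prob_space by simp
  qed
  have tele: "\<bar>Hyb j - Hyb 0\<bar> \<le> real j * (2 * C * e) + real (\<kappa> j - \<kappa> 0) * lindeberg_error K e h" if "j \<le> J" for j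
    using that
  proof (induction j)
    case (Suc j)
    have "\<kappa> 0 \<le> \<kappa> j" "\<kappa> j \<le> \<kappa> (Suc j)" using monoD[OF \<kappa>] by auto
    then have "real (\<kappa> (Suc j) - \<kappa> 0) = real (\<kappa> j - \<kappa> 0) + real (\<kappa> (Suc j) - \<kappa> j)" by linarith
    then have "real (\<kappa> (Suc j) - \<kappa> 0) * lindeberg_error K e h
       = real (\<kappa> j - \<kappa> 0) * lindeberg_error K e h + real (\<kappa> (Suc j) - \<kappa> j) * lindeberg_error K e h"
      by (simp only: distrib_right)
    moreover have "real (Suc j) * (2 * C * e) = real j * (2 * C * e) + 2 * C * e"
      by (simp only: of_nat_Suc distrib_right mult_1_left add.commute)
    ultimately show ?case using step[of j] Suc by linarith
  qed simp
  \<comment> \<open>The Lipschitz bound involves coordinates below \<open>J\<close> only, so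
    \<open>G\<close> cannot see where \<open>W J\<close> and \<open>\<Delta>\<close> differ.\<close>
  have "G \<omega> (W J \<omega> \<xi>) = G \<omega> (\<Delta> \<omega>)" for \<omega> \<xi>
    using C[of \<omega> "W J \<omega> \<xi>" "\<Delta> \<omega>"] by (simp add: W_def)
  then have "Hyb J = (\<integral>\<omega>. G \<omega> (\<lambda>j. S \<omega> (\<kappa> (Suc j)) - S \<omega> (\<kappa> j)) \<partial>Q)"
    using gauss_seq.prob_space by (simp add: Hyb_def \<Delta>_def[abs_def])
  moreover have "Hyb 0 = (\<integral>\<omega>. \<integral>\<xi>. G \<omega> (\<lambda>j. sqrt (h * real (\<kappa> (Suc j) - \<kappa> j)) * \<xi> j) \<partial>gauss_seq \<partial>Q)"
    by (simp add: Hyb_def W_def s_def)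
  ultimately show ?thesis using tele[of J] by simp
qed

text \<open>Freezing the increments once the level \<open>\<theta>\<close> is reached turns the fourth moment bound into a maximal inequality.\<close>

primrec stopped :: "real \<Rightarrow> nat \<Rightarrow> 's \<times> (nat \<Rightarrow> 'n) \<Rightarrow> nat \<Rightarrow> real" where
  "stopped \<theta> r \<omega> 0 = 0"
| "stopped \<theta> r \<omega> (Suc i) = stopped \<theta> r \<omega> i
    + (if \<bar>stopped \<theta> r \<omega> i\<bar> < \<theta> then 1 else 0) * m (X \<omega> (r + i)) (snd \<omega> (r + i))"

lemma stopped_measurable[measurable]: "(\<lambda>\<omega>. stopped \<theta> r \<omega> i) \<in> borel_measurable Q"
  by (induction i) auto

lemma adapted_stopped: "adapted (r + i) (\<lambda>\<omega>. stopped \<theta> r \<omega> i)"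
proof (induction i)
  case (Suc i)
  have "adapted (Suc (r + i)) (\<lambda>\<omega>. stopped \<theta> r \<omega> i)" "adapted (Suc (r + i)) (\<lambda>\<omega>. X \<omega> (r + i))"
    "adapted (Suc (r + i)) (\<lambda>\<omega>. snd \<omega> (r + i))"
    using adapted_mono[OF Suc] adapted_mono[OF adapted_X[of "r + i"]] adapted_snd by auto
  then show ?case by (simp add: adapted_def)
qed (simp add: adapted_def)

lemma stopped_reaches:
  assumes "0 < \<theta>" "k \<le> i" "\<theta> \<le> \<bar>S \<omega> (r + k) - S \<omega> r\<bar>"
  shows "\<theta> \<le> \<bar>stopped \<theta> r \<omega> i\<bar>"
proof -
  have "\<theta> \<le> \<bar>stopped \<theta> r \<omega> i\<bar> \<or> (stopped \<theta> r \<omega> i = S \<omega> (r + i) - S \<omega> r \<and>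
      (\<forall>k\<le>i. \<bar>S \<omega> (r + k) - S \<omega> r\<bar> < \<theta>))" for i
  proof (induction i)
    case (Suc i)
    then show ?case
    proof
      assume "stopped \<theta> r \<omega> i = S \<omega> (r + i) - S \<omega> r \<and> (\<forall>k\<le>i. \<bar>S \<omega> (r + k) - S \<omega> r\<bar> < \<theta>)"
      then have "stopped \<theta> r \<omega> (Suc i) = S \<omega> (r + Suc i) - S \<omega> r" "\<forall>k\<le>i. \<bar>S \<omega> (r + k) - S \<omega> r\<bar> < \<theta>"
        by (simp_all add: S_def)
      then show ?thesis by (metis le_SucE not_le)
    qed simp
  qed (use assms in simp)
  then show ?thesis using assms by (meson not_le)
qed

text \<open>The term 4 a b^3 of the binomial expansion is absorbed by 2 a^2 b^2 + 2 b^4. The term in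
  a^3 b keeps its exact coefficient, because it vanishes when the centered increment
  \<open>b\<close> is averaged.\<close>

lemma quartic_bound:
  fixes a b :: real shows "(a + b)^4 \<le> a^4 + 4 * a^3 * b + 8 * a\<^sup>2 * b\<^sup>2 + 3 * b^4"
proof -
  have "a^4 + 4 * a^3 * b + 8 * a\<^sup>2 * b\<^sup>2 + 3 * b^4 - (a + b)^4 = 2 * (b * (a - b))\<^sup>2"
    by (simp add: power2_eq_square power3_eq_cube power4_eq_xxxx algebra_simps)
  also have "0 \<le> \<dots>" by simp
  finally show ?thesis by simp
qed

lemma power4_sum_le:
  fixes a b :: real shows "(a + b)^4 \<le> 8 * a^4 + 8 * b^4"
proof -
  have "8 * a^4 + 8 * b^4 - (a + b)^4 = (a - b)\<^sup>2 * (5 * (a + b)\<^sup>2 + 2 * a\<^sup>2 + 2 * b\<^sup>2)"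
    by (simp add: power2_eq_square power4_eq_xxxx algebra_simps)
  also have "0 \<le> \<dots>" by simp
  finally show ?thesis by simp
qed

lemma square_le_quartic:
  fixes x :: real shows "x\<^sup>2 \<le> 1 + x^4"
proof (cases "\<bar>x\<bar> \<le> 1")
  case True then show ?thesis by (simp add: abs_square_le_1 add_increasing2)
next
  case False then show ?thesis using power_increasing[of 2 4 "\<bar>x\<bar>"] by (simp add: power_even_abs)
qed

text \<open>One step adds at most \<open>\<kappa>2\<close> to the second moment and
  \<open>8 * \<kappa>2 * (real i * \<kappa>2) + 3 * \<kappa>4\<close> to the fourth. As
  \<open>\<kappa>2\<^sup>2 \<le> \<kappa>4\<close>, the latter is at most 8 i + 3 times
  \<open>\<kappa>4\<close>, while 4 i^2 + 3 i grows by 8 i + 7. Integrability of the fourth power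
  has to be carried through the same induction.\<close>

lemma stopped_moments:
  defines "\<kappa>2 \<equiv> (\<integral>n. \<rho> n ^ 2 \<partial>V)" and "\<kappa>4 \<equiv> (\<integral>n. \<rho> n ^ 4 \<partial>V)"
  shows "integrable Q (\<lambda>\<omega>. stopped \<theta> r \<omega> i ^ 4)"
    and "(\<integral>\<omega>. (stopped \<theta> r \<omega> i)\<^sup>2 \<partial>Q) \<le> real i * \<kappa>2"
    and "(\<integral>\<omega>. stopped \<theta> r \<omega> i ^ 4 \<partial>Q) \<le> (4 * (real i)\<^sup>2 + 3 * real i) * \<kappa>4"
proof -
  have k24: "\<kappa>2\<^sup>2 \<le> \<kappa>4"
  proof -
    have "0 \<le> (\<integral>n. (\<rho> n ^ 2 - \<kappa>2)\<^sup>2 \<partial>V)" by (rule Bochner_Integration.integral_nonneg) simp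
    also have "(\<integral>n. (\<rho> n ^ 2 - \<kappa>2)\<^sup>2 \<partial>V) = (\<integral>n. \<rho> n ^ 4 - 2 * \<kappa>2 * \<rho> n ^ 2 + \<kappa>2\<^sup>2 \<partial>V)"
      by (intro Bochner_Integration.integral_cong) (auto simp: power2_eq_square power4_eq_xxxx algebra_simps)
    also have "\<dots> = \<kappa>4 - 2 * \<kappa>2 * \<kappa>2 + \<kappa>2\<^sup>2"
      using integrable_rho[of 2] integrable_rho[of 4] V.prob_space by (simp add: \<kappa>2_def \<kappa>4_def)
    finally show ?thesis by (simp add: power2_eq_square)
  qed
  have k0: "0 \<le> \<kappa>2" "0 \<le> \<kappa>4" unfolding \<kappa>2_def \<kappa>4_def using rho_nonneg
    by (auto intro!: Bochner_Integration.integral_nonneg)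
  have "integrable Q (\<lambda>\<omega>. stopped \<theta> r \<omega> i ^ 4) \<and> (\<integral>\<omega>. (stopped \<theta> r \<omega> i)\<^sup>2 \<partial>Q) \<le> real i * \<kappa>2
    \<and> (\<integral>\<omega>. stopped \<theta> r \<omega> i ^ 4 \<partial>Q) \<le> (4 * (real i)\<^sup>2 + 3 * real i) * \<kappa>4"
  proof (induction i)
    case (Suc i)
    let ?N = "\<lambda>\<omega>. stopped \<theta> r \<omega> i"
    define c :: "_ \<Rightarrow> real" where "c \<omega> = (if \<bar>?N \<omega>\<bar> < \<theta> then 1 else 0)" for \<omega>
    have c: "c \<omega> = 0 \<or> c \<omega> = 1" for \<omega> by (simp add: c_def)
    have [measurable]: "c \<in> borel_measurable Q" unfolding c_def[abs_def] by measurable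
    define Z where "Z \<omega> n = ?N \<omega> + c \<omega> * m (X \<omega> (r + i)) n" for \<omega> n
    have adZ: "adapted (r + i) (\<lambda>\<omega> n. p (Z \<omega> n))" for p :: "real \<Rightarrow> real"
      using adapted_stopped[of r i \<theta>] adapted_X[of "r + i"] by (simp add: adapted_def Z_def c_def)
    have [measurable]: "(\<lambda>w. Z (fst w) (snd w)) \<in> borel_measurable (Q \<Otimes>\<^sub>M V)" unfolding Z_def by measurable
    have N4: "integrable Q (\<lambda>\<omega>. ?N \<omega> ^ 4)" using Suc by simp
    have N2: "integrable Q (\<lambda>\<omega>. (?N \<omega>)\<^sup>2)"
    proof (rule Bochner_Integration.integrable_bound[where f="\<lambda>\<omega>. 1 + ?N \<omega> ^ 4"])
      show "AE \<omega> in Q. norm ((?N \<omega>)\<^sup>2) \<le> norm (1 + ?N \<omega> ^ 4)" by (simp add: square_le_quartic)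
    qed (use N4 in auto)
    have int4: "integrable (Q \<Otimes>\<^sub>M V) (\<lambda>w. Z (fst w) (snd w) ^ 4)"
    proof (rule Bochner_Integration.integrable_bound)
      have i1: "integrable (Q \<Otimes>\<^sub>M V) (\<lambda>(\<omega>, n). ?N \<omega> ^ 4)"
        by (rule QV.Fubini_integrable) (use N4 V.prob_space in auto)
      have i2: "integrable (Q \<Otimes>\<^sub>M V) (\<lambda>(\<omega>, n). \<rho> n ^ 4)"
        by (rule QV.Fubini_integrable) (use integrable_rho[of 4] in auto)
      show "integrable (Q \<Otimes>\<^sub>M V) (\<lambda>w. 8 * (case w of (\<omega>, n) \<Rightarrow> ?N \<omega> ^ 4) + 8 * (case w of (\<omega>, n) \<Rightarrow> \<rho> n ^ 4))"
        using i1 i2 by (intro Bochner_Integration.integrable_add integrable_mult_right)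
      have "norm (Z \<omega> n ^ 4) \<le> norm (8 * ?N \<omega> ^ 4 + 8 * \<rho> n ^ 4)" for \<omega> n
      proof -
        have "\<bar>c \<omega> * m (X \<omega> (r + i)) n\<bar> \<le> \<rho> n" using c[of \<omega>] m_le rho_nonneg by auto
        then have "(c \<omega> * m (X \<omega> (r + i)) n)^4 \<le> \<rho> n ^ 4"
          using power_mono[of "\<bar>c \<omega> * m (X \<omega> (r + i)) n\<bar>" "\<rho> n" 4] by simp
        then show ?thesis using power4_sum_le[of "?N \<omega>" "c \<omega> * m (X \<omega> (r + i)) n"] by (simp add: Z_def)
      qed
      then show "AE w in Q \<Otimes>\<^sub>M V. norm (Z (fst w) (snd w) ^ 4)
        \<le> norm (8 * (case w of (\<omega>, n) \<Rightarrow> ?N \<omega> ^ 4) + 8 * (case w of (\<omega>, n) \<Rightarrow> \<rho> n ^ 4))"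
        by (simp add: split_beta')
    qed measurable
    have st: "stopped \<theta> r \<omega> (Suc i) = Z \<omega> (snd \<omega> (r + i))" for \<omega> by (simp add: Z_def c_def)
    have int4': "integrable Q (\<lambda>\<omega>. stopped \<theta> r \<omega> (Suc i) ^ 4)"
      unfolding st using int4 by (subst integrable_step[OF _ adZ[of "\<lambda>x. x ^ 4"]]) (auto simp: split_beta')
    have int2: "integrable (Q \<Otimes>\<^sub>M V) (\<lambda>w. (Z (fst w) (snd w))\<^sup>2)"
    proof (rule Bochner_Integration.integrable_bound[where f="\<lambda>w. 1 + Z (fst w) (snd w) ^ 4"])
      show "AE w in Q \<Otimes>\<^sub>M V. norm ((Z (fst w) (snd w))\<^sup>2) \<le> norm (1 + Z (fst w) (snd w) ^ 4)" by (simp add: square_le_quartic)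
    qed (use int4 in auto)
    have in2: "(\<integral>n. (Z \<omega> n)\<^sup>2 \<partial>V) \<le> (?N \<omega>)\<^sup>2 + \<kappa>2"
      and in4: "(\<integral>n. Z \<omega> n ^ 4 \<partial>V) \<le> ?N \<omega> ^ 4 + 8 * \<kappa>2 * (?N \<omega>)\<^sup>2 + 3 * \<kappa>4" if \<omega>: "\<omega> \<in> space Q" for \<omega>
    proof -
      have x: "X \<omega> (r + i) \<in> space P0" by (rule X_in_space[OF \<omega>])
      let ?m = "m (X \<omega> (r + i))"
      note [measurable] = m_sect[OF x]
      note im = integrable_m[OF x] integrable_m2[OF x] integrable_m_abs[OF x, of 4]
      have im4: "integrable V (\<lambda>n. ?m n ^ 4)" using im(3) by (simp add: power_even_abs)
      have v2: "(\<integral>n. (?m n)\<^sup>2 \<partial>V) \<le> \<kappa>2" using integral_m_abs_le[OF x, of 2] by (simp add: \<kappa>2_def)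
      have v4: "(\<integral>n. ?m n ^ 4 \<partial>V) \<le> \<kappa>4" using integral_m_abs_le[OF x, of 4] by (simp add: \<kappa>4_def power_even_abs)
      have "(\<integral>n. (Z \<omega> n)\<^sup>2 \<partial>V) = (\<integral>n. (?N \<omega>)\<^sup>2 + 2 * ?N \<omega> * c \<omega> * ?m n + (c \<omega>)\<^sup>2 * (?m n)\<^sup>2 \<partial>V)"
        by (intro Bochner_Integration.integral_cong) (auto simp: Z_def power2_eq_square algebra_simps)
      also have "\<dots> = (?N \<omega>)\<^sup>2 + (c \<omega>)\<^sup>2 * (\<integral>n. (?m n)\<^sup>2 \<partial>V)"
        using im m_centered[OF x] V.prob_space by simp
      also have "\<dots> \<le> (?N \<omega>)\<^sup>2 + \<kappa>2" using c[of \<omega>] v2 k0 by auto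
      finally show "(\<integral>n. (Z \<omega> n)\<^sup>2 \<partial>V) \<le> (?N \<omega>)\<^sup>2 + \<kappa>2" .
      show "(\<integral>n. Z \<omega> n ^ 4 \<partial>V) \<le> ?N \<omega> ^ 4 + 8 * \<kappa>2 * (?N \<omega>)\<^sup>2 + 3 * \<kappa>4"
      proof (cases "c \<omega> = 0")
        case True
        then show ?thesis using k0 V.prob_space by (simp add: Z_def)
      next
        case False
        then have c1: "c \<omega> = 1" using c[of \<omega>] by simp
        let ?b = "\<lambda>n. ?N \<omega> ^ 4 + 4 * ?N \<omega> ^ 3 * ?m n + 8 * (?N \<omega>)\<^sup>2 * (?m n)\<^sup>2 + 3 * ?m n ^ 4"
        have "(\<integral>n. Z \<omega> n ^ 4 \<partial>V) \<le> (\<integral>n. ?b n \<partial>V)"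
        proof (rule integral_mono_AE')
          show "integrable V ?b" using im im4 by simp
          show "AE n in V. Z \<omega> n ^ 4 \<le> ?b n" by (simp add: Z_def c1 quartic_bound)
          show "AE n in V. 0 \<le> ?b n" by (intro AE_I2 order_trans[OF _ quartic_bound]) simp
        qed
        also have "\<dots> = ?N \<omega> ^ 4 + 8 * (?N \<omega>)\<^sup>2 * (\<integral>n. (?m n)\<^sup>2 \<partial>V) + 3 * (\<integral>n. ?m n ^ 4 \<partial>V)"
          using im im4 m_centered[OF x] V.prob_space by simp
        also have "\<dots> \<le> ?N \<omega> ^ 4 + 8 * (?N \<omega>)\<^sup>2 * \<kappa>2 + 3 * \<kappa>4"
          by (intro add_mono mult_left_mono v2 v4) auto
        finally show ?thesis by (simp add: ac_simps)
      qed
    qed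
    have "(\<integral>\<omega>. (stopped \<theta> r \<omega> (Suc i))\<^sup>2 \<partial>Q) = (\<integral>w. (Z (fst w) (snd w))\<^sup>2 \<partial>(Q \<Otimes>\<^sub>M V))"
      unfolding st by (rule integral_step[OF _ adZ[of "\<lambda>x. x\<^sup>2"]]) (auto simp: split_beta')
    also have "\<dots> = (\<integral>\<omega>. \<integral>n. (Z \<omega> n)\<^sup>2 \<partial>V \<partial>Q)"
      using QV.integral_fst'[OF int2] by simp
    also have "\<dots> \<le> (\<integral>\<omega>. (?N \<omega>)\<^sup>2 + \<kappa>2 \<partial>Q)"
      using QV.integrable_fst'[OF int2] N2 by (intro integral_mono in2) auto
    also have "\<dots> = (\<integral>\<omega>. (?N \<omega>)\<^sup>2 \<partial>Q) + \<kappa>2" using N2 Q.prob_space by simp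
    finally have c2: "(\<integral>\<omega>. (stopped \<theta> r \<omega> (Suc i))\<^sup>2 \<partial>Q) \<le> real (Suc i) * \<kappa>2"
      using Suc by (simp add: algebra_simps)
    have "(\<integral>\<omega>. stopped \<theta> r \<omega> (Suc i) ^ 4 \<partial>Q) = (\<integral>w. Z (fst w) (snd w) ^ 4 \<partial>(Q \<Otimes>\<^sub>M V))"
      unfolding st by (rule integral_step[OF _ adZ[of "\<lambda>x. x ^ 4"]]) (auto simp: split_beta')
    also have "\<dots> = (\<integral>\<omega>. \<integral>n. Z \<omega> n ^ 4 \<partial>V \<partial>Q)"
      using QV.integral_fst'[OF int4] by simp
    also have "\<dots> \<le> (\<integral>\<omega>. ?N \<omega> ^ 4 + 8 * \<kappa>2 * (?N \<omega>)\<^sup>2 + 3 * \<kappa>4 \<partial>Q)"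
      using QV.integrable_fst'[OF int4] N2 N4 by (intro integral_mono in4) auto
    also have "\<dots> = (\<integral>\<omega>. ?N \<omega> ^ 4 \<partial>Q) + 8 * \<kappa>2 * (\<integral>\<omega>. (?N \<omega>)\<^sup>2 \<partial>Q) + 3 * \<kappa>4"
      using N2 N4 Q.prob_space by simp
    also have "\<dots> \<le> (4 * (real i)\<^sup>2 + 3 * real i) * \<kappa>4 + 8 * \<kappa>2 * (real i * \<kappa>2) + 3 * \<kappa>4"
      using Suc k0 by (intro add_mono mult_left_mono) auto
    also have "8 * \<kappa>2 * (real i * \<kappa>2) = 8 * real i * \<kappa>2\<^sup>2" by (simp add: power2_eq_square)
    also have "8 * real i * \<kappa>2\<^sup>2 \<le> 8 * real i * \<kappa>4" using k24 by (intro mult_left_mono) auto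
    also have "(4 * (real i)\<^sup>2 + 3 * real i) * \<kappa>4 + 8 * real i * \<kappa>4 + 3 * \<kappa>4 \<le> (4 * (real (Suc i))\<^sup>2 + 3 * real (Suc i)) * \<kappa>4"
      using k0 by (simp add: power2_eq_square algebra_simps)
    finally have c4: "(\<integral>\<omega>. stopped \<theta> r \<omega> (Suc i) ^ 4 \<partial>Q) \<le> (4 * (real (Suc i))\<^sup>2 + 3 * real (Suc i)) * \<kappa>4" by simp
    show ?case using int4' c2 c4 by blast
  qed simp
  then show "integrable Q (\<lambda>\<omega>. stopped \<theta> r \<omega> i ^ 4)" "(\<integral>\<omega>. (stopped \<theta> r \<omega> i)\<^sup>2 \<partial>Q) \<le> real i * \<kappa>2"
    "(\<integral>\<omega>. stopped \<theta> r \<omega> i ^ 4 \<partial>Q) \<le> (4 * (real i)\<^sup>2 + 3 * real i) * \<kappa>4" by auto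
qed

text \<open>Markov's inequality for the fourth power of the stopped sum. What matters is that the
  bound is quadratic in the block length: over n blocks of relative length 1/n it sums to order
  1/n.\<close>

lemma maximal:
  assumes "r \<le> r'" "0 < \<theta>"
  shows "Q.prob {\<omega> \<in> space Q. \<exists>k. r \<le> k \<and> k \<le> r' \<and> \<theta> \<le> \<bar>S \<omega> k - S \<omega> r\<bar>}
    \<le> 7 * (real (r' - r))\<^sup>2 * (\<integral>n. \<rho> n ^ 4 \<partial>V) / \<theta>^4"
proof -
  let ?D = "r' - r"
  have "Q.prob {\<omega> \<in> space Q. \<exists>k. r \<le> k \<and> k \<le> r' \<and> \<theta> \<le> \<bar>S \<omega> k - S \<omega> r\<bar>}
    \<le> Q.prob {\<omega> \<in> space Q. \<theta>^4 \<le> stopped \<theta> r \<omega> ?D ^ 4}"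
  proof (rule Q.finite_measure_mono)
    show "{\<omega> \<in> space Q. \<exists>k. r \<le> k \<and> k \<le> r' \<and> \<theta> \<le> \<bar>S \<omega> k - S \<omega> r\<bar>}
      \<subseteq> {\<omega> \<in> space Q. \<theta>^4 \<le> stopped \<theta> r \<omega> ?D ^ 4}"
    proof clarify
      fix \<omega>' ns k assume k: "r \<le> k" "k \<le> r'" "\<theta> \<le> \<bar>S (\<omega>', ns) k - S (\<omega>', ns) r\<bar>"
      then have "\<theta> \<le> \<bar>stopped \<theta> r (\<omega>', ns) ?D\<bar>"
        using assms by (intro stopped_reaches[where k="k - r"]) auto
      then have "\<theta>^4 \<le> \<bar>stopped \<theta> r (\<omega>', ns) ?D\<bar>^4" using assms by (intro power_mono) auto
      then show "\<theta>^4 \<le> stopped \<theta> r (\<omega>', ns) ?D ^ 4" by (simp add: power_even_abs)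
    qed
  qed measurable
  also have "\<dots> \<le> (\<integral>\<omega>. stopped \<theta> r \<omega> ?D ^ 4 \<partial>Q) / \<theta>^4"
    using assms by (intro integral_Markov_inequality_measure[where A="{}"] stopped_moments(1)) auto
  also have "\<dots> \<le> (1 / \<theta>^4) * ((4 * (real ?D)\<^sup>2 + 3 * real ?D) * (\<integral>n. \<rho> n ^ 4 \<partial>V))"
    using divide_right_mono[OF stopped_moments(3), of "\<theta>^4" \<theta> r ?D] by simp
  also have "\<dots> \<le> (1 / \<theta>^4) * ((7 * (real ?D)\<^sup>2) * (\<integral>n. \<rho> n ^ 4 \<partial>V))"
  proof (intro mult_left_mono mult_right_mono)
    have "real ?D \<le> (real ?D)\<^sup>2" by (simp add: power2_eq_square) (metis le_square of_nat_le_iff of_nat_mult)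
    then show "4 * (real ?D)\<^sup>2 + 3 * real ?D \<le> 7 * (real ?D)\<^sup>2" by linarith
  qed (use rho_nonneg in \<open>auto intro!: Bochner_Integration.integral_nonneg\<close>)
  finally show ?thesis by simp
qed

end

section \<open>Stationarity of the sampler\<close>

locale pos_density =
  fixes f :: "real \<Rightarrow> real"
  assumes f_pos: "f x > 0" and f_borel[measurable]: "f \<in> borel_measurable borel"
    and f_integrable: "integrable lborel f" and f_integral: "(\<integral>x. f x \<partial>lborel) = 1"
begin

abbreviation fm :: "real measure" where "fm \<equiv> density lborel f"

lemma prob_fm: "prob_space fm"
proof
  have "(\<integral>\<^sup>+x. ennreal (f x) \<partial>lborel) = ennreal 1"
    using nn_integral_eq_integral[OF f_integrable] f_integral f_pos by (simp add: less_imp_le)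
  then show "emeasure fm (space fm) = 1" by (simp add: emeasure_density)
qed

sublocale fm: prob_space fm by (rule prob_fm)

abbreviation mu :: "(nat \<Rightarrow> real) measure" where "mu \<equiv> PiM UNIV (\<lambda>i::nat. fm)"

sublocale mu: prob_space mu by (intro prob_space_PiM prob_fm)
sublocale MG: pair_prob_space mu gauss_seq ..

text \<open>The involution below for a single coordinate. The ratio replaces the density at
  \<open>a\<close> by the density at the shifted point; then Lebesgue measure is invariant under the
  shift by \<open>\<sigma> * b\<close>, and the Gaussian density is even.\<close>

lemma nn_integral_fm_shift:
  fixes H :: "real \<Rightarrow> real \<Rightarrow> ennreal"
  assumes H: "(\<lambda>(a, b). H a b) \<in> borel_measurable (borel \<Otimes>\<^sub>M borel)"
  shows "(\<integral>\<^sup>+a. \<integral>\<^sup>+b. H (a + \<sigma> * b) (- b) * ennreal (f (a + \<sigma> * b) / f a) \<partial>gauss \<partial>fm)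
    = (\<integral>\<^sup>+a. \<integral>\<^sup>+b. H a b \<partial>gauss \<partial>fm)"
proof -
  note Hc[measurable] = measurable_uncurry_compose[OF H]
  let ?\<phi> = "\<lambda>b. ennreal (std_normal_density b)"
  have cancel: "ennreal (f a) * ennreal (f y / f a) = ennreal (f y)" for a y
    using f_pos[of a] f_pos[of y] by (simp add: ennreal_mult[symmetric])
  have cancel': "ennreal (f a) * (p * (q * ennreal (f y / f a))) = p * (q * ennreal (f y))" for a y p q
    by (simp only: mult.left_commute[of "ennreal (f a)"] cancel)
  have "(\<integral>\<^sup>+a. \<integral>\<^sup>+b. H (a + \<sigma> * b) (- b) * ennreal (f (a + \<sigma> * b) / f a) \<partial>gauss \<partial>fm)
    = (\<integral>\<^sup>+a. ennreal (f a) * (\<integral>\<^sup>+b. ?\<phi> b * (H (a + \<sigma> * b) (- b) * ennreal (f (a + \<sigma> * b) / f a)) \<partial>lborel) \<partial>lborel)"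
    by (simp add: nn_integral_density)
  also have "\<dots> = (\<integral>\<^sup>+a. \<integral>\<^sup>+b. ?\<phi> b * (H (a + \<sigma> * b) (- b) * ennreal (f (a + \<sigma> * b))) \<partial>lborel \<partial>lborel)"
    by (subst nn_integral_cmult[symmetric]) (auto simp: cancel' intro!: nn_integral_cong)
  also have "\<dots> = (\<integral>\<^sup>+b. \<integral>\<^sup>+a. ?\<phi> b * (H (a + \<sigma> * b) (- b) * ennreal (f (a + \<sigma> * b))) \<partial>lborel \<partial>lborel)"
    by (rule lborel_pair.Fubini'[symmetric]) measurable
  also have "\<dots> = (\<integral>\<^sup>+b. \<integral>\<^sup>+a. ?\<phi> b * (H a (- b) * ennreal (f a)) \<partial>lborel \<partial>lborel)"
  proof (rule nn_integral_cong)
    fix b :: real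
    show "(\<integral>\<^sup>+a. ?\<phi> b * (H (a + \<sigma> * b) (- b) * ennreal (f (a + \<sigma> * b))) \<partial>lborel)
      = (\<integral>\<^sup>+a. ?\<phi> b * (H a (- b) * ennreal (f a)) \<partial>lborel)"
      using nn_integral_real_affine[of "\<lambda>a. ?\<phi> b * (H a (- b) * ennreal (f a))" 1 "\<sigma> * b"]
      by (simp add: add.commute)
  qed
  also have "\<dots> = (\<integral>\<^sup>+b. \<integral>\<^sup>+a. ?\<phi> b * (H a b * ennreal (f a)) \<partial>lborel \<partial>lborel)"
    using nn_integral_real_affine[of "\<lambda>b. \<integral>\<^sup>+a. ?\<phi> b * (H a b * ennreal (f a)) \<partial>lborel" "-1" 0]
    by (simp add: std_normal_density_def)
  also have "\<dots> = (\<integral>\<^sup>+a. \<integral>\<^sup>+b. ?\<phi> b * (H a b * ennreal (f a)) \<partial>lborel \<partial>lborel)"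
    by (rule lborel_pair.Fubini') measurable
  also have "\<dots> = (\<integral>\<^sup>+a. \<integral>\<^sup>+b. H a b \<partial>gauss \<partial>fm)"
    by (subst (1 2) nn_integral_density)
      (auto simp: nn_integral_cmult[symmetric] ac_simps intro!: nn_integral_cong)
  finally show ?thesis .
qed

end

lemma PiM_resample_nn_integral:
  fixes g :: "(nat \<Rightarrow> 'a) \<Rightarrow> ennreal"
  assumes M: "prob_space M" and g[measurable]: "g \<in> borel_measurable (PiM UNIV (\<lambda>_. M))"
  shows "(\<integral>\<^sup>+\<xi>. \<integral>\<^sup>+x. g (\<xi>(j := x)) \<partial>M \<partial>PiM UNIV (\<lambda>_. M)) = (\<integral>\<^sup>+\<xi>. g \<xi> \<partial>PiM UNIV (\<lambda>_. M))"
proof -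
  interpret M: prob_space M by (rule M)
  interpret PM: prob_space "PiM UNIV (\<lambda>_::nat. M)" by (intro prob_space_PiM M)
  interpret pair_prob_space M "PiM UNIV (\<lambda>_::nat. M)" ..
  have [measurable]: "(\<lambda>(x, \<xi>). \<xi>(j := x)) \<in> M \<Otimes>\<^sub>M PiM UNIV (\<lambda>_. M) \<rightarrow>\<^sub>M PiM UNIV (\<lambda>_. M)"
    unfolding split_beta by (rule measurable_fun_upd[where J=UNIV]) auto
  have "(\<integral>\<^sup>+\<xi>. \<integral>\<^sup>+x. g (\<xi>(j := x)) \<partial>M \<partial>PiM UNIV (\<lambda>_. M)) = (\<integral>\<^sup>+w. g ((snd w)(j := fst w)) \<partial>(M \<Otimes>\<^sub>M PiM UNIV (\<lambda>_. M)))"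
    by (subst nn_integral_snd[symmetric]) (auto simp: split_beta')
  also have "\<dots> = (\<integral>\<^sup>+\<xi>. g \<xi> \<partial>distr (M \<Otimes>\<^sub>M PiM UNIV (\<lambda>_. M)) (PiM UNIV (\<lambda>_. M)) (\<lambda>(x, \<xi>). \<xi>(j := x)))"
    by (subst nn_integral_distr) (auto simp: split_beta')
  finally show ?thesis by (simp add: PiM_resample M)
qed

lemma measurable_fun_upd_pair[measurable]:
  "(\<lambda>(X, x). X(j := x)) \<in> PiM UNIV (\<lambda>_. M) \<Otimes>\<^sub>M M \<rightarrow>\<^sub>M PiM UNIV (\<lambda>_. M)"
  unfolding split_beta by (rule measurable_fun_upd[where J=UNIV]) auto

lemma measurable_fun_upd_compose:
  "F \<in> N \<rightarrow>\<^sub>M PiM UNIV (\<lambda>_. M) \<Longrightarrow> a \<in> N \<rightarrow>\<^sub>M M \<Longrightarrow> (\<lambda>w. (F w)(j := a w)) \<in> N \<rightarrow>\<^sub>M PiM UNIV (\<lambda>_. M)"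
  by (rule measurable_fun_upd[where J=UNIV]) auto

lemma nn_integral_resample_pair:
  fixes K :: "(nat \<Rightarrow> 'a) \<Rightarrow> (nat \<Rightarrow> 'b) \<Rightarrow> ennreal"
  assumes M: "prob_space M" and N: "prob_space N"
    and K: "(\<lambda>(x, Z). K x Z) \<in> borel_measurable (PiM UNIV (\<lambda>_. M) \<Otimes>\<^sub>M PiM UNIV (\<lambda>_. N))"
  shows "(\<integral>\<^sup>+x. \<integral>\<^sup>+Z. K x Z \<partial>PiM UNIV (\<lambda>_. N) \<partial>PiM UNIV (\<lambda>_. M))
    = (\<integral>\<^sup>+x. \<integral>\<^sup>+Z. \<integral>\<^sup>+a. \<integral>\<^sup>+b. K (x(j := a)) (Z(j := b)) \<partial>N \<partial>M \<partial>PiM UNIV (\<lambda>_. N) \<partial>PiM UNIV (\<lambda>_. M))"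
proof -
  interpret M: prob_space M by (rule M)
  interpret N: prob_space N by (rule N)
  let ?PM = "PiM UNIV (\<lambda>_::nat. M)" and ?PN = "PiM UNIV (\<lambda>_::nat. N)"
  interpret PM: prob_space ?PM by (intro prob_space_PiM M)
  interpret PN: prob_space ?PN by (intro prob_space_PiM N)
  interpret NM: pair_prob_space M ?PN ..
  note Kc = measurable_uncurry_compose[OF K]
  have "(\<integral>\<^sup>+x. \<integral>\<^sup>+Z. K x Z \<partial>?PN \<partial>?PM) = (\<integral>\<^sup>+x. \<integral>\<^sup>+a. \<integral>\<^sup>+Z. K (x(j := a)) Z \<partial>?PN \<partial>M \<partial>?PM)"
    using PN.borel_measurable_nn_integral[OF K]
    by (intro PiM_resample_nn_integral[OF M, symmetric]) simp
  also have "\<dots> = (\<integral>\<^sup>+x. \<integral>\<^sup>+a. \<integral>\<^sup>+Z. \<integral>\<^sup>+b. K (x(j := a)) (Z(j := b)) \<partial>N \<partial>?PN \<partial>M \<partial>?PM)"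
  proof (rule nn_integral_cong, rule nn_integral_cong, rule PiM_resample_nn_integral[OF N, symmetric])
    fix x a assume "x \<in> space ?PM" "a \<in> space M"
    then have "x(j := a) \<in> space ?PM" by (auto simp: space_PiM)
    then show "K (x(j := a)) \<in> borel_measurable ?PN"
      using measurable_compose_Pair1[OF _ K] by simp
  qed
  also have "\<dots> = (\<integral>\<^sup>+x. \<integral>\<^sup>+Z. \<integral>\<^sup>+a. \<integral>\<^sup>+b. K (x(j := a)) (Z(j := b)) \<partial>N \<partial>M \<partial>?PN \<partial>?PM)"
  proof (rule nn_integral_cong)
    fix x assume x: "x \<in> space ?PM"
    have "(\<lambda>w. K (x(j := fst (fst w))) ((snd (fst w))(j := snd w))) \<in> borel_measurable ((M \<Otimes>\<^sub>M ?PN) \<Otimes>\<^sub>M N)"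
      by (intro Kc measurable_fun_upd_compose) (use x in auto)
    then have "(\<lambda>w. \<integral>\<^sup>+b. K (x(j := fst w)) ((snd w)(j := b)) \<partial>N) \<in> borel_measurable (M \<Otimes>\<^sub>M ?PN)"
      by (intro N.borel_measurable_nn_integral) (simp add: split_beta')
    then show "(\<integral>\<^sup>+a. \<integral>\<^sup>+Z. \<integral>\<^sup>+b. K (x(j := a)) (Z(j := b)) \<partial>N \<partial>?PN \<partial>M)
      = (\<integral>\<^sup>+Z. \<integral>\<^sup>+a. \<integral>\<^sup>+b. K (x(j := a)) (Z(j := b)) \<partial>N \<partial>M \<partial>?PN)"
      by (intro NM.Fubini'[symmetric]) (simp add: split_beta')
  qed
  finally show ?thesis .
qed

text \<open>\<open>(x, Z) \<mapsto> (move \<sigma> A x Z, flip A Z)\<close> is an involution changing the target measure by the factor \<open>ratio\<close>; this gives detailed balance.\<close>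

definition move :: "real \<Rightarrow> nat set \<Rightarrow> (nat \<Rightarrow> real) \<Rightarrow> (nat \<Rightarrow> real) \<Rightarrow> nat \<Rightarrow> real" where
  "move \<sigma> A x Z = (\<lambda>i. if i \<in> A then x i + \<sigma> * Z i else x i)"

definition flip :: "nat set \<Rightarrow> (nat \<Rightarrow> real) \<Rightarrow> nat \<Rightarrow> real" where
  "flip A Z = (\<lambda>i. if i \<in> A then - Z i else Z i)"

context pos_density
begin

text \<open>Coordinates outside \<open>A\<close> cancel in the quotient of the target densities, so
  the dimension does not appear.\<close>

definition ratio :: "real \<Rightarrow> nat set \<Rightarrow> (nat \<Rightarrow> real) \<Rightarrow> (nat \<Rightarrow> real) \<Rightarrow> real" where
  "ratio \<sigma> A x Z = (\<Prod>i\<in>A. f (x i + \<sigma> * Z i) / f (x i))"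

lemma ratio_pos: "0 < ratio \<sigma> A x Z"
  unfolding ratio_def by (intro prod_pos) (simp add: f_pos)

lemma sets_mu: "sets mu = sets (PiM UNIV (\<lambda>_. borel))" "sets gauss_seq = sets (PiM UNIV (\<lambda>_. borel))"
  by (intro sets_PiM_cong refl; simp)+

lemma measurable_mu_component: "F \<in> N \<rightarrow>\<^sub>M mu \<Longrightarrow> (\<lambda>w. F w i) \<in> borel_measurable N"
  using measurable_compose[of F N mu "\<lambda>x. x i" borel] by simp

lemma measurable_seq_component: "F \<in> N \<rightarrow>\<^sub>M gauss_seq \<Longrightarrow> (\<lambda>w. F w i) \<in> borel_measurable N"
  using measurable_compose[of F N gauss_seq "\<lambda>x. x i" borel] by simp

lemma measurable_into_mu: "(\<And>i. (\<lambda>w. F w i) \<in> borel_measurable N) \<Longrightarrow> F \<in> N \<rightarrow>\<^sub>M mu"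
  using measurable_to_PiM_UNIV[of F N] measurable_cong_sets[OF refl sets_mu(1)] by blast

lemma measurable_into_seq: "(\<And>i. (\<lambda>w. F w i) \<in> borel_measurable N) \<Longrightarrow> F \<in> N \<rightarrow>\<^sub>M gauss_seq"
  using measurable_to_PiM_UNIV[of F N] measurable_cong_sets[OF refl sets_mu(2)] by blast

lemma move_measurable: "F \<in> N \<rightarrow>\<^sub>M mu \<Longrightarrow> G \<in> N \<rightarrow>\<^sub>M gauss_seq \<Longrightarrow> (\<lambda>w. move \<sigma> A (F w) (G w)) \<in> N \<rightarrow>\<^sub>M mu"
proof (rule measurable_into_mu)
  fix i assume F: "F \<in> N \<rightarrow>\<^sub>M mu" and G: "G \<in> N \<rightarrow>\<^sub>M gauss_seq"
  note [measurable] = measurable_mu_component[OF F, of i] measurable_seq_component[OF G, of i]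
  show "(\<lambda>w. move \<sigma> A (F w) (G w) i) \<in> borel_measurable N" by (cases "i \<in> A") (simp_all add: move_def)
qed

lemma flip_measurable: "G \<in> N \<rightarrow>\<^sub>M gauss_seq \<Longrightarrow> (\<lambda>w. flip A (G w)) \<in> N \<rightarrow>\<^sub>M gauss_seq"
proof (rule measurable_into_seq)
  fix i assume G: "G \<in> N \<rightarrow>\<^sub>M gauss_seq"
  note [measurable] = measurable_seq_component[OF G, of i]
  show "(\<lambda>w. flip A (G w) i) \<in> borel_measurable N" by (cases "i \<in> A") (simp_all add: flip_def)
qed

lemma ratio_measurable: "F \<in> N \<rightarrow>\<^sub>M mu \<Longrightarrow> G \<in> N \<rightarrow>\<^sub>M gauss_seq \<Longrightarrow> (\<lambda>w. ratio \<sigma> A (F w) (G w)) \<in> borel_measurable N"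
  unfolding ratio_def
proof (rule borel_measurable_prod)
  fix i assume F: "F \<in> N \<rightarrow>\<^sub>M mu" and G: "G \<in> N \<rightarrow>\<^sub>M gauss_seq"
  note [measurable] = measurable_mu_component[OF F, of i] measurable_seq_component[OF G, of i]
  show "(\<lambda>w. f (F w i + \<sigma> * G w i) / f (F w i)) \<in> borel_measurable N" by measurable
qed

text \<open>Involutions on distinct coordinates act independently and their ratios multiply, so one
  coordinate is added at a time. Redrawing it in both \<open>x\<close> and \<open>Z\<close> reduces
  the new factor to \<open>nn_integral_fm_shift\<close>.\<close>

lemma nn_integral_move:
  fixes H :: "(nat \<Rightarrow> real) \<Rightarrow> (nat \<Rightarrow> real) \<Rightarrow> ennreal"
  assumes "finite A" and "(\<lambda>(x, Z). H x Z) \<in> borel_measurable (mu \<Otimes>\<^sub>M gauss_seq)"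
  shows "(\<integral>\<^sup>+x. \<integral>\<^sup>+Z. H (move \<sigma> A x Z) (flip A Z) * ennreal (ratio \<sigma> A x Z) \<partial>gauss_seq \<partial>mu)
    = (\<integral>\<^sup>+x. \<integral>\<^sup>+Z. H x Z \<partial>gauss_seq \<partial>mu)"
  using assms
proof (induction A arbitrary: H)
  case empty
  then show ?case by (simp add: move_def flip_def ratio_def)
next
  case (insert j A)
  note Hc = measurable_uncurry_compose[OF insert.prems]
  define H' where "H' x Z = H (move \<sigma> {j} x Z) (flip {j} Z) * ennreal (ratio \<sigma> {j} x Z)" for x Z
  have H'_meas: "(\<lambda>(x, Z). H' x Z) \<in> borel_measurable (mu \<Otimes>\<^sub>M gauss_seq)"
    unfolding H'_def split_beta'
    by (intro borel_measurable_times_ennreal Hc move_measurable flip_measurable measurable_compose[OF ratio_measurable measurable_ennreal]) auto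
  have "(\<integral>\<^sup>+x. \<integral>\<^sup>+Z. H (move \<sigma> (insert j A) x Z) (flip (insert j A) Z) * ennreal (ratio \<sigma> (insert j A) x Z) \<partial>gauss_seq \<partial>mu)
    = (\<integral>\<^sup>+x. \<integral>\<^sup>+Z. H' (move \<sigma> A x Z) (flip A Z) * ennreal (ratio \<sigma> A x Z) \<partial>gauss_seq \<partial>mu)"
  proof (intro nn_integral_cong)
    fix x Z
    have "move \<sigma> {j} (move \<sigma> A x Z) (flip A Z) = move \<sigma> (insert j A) x Z" "flip {j} (flip A Z) = flip (insert j A) Z"
      using insert.hyps by (auto simp: move_def flip_def)
    moreover have "ratio \<sigma> (insert j A) x Z = ratio \<sigma> {j} (move \<sigma> A x Z) (flip A Z) * ratio \<sigma> A x Z"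
      using insert.hyps by (simp add: ratio_def move_def flip_def)
    ultimately show "H (move \<sigma> (insert j A) x Z) (flip (insert j A) Z) * ennreal (ratio \<sigma> (insert j A) x Z)
      = H' (move \<sigma> A x Z) (flip A Z) * ennreal (ratio \<sigma> A x Z)"
      using ratio_pos by (simp add: H'_def ennreal_mult less_imp_le mult.assoc)
  qed
  also have "\<dots> = (\<integral>\<^sup>+x. \<integral>\<^sup>+Z. H' x Z \<partial>gauss_seq \<partial>mu)"
    by (rule insert.IH[OF H'_meas])
  also have "\<dots> = (\<integral>\<^sup>+x. \<integral>\<^sup>+Z. \<integral>\<^sup>+a. \<integral>\<^sup>+b. H' (x(j := a)) (Z(j := b)) \<partial>gauss \<partial>fm \<partial>gauss_seq \<partial>mu)"
    by (rule nn_integral_resample_pair[OF prob_fm std_normal.prob_space_axioms H'_meas])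
  also have "\<dots> = (\<integral>\<^sup>+x. \<integral>\<^sup>+Z. \<integral>\<^sup>+a. \<integral>\<^sup>+b. H (x(j := a)) (Z(j := b)) \<partial>gauss \<partial>fm \<partial>gauss_seq \<partial>mu)"
  proof (rule nn_integral_cong, rule nn_integral_cong)
    fix x Z assume x: "x \<in> space mu" and Z: "Z \<in> space gauss_seq"
    have "H' (x(j := a)) (Z(j := b)) = H (x(j := a + \<sigma> * b)) (Z(j := - b)) * ennreal (f (a + \<sigma> * b) / f a)" for a b
    proof -
      have "move \<sigma> {j} (x(j := a)) (Z(j := b)) = x(j := a + \<sigma> * b)" "flip {j} (Z(j := b)) = Z(j := - b)"
        by (auto simp: move_def flip_def)
      then show ?thesis by (simp add: H'_def ratio_def)
    qed
    moreover have "(\<lambda>(a, b). H (x(j := a)) (Z(j := b))) \<in> borel_measurable (borel \<Otimes>\<^sub>M borel)"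
      unfolding split_beta' by (intro Hc measurable_into_mu measurable_into_seq) auto
    ultimately show "(\<integral>\<^sup>+a. \<integral>\<^sup>+b. H' (x(j := a)) (Z(j := b)) \<partial>gauss \<partial>fm)
      = (\<integral>\<^sup>+a. \<integral>\<^sup>+b. H (x(j := a)) (Z(j := b)) \<partial>gauss \<partial>fm)"
      using nn_integral_fm_shift[of "\<lambda>a b. H (x(j := a)) (Z(j := b))" \<sigma>] by simp
  qed
  also have "\<dots> = (\<integral>\<^sup>+x. \<integral>\<^sup>+Z. H x Z \<partial>gauss_seq \<partial>mu)"
    by (rule nn_integral_resample_pair[OF prob_fm std_normal.prob_space_axioms insert.prems, symmetric])
  finally show ?case .
qed

text \<open>The involution inverts the ratio r, and min(1, 1/r) r = min(1, r). Hence the accepted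
  mass arriving in \<open>E\<close> equals the accepted mass starting in \<open>E\<close>.\<close>

lemma detailed_balance:
  assumes A: "finite A" and E[measurable]: "E \<in> sets mu"
  shows "(\<integral>\<^sup>+x. \<integral>\<^sup>+Z. ennreal (min 1 (ratio \<sigma> A x Z)) * indicator E (move \<sigma> A x Z) \<partial>gauss_seq \<partial>mu)
    = (\<integral>\<^sup>+x. \<integral>\<^sup>+Z. ennreal (min 1 (ratio \<sigma> A x Z)) * indicator E x \<partial>gauss_seq \<partial>mu)"
proof -
  define H :: "(nat \<Rightarrow> real) \<Rightarrow> (nat \<Rightarrow> real) \<Rightarrow> ennreal"
    where "H x Z = ennreal (min 1 (ratio \<sigma> A x Z)) * indicator E x" for x Z
  have [measurable]: "(\<lambda>w. ratio \<sigma> A (fst w) (snd w)) \<in> borel_measurable (mu \<Otimes>\<^sub>M gauss_seq)"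
    by (rule ratio_measurable) auto
  have H_meas: "(\<lambda>(x, Z). H x Z) \<in> borel_measurable (mu \<Otimes>\<^sub>M gauss_seq)"
    unfolding H_def split_beta' by measurable
  have "H (move \<sigma> A x Z) (flip A Z) * ennreal (ratio \<sigma> A x Z)
    = ennreal (min 1 (ratio \<sigma> A x Z)) * indicator E (move \<sigma> A x Z)" for x Z
  proof -
    have "ratio \<sigma> A (move \<sigma> A x Z) (flip A Z) = (\<Prod>i\<in>A. 1 / (f (x i + \<sigma> * Z i) / f (x i)))"
      unfolding ratio_def by (intro prod.cong) (auto simp: move_def flip_def)
    then have inv: "ratio \<sigma> A (move \<sigma> A x Z) (flip A Z) = 1 / ratio \<sigma> A x Z"
      unfolding ratio_def by (simp only: prod_dividef prod.neutral_const)
    have "min 1 (1 / ratio \<sigma> A x Z) * ratio \<sigma> A x Z = min 1 (ratio \<sigma> A x Z)"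
      using ratio_pos[of \<sigma> A x Z] by (auto simp: min_def field_simps)
    then have "ennreal (min 1 (1 / ratio \<sigma> A x Z)) * ennreal (ratio \<sigma> A x Z) = ennreal (min 1 (ratio \<sigma> A x Z))"
      using ratio_pos[of \<sigma> A x Z] by (simp add: ennreal_mult[symmetric])
    then show ?thesis by (simp add: H_def inv mult.assoc[symmetric] mult.commute)
  qed
  then show ?thesis using nn_integral_move[OF A H_meas, of \<sigma>] by (simp add: H_def)
qed

end

section \<open>Invariance of the product law under one step\<close>

lemma nn_integral_uniform_if:
  assumes "0 < R"
  shows "(\<integral>\<^sup>+v. (if v < R then a else b) \<partial>uniform_measure lborel {0..1}) = ennreal (min 1 R) * a + ennreal (1 - min 1 R) * b"
proof -
  have "{0..1} \<inter> {..<R} = (if R \<le> 1 then {0..<R} else {0..1})" "{0..1} \<inter> {R..} = (if R \<le> 1 then {R..1} else {})"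
    using assms by auto
  then have e: "emeasure (uniform_measure lborel {0..1}) {..<R} = ennreal (min 1 R)"
    "emeasure (uniform_measure lborel {0..1}) {R..} = ennreal (1 - min 1 R)"
    using assms by (cases "R \<le> 1"; simp add: emeasure_uniform_measure divide_ennreal_def min_def)+
  have "(\<integral>\<^sup>+v. (if v < R then a else b) \<partial>uniform_measure lborel {0..1})
    = (\<integral>\<^sup>+v. a * indicator {..<R} v + b * indicator {R..} v \<partial>uniform_measure lborel {0..1})"
    by (intro nn_integral_cong) (auto simp: indicator_def)
  also have "\<dots> = a * emeasure (uniform_measure lborel {0..1}) {..<R} + b * emeasure (uniform_measure lborel {0..1}) {R..}"
    by (subst nn_integral_add) (auto simp: nn_integral_cmult_indicator)
  finally show ?thesis by (simp add: e mult.commute)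
qed

interpretation unif: prob_space "uniform_measure lborel {0..1::real}"
  by (rule prob_space_uniform_measure) auto

abbreviation subset_pmf :: "nat \<Rightarrow> nat \<Rightarrow> nat set pmf" where
  "subset_pmf d k \<equiv> pmf_of_set {A. A \<subseteq> {..<d} \<and> card A = k}"

lemma borel_snd_unif: "snd \<in> N \<Otimes>\<^sub>M uniform_measure lborel {0..1::real} \<rightarrow>\<^sub>M borel"
  using measurable_snd[of N "uniform_measure lborel {0..1::real}"] measurable_cong_sets[OF refl, of "uniform_measure lborel {0..1::real}" borel]
  by simp

lemma finite_subsets_card: "finite {A. A \<subseteq> {..<d::nat} \<and> card A = k}"
  by (rule finite_subset[of _ "Pow {..<d}"]) auto

lemma subsets_card_nonempty: "k \<le> d \<Longrightarrow> {A. A \<subseteq> {..<d::nat} \<and> card A = k} \<noteq> {}"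
  using obtain_subset_with_card_n[of k "{..<d}"] by fastforce

lemma AE_subset_pmf: "k \<le> d \<Longrightarrow> AE A in measure_pmf (subset_pmf d k). A \<subseteq> {..<d} \<and> card A = k"
  by (auto simp: AE_measure_pmf_iff set_pmf_of_set[OF subsets_card_nonempty finite_subsets_card])

lemma prob_step_noise: "prob_space (step_noise d k)"
proof -
  interpret A: pair_prob_space "measure_pmf (subset_pmf d k)" gauss_seq ..
  interpret B: pair_prob_space "measure_pmf (subset_pmf d k) \<Otimes>\<^sub>M gauss_seq" "uniform_measure lborel {0..1::real}" ..
  show ?thesis unfolding step_noise_def by (rule B.prob_space_axioms)
qed

lemma step_noise_measurable[measurable]:
  "(\<lambda>n. fst (fst n)) \<in> step_noise d k \<rightarrow>\<^sub>M measure_pmf (subset_pmf d k)"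
  "(\<lambda>n. snd (fst n)) \<in> step_noise d k \<rightarrow>\<^sub>M gauss_seq"
  "snd \<in> step_noise d k \<rightarrow>\<^sub>M borel"
proof -
  show "(\<lambda>n. fst (fst n)) \<in> step_noise d k \<rightarrow>\<^sub>M measure_pmf (subset_pmf d k)"
    "(\<lambda>n. snd (fst n)) \<in> step_noise d k \<rightarrow>\<^sub>M gauss_seq"
    unfolding step_noise_def by measurable
  show "snd \<in> step_noise d k \<rightarrow>\<^sub>M borel" unfolding step_noise_def by (rule borel_snd_unif)
qed

lemma nn_integral_step_noise:
  assumes G: "G \<in> borel_measurable (step_noise d k)"
  shows "(\<integral>\<^sup>+n. G n \<partial>step_noise d k) = (\<integral>\<^sup>+A. \<integral>\<^sup>+Z. \<integral>\<^sup>+v. G ((A, Z), v) \<partial>uniform_measure lborel {0..1}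
    \<partial>gauss_seq \<partial>measure_pmf (subset_pmf d k))"
proof -
  have G': "G \<in> borel_measurable ((measure_pmf (subset_pmf d k) \<Otimes>\<^sub>M gauss_seq) \<Otimes>\<^sub>M uniform_measure lborel {0..1::real})"
    using G by (simp add: step_noise_def)
  have "(\<lambda>w. \<integral>\<^sup>+v. G (w, v) \<partial>uniform_measure lborel {0..1}) \<in> borel_measurable (measure_pmf (subset_pmf d k) \<Otimes>\<^sub>M gauss_seq)"
    using G' by (intro unif.borel_measurable_nn_integral) simp
  then show ?thesis unfolding step_noise_def
    using unif.nn_integral_fst[OF G'] gauss_seq.nn_integral_fst[of "\<lambda>w. \<integral>\<^sup>+v. G (w, v) \<partial>uniform_measure lborel {0..1}"]
    by simp
qed

lemma distr_step_noise_fst: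
  "distr (step_noise d k) (measure_pmf (subset_pmf d k) \<Otimes>\<^sub>M gauss_seq) fst = measure_pmf (subset_pmf d k) \<Otimes>\<^sub>M gauss_seq"
  unfolding step_noise_def by (rule unif.distr_pair_fst)

context pos_density
begin

lemma rwg_step_eq:
  assumes "A \<subseteq> {..<d}"
  shows "rwg_step f d \<sigma> x ((A, Z), v) = (if v < ratio \<sigma> A x Z then move \<sigma> A x Z else x)"
proof -
  let ?y = "\<lambda>i. if i \<in> A then x i + \<sigma> * Z i else x i"
  have "pi_d f d ?y / pi_d f d x = (\<Prod>i<d. f (?y i) / f (x i))" by (simp add: pi_d_def prod_dividef)
  also have "\<dots> = (\<Prod>i\<in>A. f (?y i) / f (x i))"
    using assms f_pos[THEN less_imp_neq] by (intro prod.mono_neutral_right) auto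
  also have "\<dots> = ratio \<sigma> A x Z" unfolding ratio_def by (intro prod.cong) auto
  finally show ?thesis by (simp add: rwg_step_def move_def)
qed

lemma rwg_step_measurable: "(\<lambda>(x, n). rwg_step f d \<sigma> x n) \<in> mu \<Otimes>\<^sub>M step_noise d k \<rightarrow>\<^sub>M mu"
  unfolding split_beta'
proof (rule measurable_into_mu)
  fix i
  let ?M = "mu \<Otimes>\<^sub>M step_noise d k"
  have [measurable]: "(\<lambda>w. fst w j) \<in> borel_measurable ?M" for j by (rule measurable_mu_component) simp
  have [measurable]: "(\<lambda>w. snd (fst (snd w)) j) \<in> borel_measurable ?M" for j by (rule measurable_seq_component) simp
  have [measurable]: "Measurable.pred ?M (\<lambda>w. j \<in> fst (fst (snd w)))" for j
    by (rule measurable_compose[OF measurable_compose[OF measurable_snd step_noise_measurable(1)[of d k]]]) simp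
  show "(\<lambda>w. rwg_step f d \<sigma> (fst w) (snd w) i) \<in> borel_measurable ?M"
    unfolding rwg_step_def Let_def pi_d_def if_distrib[of "\<lambda>h. h i"] by measurable
qed

text \<open>Detailed balance lets the accepted mass be counted at its starting point; together with
  the rejected mass, which stays, it is the whole mass of \<open>E\<close>.\<close>

lemma nn_integral_rwg_step:
  assumes A: "A \<subseteq> {..<d}" and E[measurable]: "E \<in> sets mu"
  shows "(\<integral>\<^sup>+x. \<integral>\<^sup>+Z. \<integral>\<^sup>+v. indicator E (rwg_step f d \<sigma> x ((A, Z), v)) \<partial>uniform_measure lborel {0..1}
      \<partial>gauss_seq \<partial>mu) = emeasure mu E"
proof -
  have [measurable]: "(\<lambda>w. ratio \<sigma> A (fst w) (snd w)) \<in> borel_measurable (mu \<Otimes>\<^sub>M gauss_seq)"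
    by (rule ratio_measurable) auto
  have [measurable]: "(\<lambda>w. move \<sigma> A (fst w) (snd w)) \<in> mu \<Otimes>\<^sub>M gauss_seq \<rightarrow>\<^sub>M mu"
    by (rule move_measurable) auto
  have [measurable]: "(\<lambda>Z. ratio \<sigma> A x Z) \<in> borel_measurable gauss_seq" "(\<lambda>Z. move \<sigma> A x Z) \<in> gauss_seq \<rightarrow>\<^sub>M mu"
    if "x \<in> space mu" for x
    using that by (auto intro!: ratio_measurable move_measurable)
  let ?a = "\<lambda>x Z. ennreal (min 1 (ratio \<sigma> A x Z))" and ?b = "\<lambda>x Z. ennreal (1 - min 1 (ratio \<sigma> A x Z))"
  have fin: "finite A" using A finite_subset by blast
  have ab: "?a x Z + ?b x Z = 1" for x Z
    using ratio_pos[of \<sigma> A x Z] by (simp add: ennreal_plus[symmetric] del: ennreal_plus)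
  have "(\<integral>\<^sup>+x. \<integral>\<^sup>+Z. \<integral>\<^sup>+v. indicator E (rwg_step f d \<sigma> x ((A, Z), v)) \<partial>uniform_measure lborel {0..1} \<partial>gauss_seq \<partial>mu)
    = (\<integral>\<^sup>+x. \<integral>\<^sup>+Z. ?a x Z * indicator E (move \<sigma> A x Z) + ?b x Z * indicator E x \<partial>gauss_seq \<partial>mu)"
    by (intro nn_integral_cong)
      (simp add: rwg_step_eq[OF A] if_distrib[of "indicator E"] nn_integral_uniform_if ratio_pos cong: if_cong)
  also have "\<dots> = (\<integral>\<^sup>+x. (\<integral>\<^sup>+Z. ?a x Z * indicator E (move \<sigma> A x Z) \<partial>gauss_seq)
      + (\<integral>\<^sup>+Z. ?b x Z * indicator E x \<partial>gauss_seq) \<partial>mu)"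
    by (intro nn_integral_cong nn_integral_add) measurable
  also have "\<dots> = (\<integral>\<^sup>+x. \<integral>\<^sup>+Z. ?a x Z * indicator E (move \<sigma> A x Z) \<partial>gauss_seq \<partial>mu)
      + (\<integral>\<^sup>+x. \<integral>\<^sup>+Z. ?b x Z * indicator E x \<partial>gauss_seq \<partial>mu)"
    by (rule nn_integral_add; rule gauss_seq.borel_measurable_nn_integral; simp add: split_beta')
  also have "\<dots> = (\<integral>\<^sup>+x. \<integral>\<^sup>+Z. ?a x Z * indicator E x \<partial>gauss_seq \<partial>mu)
      + (\<integral>\<^sup>+x. \<integral>\<^sup>+Z. ?b x Z * indicator E x \<partial>gauss_seq \<partial>mu)"
    using detailed_balance[OF fin E] by simp
  also have "\<dots> = (\<integral>\<^sup>+x. (\<integral>\<^sup>+Z. ?a x Z * indicator E x \<partial>gauss_seq)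
      + (\<integral>\<^sup>+Z. ?b x Z * indicator E x \<partial>gauss_seq) \<partial>mu)"
    by (rule nn_integral_add[symmetric]; rule gauss_seq.borel_measurable_nn_integral; simp add: split_beta')
  also have "\<dots> = (\<integral>\<^sup>+x. \<integral>\<^sup>+Z. ?a x Z * indicator E x + ?b x Z * indicator E x \<partial>gauss_seq \<partial>mu)"
    by (intro nn_integral_cong nn_integral_add[symmetric]) measurable
  also have "\<dots> = (\<integral>\<^sup>+x. \<integral>\<^sup>+Z. indicator E x \<partial>gauss_seq \<partial>mu)"
    by (simp only: distrib_right[symmetric] ab mult_1_left)
  also have "\<dots> = emeasure mu E"
    by (simp add: gauss_seq.emeasure_space_1)
  finally show ?thesis .
qed

text \<open>Each fixed set \<open>A\<close> of moved coordinates preserves the law, hence so does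
  the mixture over \<open>A\<close>. States have infinitely many coordinates, those from
  \<open>d\<close> on never move, and thus one measure \<open>mu\<close> serves all
  dimensions.\<close>

lemma rwg_stationary:
  assumes "k \<le> d"
  shows "distr (mu \<Otimes>\<^sub>M step_noise d k) mu (\<lambda>(x, n). rwg_step f d \<sigma> x n) = mu"
proof (rule measure_eqI)
  fix E assume "E \<in> sets (distr (mu \<Otimes>\<^sub>M step_noise d k) mu (\<lambda>(x, n). rwg_step f d \<sigma> x n))"
  then have E[measurable]: "E \<in> sets mu" by simp
  interpret SN: prob_space "step_noise d k" by (rule prob_step_noise)
  let ?p = "measure_pmf (subset_pmf d k)"
  interpret MP: pair_prob_space mu ?p ..
  note stepc = measurable_uncurry_compose[OF rwg_step_measurable[of d \<sigma> k]]
  have into: "(\<lambda>w. ((a w, z w), u w)) \<in> N \<rightarrow>\<^sub>M step_noise d k"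
    if "a \<in> N \<rightarrow>\<^sub>M ?p" "z \<in> N \<rightarrow>\<^sub>M gauss_seq" "u \<in> borel_measurable N" for a z u and N :: "'z measure"
  proof -
    have [measurable]: "u \<in> N \<rightarrow>\<^sub>M uniform_measure lborel {0..1}"
      using that(3) measurable_cong_sets[OF refl, of "uniform_measure lborel {0..1::real}" borel N] by simp
    note [measurable] = that
    show ?thesis unfolding step_noise_def by measurable
  qed
  have "emeasure (distr (mu \<Otimes>\<^sub>M step_noise d k) mu (\<lambda>(x, n). rwg_step f d \<sigma> x n)) E
    = (\<integral>\<^sup>+w. indicator E (rwg_step f d \<sigma> (fst w) (snd w)) \<partial>(mu \<Otimes>\<^sub>M step_noise d k))"
    by (subst emeasure_distr_nn_integral[OF rwg_step_measurable E]) (simp add: split_beta')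
  also have "\<dots> = (\<integral>\<^sup>+x. \<integral>\<^sup>+n. indicator E (rwg_step f d \<sigma> x n) \<partial>step_noise d k \<partial>mu)"
    by (subst SN.nn_integral_fst[symmetric])
      (auto intro!: measurable_compose[OF stepc borel_measurable_indicator])
  also have "\<dots> = (\<integral>\<^sup>+x. \<integral>\<^sup>+A. \<integral>\<^sup>+Z. \<integral>\<^sup>+v. indicator E (rwg_step f d \<sigma> x ((A, Z), v)) \<partial>uniform_measure lborel {0..1}
      \<partial>gauss_seq \<partial>?p \<partial>mu)"
    by (intro nn_integral_cong nn_integral_step_noise) (auto intro!: measurable_compose[OF stepc borel_measurable_indicator])
  also have "\<dots> = (\<integral>\<^sup>+A. \<integral>\<^sup>+x. \<integral>\<^sup>+Z. \<integral>\<^sup>+v. indicator E (rwg_step f d \<sigma> x ((A, Z), v)) \<partial>uniform_measure lborel {0..1}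
      \<partial>gauss_seq \<partial>mu \<partial>?p)"
  proof (rule MP.Fubini'[symmetric])
    have "(\<lambda>w. indicator E (rwg_step f d \<sigma> (fst (fst (fst w))) ((snd (fst (fst w)), snd (fst w)), snd w)) :: ennreal)
      \<in> borel_measurable (((mu \<Otimes>\<^sub>M ?p) \<Otimes>\<^sub>M gauss_seq) \<Otimes>\<^sub>M uniform_measure lborel {0..1::real})"
      by (rule measurable_compose[OF stepc[OF
            measurable_compose[OF measurable_fst measurable_compose[OF measurable_fst measurable_fst]]
            into[OF measurable_compose[OF measurable_fst measurable_compose[OF measurable_fst measurable_snd]]
              measurable_compose[OF measurable_fst measurable_snd] borel_snd_unif]]
          borel_measurable_indicator[OF E]])
    then have "(\<lambda>w. \<integral>\<^sup>+v. indicator E (rwg_step f d \<sigma> (fst (fst w)) ((snd (fst w), snd w), v)) \<partial>uniform_measure lborel {0..1::real})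
      \<in> borel_measurable ((mu \<Otimes>\<^sub>M ?p) \<Otimes>\<^sub>M gauss_seq)"
      by (intro unif.borel_measurable_nn_integral) (simp add: split_beta')
    then have "(\<lambda>w. \<integral>\<^sup>+Z. \<integral>\<^sup>+v. indicator E (rwg_step f d \<sigma> (fst w) ((snd w, Z), v)) \<partial>uniform_measure lborel {0..1::real} \<partial>gauss_seq)
      \<in> borel_measurable (mu \<Otimes>\<^sub>M ?p)"
      by (intro gauss_seq.borel_measurable_nn_integral) (simp add: split_beta')
    then show "(\<lambda>(x, A). \<integral>\<^sup>+Z. \<integral>\<^sup>+v. indicator E (rwg_step f d \<sigma> x ((A, Z), v)) \<partial>uniform_measure lborel {0..1::real} \<partial>gauss_seq)
      \<in> borel_measurable (mu \<Otimes>\<^sub>M ?p)" by (simp add: split_beta')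
  qed
  also have "\<dots> = (\<integral>\<^sup>+A. emeasure mu E \<partial>?p)"
    using AE_subset_pmf[OF assms] by (intro nn_integral_cong_AE) (auto simp: nn_integral_rwg_step)
  also have "\<dots> = emeasure mu E" by simp
  finally show "emeasure (distr (mu \<Otimes>\<^sub>M step_noise d k) mu (\<lambda>(x, n). rwg_step f d \<sigma> x n)) E = emeasure mu E" .
qed simp

lemma stationary_chain_rwg: "k \<le> d \<Longrightarrow> stationary_chain mu (step_noise d k) (rwg_step f d \<sigma>)"
  by (rule stationary_chain.intro[OF mu.prob_space_axioms prob_step_noise rwg_step_measurable rwg_stationary])

text \<open>Integrating out the uniform variable turns the accept decision into the acceptance
  probability. Because \<open>\<psi> 0 = 0\<close>, rejections and sets \<open>A\<close> without
  coordinate 0 contribute nothing.\<close>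

lemma integral_step_noise_increment:
  fixes \<psi> :: "real \<Rightarrow> real"
  assumes k: "k \<le> d" and [measurable]: "\<psi> \<in> borel_measurable borel" and \<psi>0: "\<psi> 0 = 0"
    and int: "integrable gauss (\<lambda>z. \<psi> (\<sigma> * z))"
  shows "(\<integral>n. \<psi> (rwg_step f d \<sigma> x n 0 - x 0) \<partial>step_noise d k)
    = measure_pmf.expectation (subset_pmf d k)
       (\<lambda>A. if 0 \<in> A then \<integral>Z. \<psi> (\<sigma> * Z 0) * min 1 (ratio \<sigma> A x Z) \<partial>gauss_seq else 0)"
proof -
  let ?p = "measure_pmf (subset_pmf d k)" and ?U = "uniform_measure lborel {0..1::real}"
  let ?M = "?p \<Otimes>\<^sub>M gauss_seq"
  interpret PS: pair_prob_space ?p gauss_seq ..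
  interpret PU: pair_prob_space ?M ?U ..
  define G where "G n = \<psi> (rwg_step f d \<sigma> x n 0 - x 0)" for n
  have x: "x \<in> space mu" by (simp add: space_PiM)
  have "(\<lambda>n. rwg_step f d \<sigma> x n) \<in> step_noise d k \<rightarrow>\<^sub>M mu"
    using measurable_compose_Pair1[OF x rwg_step_measurable[of d \<sigma> k]] by simp
  note [measurable] = measurable_mu_component[OF this, of 0]
  have [measurable]: "G \<in> borel_measurable (step_noise d k)" unfolding G_def[abs_def] by measurable
  have G_le: "\<bar>G n\<bar> \<le> \<bar>\<psi> (\<sigma> * snd (fst n) 0)\<bar>" for n
    by (simp add: G_def rwg_step_def Let_def \<psi>0)
  have [measurable]: "(\<lambda>Z. Z 0) \<in> borel_measurable gauss_seq" by (rule measurable_seq_component) simp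
  have seq0: "integrable gauss_seq (\<lambda>Z. \<psi> (\<sigma> * Z 0))"
  proof -
    have "distr gauss_seq gauss (\<lambda>Z. Z 0) = gauss"
      by (rule distr_PiM_component) (auto intro: std_normal.prob_space_axioms)
    then have "integrable (distr gauss_seq gauss (\<lambda>Z. Z 0)) (\<lambda>z. \<psi> (\<sigma> * z))" using int by simp
    then show ?thesis by (subst (asm) integrable_distr_eq) auto
  qed
  have dom: "integrable ?M (\<lambda>w. \<psi> (\<sigma> * snd w 0))"
    by (rule PS.Fubini_integrable) (use seq0 in auto)
  have [measurable]: "(\<lambda>w. \<psi> (\<sigma> * snd w 0)) \<in> borel_measurable ?M" using dom by (rule borel_measurable_integrable)
  have fst_meas[measurable]: "fst \<in> step_noise d k \<rightarrow>\<^sub>M ?M" unfolding step_noise_def by measurable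
  have "integrable (step_noise d k) (\<lambda>n. \<psi> (\<sigma> * snd (fst n) 0))"
    using dom by (subst (asm) distr_step_noise_fst[symmetric], subst (asm) integrable_distr_eq) auto
  then have "integrable (step_noise d k) G"
    by (rule Bochner_Integration.integrable_bound) (auto intro: G_le)
  then have intG: "integrable (?M \<Otimes>\<^sub>M ?U) G" by (simp add: step_noise_def)
  have iw: "integrable ?M (\<lambda>w. \<integral>v. G (w, v) \<partial>?U)" by (rule PU.integrable_fst'[OF intG])
  have "(\<integral>n. G n \<partial>step_noise d k) = (\<integral>w. \<integral>v. G (w, v) \<partial>?U \<partial>?M)"
    unfolding step_noise_def by (rule PU.integral_fst'[OF intG, symmetric])
  also have "\<dots> = (\<integral>A. \<integral>Z. \<integral>v. G ((A, Z), v) \<partial>?U \<partial>gauss_seq \<partial>?p)"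
    by (rule PS.integral_fst'[OF iw, symmetric])
  also have "\<dots> = (\<integral>A. (if 0 \<in> A then \<integral>Z. \<psi> (\<sigma> * Z 0) * min 1 (ratio \<sigma> A x Z) \<partial>gauss_seq else 0) \<partial>?p)"
  proof (rule integral_cong_AE)
    show "AE A in ?p. (\<integral>Z. \<integral>v. G ((A, Z), v) \<partial>?U \<partial>gauss_seq)
       = (if 0 \<in> A then \<integral>Z. \<psi> (\<sigma> * Z 0) * min 1 (ratio \<sigma> A x Z) \<partial>gauss_seq else 0)"
      using AE_subset_pmf[OF k]
    proof eventually_elim
      case (elim A)
      have Gv: "(\<integral>v. G ((A, Z), v) \<partial>?U) = (if 0 \<in> A then \<psi> (\<sigma> * Z 0) * min 1 (ratio \<sigma> A x Z) else 0)" for Z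
      proof -
        have "G ((A, Z), v) = (if 0 \<in> A then \<psi> (\<sigma> * Z 0) * indicator {..< ratio \<sigma> A x Z} v else 0)" for v
          using elim by (auto simp: G_def rwg_step_eq move_def \<psi>0 indicator_def)
        moreover have "measure ?U {..< ratio \<sigma> A x Z} = min 1 (ratio \<sigma> A x Z)"
        proof -
          have "emeasure ?U {..< ratio \<sigma> A x Z} = (\<integral>\<^sup>+v. indicator {..< ratio \<sigma> A x Z} v \<partial>?U)"
            by (rule nn_integral_indicator[symmetric]) simp
          also have "\<dots> = (\<integral>\<^sup>+v. (if v < ratio \<sigma> A x Z then 1 else 0) \<partial>?U)"
            by (rule nn_integral_cong) (simp add: indicator_def)
          also have "\<dots> = ennreal (min 1 (ratio \<sigma> A x Z))" by (subst nn_integral_uniform_if) (auto simp: ratio_pos)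
          finally show ?thesis using ratio_pos[of \<sigma> A x Z] by (simp add: measure_def)
        qed
        ultimately show ?thesis by simp
      qed
      show ?case by (simp add: Gv)
    qed
  qed simp_all
  finally show ?thesis by (simp add: G_def)
qed

end

section \<open>The log acceptance ratio\<close>

lemma (in prob_space) L1_le_L2:
  fixes Y :: "'a \<Rightarrow> real"
  assumes [measurable]: "Y \<in> borel_measurable M" and Y2: "integrable M (\<lambda>x. (Y x)\<^sup>2)"
  shows "integrable M Y" "(\<integral>x. \<bar>Y x\<bar> \<partial>M) \<le> sqrt (\<integral>x. (Y x)\<^sup>2 \<partial>M)"
proof -
  show i: "integrable M Y"
  proof (rule Bochner_Integration.integrable_bound[where f="\<lambda>x. 1 + (Y x)\<^sup>2"])
    have "\<bar>y\<bar> \<le> 1 + y\<^sup>2" for y :: real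
    proof -
      have "0 \<le> (\<bar>y\<bar> - 1)\<^sup>2" "0 \<le> y\<^sup>2" by auto
      then show ?thesis unfolding power2_diff by (simp add: power2_eq_square abs_mult_self_eq)
    qed
    then show "AE x in M. norm (Y x) \<le> norm (1 + (Y x)\<^sup>2)" by simp
  qed (use Y2 in auto)
  define c where "c = (\<integral>x. \<bar>Y x\<bar> \<partial>M)"
  have "0 \<le> (\<integral>x. (\<bar>Y x\<bar> - c)\<^sup>2 \<partial>M)" by (rule Bochner_Integration.integral_nonneg) simp
  also have "(\<integral>x. (\<bar>Y x\<bar> - c)\<^sup>2 \<partial>M) = (\<integral>x. (Y x)\<^sup>2 - 2 * c * \<bar>Y x\<bar> + c\<^sup>2 \<partial>M)"
    by (intro Bochner_Integration.integral_cong) (auto simp: power2_diff)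
  also have "\<dots> = (\<integral>x. (Y x)\<^sup>2 \<partial>M) - c\<^sup>2"
    using i Y2 prob_space by (simp add: c_def power2_eq_square)
  finally have "c\<^sup>2 \<le> (\<integral>x. (Y x)\<^sup>2 \<partial>M)" by simp
  then show "(\<integral>x. \<bar>Y x\<bar> \<partial>M) \<le> sqrt (\<integral>x. (Y x)\<^sup>2 \<partial>M)" unfolding c_def[symmetric] by (rule real_le_rsqrt)
qed

lemma has_real_derivative_shift:
  assumes "\<And>x. (h has_real_derivative h' x) (at x)"
  shows "((\<lambda>s. h (x + s)) has_real_derivative h' (x + s)) (at s)"
  using assms[of "s + x"] DERIV_shift[of h "h' (s + x)" s x] by (simp add: add.commute)

locale target = pos_density f for f :: "real \<Rightarrow> real" +
  fixes f1 f2 f3 :: "real \<Rightarrow> real" and L :: real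
  assumes f_deriv: "\<And>x. (f has_real_derivative f1 x) (at x)"
    and f1_deriv: "\<And>x. (f1 has_real_derivative f2 x) (at x)"
    and f2_deriv: "\<And>x. (f2 has_real_derivative f3 x) (at x)"
    and L: "\<And>x y. \<bar>f1 x / f x - f1 y / f y\<bar> \<le> L * \<bar>x - y\<bar>"
    and mom8: "integrable lborel (\<lambda>x. (f1 x / f x) ^ 8 * f x)"
begin

text \<open>With g = log f these are g' and, next, g''; \<open>G\<close> is g itself.\<close>

definition g1 :: "real \<Rightarrow> real" where "g1 x = f1 x / f x"
definition g2 :: "real \<Rightarrow> real" where "g2 x = f2 x / f x - (g1 x)\<^sup>2"
definition G :: "real \<Rightarrow> real" where "G x = ln (f x)"
definition I :: real where "I = (\<integral>x. (g1 x)\<^sup>2 \<partial>fm)"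

lemma isCont_f: "isCont f x" "isCont f1 x" "isCont f2 x"
  using f_deriv f1_deriv f2_deriv by (auto intro: DERIV_isCont)

lemma f12_measurable[measurable]: "f1 \<in> borel_measurable borel" "f2 \<in> borel_measurable borel"
  by (rule borel_measurable_continuous_onI; simp add: continuous_at_imp_continuous_on isCont_f)+

lemma g_measurable[measurable]: "g1 \<in> borel_measurable borel" "g2 \<in> borel_measurable borel" "G \<in> borel_measurable borel"
  unfolding g1_def[abs_def] g2_def[abs_def] G_def[abs_def] by measurable

lemma L_nonneg: "0 \<le> L" using L[of 1 0] by simp

lemma g1_lip: "\<bar>g1 x - g1 y\<bar> \<le> L * \<bar>x - y\<bar>" unfolding g1_def by (rule L)

lemma G_deriv: "(G has_real_derivative g1 x) (at x)"
  unfolding G_def[abs_def] g1_def using f_pos[of x]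
  by (auto intro!: derivative_eq_intros f_deriv simp: divide_inverse)

lemma g1_deriv: "(g1 has_real_derivative g2 x) (at x)"
proof -
  have "((\<lambda>x. f1 x / f x) has_real_derivative (f2 x * f x - f1 x * f1 x) / (f x * f x)) (at x)"
    using f_pos[of x] by (intro DERIV_divide f1_deriv f_deriv) simp
  moreover have "(f2 x * f x - f1 x * f1 x) / (f x * f x) = g2 x"
    using f_pos[of x] by (simp add: g2_def g1_def power2_eq_square field_simps)
  ultimately show ?thesis by (simp add: g1_def[abs_def])
qed

lemma isCont_g2: "isCont g2 x"
  unfolding g2_def[abs_def] g1_def using f_pos[of x] by (intro continuous_intros isCont_f) auto

lemma g2_bound: "\<bar>g2 x\<bar> \<le> L"
proof -
  have "((\<lambda>h. (g1 (x + h) - g1 x) / h) \<longlongrightarrow> g2 x) (at 0)"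
    using g1_deriv[of x] by (simp add: DERIV_def)
  then have "((\<lambda>h. \<bar>(g1 (x + h) - g1 x) / h\<bar>) \<longlongrightarrow> \<bar>g2 x\<bar>) (at 0)" by (rule tendsto_rabs)
  moreover have "\<forall>\<^sub>F h in at 0. \<bar>(g1 (x + h) - g1 x) / h\<bar> \<le> L"
  proof -
    have "\<bar>(g1 (x + h) - g1 x) / h\<bar> \<le> L" if "h \<noteq> 0" for h
      using g1_lip[of "x + h" x] that by (simp add: abs_divide pos_divide_le_eq)
    then show ?thesis by (auto simp: eventually_at_filter)
  qed
  ultimately show ?thesis by (rule tendsto_upperbound) simp
qed

definition rem :: "real \<Rightarrow> real \<Rightarrow> real" where "rem x h = G (x + h) - G x - h * g1 x"

lemma rem_taylor: "\<exists>t. \<bar>t - x\<bar> \<le> \<bar>h\<bar> \<and> rem x h = g2 t / 2 * h\<^sup>2"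
proof -
  define diff :: "nat \<Rightarrow> real \<Rightarrow> real" where "diff m = (if m = 0 then (\<lambda>s. G (x + s)) else if m = 1 then (\<lambda>s. g1 (x + s)) else (\<lambda>s. g2 (x + s)))" for m
  have D: "(diff m has_real_derivative diff (Suc m) s) (at s)" if "m < 2" for m s
  proof -
    have "m = 0 \<or> m = 1" using that by auto
    then show ?thesis using has_real_derivative_shift[OF G_deriv] has_real_derivative_shift[OF g1_deriv]
      by (auto simp: diff_def)
  qed
  have "\<exists>t. \<bar>t\<bar> \<le> \<bar>h\<bar> \<and> G (x + h) = (\<Sum>m<2. diff m 0 / fact m * h ^ m) + diff 2 t / fact 2 * h ^ 2"
    using Maclaurin_bi_le[of diff "\<lambda>s. G (x + s)" 2 h] D by (auto simp: diff_def)
  then obtain t where "\<bar>t\<bar> \<le> \<bar>h\<bar>" "G (x + h) = (\<Sum>m<2. diff m 0 / fact m * h ^ m) + diff 2 t / fact 2 * h ^ 2" by blast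
  then show ?thesis
    by (intro exI[of _ "x + t"]) (simp add: rem_def diff_def numeral_2_eq_2)
qed

lemma rem_bound: "\<bar>rem x h\<bar> \<le> L / 2 * h\<^sup>2"
proof -
  obtain t where "rem x h = g2 t / 2 * h\<^sup>2" using rem_taylor by blast
  then have "\<bar>rem x h\<bar> = \<bar>g2 t\<bar> / 2 * h\<^sup>2" by (simp only: abs_mult abs_divide abs_numeral abs_power2)
  also have "\<dots> \<le> L / 2 * h\<^sup>2" by (intro mult_right_mono divide_right_mono g2_bound) auto
  finally show ?thesis .
qed

lemma rem_measurable[measurable (raw)]:
  assumes [measurable]: "a \<in> borel_measurable M" "b \<in> borel_measurable M"
  shows "(\<lambda>w. rem (a w) (b w)) \<in> borel_measurable M"
  unfolding rem_def by measurable

text \<open>Taylor's formula with an intermediate point, and continuity of g''. The conditional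
  matches the convention that division by 0 gives 0.\<close>

lemma rem_limit:
  assumes \<sigma>: "\<sigma> \<longlonglongrightarrow> 0"
  shows "(\<lambda>d. rem x (\<sigma> d * z) / (\<sigma> d)\<^sup>2 - (if \<sigma> d = 0 then 0 else g2 x / 2 * z\<^sup>2)) \<longlonglongrightarrow> 0"
proof (rule LIMSEQ_I)
  fix e :: real assume "0 < e"
  define e' where "e' = 2 * e / (z\<^sup>2 + 1)"
  have "0 < z\<^sup>2 + 1" by (simp add: add_nonneg_pos)
  then have e': "0 < e'" using \<open>0 < e\<close> by (simp add: e'_def)
  have "e' / 2 * z\<^sup>2 < e" using \<open>0 < e\<close> \<open>0 < z\<^sup>2 + 1\<close> by (simp add: e'_def field_simps)
  obtain \<delta> where \<delta>: "\<delta> > 0" "\<And>t. \<bar>t - x\<bar> < \<delta> \<Longrightarrow> \<bar>g2 t - g2 x\<bar> < e'"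
    using isCont_g2[of x] e' unfolding isCont_def LIM_def dist_real_def by (metis abs_0 diff_self)
  have "(\<lambda>d. \<bar>\<sigma> d * z\<bar>) \<longlonglongrightarrow> \<bar>0 * z\<bar>" by (intro tendsto_intros \<sigma>)
  then have "\<forall>\<^sub>F d in sequentially. \<bar>\<sigma> d * z\<bar> < \<delta>" using \<delta>(1) by (intro order_tendstoD(2)) auto
  then obtain N where N: "\<And>d. d \<ge> N \<Longrightarrow> \<bar>\<sigma> d * z\<bar> < \<delta>" by (auto simp: eventually_sequentially)
  have "norm (rem x (\<sigma> d * z) / (\<sigma> d)\<^sup>2 - (if \<sigma> d = 0 then 0 else g2 x / 2 * z\<^sup>2) - 0) < e" if "d \<ge> N" for d
  proof (cases "\<sigma> d = 0")
    case False
    obtain t where t: "\<bar>t - x\<bar> \<le> \<bar>\<sigma> d * z\<bar>" "rem x (\<sigma> d * z) = g2 t / 2 * (\<sigma> d * z)\<^sup>2" using rem_taylor by blast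
    then have "rem x (\<sigma> d * z) / (\<sigma> d)\<^sup>2 - g2 x / 2 * z\<^sup>2 = (g2 t - g2 x) / 2 * z\<^sup>2"
      using False by (simp add: power_mult_distrib left_diff_distrib diff_divide_distrib)
    then have "\<bar>rem x (\<sigma> d * z) / (\<sigma> d)\<^sup>2 - g2 x / 2 * z\<^sup>2\<bar> = \<bar>g2 t - g2 x\<bar> / 2 * z\<^sup>2"
      by (simp only: abs_mult abs_divide abs_numeral abs_power2)
    also have "\<dots> \<le> e' / 2 * z\<^sup>2"
      using \<delta>(2)[of t] t(1) N[OF that] by (intro mult_right_mono divide_right_mono) auto
    also have "\<dots> < e" by fact
    finally show ?thesis using False by simp
  qed (use \<open>0 < e\<close> in simp)
  then show "\<exists>no. \<forall>d\<ge>no. norm (rem x (\<sigma> d * z) / (\<sigma> d)\<^sup>2 - (if \<sigma> d = 0 then 0 else g2 x / 2 * z\<^sup>2) - 0) < e" by blast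
qed

lemma integrable_fm_iff:
  assumes [measurable]: "p \<in> borel_measurable borel"
  shows "integrable fm p \<longleftrightarrow> integrable lborel (\<lambda>x. p x * f x)" and "(\<integral>x. p x \<partial>fm) = (\<integral>x. p x * f x \<partial>lborel)"
  using f_pos by (simp_all add: integrable_density integral_density less_imp_le mult.commute)

lemma integrable_g1_abs_pow: "j \<le> 8 \<Longrightarrow> integrable fm (\<lambda>x. \<bar>g1 x\<bar> ^ j)"
proof (rule Bochner_Integration.integrable_bound[where f="\<lambda>x. 1 + \<bar>g1 x\<bar> ^ 8"])
  assume "j \<le> 8"
  have "\<bar>g1 x\<bar> ^ j \<le> 1 + \<bar>g1 x\<bar> ^ 8" for x
  proof (cases "\<bar>g1 x\<bar> \<le> 1")
    case True
    then show ?thesis by (intro add_increasing2 power_le_one) auto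
  next
    case False
    then have "\<bar>g1 x\<bar> ^ j \<le> \<bar>g1 x\<bar> ^ 8" using \<open>j \<le> 8\<close> by (intro power_increasing) auto
    then show ?thesis by simp
  qed
  then show "AE x in fm. norm (\<bar>g1 x\<bar> ^ j) \<le> norm (1 + \<bar>g1 x\<bar> ^ 8)" by (simp add: abs_of_nonneg)
  have "integrable fm (\<lambda>x. (g1 x)^8)" using mom8 by (subst integrable_fm_iff) (auto simp: g1_def)
  then show "integrable fm (\<lambda>x. 1 + \<bar>g1 x\<bar> ^ 8)" by (simp add: power_even_abs)
qed measurable

lemma integrable_g1: "integrable fm g1" "integrable fm (\<lambda>x. (g1 x)\<^sup>2)" "integrable fm (\<lambda>x. (g1 x)^4)"
  using integrable_g1_abs_pow[of 1] integrable_g1_abs_pow[of 2] integrable_g1_abs_pow[of 4]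
  by (simp_all add: power_even_abs integrable_abs_iff)

lemma integrable_g2: "integrable fm g2"
  by (rule fm.integrable_const_bound[where B=L]) (use g2_bound in auto)

lemma integrable_f12: "integrable lborel f1" "integrable lborel f2"
proof -
  show "integrable lborel f1" using integrable_g1(1) f_pos[THEN less_imp_neq] by (simp add: integrable_fm_iff g1_def)
  have "integrable fm (\<lambda>x. g2 x + (g1 x)\<^sup>2)" using integrable_g2 integrable_g1(2) by simp
  then show "integrable lborel f2" using f_pos[THEN less_imp_neq] by (simp add: integrable_fm_iff g2_def)
qed

section \<open>Identities for the Fisher information\<close>

text \<open>The behavior of f' at infinity is not known beforehand, so the integral is averaged over
  shifts by t in [0, 1]. Fubini and the fundamental theorem turn it into the integral of f'(x + 1) -
  f'(x), which vanishes by translation invariance.\<close>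

lemma integral_f2: "(\<integral>x. f2 x \<partial>lborel) = 0"
proof -
  let ?h = "\<lambda>t x. indicator {0..1} t * f2 (x + t)"
  have sh: "integrable lborel (\<lambda>x. f2 (x + t))" "(\<integral>x. f2 (x + t) \<partial>lborel) = (\<integral>x. f2 x \<partial>lborel)"
    "(\<integral>x. \<bar>f2 (x + t)\<bar> \<partial>lborel) = (\<integral>x. \<bar>f2 x\<bar> \<partial>lborel)" for t
    using lborel_integrable_real_affine[OF integrable_f12(2), of 1 t] lborel_integral_real_affine[of 1 f2 t]
      lborel_integral_real_affine[of 1 "\<lambda>x. \<bar>f2 x\<bar>" t] by (simp_all add: add.commute)
  have ind: "integrable lborel (\<lambda>t::real. indicator {0..1} t * c)" for c :: real
    by (intro integrable_mult_left integrable_real_indicator) auto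
  have int: "integrable (lborel \<Otimes>\<^sub>M lborel) (\<lambda>(t, x). ?h t x)"
  proof (rule lborel_pair.Fubini_integrable)
    show "integrable lborel (\<lambda>t. \<integral>x. norm (case (t, x) of (t, x) \<Rightarrow> ?h t x) \<partial>lborel)"
      using ind sh by (simp add: abs_mult)
  qed (use sh in auto)
  have FTC: "(\<integral>t. ?h t x \<partial>lborel) = f1 (x + 1) - f1 (x + 0)" for x
  proof -
    have "(\<integral>t. f2 (x + t) * indicator {0..1} t \<partial>lborel) = f1 (x + 1) - f1 (x + 0)"
    proof (rule integral_FTC_Icc_real)
      fix t :: real
      show "((\<lambda>t. f1 (x + t)) has_real_derivative f2 (x + t)) (at t)"
        by (rule has_real_derivative_shift[OF f1_deriv])
      show "isCont (\<lambda>t. f2 (x + t)) t" by (intro isCont_o2[OF _ isCont_f(3)] continuous_intros)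
    qed simp
    then show ?thesis by (simp add: mult.commute)
  qed
  have i1: "integrable lborel (\<lambda>x. f1 (x + 1))" "(\<integral>x. f1 (x + 1) \<partial>lborel) = (\<integral>x. f1 x \<partial>lborel)"
    using lborel_integrable_real_affine[OF integrable_f12(1), of 1 1] lborel_integral_real_affine[of 1 f1 1]
    by (simp_all add: add.commute)
  have "(\<integral>x. f2 x \<partial>lborel) = (\<integral>t. indicator {0..1::real} t * (\<integral>x. f2 x \<partial>lborel) \<partial>lborel)" by (simp add: content_real)
  also have "\<dots> = (\<integral>t. \<integral>x. ?h t x \<partial>lborel \<partial>lborel)" by (simp add: sh)
  also have "\<dots> = (\<integral>x. \<integral>t. ?h t x \<partial>lborel \<partial>lborel)" by (rule lborel_pair.Fubini_integral[OF int, symmetric])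
  also have "\<dots> = (\<integral>x. f1 (x + 1) - f1 x \<partial>lborel)" by (simp add: FTC)
  also have "\<dots> = 0" using i1 integrable_f12 by simp
  finally show ?thesis .
qed

text \<open>f''/f = g'' + (g')^2, and f'' integrates to 0. This identity ties the mean of the log
  acceptance ratio to minus half its variance.\<close>

lemma integral_g2: "(\<integral>x. g2 x \<partial>fm) = - I"
proof -
  have "(\<integral>x. g2 x + (g1 x)\<^sup>2 \<partial>fm) = (\<integral>x. f2 x \<partial>lborel)"
    using f_pos[THEN less_imp_neq] by (simp add: integrable_fm_iff g2_def)
  then show ?thesis using integrable_g2 integrable_g1 integral_f2 by (simp add: I_def)
qed

text \<open>Otherwise f' would vanish almost everywhere and f would be a positive constant, of
  infinite mass on the line.\<close>

lemma I_pos: "0 < I"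
proof (rule ccontr)
  assume "\<not> 0 < I"
  moreover have "0 \<le> I" unfolding I_def by (rule Bochner_Integration.integral_nonneg) simp
  ultimately have "(\<integral>x. (g1 x)\<^sup>2 \<partial>fm) = 0" unfolding I_def by linarith
  then have "AE x in fm. (g1 x)\<^sup>2 = 0" using integral_nonneg_eq_0_iff_AE[OF integrable_g1(2)] by simp
  then have AE: "AE x in lborel. f1 x = 0"
    by (subst (asm) AE_density) (use f_pos in \<open>auto simp: g1_def order.strict_implies_not_eq[symmetric] less_imp_neq[symmetric]\<close>)
  have "f x = f y" if "x \<le> y" for x y
  proof -
    have "(\<integral>t. f1 t * indicator {x..y} t \<partial>lborel) = f y - f x"
      by (rule integral_FTC_Icc_real[OF that f_deriv isCont_f(2)])
    moreover have "(\<integral>t. f1 t * indicator {x..y} t \<partial>lborel) = 0"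
      by (rule integral_eq_zero_AE) (use AE in auto)
    ultimately show ?thesis by simp
  qed
  then have c: "f x = f 0" for x by (metis linear)
  have "emeasure fm (space fm) = (\<integral>\<^sup>+x. ennreal (f x) \<partial>lborel)" by (simp add: emeasure_density)
  also have "\<dots> = (\<integral>\<^sup>+x. ennreal (f 0) \<partial>(lborel :: real measure))" by (intro nn_integral_cong) (metis c)
  also have "\<dots> = \<infinity>" using f_pos[of 0] by (simp add: ennreal_mult_top)
  finally show False using fm.emeasure_space_1 by simp
qed

sublocale FN: pair_prob_space fm gauss ..

text \<open>The cross term vanishes by centering when one more coordinate is redrawn. The induction
  runs on nonnegative integrals, so integrability of the square comes out together with its
  value.\<close>

lemma iid_sum_sq:
  fixes y :: "real \<Rightarrow> real \<Rightarrow> real"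
  assumes y[measurable]: "(\<lambda>(a, b). y a b) \<in> borel_measurable (borel \<Otimes>\<^sub>M borel)"
    and y2: "integrable (fm \<Otimes>\<^sub>M gauss) (\<lambda>w. (y (fst w) (snd w))\<^sup>2)"
    and y0: "(\<integral>w. y (fst w) (snd w) \<partial>(fm \<Otimes>\<^sub>M gauss)) = 0" and "finite A"
  shows "integrable (mu \<Otimes>\<^sub>M gauss_seq) (\<lambda>w. (\<Sum>i\<in>A. y (fst w i) (snd w i))\<^sup>2)" (is ?int)
    and "(\<integral>w. (\<Sum>i\<in>A. y (fst w i) (snd w i))\<^sup>2 \<partial>(mu \<Otimes>\<^sub>M gauss_seq))
      = real (card A) * (\<integral>w. (y (fst w) (snd w))\<^sup>2 \<partial>(fm \<Otimes>\<^sub>M gauss))" (is ?eq)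
proof -
  let ?v = "\<integral>w. (y (fst w) (snd w))\<^sup>2 \<partial>(fm \<Otimes>\<^sub>M gauss)"
  note yc = measurable_uncurry_compose[OF y]
  have [measurable]: "(\<lambda>w. y (fst w) (snd w)) \<in> borel_measurable (fm \<Otimes>\<^sub>M gauss)"
    by (rule yc) auto
  have y1: "integrable (fm \<Otimes>\<^sub>M gauss) (\<lambda>w. y (fst w) (snd w))"
    by (rule FN.L1_le_L2(1)[OF _ y2]) measurable
  have Ym: "(\<lambda>w. y (F w i) (K w i)) \<in> borel_measurable N" if "F \<in> N \<rightarrow>\<^sub>M mu" "K \<in> N \<rightarrow>\<^sub>M gauss_seq" for F K i and N :: "'z measure"
    by (rule yc[OF measurable_mu_component[OF that(1)] measurable_seq_component[OF that(2)]])
  have S_meas: "(\<lambda>w. (\<Sum>i\<in>A. y (fst w i) (snd w i))\<^sup>2) \<in> borel_measurable (mu \<Otimes>\<^sub>M gauss_seq)" for A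
    by (intro borel_measurable_power borel_measurable_sum Ym) auto
  have v0: "0 \<le> ?v" by (rule Bochner_Integration.integral_nonneg) simp
  have nn: "(\<integral>\<^sup>+x. \<integral>\<^sup>+Z. ennreal ((\<Sum>i\<in>A. y (x i) (Z i))\<^sup>2) \<partial>gauss_seq \<partial>mu) = ennreal (real (card A) * ?v)"
    using \<open>finite A\<close>
  proof (induction A)
    case (insert j A)
    have m: "(\<lambda>(x, Z). ennreal ((\<Sum>i\<in>A. y (x i) (Z i))\<^sup>2)) \<in> borel_measurable (mu \<Otimes>\<^sub>M gauss_seq)" for A
      using S_meas[of A] by (simp add: split_beta')
    have "(\<integral>\<^sup>+x. \<integral>\<^sup>+Z. ennreal ((\<Sum>i\<in>insert j A. y (x i) (Z i))\<^sup>2) \<partial>gauss_seq \<partial>mu)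
      = (\<integral>\<^sup>+x. \<integral>\<^sup>+Z. \<integral>\<^sup>+a. \<integral>\<^sup>+b. ennreal ((\<Sum>i\<in>insert j A. y ((x(j := a)) i) ((Z(j := b)) i))\<^sup>2)
          \<partial>gauss \<partial>fm \<partial>gauss_seq \<partial>mu)"
      by (rule nn_integral_resample_pair[OF prob_fm std_normal.prob_space_axioms m])
    also have "\<dots> = (\<integral>\<^sup>+x. \<integral>\<^sup>+Z. ennreal ((\<Sum>i\<in>A. y (x i) (Z i))\<^sup>2) + ennreal ?v \<partial>gauss_seq \<partial>mu)"
    proof (rule nn_integral_cong, rule nn_integral_cong)
      fix x Z
      define U where "U = (\<Sum>i\<in>A. y (x i) (Z i))"
      have "(\<Sum>i\<in>insert j A. y ((x(j := a)) i) ((Z(j := b)) i)) = y a b + U" for a b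
      proof -
        have "(\<Sum>i\<in>A. y ((x(j := a)) i) ((Z(j := b)) i)) = U"
          unfolding U_def using insert.hyps by (intro sum.cong) auto
        then show ?thesis using insert.hyps by simp
      qed
      then have "(\<integral>\<^sup>+a. \<integral>\<^sup>+b. ennreal ((\<Sum>i\<in>insert j A. y ((x(j := a)) i) ((Z(j := b)) i))\<^sup>2) \<partial>gauss \<partial>fm)
        = (\<integral>\<^sup>+a. \<integral>\<^sup>+b. ennreal ((y a b + U)\<^sup>2) \<partial>gauss \<partial>fm)" by simp
      also have "\<dots> = (\<integral>\<^sup>+w. ennreal ((y (fst w) (snd w) + U)\<^sup>2) \<partial>(fm \<Otimes>\<^sub>M gauss))"
        by (subst std_normal.nn_integral_fst[symmetric]) auto
      also have "\<dots> = ennreal (\<integral>w. (y (fst w) (snd w) + U)\<^sup>2 \<partial>(fm \<Otimes>\<^sub>M gauss))"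
      proof (rule nn_integral_eq_integral)
        show "integrable (fm \<Otimes>\<^sub>M gauss) (\<lambda>w. (y (fst w) (snd w) + U)\<^sup>2)"
          unfolding power2_sum using y1 y2 by simp
      qed simp
      also have "(\<integral>w. (y (fst w) (snd w) + U)\<^sup>2 \<partial>(fm \<Otimes>\<^sub>M gauss))
         = (\<integral>w. (y (fst w) (snd w))\<^sup>2 + U\<^sup>2 + 2 * U * y (fst w) (snd w) \<partial>(fm \<Otimes>\<^sub>M gauss))"
        by (simp add: power2_sum mult_ac)
      also have "\<dots> = U\<^sup>2 + ?v"
        using y1 y2 y0 FN.prob_space by simp
      finally show "(\<integral>\<^sup>+a. \<integral>\<^sup>+b. ennreal ((\<Sum>i\<in>insert j A. y ((x(j := a)) i) ((Z(j := b)) i))\<^sup>2) \<partial>gauss \<partial>fm)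
        = ennreal ((\<Sum>i\<in>A. y (x i) (Z i))\<^sup>2) + ennreal ?v"
        using v0 by (simp add: U_def)
    qed
    also have "\<dots> = (\<integral>\<^sup>+x. (\<integral>\<^sup>+Z. ennreal ((\<Sum>i\<in>A. y (x i) (Z i))\<^sup>2) \<partial>gauss_seq) + ennreal ?v \<partial>mu)"
      using measurable_compose_Pair1[OF _ m[of A]] gauss_seq.emeasure_space_1
      by (intro nn_integral_cong, subst nn_integral_add) auto
    also have "\<dots> = (\<integral>\<^sup>+x. (\<integral>\<^sup>+Z. ennreal ((\<Sum>i\<in>A. y (x i) (Z i))\<^sup>2) \<partial>gauss_seq) \<partial>mu) + ennreal ?v"
      using gauss_seq.borel_measurable_nn_integral[OF m[of A]] mu.emeasure_space_1
      by (subst nn_integral_add) auto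
    also have "\<dots> = ennreal (real (card (insert j A)) * ?v)"
      using insert v0 by (simp add: ennreal_plus[symmetric] algebra_simps del: ennreal_plus)
    finally show ?case .
  qed simp
  have nn': "(\<integral>\<^sup>+w. ennreal ((\<Sum>i\<in>A. y (fst w i) (snd w i))\<^sup>2) \<partial>(mu \<Otimes>\<^sub>M gauss_seq)) = ennreal (real (card A) * ?v)"
    using S_meas[of A] by (subst gauss_seq.nn_integral_fst[symmetric]) (auto simp: nn)
  show ?int
    using nn' S_meas[of A] by (intro integrableI_nonneg) auto
  show ?eq
    using nn' S_meas[of A] v0 by (subst integral_eq_nn_integral) auto
qed

text \<open>Redrawing coordinate \<open>j\<close> affects \<open>p\<close> but not \<open>h\<close>,
  so the integral splits into a product.\<close>

lemma coord_indep_seq: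
  fixes p :: "real \<Rightarrow> real" and h :: "(nat \<Rightarrow> real) \<Rightarrow> real"
  assumes M: "prob_space M" and p[measurable]: "p \<in> borel_measurable M" and p_int: "integrable M p"
    and h[measurable]: "h \<in> borel_measurable (PiM UNIV (\<lambda>_. M))" and hK: "\<And>Z. \<bar>h Z\<bar> \<le> K"
    and h_indep: "\<And>Z b. h (Z(j := b)) = h Z"
  shows "integrable (PiM UNIV (\<lambda>_. M)) (\<lambda>Z. p (Z j) * h Z)"
    and "(\<integral>Z. p (Z j) * h Z \<partial>PiM UNIV (\<lambda>_. M)) = (\<integral>b. p b \<partial>M) * (\<integral>Z. h Z \<partial>PiM UNIV (\<lambda>_. M))"
proof -
  interpret M: prob_space M by (rule M)
  let ?P = "PiM UNIV (\<lambda>_::nat. M)"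
  interpret PM: prob_space ?P by (intro prob_space_PiM M)
  interpret MP: pair_prob_space M ?P ..
  have [measurable]: "(\<lambda>(x, \<xi>). \<xi>(j := x)) \<in> M \<Otimes>\<^sub>M ?P \<rightarrow>\<^sub>M ?P"
    unfolding split_beta by (rule measurable_fun_upd[where J=UNIV]) auto
  have comp: "(\<lambda>Z. Z j) \<in> ?P \<rightarrow>\<^sub>M M" by measurable
  have [measurable]: "(\<lambda>Z. p (Z j)) \<in> borel_measurable ?P" by (rule measurable_compose[OF comp p])
  have int: "integrable (M \<Otimes>\<^sub>M ?P) (\<lambda>(b, Z). p b * h Z)"
  proof (rule MP.Fubini_integrable)
    show "integrable M (\<lambda>x. \<integral>y. norm (case (x, y) of (b, Z) \<Rightarrow> p b * h Z) \<partial>?P)"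
      using p_int by (simp add: abs_mult)
    show "AE x in M. integrable ?P (\<lambda>y. case (x, y) of (b, Z) \<Rightarrow> p b * h Z)"
      using PM.integrable_const_bound[where B=K and f=h] hK by simp
  qed measurable
  have eq: "(\<lambda>w. (\<lambda>Z. p (Z j) * h Z) (case w of (x, \<xi>) \<Rightarrow> \<xi>(j := x))) = (\<lambda>(b, Z). p b * h Z)"
    by (auto simp: h_indep)
  have "integrable (distr (M \<Otimes>\<^sub>M ?P) ?P (\<lambda>(x, \<xi>). \<xi>(j := x))) (\<lambda>Z. p (Z j) * h Z)"
    by (subst integrable_distr_eq) (use int in \<open>simp_all add: eq\<close>)
  then show "integrable ?P (\<lambda>Z. p (Z j) * h Z)" by (simp add: PiM_resample M)
  have "(\<integral>Z. p (Z j) * h Z \<partial>?P) = (\<integral>Z. p (Z j) * h Z \<partial>distr (M \<Otimes>\<^sub>M ?P) ?P (\<lambda>(x, \<xi>). \<xi>(j := x)))"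
    by (simp add: PiM_resample M)
  also have "\<dots> = (\<integral>w. (case w of (b, Z) \<Rightarrow> p b * h Z) \<partial>(M \<Otimes>\<^sub>M ?P))"
    by (subst integral_distr) (simp_all add: eq)
  also have "\<dots> = (\<integral>b. \<integral>Z. p b * h Z \<partial>?P \<partial>M)" using MP.integral_fst'[OF int] by simp
  also have "\<dots> = (\<integral>b. p b \<partial>M) * (\<integral>Z. h Z \<partial>?P)" by simp
  finally show "(\<integral>Z. p (Z j) * h Z \<partial>?P) = (\<integral>b. p b \<partial>M) * (\<integral>Z. h Z \<partial>?P)" .
qed

section \<open>Normal approximation of the log acceptance ratio\<close>

definition rsum :: "real \<Rightarrow> nat set \<Rightarrow> (nat \<Rightarrow> real) \<Rightarrow> (nat \<Rightarrow> real) \<Rightarrow> real" where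
  "rsum \<sigma> A x Z = (\<Sum>i\<in>A. G (x i + \<sigma> * Z i) - G (x i))"

definition EV :: "real \<Rightarrow> real" where
  "EV \<sigma> = (\<integral>w. rem (fst w) (\<sigma> * snd w) \<partial>(fm \<Otimes>\<^sub>M gauss))"

lemma integrable_snd_FN:
  fixes p :: "real \<Rightarrow> real"
  assumes "integrable gauss p"
  shows "integrable (fm \<Otimes>\<^sub>M gauss) (\<lambda>w. p (snd w))"
    and "(\<integral>w. p (snd w) \<partial>(fm \<Otimes>\<^sub>M gauss)) = (\<integral>z. p z \<partial>gauss)"
proof -
  have [measurable]: "p \<in> borel_measurable borel" using borel_measurable_integrable[OF assms] by simp
  show i: "integrable (fm \<Otimes>\<^sub>M gauss) (\<lambda>w. p (snd w))"
    by (rule FN.Fubini_integrable) (use assms in auto)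
  show "(\<integral>w. p (snd w) \<partial>(fm \<Otimes>\<^sub>M gauss)) = (\<integral>z. p z \<partial>gauss)"
    using FN.integral_fst'[OF i] fm.prob_space by simp
qed

lemma integrable_fst_FN:
  fixes p :: "real \<Rightarrow> real"
  assumes "integrable fm p"
  shows "integrable (fm \<Otimes>\<^sub>M gauss) (\<lambda>w. p (fst w))"
    and "(\<integral>w. p (fst w) \<partial>(fm \<Otimes>\<^sub>M gauss)) = (\<integral>z. p z \<partial>fm)"
proof -
  have [measurable]: "p \<in> borel_measurable borel" using borel_measurable_integrable[OF assms] by simp
  show i: "integrable (fm \<Otimes>\<^sub>M gauss) (\<lambda>w. p (fst w))"
    by (rule FN.Fubini_integrable) (use assms std_normal.prob_space in auto)
  show "(\<integral>w. p (fst w) \<partial>(fm \<Otimes>\<^sub>M gauss)) = (\<integral>z. p z \<partial>fm)"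
    using FN.integral_fst'[OF i] std_normal.prob_space by simp
qed

lemma std_normal_fourth: "integrable gauss (\<lambda>z. z^4)" "(\<integral>z. z^4 \<partial>gauss) = 3"
  using std_normal_distribution_even_moments[of 2] by (simp_all add: fact_numeral)

lemma rem_sq:
  shows "integrable (fm \<Otimes>\<^sub>M gauss) (\<lambda>w. (rem (fst w) (\<sigma> * snd w))\<^sup>2)"
    and "(\<integral>w. (rem (fst w) (\<sigma> * snd w))\<^sup>2 \<partial>(fm \<Otimes>\<^sub>M gauss)) \<le> (L * \<sigma>\<^sup>2)\<^sup>2"
proof -
  have le: "(rem x (\<sigma> * z))\<^sup>2 \<le> (L * \<sigma>\<^sup>2 / 2)\<^sup>2 * z^4" for x z
  proof -
    have "\<bar>rem x (\<sigma> * z)\<bar>\<^sup>2 \<le> (L / 2 * (\<sigma> * z)\<^sup>2)\<^sup>2" by (intro power_mono rem_bound) auto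
    then show ?thesis by (simp add: power_mult_distrib power_divide flip: power_mult)
  qed
  have i: "integrable (fm \<Otimes>\<^sub>M gauss) (\<lambda>w. (L * \<sigma>\<^sup>2 / 2)\<^sup>2 * snd w ^ 4)"
    by (intro integrable_mult_right integrable_snd_FN(1)[OF std_normal_fourth(1)])
  show i2: "integrable (fm \<Otimes>\<^sub>M gauss) (\<lambda>w. (rem (fst w) (\<sigma> * snd w))\<^sup>2)"
    by (rule Bochner_Integration.integrable_bound[OF i]) (auto simp: le)
  have "(\<integral>w. (rem (fst w) (\<sigma> * snd w))\<^sup>2 \<partial>(fm \<Otimes>\<^sub>M gauss))
     \<le> (\<integral>w. (L * \<sigma>\<^sup>2 / 2)\<^sup>2 * snd w ^ 4 \<partial>(fm \<Otimes>\<^sub>M gauss))"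
    by (rule integral_mono[OF i2 i le])
  also have "\<dots> = (L * \<sigma>\<^sup>2 / 2)\<^sup>2 * 3"
    using integrable_snd_FN(2)[OF std_normal_fourth(1)] std_normal_fourth(2) by simp
  also have "\<dots> \<le> (L * \<sigma>\<^sup>2)\<^sup>2" by (simp add: power_divide)
  finally show "(\<integral>w. (rem (fst w) (\<sigma> * snd w))\<^sup>2 \<partial>(fm \<Otimes>\<^sub>M gauss)) \<le> (L * \<sigma>\<^sup>2)\<^sup>2" .
qed

text \<open>The remainder divided by sigma^2 tends to g''(x) z^2 / 2 and is dominated by L z^2 / 2;
  the mean of g'' is -I and that of z^2 is 1.\<close>

lemma EV_limit:
  assumes \<sigma>: "\<sigma> \<longlonglongrightarrow> 0" and pos: "\<And>d. \<sigma> d > 0"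
  shows "(\<lambda>d. EV (\<sigma> d) / (\<sigma> d)\<^sup>2) \<longlonglongrightarrow> - I / 2"
proof -
  let ?N = "fm \<Otimes>\<^sub>M gauss"
  have "(\<lambda>d. \<integral>w. rem (fst w) (\<sigma> d * snd w) / (\<sigma> d)\<^sup>2 \<partial>?N) \<longlonglongrightarrow> (\<integral>w. g2 (fst w) / 2 * (snd w)\<^sup>2 \<partial>?N)"
  proof (rule integral_dominated_convergence[where w="\<lambda>w. L / 2 * (snd w)\<^sup>2"])
    show "integrable ?N (\<lambda>w. L / 2 * (snd w)\<^sup>2)"
      by (intro integrable_mult_right integrable_snd_FN(1) std_normal_moments)
    show "AE w in ?N. (\<lambda>d. rem (fst w) (\<sigma> d * snd w) / (\<sigma> d)\<^sup>2) \<longlonglongrightarrow> g2 (fst w) / 2 * (snd w)\<^sup>2"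
    proof (rule AE_I2)
      fix w :: "real \<times> real"
      show "(\<lambda>d. rem (fst w) (\<sigma> d * snd w) / (\<sigma> d)\<^sup>2) \<longlonglongrightarrow> g2 (fst w) / 2 * (snd w)\<^sup>2"
        using rem_limit[OF \<sigma>, of "fst w" "snd w"] pos[THEN less_imp_neq, THEN not_sym]
        by (simp add: LIM_zero_iff)
    qed
    fix d
    have "\<bar>rem x (\<sigma> d * z)\<bar> / (\<sigma> d)\<^sup>2 \<le> L / 2 * z\<^sup>2" for x z
    proof -
      have "\<bar>rem x (\<sigma> d * z)\<bar> / (\<sigma> d)\<^sup>2 \<le> (L / 2 * (\<sigma> d * z)\<^sup>2) / (\<sigma> d)\<^sup>2" by (intro divide_right_mono rem_bound) auto
      also have "\<dots> = L / 2 * z\<^sup>2" using pos[of d] by (simp add: power_mult_distrib)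
      finally show ?thesis .
    qed
    then show "AE w in ?N. norm (rem (fst w) (\<sigma> d * snd w) / (\<sigma> d)\<^sup>2) \<le> L / 2 * (snd w)\<^sup>2"
      by (simp add: abs_divide)
  qed measurable
  also have "(\<integral>w. g2 (fst w) / 2 * (snd w)\<^sup>2 \<partial>?N) = (\<integral>a. \<integral>z. g2 a / 2 * z\<^sup>2 \<partial>gauss \<partial>fm)"
  proof -
    have "integrable ?N (\<lambda>w. g2 (fst w) / 2 * (snd w)\<^sup>2)"
    proof (rule Bochner_Integration.integrable_bound[where f="\<lambda>w. L / 2 * (snd w)\<^sup>2"])
      show "integrable ?N (\<lambda>w. L / 2 * (snd w)\<^sup>2)"
        by (intro integrable_mult_right integrable_snd_FN(1) std_normal_moments)
      show "AE w in ?N. norm (g2 (fst w) / 2 * (snd w)\<^sup>2) \<le> norm (L / 2 * (snd w)\<^sup>2)"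
        using g2_bound L_nonneg by (auto simp: abs_mult intro!: mult_right_mono)
    qed measurable
    from FN.integral_fst'[OF this] show ?thesis by simp
  qed
  also have "\<dots> = - I / 2" using std_normal_moments(2) integral_g2 by simp
  finally show ?thesis by (simp add: EV_def)
qed

text \<open>Four errors: the fluctuation of the summed Taylor remainders, the distance of their mean
  from -S^2/2, the fluctuation of sigma^2 times the sum of the (g')^2, and the distance of its mean
  from S^2. The last two are divided by \<open>S\<close> because |sqrt s - S| is at most |s - S^2| /
  S.\<close>

definition approx_err :: "real \<Rightarrow> nat \<Rightarrow> real \<Rightarrow> real" where
  "approx_err S n \<sigma> = sqrt (real n) * (L * \<sigma>\<^sup>2) + \<bar>real n * EV \<sigma> + S\<^sup>2 / 2\<bar>
     + (sqrt (real n) * (\<sigma>\<^sup>2 * sqrt (\<integral>x. (g1 x)^4 \<partial>fm)) + \<bar>real n * \<sigma>\<^sup>2 * I - S\<^sup>2\<bar>) / S"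

lemma rsum_measurable: "F \<in> N \<rightarrow>\<^sub>M mu \<Longrightarrow> H \<in> N \<rightarrow>\<^sub>M gauss_seq \<Longrightarrow> (\<lambda>w. rsum \<sigma> A (F w) (H w)) \<in> borel_measurable N"
  unfolding rsum_def
proof (rule borel_measurable_sum)
  fix i assume F: "F \<in> N \<rightarrow>\<^sub>M mu" and H: "H \<in> N \<rightarrow>\<^sub>M gauss_seq"
  note [measurable] = measurable_mu_component[OF F, of i] measurable_seq_component[OF H, of i]
  show "(\<lambda>w. G (F w i + \<sigma> * H w i) - G (F w i)) \<in> borel_measurable N" by measurable
qed

lemma space_mu: "space mu = UNIV" "space gauss_seq = UNIV"
  by (auto simp: space_PiM)

text \<open>For fixed \<open>x\<close> the linear part of the log ratio is a linear form in
  \<open>Z\<close>, hence normal with variance \<open>s2 x\<close>. \<open>W\<close> is the sum of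
  the Taylor remainders freed of its limiting mean. Both \<open>W\<close> and
  \<open>s2 x - S\<^sup>2\<close> are controlled in L2 as sums of independent terms, and since they
  are small in mean only, the test function \<open>q\<close> has to be Lipschitz.\<close>

lemma gauss_approx:
  fixes q :: "real \<Rightarrow> real"
  assumes q[measurable]: "q \<in> borel_measurable borel" and K: "\<And>r. \<bar>q r\<bar> \<le> K"
    and Lq: "\<And>r s. \<bar>q r - q s\<bar> \<le> Lq * \<bar>r - s\<bar>" and S: "0 < S" and A: "finite A"
  shows "(\<integral>x. \<bar>(\<integral>Z. q (rsum \<sigma> A x Z) \<partial>gauss_seq) - (\<integral>z. q (S * z - S\<^sup>2 / 2) \<partial>gauss)\<bar> \<partial>mu)
    \<le> Lq * approx_err S (card A) \<sigma>"
proof -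
  let ?n = "real (card A)" and ?N = "fm \<Otimes>\<^sub>M gauss" and ?MG = "mu \<Otimes>\<^sub>M gauss_seq" and ?g4 = "\<integral>x. (g1 x)^4 \<partial>fm"
  have Lq0: "0 \<le> Lq" using Lq[of 1 0] by simp
  note rm[measurable] = rsum_measurable[OF measurable_fst measurable_snd, of \<sigma> A]
  have mcomp[measurable]: "(\<lambda>x. x i) \<in> borel_measurable mu" for i by (rule measurable_mu_component) simp
  have scomp[measurable]: "(\<lambda>x. x i) \<in> borel_measurable gauss_seq" for i by (rule measurable_seq_component) simp
  have fcomp[measurable]: "(\<lambda>w. fst w i) \<in> borel_measurable ?MG" "(\<lambda>w. snd w i) \<in> borel_measurable ?MG" for i
    by (rule measurable_mu_component measurable_seq_component; simp)+
  define y where "y a b = rem a (\<sigma> * b) - EV \<sigma>" for a b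
  define u where "u a b = \<sigma>\<^sup>2 * ((g1 a)\<^sup>2 - I)" for a b :: real
  define W where "W x Z = (\<Sum>i\<in>A. rem (x i) (\<sigma> * Z i)) + S\<^sup>2 / 2" for x Z
  have Wm[measurable]: "(\<lambda>w. W (fst w) (snd w)) \<in> borel_measurable ?MG" unfolding W_def by measurable
  have remi: "integrable ?N (\<lambda>w. rem (fst w) (\<sigma> * snd w))" by (rule FN.L1_le_L2(1)[OF _ rem_sq(1)]) measurable
  have y2: "integrable ?N (\<lambda>w. (y (fst w) (snd w))\<^sup>2)"
    unfolding y_def power2_diff using rem_sq(1) remi by simp
  have y0: "(\<integral>w. y (fst w) (snd w) \<partial>?N) = 0" using remi FN.prob_space by (simp add: y_def EV_def)
  have vy: "(\<integral>w. (y (fst w) (snd w))\<^sup>2 \<partial>?N) \<le> (L * \<sigma>\<^sup>2)\<^sup>2"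
  proof -
    have "(\<integral>w. (y (fst w) (snd w))\<^sup>2 \<partial>?N) = (\<integral>w. (rem (fst w) (\<sigma> * snd w))\<^sup>2 + (EV \<sigma>)\<^sup>2 - 2 * EV \<sigma> * rem (fst w) (\<sigma> * snd w) \<partial>?N)"
      by (simp add: y_def power2_diff mult_ac)
    also have "\<dots> = (\<integral>w. (rem (fst w) (\<sigma> * snd w))\<^sup>2 \<partial>?N) - (EV \<sigma>)\<^sup>2"
      using rem_sq(1) remi FN.prob_space by (simp add: EV_def[symmetric] power2_eq_square)
    also have "\<dots> \<le> (L * \<sigma>\<^sup>2)\<^sup>2" using rem_sq(2)[of \<sigma>] by (simp add: add_increasing2 diff_le_eq)
    finally show ?thesis .
  qed
  have ym: "(\<lambda>(a, b). y a b) \<in> borel_measurable (borel \<Otimes>\<^sub>M borel)" unfolding y_def split_beta' by measurable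
  have um: "(\<lambda>(a, b). u a b) \<in> borel_measurable (borel \<Otimes>\<^sub>M borel)" unfolding u_def split_beta' by measurable
  have u2i: "integrable fm (\<lambda>a. (\<sigma>\<^sup>2 * ((g1 a)\<^sup>2 - I))\<^sup>2)"
    unfolding power_mult_distrib power2_diff using integrable_g1 by (simp flip: power_mult)
  have u2: "integrable ?N (\<lambda>w. (u (fst w) (snd w))\<^sup>2)"
    unfolding u_def by (rule integrable_fst_FN(1)[OF u2i])
  have u1i: "integrable fm (\<lambda>a. \<sigma>\<^sup>2 * ((g1 a)\<^sup>2 - I))" using integrable_g1 by simp
  have u0: "(\<integral>w. u (fst w) (snd w) \<partial>?N) = 0"
    unfolding u_def integrable_fst_FN(2)[OF u1i] using integrable_g1 fm.prob_space by (simp add: I_def)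
  have vu: "(\<integral>w. (u (fst w) (snd w))\<^sup>2 \<partial>?N) \<le> (\<sigma>\<^sup>2)\<^sup>2 * ?g4"
  proof -
    have "(\<integral>w. (u (fst w) (snd w))\<^sup>2 \<partial>?N) = (\<integral>a. (\<sigma>\<^sup>2)\<^sup>2 * ((g1 a)^4 + I\<^sup>2 - 2 * I * (g1 a)\<^sup>2) \<partial>fm)"
      unfolding u_def integrable_fst_FN(2)[OF u2i]
      by (intro Bochner_Integration.integral_cong) (simp_all add: power_mult_distrib power2_diff mult_ac flip: power_mult)
    also have "\<dots> = (\<sigma>\<^sup>2)\<^sup>2 * (?g4 - I\<^sup>2)"
    proof -
      have "(\<integral>a. (\<sigma>\<^sup>2)\<^sup>2 * ((g1 a)^4 + I\<^sup>2 - 2 * I * (g1 a)\<^sup>2) \<partial>fm)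
        = (\<sigma>\<^sup>2)\<^sup>2 * (?g4 + I\<^sup>2 - 2 * I * I)"
        using integrable_g1 fm.prob_space by (simp add: I_def[symmetric])
      then show ?thesis by (simp add: power2_eq_square[of I])
    qed
    also have "\<dots> \<le> (\<sigma>\<^sup>2)\<^sup>2 * ?g4" by (intro mult_left_mono) auto
    finally show ?thesis .
  qed
  have iid: "integrable ?MG (\<lambda>w. \<Sum>i\<in>A. p (fst w i) (snd w i))"
      "(\<integral>w. \<bar>\<Sum>i\<in>A. p (fst w i) (snd w i)\<bar> \<partial>?MG) \<le> sqrt ?n * s"
    if p: "(\<lambda>(a, b). p a b) \<in> borel_measurable (borel \<Otimes>\<^sub>M borel)" "integrable ?N (\<lambda>w. (p (fst w) (snd w))\<^sup>2)"
      "(\<integral>w. p (fst w) (snd w) \<partial>?N) = 0" and v: "(\<integral>w. (p (fst w) (snd w))\<^sup>2 \<partial>?N) \<le> s\<^sup>2" "0 \<le> s"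
    for p :: "real \<Rightarrow> real \<Rightarrow> real" and s
  proof -
    have m: "(\<lambda>w. \<Sum>i\<in>A. p (fst w i) (snd w i)) \<in> borel_measurable ?MG"
      by (intro borel_measurable_sum measurable_uncurry_compose[OF p(1)] fcomp)
    note sq = iid_sum_sq[OF p A]
    show "integrable ?MG (\<lambda>w. \<Sum>i\<in>A. p (fst w i) (snd w i))" by (rule MG.L1_le_L2(1)[OF m sq(1)])
    have "(\<integral>w. \<bar>\<Sum>i\<in>A. p (fst w i) (snd w i)\<bar> \<partial>?MG) \<le> sqrt (?n * (\<integral>w. (p (fst w) (snd w))\<^sup>2 \<partial>?N))"
      using MG.L1_le_L2(2)[OF m sq(1)] by (simp only: sq(2))
    also have "\<dots> \<le> sqrt (?n * s\<^sup>2)" by (intro real_sqrt_le_mono mult_left_mono v) auto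
    also have "\<dots> = sqrt ?n * s" using v(2) by (simp add: real_sqrt_mult)
    finally show "(\<integral>w. \<bar>\<Sum>i\<in>A. p (fst w i) (snd w i)\<bar> \<partial>?MG) \<le> sqrt ?n * s" .
  qed
  let ?Y = "\<lambda>w. \<Sum>i\<in>A. y (fst w i) (snd w i)" and ?U = "\<lambda>w. \<Sum>i\<in>A. u (fst w i) (snd w i)"
  have "0 \<le> L * \<sigma>\<^sup>2" using L_nonneg by simp
  note sumy = iid[OF ym y2 y0 vy this]
  have "0 \<le> ?g4" by (intro Bochner_Integration.integral_nonneg) simp
  then have "(\<integral>w. (u (fst w) (snd w))\<^sup>2 \<partial>?N) \<le> (\<sigma>\<^sup>2 * sqrt ?g4)\<^sup>2" "0 \<le> \<sigma>\<^sup>2 * sqrt ?g4"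
    using vu by (simp_all add: power_mult_distrib)
  note sumu = iid[OF um u2 u0 this]
  have W_eq: "W x Z = (\<Sum>i\<in>A. y (x i) (Z i)) + (?n * EV \<sigma> + S\<^sup>2 / 2)" for x Z
    by (simp add: W_def y_def sum_subtractf)
  have Wi: "integrable ?MG (\<lambda>w. W (fst w) (snd w))" unfolding W_eq using sumy(1) by simp
  have W1: "(\<integral>w. \<bar>W (fst w) (snd w)\<bar> \<partial>?MG) \<le> sqrt ?n * (L * \<sigma>\<^sup>2) + \<bar>?n * EV \<sigma> + S\<^sup>2 / 2\<bar>"
  proof -
    have "(\<integral>w. \<bar>W (fst w) (snd w)\<bar> \<partial>?MG) \<le> (\<integral>w. \<bar>?Y w\<bar> + \<bar>?n * EV \<sigma> + S\<^sup>2 / 2\<bar> \<partial>?MG)"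
      using Wi sumy(1) by (intro integral_mono) (auto simp: W_eq abs_triangle_ineq)
    also have "\<dots> = (\<integral>w. \<bar>?Y w\<bar> \<partial>?MG) + \<bar>?n * EV \<sigma> + S\<^sup>2 / 2\<bar>"
      using sumy(1) MG.prob_space by simp
    finally show ?thesis using sumy(2) by linarith
  qed
  define s2 where "s2 x = (\<Sum>i\<in>A. (\<sigma> * g1 (x i))\<^sup>2)" for x
  have s2m[measurable]: "s2 \<in> borel_measurable mu" unfolding s2_def[abs_def] by measurable
  have s2_eq: "s2 x - S\<^sup>2 = (\<Sum>i\<in>A. u (x i) (Z i)) + (?n * \<sigma>\<^sup>2 * I - S\<^sup>2)" for x Z
    by (simp add: s2_def u_def power_mult_distrib sum_subtractf right_diff_distrib sum_distrib_left)
  have s2i: "integrable mu (\<lambda>x. \<bar>s2 x - S\<^sup>2\<bar>)"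
    and s2b: "(\<integral>x. \<bar>s2 x - S\<^sup>2\<bar> \<partial>mu) \<le> sqrt ?n * (\<sigma>\<^sup>2 * sqrt ?g4) + \<bar>?n * \<sigma>\<^sup>2 * I - S\<^sup>2\<bar>"
  proof -
    have i: "integrable ?MG (\<lambda>w. \<bar>s2 (fst w) - S\<^sup>2\<bar>)"
    proof -
      have "integrable ?MG (\<lambda>w. \<bar>?U w + (?n * \<sigma>\<^sup>2 * I - S\<^sup>2)\<bar>)"
        using sumu(1) by (intro integrable_abs Bochner_Integration.integrable_add) auto
      then show ?thesis by (simp only: s2_eq[symmetric])
    qed
    then show "integrable mu (\<lambda>x. \<bar>s2 x - S\<^sup>2\<bar>)"
      using MG.integrable_fst'[OF i] gauss_seq.prob_space by simp
    have "(\<integral>x. \<bar>s2 x - S\<^sup>2\<bar> \<partial>mu) = (\<integral>w. \<bar>s2 (fst w) - S\<^sup>2\<bar> \<partial>?MG)"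
      using MG.integral_fst'[OF i] gauss_seq.prob_space by simp
    also have "\<dots> \<le> (\<integral>w. \<bar>?U w\<bar> + \<bar>?n * \<sigma>\<^sup>2 * I - S\<^sup>2\<bar> \<partial>?MG)"
    proof (rule integral_mono[OF i])
      show "integrable ?MG (\<lambda>w. \<bar>?U w\<bar> + \<bar>?n * \<sigma>\<^sup>2 * I - S\<^sup>2\<bar>)" using sumu(1) by simp
      fix w show "\<bar>s2 (fst w) - S\<^sup>2\<bar> \<le> \<bar>?U w\<bar> + \<bar>?n * \<sigma>\<^sup>2 * I - S\<^sup>2\<bar>"
        unfolding s2_eq[of "fst w" "snd w"] by (rule abs_triangle_ineq)
    qed
    also have "\<dots> = (\<integral>w. \<bar>?U w\<bar> \<partial>?MG) + \<bar>?n * \<sigma>\<^sup>2 * I - S\<^sup>2\<bar>"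
      using sumu(1) MG.prob_space by simp
    finally show "(\<integral>x. \<bar>s2 x - S\<^sup>2\<bar> \<partial>mu) \<le> sqrt ?n * (\<sigma>\<^sup>2 * sqrt ?g4) + \<bar>?n * \<sigma>\<^sup>2 * I - S\<^sup>2\<bar>"
      using sumu(2) by linarith
  qed
  have pw: "\<bar>(\<integral>Z. q (rsum \<sigma> A x Z) \<partial>gauss_seq) - (\<integral>z. q (S * z - S\<^sup>2 / 2) \<partial>gauss)\<bar>
     \<le> Lq * (\<integral>Z. \<bar>W x Z\<bar> \<partial>gauss_seq) + Lq * (\<bar>s2 x - S\<^sup>2\<bar> / S)"
    if Wx: "integrable gauss_seq (\<lambda>Z. \<bar>W x Z\<bar>)" for x
  proof -
    have xs: "x \<in> space mu" by (simp add: space_mu)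
    have [measurable]: "(\<lambda>Z. rsum \<sigma> A x Z) \<in> borel_measurable gauss_seq" by (rule rsum_measurable) (use xs in auto)
    let ?lin = "\<lambda>Z. - S\<^sup>2 / 2 + (\<Sum>i\<in>A. (\<sigma> * g1 (x i)) * Z i)"
    have diff: "rsum \<sigma> A x Z - ?lin Z = W x Z" for Z
      by (simp add: rsum_def W_def rem_def sum_subtractf sum.distrib algebra_simps)
    have "\<bar>(\<integral>Z. q (rsum \<sigma> A x Z) \<partial>gauss_seq) - (\<integral>Z. q (?lin Z) \<partial>gauss_seq)\<bar> \<le> (\<integral>Z. Lq * \<bar>W x Z\<bar> \<partial>gauss_seq)"
    proof (rule gauss_seq.abs_integral_diff_le)
      show "integrable gauss_seq (\<lambda>Z. q (rsum \<sigma> A x Z))"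
        by (rule gauss_seq.integrable_const_bound[where B=K]) (use K in auto)
      show "integrable gauss_seq (\<lambda>Z. q (?lin Z))"
        by (rule gauss_seq.integrable_const_bound[where B=K]) (use K in auto)
      show "integrable gauss_seq (\<lambda>Z. Lq * \<bar>W x Z\<bar>)" using Wx by simp
      fix Z show "\<bar>q (rsum \<sigma> A x Z) - q (?lin Z)\<bar> \<le> Lq * \<bar>W x Z\<bar>"
        unfolding diff[symmetric] by (rule Lq)
    qed
    moreover have "(\<integral>Z. q (?lin Z) \<partial>gauss_seq) = (\<integral>z. q (- S\<^sup>2 / 2 + sqrt (s2 x) * z) \<partial>gauss)"
      unfolding s2_def by (rule integral_std_normal_sum[OF q K A])
    moreover have "(\<integral>z. q (S * z - S\<^sup>2 / 2) \<partial>gauss) = (\<integral>z. q (- S\<^sup>2 / 2 + S * z) \<partial>gauss)"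
      by (simp add: add.commute)
    moreover have "\<bar>(\<integral>z. q (- S\<^sup>2 / 2 + sqrt (s2 x) * z) \<partial>gauss) - (\<integral>z. q (- S\<^sup>2 / 2 + S * z) \<partial>gauss)\<bar>
      \<le> Lq * \<bar>sqrt (s2 x) - S\<bar>"
      by (rule integral_std_normal_lipschitz_scale[OF q K Lq])
    moreover have "Lq * \<bar>sqrt (s2 x) - S\<bar> \<le> Lq * (\<bar>s2 x - S\<^sup>2\<bar> / S)"
    proof (rule mult_left_mono[OF _ Lq0])
      have s0: "0 \<le> s2 x" unfolding s2_def by (intro sum_nonneg) auto
      have "s2 x - S\<^sup>2 = (sqrt (s2 x) - S) * (sqrt (s2 x) + S)"
        using s0 by (simp add: algebra_simps power2_eq_square)
      then have "\<bar>s2 x - S\<^sup>2\<bar> = \<bar>sqrt (s2 x) - S\<bar> * (sqrt (s2 x) + S)" using S s0 by (simp add: abs_mult)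
      also have "\<dots> \<ge> \<bar>sqrt (s2 x) - S\<bar> * S" using s0 by (intro mult_left_mono) auto
      finally show "\<bar>sqrt (s2 x) - S\<bar> \<le> \<bar>s2 x - S\<^sup>2\<bar> / S" using S by (simp add: pos_le_divide_eq)
    qed
    ultimately show ?thesis by simp
  qed
  have Wai: "integrable ?MG (\<lambda>w. \<bar>W (fst w) (snd w)\<bar>)" using Wi by simp
  have aeW: "AE x in mu. integrable gauss_seq (\<lambda>Z. \<bar>W x Z\<bar>)"
    using MG.AE_integrable_fst'[OF Wai] by simp
  have iW: "integrable mu (\<lambda>x. \<integral>Z. \<bar>W x Z\<bar> \<partial>gauss_seq)" using MG.integrable_fst'[OF Wai] by simp
  let ?D = "\<lambda>x. (\<integral>Z. q (rsum \<sigma> A x Z) \<partial>gauss_seq) - (\<integral>z. q (S * z - S\<^sup>2 / 2) \<partial>gauss)"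
  have Dm: "(\<lambda>x. \<integral>Z. q (rsum \<sigma> A x Z) \<partial>gauss_seq) \<in> borel_measurable mu"
    by (rule gauss_seq.borel_measurable_lebesgue_integral) (simp add: split_beta')
  have "(\<integral>x. \<bar>?D x\<bar> \<partial>mu) \<le> (\<integral>x. Lq * (\<integral>Z. \<bar>W x Z\<bar> \<partial>gauss_seq) + Lq * (\<bar>s2 x - S\<^sup>2\<bar> / S) \<partial>mu)"
  proof (rule integral_mono_AE)
    show "integrable mu (\<lambda>x. \<bar>?D x\<bar>)"
    proof (rule mu.integrable_const_bound[where B="2 * K"])
      have "\<bar>?D x\<bar> \<le> 2 * K" for x
        using gauss_seq.abs_integral_le[of "\<lambda>Z. q (rsum \<sigma> A x Z)" K]
          std_normal.abs_integral_le[of "\<lambda>z. q (S * z - S\<^sup>2 / 2)" K] K by (simp add: abs_le_iff)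
      then show "AE x in mu. norm \<bar>?D x\<bar> \<le> 2 * K" by simp
    qed (use Dm in measurable)
    show "integrable mu (\<lambda>x. Lq * (\<integral>Z. \<bar>W x Z\<bar> \<partial>gauss_seq) + Lq * (\<bar>s2 x - S\<^sup>2\<bar> / S))"
      using iW s2i by simp
    show "AE x in mu. \<bar>?D x\<bar> \<le> Lq * (\<integral>Z. \<bar>W x Z\<bar> \<partial>gauss_seq) + Lq * (\<bar>s2 x - S\<^sup>2\<bar> / S)"
      using aeW by eventually_elim (rule pw)
  qed
  also have "\<dots> = Lq * (\<integral>x. \<integral>Z. \<bar>W x Z\<bar> \<partial>gauss_seq \<partial>mu) + Lq * ((\<integral>x. \<bar>s2 x - S\<^sup>2\<bar> \<partial>mu) / S)"
    using iW s2i by simp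
  also have "(\<integral>x. \<integral>Z. \<bar>W x Z\<bar> \<partial>gauss_seq \<partial>mu) = (\<integral>w. \<bar>W (fst w) (snd w)\<bar> \<partial>?MG)"
    using MG.integral_fst'[OF Wai] by simp
  also have "Lq * (\<integral>w. \<bar>W (fst w) (snd w)\<bar> \<partial>?MG) + Lq * ((\<integral>x. \<bar>s2 x - S\<^sup>2\<bar> \<partial>mu) / S)
     \<le> Lq * (sqrt ?n * (L * \<sigma>\<^sup>2) + \<bar>?n * EV \<sigma> + S\<^sup>2 / 2\<bar>)
      + Lq * ((sqrt ?n * (\<sigma>\<^sup>2 * sqrt ?g4) + \<bar>?n * \<sigma>\<^sup>2 * I - S\<^sup>2\<bar>) / S)"
    using S by (intro add_mono mult_left_mono W1 divide_right_mono s2b Lq0) auto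
  also have "\<dots> = Lq * approx_err S (card A) \<sigma>" by (simp only: approx_err_def distrib_left)
  finally show ?thesis .
qed

end

section \<open>Conditional drift and variance\<close>

lemma indicator_leI: "(r \<in> A \<Longrightarrow> 1 \<le> c) \<Longrightarrow> 0 \<le> c \<Longrightarrow> indicator A r \<le> (c :: real)"
  by (cases "r \<in> A") simp_all

lemma card_subsets_containing_0:
  assumes "1 \<le> k" "k \<le> d"
  shows "real (card {A. A \<subseteq> {..<d} \<and> card A = k \<and> 0 \<in> A}) / real (card {A. A \<subseteq> {..<d} \<and> card A = k}) = real k / real d"
proof -
  obtain k' d' where kd: "k = Suc k'" "d = Suc d'" using assms by (metis Suc_le_D One_nat_def order_trans)
  have "bij_betw (insert 0) {B. B \<subseteq> {1..<d} \<and> card B = k'} {A. A \<subseteq> {..<d} \<and> card A = k \<and> 0 \<in> A}"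
  proof (rule bij_betwI[where g="\<lambda>A. A - {0}"])
    show "insert 0 \<in> {B. B \<subseteq> {1..<d} \<and> card B = k'} \<rightarrow> {A. A \<subseteq> {..<d} \<and> card A = k \<and> 0 \<in> A}"
    proof
      fix B assume "B \<in> {B. B \<subseteq> {1..<d} \<and> card B = k'}"
      then have "B \<subseteq> {1..<d}" "card B = k'" "finite B" "0 \<notin> B" by (auto intro: finite_subset)
      then show "insert 0 B \<in> {A. A \<subseteq> {..<d} \<and> card A = k \<and> 0 \<in> A}" by (auto simp: kd)
    qed
    show "(\<lambda>A. A - {0}) \<in> {A. A \<subseteq> {..<d} \<and> card A = k \<and> 0 \<in> A} \<rightarrow> {B. B \<subseteq> {1..<d} \<and> card B = k'}"
    proof
      fix A assume "A \<in> {A. A \<subseteq> {..<d} \<and> card A = k \<and> 0 \<in> A}"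
      then have A: "A \<subseteq> {..<d}" "card A = k" "finite A" "0 \<in> A" by (auto intro: finite_subset)
      have "A - {0} \<subseteq> {1..<d}"
      proof
        fix i assume "i \<in> A - {0}"
        then have "i < d" "i \<noteq> 0" using A(1) by auto
        then show "i \<in> {1..<d}" by simp
      qed
      then show "A - {0} \<in> {B. B \<subseteq> {1..<d} \<and> card B = k'}" using A by (simp add: kd card_Diff_singleton)
    qed
  qed auto
  then have "card {A. A \<subseteq> {..<d} \<and> card A = k \<and> 0 \<in> A} = card {B. B \<subseteq> {1..<d} \<and> card B = k'}"
    by (simp add: bij_betw_same_card)
  also have "\<dots> = d' choose k'" by (simp add: n_subsets kd)
  finally have c1: "card {A. A \<subseteq> {..<d} \<and> card A = k \<and> 0 \<in> A} = d' choose k'" .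
  have c2: "card {A. A \<subseteq> {..<d} \<and> card A = k} = d choose k" by (simp add: n_subsets)
  have "k * (d choose k) = d * (d' choose k')" unfolding kd by (rule Suc_times_binomial_eq[symmetric, simplified mult.commute])
  then have "real k * real (d choose k) = real d * real (d' choose k')" by (metis of_nat_mult)
  moreover have "0 < d choose k" "0 < d" using assms by auto
  ultimately show ?thesis unfolding c1 c2 by (simp add: field_simps)
qed

context target
begin

section \<open>Mean and second moment of a move of coordinate 0\<close>

abbreviation M3 :: real where "M3 \<equiv> (\<integral>z. \<bar>z\<bar>^3 \<partial>gauss)"

definition incr :: "real \<Rightarrow> real \<Rightarrow> real \<Rightarrow> real" where "incr \<sigma> a z = G (a + \<sigma> * z) - G a"

text \<open>Here \<open>A\<close> holds the moved coordinates other than 0, so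
  \<open>incr + rsum\<close> is the full log ratio. Given that coordinate 0 is selected, its
  increment has mean \<open>\<sigma> * Bq\<close> and second moment
  \<open>\<sigma>\<^sup>2 * Vq\<close>.\<close>

definition Vq :: "real \<Rightarrow> nat set \<Rightarrow> (nat \<Rightarrow> real) \<Rightarrow> real" where
  "Vq \<sigma> A x = (\<integral>Z. (Z 0)\<^sup>2 * acc (incr \<sigma> (x 0) (Z 0) + rsum \<sigma> A x Z) \<partial>gauss_seq)"
definition Bq :: "real \<Rightarrow> nat set \<Rightarrow> (nat \<Rightarrow> real) \<Rightarrow> real" where
  "Bq \<sigma> A x = (\<integral>Z. Z 0 * acc (incr \<sigma> (x 0) (Z 0) + rsum \<sigma> A x Z) \<partial>gauss_seq)"

lemma incr_eq: "incr \<sigma> a z = \<sigma> * z * g1 a + rem a (\<sigma> * z)"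
  by (simp add: incr_def rem_def)

lemma integral_coord:
  fixes p :: "real \<Rightarrow> real"
  assumes "integrable gauss p"
  shows "integrable gauss_seq (\<lambda>Z. p (Z j))" "(\<integral>Z. p (Z j) \<partial>gauss_seq) = (\<integral>z. p z \<partial>gauss)"
proof -
  have "p \<in> borel_measurable gauss" using assms by (rule borel_measurable_integrable)
  from coord_indep_seq[OF std_normal.prob_space_axioms this assms, of "\<lambda>_. 1" 1 j]
  show "integrable gauss_seq (\<lambda>Z. p (Z j))" "(\<integral>Z. p (Z j) \<partial>gauss_seq) = (\<integral>z. p z \<partial>gauss)"
    using gauss_seq.prob_space by simp_all
qed

lemma rsum_upd: "0 \<notin> A \<Longrightarrow> rsum \<sigma> A x (Z(0 := b)) = rsum \<sigma> A x Z" "0 \<notin> A \<Longrightarrow> rsum \<sigma> A (x(0 := b)) Z = rsum \<sigma> A x Z"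
  unfolding rsum_def by (auto intro!: sum.cong)

lemma rsum_meas_Z[measurable]: "(\<lambda>Z. rsum \<sigma> A x Z) \<in> borel_measurable gauss_seq"
  by (rule rsum_measurable) (auto simp: space_mu)

lemma coord_meas_Z[measurable]: "(\<lambda>Z. Z i) \<in> borel_measurable gauss_seq"
  by (rule measurable_seq_component) simp

lemma coord_meas_x[measurable]: "(\<lambda>x. x i) \<in> borel_measurable mu"
  by (rule measurable_mu_component) simp

lemma incr_meas[measurable]: "(\<lambda>z. incr \<sigma> a z) \<in> borel_measurable borel"
  unfolding incr_def[abs_def] by measurable

lemma integral_coord0_rsum:
  fixes p q :: "real \<Rightarrow> real"
  assumes A: "0 \<notin> A" and p: "integrable gauss p"
    and q[measurable]: "q \<in> borel_measurable borel" and K: "\<And>r. \<bar>q r\<bar> \<le> K"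
  shows "integrable gauss_seq (\<lambda>Z. p (Z 0) * q (rsum \<sigma> A x Z))"
    "(\<integral>Z. p (Z 0) * q (rsum \<sigma> A x Z) \<partial>gauss_seq) = (\<integral>z. p z \<partial>gauss) * (\<integral>Z. q (rsum \<sigma> A x Z) \<partial>gauss_seq)"
proof -
  have "(\<lambda>Z. q (rsum \<sigma> A x Z)) \<in> borel_measurable gauss_seq" by measurable
  from coord_indep_seq[OF std_normal.prob_space_axioms borel_measurable_integrable[OF p] p this K rsum_upd(1)[OF A, THEN arg_cong[where f=q]]]
  show "integrable gauss_seq (\<lambda>Z. p (Z 0) * q (rsum \<sigma> A x Z))"
    "(\<integral>Z. p (Z 0) * q (rsum \<sigma> A x Z) \<partial>gauss_seq) = (\<integral>z. p z \<partial>gauss) * (\<integral>Z. q (rsum \<sigma> A x Z) \<partial>gauss_seq)"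
    by auto
qed

lemma integrable_coord0_acc:
  fixes p :: "real \<Rightarrow> real"
  assumes p: "integrable gauss p"
  shows "integrable gauss_seq (\<lambda>Z. p (Z 0) * acc (incr \<sigma> (x 0) (Z 0) + rsum \<sigma> A x Z))"
proof (rule Bochner_Integration.integrable_bound[OF integral_coord(1)[OF p]])
  have [measurable]: "p \<in> borel_measurable borel" using borel_measurable_integrable[OF p] by simp
  show "(\<lambda>Z. p (Z 0) * acc (incr \<sigma> (x 0) (Z 0) + rsum \<sigma> A x Z)) \<in> borel_measurable gauss_seq" by measurable
  show "AE Z in gauss_seq. norm (p (Z 0) * acc (incr \<sigma> (x 0) (Z 0) + rsum \<sigma> A x Z)) \<le> norm (p (Z 0))"
    using acc_bounds by (simp add: abs_mult mult_left_le)
qed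

lemma abs_incr_le: "\<bar>incr \<sigma> a z\<bar> \<le> \<bar>\<sigma>\<bar> * \<bar>g1 a\<bar> * \<bar>z\<bar> + L / 2 * \<sigma>\<^sup>2 * z\<^sup>2"
proof -
  have "\<bar>incr \<sigma> a z\<bar> \<le> \<bar>\<sigma> * z * g1 a\<bar> + \<bar>rem a (\<sigma> * z)\<bar>" unfolding incr_eq by (rule abs_triangle_ineq)
  also have "\<dots> \<le> \<bar>\<sigma>\<bar> * \<bar>g1 a\<bar> * \<bar>z\<bar> + L / 2 * (\<sigma> * z)\<^sup>2" by (intro add_mono rem_bound) (simp add: abs_mult)
  finally show ?thesis by (simp add: power_mult_distrib)
qed

lemma abs_pow_integrals:
  "integrable gauss (\<lambda>z. \<bar>z\<bar>^3)" "integrable gauss (\<lambda>z. \<bar>z\<bar>)"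
  using integrable_std_normal_abs_moment[of 3] integrable_std_normal_abs_moment[of 1] by simp_all

text \<open>To leading order coordinate 0 does not influence acceptance: dropping
  \<open>incr\<close> costs its size by the Lipschitz bound, and then \<open>Z 0\<close>, of mean
  square 1, is independent of \<open>rsum\<close>.\<close>

lemma Vq_pointwise:
  assumes A: "0 \<notin> A" and \<sigma>: "0 < \<sigma>"
  shows "\<bar>Vq \<sigma> A x - (\<integral>Z. acc (rsum \<sigma> A x Z) \<partial>gauss_seq)\<bar> \<le> \<sigma> * M3 * \<bar>g1 (x 0)\<bar> + 2 * L * \<sigma>\<^sup>2"
proof -
  let ?p = "\<lambda>z. \<sigma> * \<bar>g1 (x 0)\<bar> * \<bar>z\<bar>^3 + L / 2 * \<sigma>\<^sup>2 * z^4"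
  have p: "integrable gauss ?p"
    by (intro Bochner_Integration.integrable_add integrable_mult_right abs_pow_integrals std_normal_fourth)
  note r = integral_coord0_rsum[OF A std_normal_moments(4) acc_measurable(1) acc_bounds(3), of \<sigma> x]
  have "(\<integral>Z. acc (rsum \<sigma> A x Z) \<partial>gauss_seq) = (\<integral>Z. (Z 0)\<^sup>2 * acc (rsum \<sigma> A x Z) \<partial>gauss_seq)"
    using r(2) std_normal_moments(2) by simp
  then have "\<bar>Vq \<sigma> A x - (\<integral>Z. acc (rsum \<sigma> A x Z) \<partial>gauss_seq)\<bar>
    = \<bar>Vq \<sigma> A x - (\<integral>Z. (Z 0)\<^sup>2 * acc (rsum \<sigma> A x Z) \<partial>gauss_seq)\<bar>" by simp
  also have "\<dots> \<le> (\<integral>Z. ?p (Z 0) \<partial>gauss_seq)"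
    unfolding Vq_def
  proof (rule gauss_seq.abs_integral_diff_le[OF integrable_coord0_acc[OF std_normal_moments(4)] r(1) integral_coord(1)[OF p]])
    fix Z :: "nat \<Rightarrow> real"
    have "\<bar>(Z 0)\<^sup>2 * acc (incr \<sigma> (x 0) (Z 0) + rsum \<sigma> A x Z) - (Z 0)\<^sup>2 * acc (rsum \<sigma> A x Z)\<bar>
      = (Z 0)\<^sup>2 * \<bar>acc (incr \<sigma> (x 0) (Z 0) + rsum \<sigma> A x Z) - acc (rsum \<sigma> A x Z)\<bar>"
      by (simp only: right_diff_distrib[symmetric] abs_mult abs_power2)
    also have "\<dots> \<le> (Z 0)\<^sup>2 * \<bar>incr \<sigma> (x 0) (Z 0)\<bar>"
      by (intro mult_left_mono order_trans[OF acc_lipschitz]) auto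
    also have "\<dots> \<le> (Z 0)\<^sup>2 * (\<bar>\<sigma>\<bar> * \<bar>g1 (x 0)\<bar> * \<bar>Z 0\<bar> + L / 2 * \<sigma>\<^sup>2 * (Z 0)\<^sup>2)"
      by (intro mult_left_mono abs_incr_le) auto
    also have "\<dots> = ?p (Z 0)"
    proof -
      have "(Z 0)\<^sup>2 * \<bar>Z 0\<bar> = \<bar>Z 0\<bar>^3" "(Z 0)\<^sup>2 * (Z 0)\<^sup>2 = Z 0 ^ 4"
        by (simp_all add: power2_eq_square power3_eq_cube power4_eq_xxxx abs_mult_self_eq flip: abs_mult)
      then show ?thesis using \<sigma> by (simp add: algebra_simps)
    qed
    finally show "\<bar>(Z 0)\<^sup>2 * acc (incr \<sigma> (x 0) (Z 0) + rsum \<sigma> A x Z) - (Z 0)\<^sup>2 * acc (rsum \<sigma> A x Z)\<bar> \<le> ?p (Z 0)" .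
  qed
  also have "\<dots> = \<sigma> * \<bar>g1 (x 0)\<bar> * M3 + L / 2 * \<sigma>\<^sup>2 * 3"
    unfolding integral_coord(2)[OF p] using abs_pow_integrals std_normal_fourth by simp
  also have "\<dots> \<le> \<sigma> * M3 * \<bar>g1 (x 0)\<bar> + 2 * L * \<sigma>\<^sup>2" using L_nonneg by (simp add: mult_right_mono)
  finally show ?thesis .
qed

lemma incr_rsum_meas:
  "(\<lambda>w. acc (incr \<sigma> (fst w 0) (snd w 0) + rsum \<sigma> A (fst w) (snd w))) \<in> borel_measurable (mu \<Otimes>\<^sub>M gauss_seq)"
proof -
  have [measurable]: "(\<lambda>w. fst w i) \<in> borel_measurable (mu \<Otimes>\<^sub>M gauss_seq)" "(\<lambda>w. snd w i) \<in> borel_measurable (mu \<Otimes>\<^sub>M gauss_seq)" for i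
    by (rule measurable_mu_component measurable_seq_component; simp)+
  have [measurable]: "(\<lambda>w. rsum \<sigma> A (fst w) (snd w)) \<in> borel_measurable (mu \<Otimes>\<^sub>M gauss_seq)"
    by (rule rsum_measurable) auto
  show ?thesis unfolding incr_def by measurable
qed

lemma Vq_Bq_measurable[measurable]: "Vq \<sigma> A \<in> borel_measurable mu" "Bq \<sigma> A \<in> borel_measurable mu"
proof -
  have [measurable]: "(\<lambda>w. snd w i) \<in> borel_measurable (mu \<Otimes>\<^sub>M gauss_seq)" for i
    by (rule measurable_seq_component) simp
  note [measurable] = incr_rsum_meas[of \<sigma> A]
  show "Vq \<sigma> A \<in> borel_measurable mu" "Bq \<sigma> A \<in> borel_measurable mu"
    unfolding Vq_def[abs_def] Bq_def[abs_def]
    by (rule gauss_seq.borel_measurable_lebesgue_integral; simp add: split_beta')+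
qed

lemma rsum_int_measurable:
  fixes q :: "real \<Rightarrow> real"
  assumes [measurable]: "q \<in> borel_measurable borel"
  shows "(\<lambda>x. \<integral>Z. q (rsum \<sigma> A x Z) \<partial>gauss_seq) \<in> borel_measurable mu"
proof -
  have [measurable]: "(\<lambda>w. rsum \<sigma> A (fst w) (snd w)) \<in> borel_measurable (mu \<Otimes>\<^sub>M gauss_seq)"
    by (rule rsum_measurable) auto
  show ?thesis by (rule gauss_seq.borel_measurable_lebesgue_integral) (simp add: split_beta')
qed

lemma Vq_Bq_bounds: "\<bar>Vq \<sigma> A x\<bar> \<le> 1" "\<bar>Bq \<sigma> A x\<bar> \<le> 1"
proof -
  have *: "\<bar>\<integral>Z. p (Z 0) * acc (incr \<sigma> (x 0) (Z 0) + rsum \<sigma> A x Z) \<partial>gauss_seq\<bar> \<le> (\<integral>z. \<bar>p z\<bar> \<partial>gauss)"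
    if p: "integrable gauss p" for p :: "real \<Rightarrow> real"
  proof -
    have "\<bar>\<integral>Z. p (Z 0) * acc (incr \<sigma> (x 0) (Z 0) + rsum \<sigma> A x Z) \<partial>gauss_seq\<bar>
      \<le> (\<integral>Z. \<bar>p (Z 0) * acc (incr \<sigma> (x 0) (Z 0) + rsum \<sigma> A x Z)\<bar> \<partial>gauss_seq)" by (rule integral_abs_bound)
    also have "\<dots> \<le> (\<integral>Z. \<bar>p (Z 0)\<bar> \<partial>gauss_seq)"
      by (rule integral_mono[OF integrable_abs[OF integrable_coord0_acc[OF p]] integrable_abs[OF integral_coord(1)[OF p]]])
        (simp add: abs_mult acc_bounds mult_left_le)
    also have "\<dots> = (\<integral>z. \<bar>p z\<bar> \<partial>gauss)" using p by (intro integral_coord(2)) simp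
    finally show ?thesis .
  qed
  show "\<bar>Vq \<sigma> A x\<bar> \<le> 1" using *[OF std_normal_moments(4)] std_normal_moments(2) by (simp add: Vq_def)
  show "\<bar>Bq \<sigma> A x\<bar> \<le> 1" using *[OF std_normal_moments(3)] std_normal_moments(5) by (simp add: Bq_def)
qed

lemma integral_mu_coord0:
  fixes p :: "real \<Rightarrow> real"
  assumes "integrable fm p"
  shows "integrable mu (\<lambda>x. p (x 0))" "(\<integral>x. p (x 0) \<partial>mu) = (\<integral>a. p a \<partial>fm)"
proof -
  have "p \<in> borel_measurable fm" using assms by (rule borel_measurable_integrable)
  from coord_indep_seq[OF prob_fm this assms, of "\<lambda>_. 1" 1 0]
  show "integrable mu (\<lambda>x. p (x 0))" "(\<integral>x. p (x 0) \<partial>mu) = (\<integral>a. p a \<partial>fm)"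
    using mu.prob_space by simp_all
qed

lemma integrable_abs_g1: "integrable fm (\<lambda>a. \<bar>g1 a\<bar>)" using integrable_g1(1) by simp

abbreviation M1 :: real where "M1 \<equiv> (\<integral>a. \<bar>g1 a\<bar> \<partial>fm)"

lemma M1_nonneg: "0 \<le> M1" by (rule Bochner_Integration.integral_nonneg) simp

lemma V_est:
  assumes A: "0 \<notin> A" "finite A" and \<sigma>: "0 < \<sigma>" and S: "0 < S"
  shows "(\<integral>x. \<bar>Vq \<sigma> A x - 2 * Phi (- S / 2)\<bar> \<partial>mu) \<le> approx_err S (card A) \<sigma> + \<sigma> * M3 * M1 + 2 * L * \<sigma>\<^sup>2"
proof -
  let ?R = "\<lambda>x. \<integral>Z. acc (rsum \<sigma> A x Z) \<partial>gauss_seq" and ?a = "2 * Phi (- S / 2)"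
  note [measurable] = rsum_int_measurable[OF acc_measurable(1), of \<sigma> A]
  have a: "\<bar>?a\<bar> \<le> 1"
    unfolding integral_acc[OF S, symmetric] by (rule std_normal.abs_integral_le) (rule acc_bounds)
  have Rb: "\<bar>?R x\<bar> \<le> 1" for x by (rule gauss_seq.abs_integral_le) (rule acc_bounds)
  have iR: "integrable mu (\<lambda>x. \<bar>?R x - ?a\<bar>)"
  proof (rule mu.integrable_const_bound[where B=2])
    have "\<bar>?R x - ?a\<bar> \<le> 2" for x using Rb[of x] a by linarith
    then show "AE x in mu. norm \<bar>?R x - ?a\<bar> \<le> 2" by simp
  qed measurable
  have iV: "integrable mu (\<lambda>x. \<bar>Vq \<sigma> A x - ?a\<bar>)"
  proof (rule mu.integrable_const_bound[where B=2])
    have "\<bar>Vq \<sigma> A x - ?a\<bar> \<le> 2" for x using Vq_Bq_bounds(1)[of \<sigma> A x] a by linarith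
    then show "AE x in mu. norm \<bar>Vq \<sigma> A x - ?a\<bar> \<le> 2" by simp
  qed measurable
  have ig: "integrable mu (\<lambda>x. \<bar>g1 (x 0)\<bar>)" by (rule integral_mu_coord0(1)[OF integrable_abs_g1])
  have "(\<integral>x. \<bar>Vq \<sigma> A x - ?a\<bar> \<partial>mu) \<le> (\<integral>x. \<bar>?R x - ?a\<bar> + (\<sigma> * M3 * \<bar>g1 (x 0)\<bar> + 2 * L * \<sigma>\<^sup>2) \<partial>mu)"
  proof (rule integral_mono[OF iV])
    show "integrable mu (\<lambda>x. \<bar>?R x - ?a\<bar> + (\<sigma> * M3 * \<bar>g1 (x 0)\<bar> + 2 * L * \<sigma>\<^sup>2))"
      by (intro Bochner_Integration.integrable_add iR integrable_mult_right ig mu.integrable_const)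
    fix x show "\<bar>Vq \<sigma> A x - ?a\<bar> \<le> \<bar>?R x - ?a\<bar> + (\<sigma> * M3 * \<bar>g1 (x 0)\<bar> + 2 * L * \<sigma>\<^sup>2)"
      using Vq_pointwise[OF A(1) \<sigma>, of x] by linarith
  qed
  also have "\<dots> = (\<integral>x. \<bar>?R x - ?a\<bar> \<partial>mu) + (\<sigma> * M3 * M1 + 2 * L * \<sigma>\<^sup>2)"
    using iR ig mu.prob_space integral_mu_coord0(2)[OF integrable_abs_g1] by simp
  also have "(\<integral>x. \<bar>?R x - ?a\<bar> \<partial>mu) \<le> 1 * approx_err S (card A) \<sigma>"
    unfolding integral_acc[OF S, symmetric]
    by (rule gauss_approx[OF acc_measurable(1) acc_bounds(3) _ S A(2)]) (use acc_lipschitz in simp)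
  finally show ?thesis by simp
qed

text \<open>The term of order 0 vanishes since \<open>Z 0\<close> is centered and independent of
  \<open>rsum\<close>, so \<open>acc\<close> must be linearized in \<open>incr\<close>, which is
  \<open>\<sigma> * Z 0 * g1 (x 0)\<close> up to second order. A second factor \<open>Z 0\<close>
  then has mean square 1. The bump measures how often \<open>rsum\<close> comes close to the
  kink.\<close>

lemma Bq_pointwise:
  assumes A: "0 \<notin> A" and \<sigma>: "0 < \<sigma>" and \<eta>: "0 < \<eta>"
  shows "\<bar>Bq \<sigma> A x - \<sigma> * g1 (x 0) * (\<integral>Z. acc' (rsum \<sigma> A x Z) \<partial>gauss_seq)\<bar>
    \<le> \<sigma>\<^sup>2 * M3 * (L / 2 + (g1 (x 0))\<^sup>2 * (1 + 2 / \<eta>)) + 2 * \<sigma> * \<bar>g1 (x 0)\<bar> * (\<integral>Z. bump \<eta> (rsum \<sigma> A x Z) \<partial>gauss_seq)"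
proof -
  let ?g = "g1 (x 0)" and ?R = "\<lambda>Z. rsum \<sigma> A x Z"
  let ?p = "\<lambda>z. \<sigma>\<^sup>2 * (L / 2 + ?g\<^sup>2 * (1 + 2 / \<eta>)) * \<bar>z\<bar>^3"
  let ?q = "\<lambda>Z. (2 * \<sigma> * \<bar>?g\<bar> * (Z 0)\<^sup>2) * bump \<eta> (?R Z)"
  have p: "integrable gauss ?p" by (intro integrable_mult_right abs_pow_integrals)
  have z2: "integrable gauss (\<lambda>z. 2 * \<sigma> * \<bar>?g\<bar> * z\<^sup>2)" by (intro integrable_mult_right std_normal_moments)
  note q = integral_coord0_rsum[OF A z2 bump_measurable(1) bump_props(2)[OF \<eta>], of \<sigma> x]
  note r1 = integral_coord0_rsum[OF A std_normal_moments(3) acc_measurable(1) acc_bounds(3), of \<sigma> x]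
  have z2': "integrable gauss (\<lambda>z. \<sigma> * ?g * z\<^sup>2)" by (intro integrable_mult_right std_normal_moments)
  note r2 = integral_coord0_rsum[OF A z2' acc_measurable(2) acc_bounds(6), of \<sigma> x]
  have "\<sigma> * ?g * (\<integral>Z. acc' (?R Z) \<partial>gauss_seq)
    = (\<integral>Z. Z 0 * acc (?R Z) \<partial>gauss_seq) + (\<integral>Z. (\<sigma> * ?g * (Z 0)\<^sup>2) * acc' (?R Z) \<partial>gauss_seq)"
    using r1(2) r2(2) std_normal_moments by simp
  also have "\<dots> = (\<integral>Z. Z 0 * acc (?R Z) + (\<sigma> * ?g * (Z 0)\<^sup>2) * acc' (?R Z) \<partial>gauss_seq)"
    by (rule Bochner_Integration.integral_add[OF r1(1) r2(1), symmetric])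
  finally have eq: "\<sigma> * ?g * (\<integral>Z. acc' (?R Z) \<partial>gauss_seq)
    = (\<integral>Z. Z 0 * acc (?R Z) + (\<sigma> * ?g * (Z 0)\<^sup>2) * acc' (?R Z) \<partial>gauss_seq)" .
  have "\<bar>Bq \<sigma> A x - (\<integral>Z. Z 0 * acc (?R Z) + (\<sigma> * ?g * (Z 0)\<^sup>2) * acc' (?R Z) \<partial>gauss_seq)\<bar>
    \<le> (\<integral>Z. ?p (Z 0) + ?q Z \<partial>gauss_seq)"
    unfolding Bq_def
  proof (rule gauss_seq.abs_integral_diff_le[OF integrable_coord0_acc[OF std_normal_moments(3)]
        Bochner_Integration.integrable_add[OF r1(1) r2(1)] Bochner_Integration.integrable_add[OF integral_coord(1)[OF p] q(1)]])
    fix Z :: "nat \<Rightarrow> real"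
    let ?z = "Z 0" and ?e = "\<sigma> * Z 0 * ?g"
    let ?b = "bump \<eta> (?R Z)"
    have t1: "\<bar>acc (incr \<sigma> (x 0) ?z + ?R Z) - acc (?R Z + ?e)\<bar> \<le> L / 2 * (\<sigma> * ?z)\<^sup>2"
      by (rule order_trans[OF acc_lipschitz]) (use rem_bound[of "x 0" "\<sigma> * ?z"] in \<open>simp add: incr_eq\<close>)
    have t2: "\<bar>acc (?R Z + ?e) - acc (?R Z) - ?e * acc' (?R Z)\<bar> \<le> ?e\<^sup>2 + 2 * \<bar>?e\<bar> * (?b + \<bar>?e\<bar> / \<eta>)"
    proof (rule order_trans[OF acc_expansion], intro add_left_mono mult_left_mono)
      have e0: "0 \<le> \<bar>?e\<bar> / \<eta>" "0 \<le> ?b" using \<eta> bump_props(1)[OF \<eta>] by simp_all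
      \<comment> \<open>Within distance |e| of the kink, either \<open>rsum\<close> is at most eta
        in size and the bump is at least 1, or |e| exceeds eta and |e| / eta is at least 1.\<close>
      show "indicator {-\<bar>?e\<bar>..\<bar>?e\<bar>} (?R Z) \<le> ?b + \<bar>?e\<bar> / \<eta>"
      proof (rule indicator_leI)
        assume "?R Z \<in> {-\<bar>?e\<bar>..\<bar>?e\<bar>}"
        then have le: "\<bar>?R Z\<bar> \<le> \<bar>?e\<bar>" by (simp only: atLeastAtMost_iff) linarith
        show "1 \<le> ?b + \<bar>?e\<bar> / \<eta>"
        proof (cases "\<bar>?R Z\<bar> \<le> \<eta>")
          case True
          then show ?thesis using bump_props(3)[OF \<eta>, of "?R Z"] e0 by linarith
        next
          case False
          then have "1 \<le> \<bar>?e\<bar> / \<eta>" using le \<eta> by (simp only: le_divide_eq) simp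
          then show ?thesis using e0 by linarith
        qed
      qed (use e0 in linarith)
    qed simp
    have "?z * acc (incr \<sigma> (x 0) ?z + ?R Z) - (?z * acc (?R Z) + (\<sigma> * ?g * ?z\<^sup>2) * acc' (?R Z))
      = ?z * ((acc (incr \<sigma> (x 0) ?z + ?R Z) - acc (?R Z + ?e)) + (acc (?R Z + ?e) - acc (?R Z) - ?e * acc' (?R Z)))"
      by (simp add: algebra_simps power2_eq_square)
    then have "\<bar>?z * acc (incr \<sigma> (x 0) ?z + ?R Z) - (?z * acc (?R Z) + (\<sigma> * ?g * ?z\<^sup>2) * acc' (?R Z))\<bar>
      = \<bar>?z\<bar> * \<bar>(acc (incr \<sigma> (x 0) ?z + ?R Z) - acc (?R Z + ?e)) + (acc (?R Z + ?e) - acc (?R Z) - ?e * acc' (?R Z))\<bar>"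
      by (simp only: abs_mult)
    also have "\<dots> \<le> \<bar>?z\<bar> * (L / 2 * (\<sigma> * ?z)\<^sup>2 + (?e\<^sup>2 + 2 * \<bar>?e\<bar> * (?b + \<bar>?e\<bar> / \<eta>)))"
      by (intro mult_left_mono order_trans[OF abs_triangle_ineq] add_mono t1 t2) auto
    also have "\<dots> = ?p ?z + ?q Z"
    proof -
      have z: "?z\<^sup>2 = \<bar>?z\<bar> * \<bar>?z\<bar>" "?g\<^sup>2 = \<bar>?g\<bar> * \<bar>?g\<bar>" "\<bar>?z\<bar>^3 = \<bar>?z\<bar> * \<bar>?z\<bar> * \<bar>?z\<bar>" "\<bar>\<sigma>\<bar> = \<sigma>"
        using \<sigma> by (simp_all add: power2_eq_square power3_eq_cube)
      show ?thesis unfolding power_mult_distrib abs_mult z using \<eta>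
        by (simp add: field_simps power2_eq_square[of \<sigma>] z(4))
    qed
    finally show "\<bar>?z * acc (incr \<sigma> (x 0) ?z + ?R Z) - (?z * acc (?R Z) + (\<sigma> * ?g * ?z\<^sup>2) * acc' (?R Z))\<bar> \<le> ?p ?z + ?q Z" .
  qed
  also have "\<dots> = (\<integral>Z. ?p (Z 0) \<partial>gauss_seq) + (\<integral>Z. ?q Z \<partial>gauss_seq)"
    by (rule Bochner_Integration.integral_add[OF integral_coord(1)[OF p] q(1)])
  also have "(\<integral>Z. ?q Z \<partial>gauss_seq) = 2 * \<sigma> * \<bar>?g\<bar> * (\<integral>Z. bump \<eta> (?R Z) \<partial>gauss_seq)"
    using q(2) std_normal_moments(2) by simp
  also have "(\<integral>Z. ?p (Z 0) \<partial>gauss_seq) = \<sigma>\<^sup>2 * M3 * (L / 2 + ?g\<^sup>2 * (1 + 2 / \<eta>))"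
    unfolding integral_coord(2)[OF p] by (simp add: mult_ac)
  finally show ?thesis unfolding eq[symmetric] .
qed

text \<open>\<open>gauss_approx\<close> asks for Lipschitz functions, so it is applied to
  \<open>acc'_lip\<close> and \<open>bump\<close> instead of the discontinuous \<open>acc'\<close>.
  The errors \<open>D1\<close> and \<open>D2\<close> do not depend on coordinate 0, so their
  products with |g'(x_0)| have factorizing means; this avoids a Cauchy-Schwarz loss.\<close>

lemma B_est:
  assumes A: "0 \<notin> A" "finite A" and \<sigma>: "0 < \<sigma>" and S: "0 < S" and \<eta>: "0 < \<eta>"
  shows "(\<integral>x. \<bar>Bq \<sigma> A x - \<sigma> * g1 (x 0) * Phi (- S / 2)\<bar> \<partial>mu)
    \<le> \<sigma>\<^sup>2 * M3 * (L / 2 + I * (1 + 2 / \<eta>)) + \<sigma> * M1 * ((1 + 4 / \<eta>) * approx_err S (card A) \<sigma> + 32 * \<eta> / S)"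
proof -
  let ?N = "\<lambda>q :: real \<Rightarrow> real. (\<integral>z. q (S * z - S\<^sup>2 / 2) \<partial>gauss)"
  let ?R = "\<lambda>q :: real \<Rightarrow> real. \<lambda>x. (\<integral>Z. q (rsum \<sigma> A x Z) \<partial>gauss_seq)"
  define D1 where "D1 x = \<bar>?R (acc'_lip \<eta>) x - ?N (acc'_lip \<eta>)\<bar>" for x
  define D2 where "D2 x = \<bar>?R (bump \<eta>) x - ?N (bump \<eta>)\<bar>" for x
  note [measurable] = rsum_int_measurable[OF bump_measurable(1)[of \<eta>], of \<sigma> A] rsum_int_measurable[OF bump_measurable(2)[of \<eta>], of \<sigma> A]
  have Rb: "\<bar>?R (acc'_lip \<eta>) x\<bar> \<le> 1" "\<bar>?R (bump \<eta>) x\<bar> \<le> 2" for x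
    by (rule gauss_seq.abs_integral_le, rule bump_props[OF \<eta>])+
  have Nb: "\<bar>?N (acc'_lip \<eta>)\<bar> \<le> 1" "\<bar>?N (bump \<eta>)\<bar> \<le> 2"
    by (rule std_normal.abs_integral_le, rule bump_props[OF \<eta>])+
  have D_le: "\<bar>D1 x\<bar> \<le> 4" "\<bar>D2 x\<bar> \<le> 4" "0 \<le> D1 x" "0 \<le> D2 x" for x
    using Rb[of x] Nb unfolding D1_def D2_def by linarith+
  have D_meas[measurable]: "D1 \<in> borel_measurable mu" "D2 \<in> borel_measurable mu"
    unfolding D1_def[abs_def] D2_def[abs_def] by measurable
  have D_upd: "D1 (x(0 := b)) = D1 x" "D2 (x(0 := b)) = D2 x" for x b
    by (simp_all add: D1_def D2_def rsum_upd(2)[OF A(1)])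
  have D_int: "(\<integral>x. D1 x \<partial>mu) \<le> (1 + 1 / \<eta>) * approx_err S (card A) \<sigma>" "(\<integral>x. D2 x \<partial>mu) \<le> (1 / \<eta>) * approx_err S (card A) \<sigma>"
    unfolding D1_def D2_def
    by (rule gauss_approx[OF bump_measurable(2) bump_props(6)[OF \<eta>] bump_props(8)[OF \<eta>] S A(2)],
        rule gauss_approx[OF bump_measurable(1) bump_props(2)[OF \<eta>] bump_props(5)[OF \<eta>] S A(2)])
  have gmeas: "(\<lambda>a. \<bar>g1 a\<bar>) \<in> borel_measurable fm" by simp
  note gD1 = coord_indep_seq[OF prob_fm gmeas integrable_abs_g1 D_meas(1) D_le(1) D_upd(1)]
  note gD2 = coord_indep_seq[OF prob_fm gmeas integrable_abs_g1 D_meas(2) D_le(2) D_upd(2)]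
  have Nbump: "0 \<le> ?N (bump \<eta>)" "?N (bump \<eta>) \<le> 8 * \<eta> / S"
    by (auto intro!: Bochner_Integration.integral_nonneg bump_props(1)[OF \<eta>] integral_bump_le \<eta> S)
  have intq: "integrable gauss_seq (\<lambda>Z. q (rsum \<sigma> A x Z))" "integrable gauss (\<lambda>z. q (S * z - S\<^sup>2 / 2))"
    if [measurable]: "q \<in> borel_measurable borel" and "\<And>r. \<bar>q r\<bar> \<le> 2" for q :: "real \<Rightarrow> real" and x
    by (rule gauss_seq.integrable_const_bound[where B=2] std_normal.integrable_const_bound[where B=2]; use that in simp)+
  have b2: "\<bar>acc' r\<bar> \<le> 2" "\<bar>acc'_lip \<eta> r\<bar> \<le> 2" "\<bar>bump \<eta> r\<bar> \<le> 2" for r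
    using acc_bounds(6)[of r] bump_props(2,6)[OF \<eta>, of r] by linarith+
  have acc'_close: "\<bar>?R acc' x - Phi (- S / 2)\<bar> \<le> D1 x + D2 x + 2 * ?N (bump \<eta>)" for x
  proof -
    have "\<bar>?R acc' x - ?R (acc'_lip \<eta>) x\<bar> \<le> ?R (bump \<eta>) x"
      by (rule gauss_seq.abs_integral_diff_le)
        (auto intro!: intq b2 bump_props(7)[OF \<eta>] simp: acc_measurable bump_measurable)
    moreover have "\<bar>?N acc' - ?N (acc'_lip \<eta>)\<bar> \<le> ?N (bump \<eta>)"
      by (rule std_normal.abs_integral_diff_le)
        (auto intro!: intq b2 bump_props(7)[OF \<eta>] simp: acc_measurable bump_measurable)
    ultimately show ?thesis unfolding integral_acc'[OF S, symmetric] D1_def D2_def by linarith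
  qed
  \<comment> \<open>The kink term of \<open>Bq_pointwise\<close> contributes \<open>D2\<close> and 8
    eta / S twice; replacing the mean of \<open>acc'\<close> by its limit adds \<open>D1\<close>,
    \<open>D2\<close> and 16 eta / S. Hence the factors 3 and 32.\<close>
  define W where "W x = \<sigma>\<^sup>2 * M3 * (L / 2 + (g1 (x 0))\<^sup>2 * (1 + 2 / \<eta>))
    + \<sigma> * (\<bar>g1 (x 0)\<bar> * D1 x + 3 * (\<bar>g1 (x 0)\<bar> * D2 x) + 32 * \<eta> / S * \<bar>g1 (x 0)\<bar>)" for x
  have pw: "\<bar>Bq \<sigma> A x - \<sigma> * g1 (x 0) * Phi (- S / 2)\<bar> \<le> W x" for x
  proof -
    let ?g = "\<bar>g1 (x 0)\<bar>"
    have "\<bar>\<sigma> * g1 (x 0) * ?R acc' x - \<sigma> * g1 (x 0) * Phi (- S / 2)\<bar> = \<sigma> * ?g * \<bar>?R acc' x - Phi (- S / 2)\<bar>"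
      using \<sigma> by (simp add: abs_mult flip: right_diff_distrib)
    also have "\<dots> \<le> \<sigma> * ?g * (D1 x + D2 x + 2 * (8 * \<eta> / S))"
      using \<sigma> acc'_close[of x] Nbump(2) by (intro mult_left_mono) auto
    finally have 1: "\<bar>\<sigma> * g1 (x 0) * ?R acc' x - \<sigma> * g1 (x 0) * Phi (- S / 2)\<bar> \<le> \<sigma> * ?g * (D1 x + D2 x + 2 * (8 * \<eta> / S))" .
    have "?R (bump \<eta>) x \<le> D2 x + 8 * \<eta> / S" using Nbump(2) unfolding D2_def by linarith
    then have "2 * \<sigma> * ?g * ?R (bump \<eta>) x \<le> 2 * \<sigma> * ?g * (D2 x + 8 * \<eta> / S)"
      using \<sigma> by (intro mult_left_mono) auto
    then have "\<bar>Bq \<sigma> A x - \<sigma> * g1 (x 0) * Phi (- S / 2)\<bar> \<le> \<sigma>\<^sup>2 * M3 * (L / 2 + (g1 (x 0))\<^sup>2 * (1 + 2 / \<eta>))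
      + 2 * \<sigma> * ?g * (D2 x + 8 * \<eta> / S) + \<sigma> * ?g * (D1 x + D2 x + 2 * (8 * \<eta> / S))"
      using Bq_pointwise[OF A(1) \<sigma> \<eta>, of x] 1 by linarith
    also have "\<dots> = W x" by (simp add: W_def algebra_simps)
    finally show ?thesis .
  qed
  have ig: "integrable mu (\<lambda>x. \<bar>g1 (x 0)\<bar>)" "(\<integral>x. \<bar>g1 (x 0)\<bar> \<partial>mu) = M1"
    by (rule integral_mu_coord0[OF integrable_abs_g1])+
  have ig2: "integrable mu (\<lambda>x. (g1 (x 0))\<^sup>2)" "(\<integral>x. (g1 (x 0))\<^sup>2 \<partial>mu) = I"
    unfolding I_def by (rule integral_mu_coord0[OF integrable_g1(2)])+
  have iW: "integrable mu W" unfolding W_def[abs_def]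
    by (intro Bochner_Integration.integrable_add integrable_mult_right integrable_mult_left mu.integrable_const ig ig2 gD1 gD2)
  have ig0: "integrable mu (\<lambda>x. g1 (x 0))" by (rule integral_mu_coord0[OF integrable_g1(1)])
  have iB: "integrable mu (\<lambda>x. \<bar>Bq \<sigma> A x - \<sigma> * g1 (x 0) * Phi (- S / 2)\<bar>)"
  proof (intro integrable_abs Bochner_Integration.integrable_diff integrable_mult_left integrable_mult_right ig0)
    show "integrable mu (Bq \<sigma> A)" by (rule mu.integrable_const_bound[where B=1]) (use Vq_Bq_bounds in auto)
  qed
  have "(\<integral>x. \<bar>Bq \<sigma> A x - \<sigma> * g1 (x 0) * Phi (- S / 2)\<bar> \<partial>mu) \<le> (\<integral>x. W x \<partial>mu)"
    by (rule integral_mono[OF iB iW pw])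
  also have "\<dots> = \<sigma>\<^sup>2 * M3 * (L / 2 + I * (1 + 2 / \<eta>))
    + \<sigma> * (M1 * (\<integral>x. D1 x \<partial>mu) + 3 * (M1 * (\<integral>x. D2 x \<partial>mu)) + 32 * \<eta> / S * M1)"
    unfolding W_def[abs_def] using ig ig2 gD1 gD2 mu.prob_space by simp
  also have "\<dots> \<le> \<sigma>\<^sup>2 * M3 * (L / 2 + I * (1 + 2 / \<eta>))
    + \<sigma> * (M1 * ((1 + 1 / \<eta>) * approx_err S (card A) \<sigma>) + 3 * (M1 * ((1 / \<eta>) * approx_err S (card A) \<sigma>)) + 32 * \<eta> / S * M1)"
    using \<sigma> M1_nonneg D_int by (intro add_left_mono mult_left_mono add_mono order_refl) auto
  also have "\<dots> = \<sigma>\<^sup>2 * M3 * (L / 2 + I * (1 + 2 / \<eta>)) + \<sigma> * M1 * ((1 + 4 / \<eta>) * approx_err S (card A) \<sigma> + 32 * \<eta> / S)"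
    by (simp add: algebra_simps)
  finally show ?thesis .
qed

text \<open>Since n sigma^2 converges and sigma tends to 0, sqrt n sigma^2 = sqrt (n sigma^2) sigma
  vanishes; the mean of the remainders is settled by \<open>EV_limit\<close>.\<close>

lemma approx_err_limit:
  assumes \<sigma>: "\<sigma> \<longlonglongrightarrow> 0" and pos: "\<And>d. \<sigma> d > 0" and n: "(\<lambda>d. real (n d) * (\<sigma> d)\<^sup>2) \<longlonglongrightarrow> S\<^sup>2 / I" and S: "0 < S"
  shows "(\<lambda>d. approx_err S (n d) (\<sigma> d)) \<longlonglongrightarrow> 0"
proof -
  have sq: "(\<lambda>d. sqrt (real (n d)) * (\<sigma> d)\<^sup>2) \<longlonglongrightarrow> 0"
  proof -
    have "sqrt (real (n d)) * (\<sigma> d)\<^sup>2 = sqrt (real (n d) * (\<sigma> d)\<^sup>2) * \<sigma> d" for d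
      using pos[of d] by (simp add: real_sqrt_mult power2_eq_square)
    moreover have "(\<lambda>d. sqrt (real (n d) * (\<sigma> d)\<^sup>2) * \<sigma> d) \<longlonglongrightarrow> sqrt (S\<^sup>2 / I) * 0"
      by (intro tendsto_intros n \<sigma>)
    ultimately show ?thesis by simp
  qed
  have ev: "(\<lambda>d. real (n d) * EV (\<sigma> d)) \<longlonglongrightarrow> S\<^sup>2 / I * (- I / 2)"
  proof -
    have "real (n d) * EV (\<sigma> d) = real (n d) * (\<sigma> d)\<^sup>2 * (EV (\<sigma> d) / (\<sigma> d)\<^sup>2)" for d
      using pos[of d] by simp
    then show ?thesis using tendsto_mult[OF n EV_limit[OF \<sigma> pos]] by simp
  qed
  have "(\<lambda>d. L * (sqrt (real (n d)) * (\<sigma> d)\<^sup>2) + \<bar>real (n d) * EV (\<sigma> d) + S\<^sup>2 / 2\<bar>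
     + (sqrt (\<integral>x. (g1 x)^4 \<partial>fm) * (sqrt (real (n d)) * (\<sigma> d)\<^sup>2) + \<bar>real (n d) * (\<sigma> d)\<^sup>2 * I - S\<^sup>2\<bar>) / S)
     \<longlonglongrightarrow> L * 0 + \<bar>S\<^sup>2 / I * (- I / 2) + S\<^sup>2 / 2\<bar> + (sqrt (\<integral>x. (g1 x)^4 \<partial>fm) * 0 + \<bar>S\<^sup>2 / I * I - S\<^sup>2\<bar>) / S"
    by (intro tendsto_intros sq ev n) (use S in simp)
  then show ?thesis using I_pos by (simp add: approx_err_def mult_ac)
qed

section \<open>Averaging over the set of moved coordinates\<close>

text \<open>A fraction \<open>k / d\<close> of the subsets contains coordinate 0; the factor c in
  the speed of the diffusion comes from here.\<close>

lemma average_le: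
  fixes h :: "nat set \<Rightarrow> (nat \<Rightarrow> real) \<Rightarrow> real"
  assumes k: "1 \<le> k" "k \<le> d"
    and int: "\<And>A. A \<subseteq> {..<d} \<Longrightarrow> card A = k \<Longrightarrow> 0 \<in> A \<Longrightarrow> integrable mu (\<lambda>x. \<bar>h A x - c x\<bar>)"
    and T: "\<And>A. A \<subseteq> {..<d} \<Longrightarrow> card A = k \<Longrightarrow> 0 \<in> A \<Longrightarrow> (\<integral>x. \<bar>h A x - c x\<bar> \<partial>mu) \<le> T"
  shows "(\<integral>x. \<bar>measure_pmf.expectation (subset_pmf d k) (\<lambda>A. if 0 \<in> A then h A x else 0) - real k / real d * c x\<bar> \<partial>mu)
    \<le> real k / real d * T"
proof -
  let ?A = "{A. A \<subseteq> {..<d} \<and> card A = k}" and ?Az = "{A. A \<subseteq> {..<d} \<and> card A = k \<and> 0 \<in> A}"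
  have fin: "finite ?A" by (rule finite_subsets_card)
  have N: "0 < real (card ?A)" using subsets_card_nonempty[OF k(2)] fin by (simp add: card_gt_0_iff)
  have E: "measure_pmf.expectation (subset_pmf d k) (\<lambda>A. if 0 \<in> A then h A x else 0) = (\<Sum>A\<in>?Az. h A x) / real (card ?A)" for x
  proof -
    have "(\<Sum>A\<in>?A. if 0 \<in> A then h A x else 0) = (\<Sum>A\<in>?Az. h A x)"
      using fin by (simp add: sum.If_cases) (intro sum.cong, auto)
    then show ?thesis by (simp add: integral_pmf_of_set[OF subsets_card_nonempty[OF k(2)] fin])
  qed
  have le: "\<bar>measure_pmf.expectation (subset_pmf d k) (\<lambda>A. if 0 \<in> A then h A x else 0) - real k / real d * c x\<bar>
    \<le> (\<Sum>A\<in>?Az. \<bar>h A x - c x\<bar>) / real (card ?A)" for x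
  proof -
    have "(\<Sum>A\<in>?Az. h A x) / real (card ?A) - real k / real d * c x = (\<Sum>A\<in>?Az. h A x - c x) / real (card ?A)"
      unfolding card_subsets_containing_0[OF k, symmetric] by (simp add: sum_subtractf diff_divide_distrib)
    then show ?thesis unfolding E using N by (simp add: divide_right_mono sum_abs)
  qed
  have i: "integrable mu (\<lambda>x. (\<Sum>A\<in>?Az. \<bar>h A x - c x\<bar>) / real (card ?A))"
    by (intro integrable_divide Bochner_Integration.integrable_sum int) auto
  have "(\<integral>x. \<bar>measure_pmf.expectation (subset_pmf d k) (\<lambda>A. if 0 \<in> A then h A x else 0) - real k / real d * c x\<bar> \<partial>mu)
    \<le> (\<integral>x. (\<Sum>A\<in>?Az. \<bar>h A x - c x\<bar>) / real (card ?A) \<partial>mu)"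
    by (rule integral_mono_AE'[OF i]) (use le in \<open>auto intro!: AE_I2 divide_nonneg_nonneg sum_nonneg\<close>)
  also have "\<dots> = (\<Sum>A\<in>?Az. \<integral>x. \<bar>h A x - c x\<bar> \<partial>mu) / real (card ?A)"
    using int by (simp add: Bochner_Integration.integral_sum)
  also have "\<dots> \<le> (\<Sum>A\<in>?Az. T) / real (card ?A)"
    by (intro divide_right_mono sum_mono T) auto
  also have "\<dots> = real k / real d * T"
    unfolding card_subsets_containing_0[OF k, symmetric] by simp
  finally show ?thesis .
qed

lemma min_ratio_eq:
  assumes "finite A" "0 \<in> A"
  shows "min 1 (ratio \<sigma> A x Z) = acc (incr \<sigma> (x 0) (Z 0) + rsum \<sigma> (A - {0}) x Z)"
proof -
  have "ratio \<sigma> A x Z = (\<Prod>i\<in>A. exp (G (x i + \<sigma> * Z i) - G (x i)))"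
    unfolding ratio_def by (intro prod.cong) (simp_all add: G_def exp_diff f_pos)
  also have "\<dots> = exp (\<Sum>i\<in>A. G (x i + \<sigma> * Z i) - G (x i))" using assms by (simp add: exp_sum)
  also have "(\<Sum>i\<in>A. G (x i + \<sigma> * Z i) - G (x i)) = incr \<sigma> (x 0) (Z 0) + rsum \<sigma> (A - {0}) x Z"
    unfolding incr_def rsum_def using assms by (simp add: sum.remove[of A 0])
  finally show ?thesis by (simp add: acc_def)
qed

definition drift :: "nat \<Rightarrow> nat \<Rightarrow> real \<Rightarrow> (nat \<Rightarrow> real) \<Rightarrow> real" where
  "drift d k \<sigma> x = (\<integral>n. (rwg_step f d \<sigma> x n 0 - x 0) \<partial>step_noise d k)"
definition msq :: "nat \<Rightarrow> nat \<Rightarrow> real \<Rightarrow> (nat \<Rightarrow> real) \<Rightarrow> real" where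
  "msq d k \<sigma> x = (\<integral>n. (rwg_step f d \<sigma> x n 0 - x 0)\<^sup>2 \<partial>step_noise d k)"

lemma drift_msq_eq:
  assumes k: "1 \<le> k" "k \<le> d"
  shows "drift d k \<sigma> x = measure_pmf.expectation (subset_pmf d k) (\<lambda>A. if 0 \<in> A then \<sigma> * Bq \<sigma> (A - {0}) x else 0)"
    and "msq d k \<sigma> x = measure_pmf.expectation (subset_pmf d k) (\<lambda>A. if 0 \<in> A then \<sigma>\<^sup>2 * Vq \<sigma> (A - {0}) x else 0)"
proof -
  let ?p = "measure_pmf (subset_pmf d k)"
  have "drift d k \<sigma> x = (\<integral>A. (if 0 \<in> A then \<integral>Z. (\<sigma> * Z 0) * min 1 (ratio \<sigma> A x Z) \<partial>gauss_seq else 0) \<partial>?p)"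
    unfolding drift_def
  proof (rule integral_step_noise_increment[OF k(2), where \<psi>="\<lambda>z. z"])
    show "integrable gauss (\<lambda>z. \<sigma> * z)" by (rule integrable_mult_right[OF std_normal_moments(3)])
  qed simp_all
  also have "\<dots> = (\<integral>A. (if 0 \<in> A then \<sigma> * Bq \<sigma> (A - {0}) x else 0) \<partial>?p)"
  proof (rule integral_cong_AE)
    show "AE A in ?p. (if 0 \<in> A then \<integral>Z. (\<sigma> * Z 0) * min 1 (ratio \<sigma> A x Z) \<partial>gauss_seq else 0)
      = (if 0 \<in> A then \<sigma> * Bq \<sigma> (A - {0}) x else 0)"
      using AE_subset_pmf[OF k(2)]
    proof eventually_elim
      case (elim A)
      then have "finite A" by (auto intro: finite_subset)
      then show ?case by (simp add: min_ratio_eq Bq_def mult.assoc)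
    qed
  qed auto
  finally show "drift d k \<sigma> x = (\<integral>A. (if 0 \<in> A then \<sigma> * Bq \<sigma> (A - {0}) x else 0) \<partial>?p)" .
  have "msq d k \<sigma> x = (\<integral>A. (if 0 \<in> A then \<integral>Z. (\<sigma> * Z 0)\<^sup>2 * min 1 (ratio \<sigma> A x Z) \<partial>gauss_seq else 0) \<partial>?p)"
    unfolding msq_def
  proof (rule integral_step_noise_increment[OF k(2), where \<psi>="\<lambda>z. z\<^sup>2"])
    show "integrable gauss (\<lambda>z. (\<sigma> * z)\<^sup>2)"
      unfolding power_mult_distrib by (rule integrable_mult_right[OF std_normal_moments(4)])
  qed simp_all
  also have "\<dots> = (\<integral>A. (if 0 \<in> A then \<sigma>\<^sup>2 * Vq \<sigma> (A - {0}) x else 0) \<partial>?p)"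
  proof (rule integral_cong_AE)
    show "AE A in ?p. (if 0 \<in> A then \<integral>Z. (\<sigma> * Z 0)\<^sup>2 * min 1 (ratio \<sigma> A x Z) \<partial>gauss_seq else 0)
      = (if 0 \<in> A then \<sigma>\<^sup>2 * Vq \<sigma> (A - {0}) x else 0)"
      using AE_subset_pmf[OF k(2)]
    proof eventually_elim
      case (elim A)
      then have "finite A" by (auto intro: finite_subset)
      then show ?case by (simp add: min_ratio_eq Vq_def mult.assoc power_mult_distrib)
    qed
  qed auto
  finally show "msq d k \<sigma> x = (\<integral>A. (if 0 \<in> A then \<sigma>\<^sup>2 * Vq \<sigma> (A - {0}) x else 0) \<partial>?p)" .
qed

lemma drift_bound:
  assumes k: "1 \<le> k" "k \<le> d" and \<sigma>: "0 < \<sigma>" and S: "0 < S" and \<eta>: "0 < \<eta>"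
  shows "real d * (\<integral>x. \<bar>drift d k \<sigma> x - h / 2 * g1 (x 0) / real d\<bar> \<partial>mu)
    \<le> real k * \<sigma>\<^sup>2 * (\<sigma> * M3 * (L / 2 + I * (1 + 2 / \<eta>)) + M1 * ((1 + 4 / \<eta>) * approx_err S (k - 1) \<sigma> + 32 * \<eta> / S))
      + \<bar>real k * \<sigma>\<^sup>2 * Phi (- S / 2) - h / 2\<bar> * M1"
proof -
  let ?B = "\<sigma>\<^sup>2 * M3 * (L / 2 + I * (1 + 2 / \<eta>)) + \<sigma> * M1 * ((1 + 4 / \<eta>) * approx_err S (k - 1) \<sigma> + 32 * \<eta> / S)"
  let ?T = "\<sigma> * ?B + \<bar>\<sigma>\<^sup>2 * Phi (- S / 2) - h / (2 * real k)\<bar> * M1"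
  \<comment> \<open>The drift to be expected once coordinate 0 is selected; multiplied by the
    selection probability \<open>k / d\<close> it becomes
    \<open>h / 2 * g1 (x 0) / d\<close>.\<close>
  let ?c = "\<lambda>x :: nat \<Rightarrow> real. h / (2 * real k) * g1 (x 0)"
  have kd: "0 < real k" "0 < real d" using k by auto
  have ig0: "integrable mu (\<lambda>x. g1 (x 0))" by (rule integral_mu_coord0[OF integrable_g1(1)])
  have ig: "integrable mu (\<lambda>x. \<bar>g1 (x 0)\<bar>)" "(\<integral>x. \<bar>g1 (x 0)\<bar> \<partial>mu) = M1"
    by (rule integral_mu_coord0[OF integrable_abs_g1])+
  have iB: "integrable mu (Bq \<sigma> A)" for A by (rule mu.integrable_const_bound[where B=1]) (use Vq_Bq_bounds in auto)
  have "(\<integral>x. \<bar>measure_pmf.expectation (subset_pmf d k) (\<lambda>A. if 0 \<in> A then \<sigma> * Bq \<sigma> (A - {0}) x else 0) - real k / real d * ?c x\<bar> \<partial>mu)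
    \<le> real k / real d * ?T"
  proof (rule average_le[OF k])
    fix A :: "nat set" assume A: "A \<subseteq> {..<d}" "card A = k" "0 \<in> A"
    let ?A = "A - {0}"
    have fA: "finite ?A" "card ?A = k - 1" using A finite_subset[OF A(1)] by (auto simp: card_Diff_singleton)
    show i: "integrable mu (\<lambda>x. \<bar>\<sigma> * Bq \<sigma> ?A x - ?c x\<bar>)"
      by (intro integrable_abs Bochner_Integration.integrable_diff integrable_mult_right iB ig0)
    have i1: "integrable mu (\<lambda>x. \<bar>Bq \<sigma> ?A x - \<sigma> * g1 (x 0) * Phi (- S / 2)\<bar>)"
      by (intro integrable_abs Bochner_Integration.integrable_diff integrable_mult_right integrable_mult_left iB ig0)
    have "(\<integral>x. \<bar>\<sigma> * Bq \<sigma> ?A x - ?c x\<bar> \<partial>mu) \<le> (\<integral>x. \<sigma> * \<bar>Bq \<sigma> ?A x - \<sigma> * g1 (x 0) * Phi (- S / 2)\<bar>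
       + \<bar>\<sigma>\<^sup>2 * Phi (- S / 2) - h / (2 * real k)\<bar> * \<bar>g1 (x 0)\<bar> \<partial>mu)"
    proof (rule integral_mono[OF i])
      show "integrable mu (\<lambda>x. \<sigma> * \<bar>Bq \<sigma> ?A x - \<sigma> * g1 (x 0) * Phi (- S / 2)\<bar>
       + \<bar>\<sigma>\<^sup>2 * Phi (- S / 2) - h / (2 * real k)\<bar> * \<bar>g1 (x 0)\<bar>)"
        by (intro Bochner_Integration.integrable_add integrable_mult_right i1 ig)
      fix x
      have "\<sigma> * Bq \<sigma> ?A x - ?c x = \<sigma> * (Bq \<sigma> ?A x - \<sigma> * g1 (x 0) * Phi (- S / 2)) + (\<sigma>\<^sup>2 * Phi (- S / 2) - h / (2 * real k)) * g1 (x 0)"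
        by (simp add: algebra_simps power2_eq_square)
      then have "\<bar>\<sigma> * Bq \<sigma> ?A x - ?c x\<bar> \<le> \<bar>\<sigma> * (Bq \<sigma> ?A x - \<sigma> * g1 (x 0) * Phi (- S / 2))\<bar> + \<bar>(\<sigma>\<^sup>2 * Phi (- S / 2) - h / (2 * real k)) * g1 (x 0)\<bar>"
        by (simp only: abs_triangle_ineq)
      then show "\<bar>\<sigma> * Bq \<sigma> ?A x - ?c x\<bar> \<le> \<sigma> * \<bar>Bq \<sigma> ?A x - \<sigma> * g1 (x 0) * Phi (- S / 2)\<bar>
       + \<bar>\<sigma>\<^sup>2 * Phi (- S / 2) - h / (2 * real k)\<bar> * \<bar>g1 (x 0)\<bar>" using \<sigma> by (simp add: abs_mult)
    qed
    also have "\<dots> = \<sigma> * (\<integral>x. \<bar>Bq \<sigma> ?A x - \<sigma> * g1 (x 0) * Phi (- S / 2)\<bar> \<partial>mu) + \<bar>\<sigma>\<^sup>2 * Phi (- S / 2) - h / (2 * real k)\<bar> * M1"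
      using i1 ig by simp
    also have "\<dots> \<le> ?T"
      using B_est[OF _ fA(1) \<sigma> S \<eta>] \<sigma> unfolding fA(2) by (intro add_right_mono mult_left_mono) auto
    finally show "(\<integral>x. \<bar>\<sigma> * Bq \<sigma> ?A x - ?c x\<bar> \<partial>mu) \<le> ?T" .
  qed
  moreover have "real k / real d * ?c x = h / 2 * g1 (x 0) / real d" for x using kd by (simp add: field_simps)
  ultimately have "(\<integral>x. \<bar>drift d k \<sigma> x - h / 2 * g1 (x 0) / real d\<bar> \<partial>mu) \<le> real k / real d * ?T"
    by (simp only: drift_msq_eq[OF k])
  then have "real d * (\<integral>x. \<bar>drift d k \<sigma> x - h / 2 * g1 (x 0) / real d\<bar> \<partial>mu) \<le> real d * (real k / real d * ?T)"
    by (rule mult_left_mono) simp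
  also have "\<dots> = real k * \<sigma> * ?B + (real k * \<bar>\<sigma>\<^sup>2 * Phi (- S / 2) - h / (2 * real k)\<bar>) * M1"
    using kd by (simp add: algebra_simps)
  also have "real k * \<bar>\<sigma>\<^sup>2 * Phi (- S / 2) - h / (2 * real k)\<bar> = \<bar>real k * (\<sigma>\<^sup>2 * Phi (- S / 2) - h / (2 * real k))\<bar>"
    using kd by (simp add: abs_mult)
  also have "real k * (\<sigma>\<^sup>2 * Phi (- S / 2) - h / (2 * real k)) = real k * \<sigma>\<^sup>2 * Phi (- S / 2) - h / 2"
    using kd by (simp add: field_simps)
  also have "real k * \<sigma> * ?B = real k * \<sigma>\<^sup>2 * (\<sigma> * M3 * (L / 2 + I * (1 + 2 / \<eta>)) + M1 * ((1 + 4 / \<eta>) * approx_err S (k - 1) \<sigma> + 32 * \<eta> / S))"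
    by (simp add: algebra_simps power2_eq_square)
  finally show ?thesis .
qed

lemma msq_bound:
  assumes k: "1 \<le> k" "k \<le> d" and \<sigma>: "0 < \<sigma>" and S: "0 < S"
  shows "real d * (\<integral>x. \<bar>msq d k \<sigma> x - h / real d\<bar> \<partial>mu)
    \<le> real k * \<sigma>\<^sup>2 * (approx_err S (k - 1) \<sigma> + \<sigma> * M3 * M1 + 2 * L * \<sigma>\<^sup>2) + \<bar>real k * \<sigma>\<^sup>2 * (2 * Phi (- S / 2)) - h\<bar>"
proof -
  let ?V = "approx_err S (k - 1) \<sigma> + \<sigma> * M3 * M1 + 2 * L * \<sigma>\<^sup>2" and ?a = "2 * Phi (- S / 2)"
  let ?T = "\<sigma>\<^sup>2 * ?V + \<bar>\<sigma>\<^sup>2 * ?a - h / real k\<bar>"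
  have kd: "0 < real k" "0 < real d" using k by auto
  have iV: "integrable mu (Vq \<sigma> A)" for A by (rule mu.integrable_const_bound[where B=1]) (use Vq_Bq_bounds in auto)
  have "(\<integral>x. \<bar>measure_pmf.expectation (subset_pmf d k) (\<lambda>A. if 0 \<in> A then \<sigma>\<^sup>2 * Vq \<sigma> (A - {0}) x else 0) - real k / real d * (h / real k)\<bar> \<partial>mu)
    \<le> real k / real d * ?T"
  proof (rule average_le[OF k])
    fix A :: "nat set" assume A: "A \<subseteq> {..<d}" "card A = k" "0 \<in> A"
    let ?A = "A - {0}"
    have fA: "finite ?A" "card ?A = k - 1" using A finite_subset[OF A(1)] by (auto simp: card_Diff_singleton)
    show i: "integrable mu (\<lambda>x. \<bar>\<sigma>\<^sup>2 * Vq \<sigma> ?A x - h / real k\<bar>)"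
      by (intro integrable_abs Bochner_Integration.integrable_diff integrable_mult_right iV mu.integrable_const)
    have i1: "integrable mu (\<lambda>x. \<bar>Vq \<sigma> ?A x - ?a\<bar>)"
      by (intro integrable_abs Bochner_Integration.integrable_diff iV mu.integrable_const)
    have "(\<integral>x. \<bar>\<sigma>\<^sup>2 * Vq \<sigma> ?A x - h / real k\<bar> \<partial>mu) \<le> (\<integral>x. \<sigma>\<^sup>2 * \<bar>Vq \<sigma> ?A x - ?a\<bar> + \<bar>\<sigma>\<^sup>2 * ?a - h / real k\<bar> \<partial>mu)"
    proof (rule integral_mono[OF i])
      show "integrable mu (\<lambda>x. \<sigma>\<^sup>2 * \<bar>Vq \<sigma> ?A x - ?a\<bar> + \<bar>\<sigma>\<^sup>2 * ?a - h / real k\<bar>)"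
        by (intro Bochner_Integration.integrable_add integrable_mult_right i1 mu.integrable_const)
      fix x
      have "\<sigma>\<^sup>2 * Vq \<sigma> ?A x - h / real k = \<sigma>\<^sup>2 * (Vq \<sigma> ?A x - ?a) + (\<sigma>\<^sup>2 * ?a - h / real k)"
        by (simp add: algebra_simps)
      then have "\<bar>\<sigma>\<^sup>2 * Vq \<sigma> ?A x - h / real k\<bar> \<le> \<bar>\<sigma>\<^sup>2 * (Vq \<sigma> ?A x - ?a)\<bar> + \<bar>\<sigma>\<^sup>2 * ?a - h / real k\<bar>"
        by (simp only: abs_triangle_ineq)
      then show "\<bar>\<sigma>\<^sup>2 * Vq \<sigma> ?A x - h / real k\<bar> \<le> \<sigma>\<^sup>2 * \<bar>Vq \<sigma> ?A x - ?a\<bar> + \<bar>\<sigma>\<^sup>2 * ?a - h / real k\<bar>"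
        by (simp only: abs_mult[of "\<sigma>\<^sup>2"] abs_power2)
    qed
    also have "\<dots> = \<sigma>\<^sup>2 * (\<integral>x. \<bar>Vq \<sigma> ?A x - ?a\<bar> \<partial>mu) + \<bar>\<sigma>\<^sup>2 * ?a - h / real k\<bar>"
      using i1 mu.prob_space by simp
    also have "\<dots> \<le> ?T"
      using V_est[OF _ fA(1) \<sigma> S] unfolding fA(2) by (intro add_right_mono mult_left_mono) auto
    finally show "(\<integral>x. \<bar>\<sigma>\<^sup>2 * Vq \<sigma> ?A x - h / real k\<bar> \<partial>mu) \<le> ?T" .
  qed
  moreover have "real k / real d * (h / real k) = h / real d" using kd by simp
  ultimately have "(\<integral>x. \<bar>msq d k \<sigma> x - h / real d\<bar> \<partial>mu) \<le> real k / real d * ?T"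
    by (simp only: drift_msq_eq[OF k])
  then have "real d * (\<integral>x. \<bar>msq d k \<sigma> x - h / real d\<bar> \<partial>mu) \<le> real d * (real k / real d * ?T)"
    by (rule mult_left_mono) simp
  also have "\<dots> = real k * \<sigma>\<^sup>2 * ?V + real k * \<bar>\<sigma>\<^sup>2 * ?a - h / real k\<bar>"
    using kd by (simp add: algebra_simps)
  also have "real k * \<bar>\<sigma>\<^sup>2 * ?a - h / real k\<bar> = \<bar>real k * (\<sigma>\<^sup>2 * ?a - h / real k)\<bar>"
    using kd by (simp add: abs_mult)
  also have "real k * (\<sigma>\<^sup>2 * ?a - h / real k) = real k * \<sigma>\<^sup>2 * ?a - h"
    using kd by (simp add: field_simps)
  finally show ?thesis .
qed

text \<open>\<open>S\<close> is the limiting standard deviation of the log ratio. Besides coordinate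
  0 there are \<open>k d - 1\<close> moved coordinates, which makes no difference in the limit
  because \<open>\<sigma>\<close> tends to 0.\<close>

lemma
  fixes \<sigma> :: "nat \<Rightarrow> real" and k D :: "nat \<Rightarrow> nat"
  assumes k: "\<And>d. 1 \<le> k d" "\<And>d. k d \<le> D d" and \<sigma>: "\<sigma> \<longlonglongrightarrow> 0" and pos: "\<And>d. \<sigma> d > 0"
    and n: "(\<lambda>d. real (k d) * (\<sigma> d)\<^sup>2) \<longlonglongrightarrow> S\<^sup>2 / I" and S: "0 < S"
    and h: "h = 2 * (S\<^sup>2 / I) * Phi (- S / 2)"
  shows drift_limit: "(\<lambda>d. real (D d) * (\<integral>x. \<bar>drift (D d) (k d) (\<sigma> d) x - h / 2 * g1 (x 0) / real (D d)\<bar> \<partial>mu)) \<longlonglongrightarrow> 0"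
    and msq_limit: "(\<lambda>d. real (D d) * (\<integral>x. \<bar>msq (D d) (k d) (\<sigma> d) x - h / real (D d)\<bar> \<partial>mu)) \<longlonglongrightarrow> 0"
proof -
  have "(\<lambda>d. real (k d) * (\<sigma> d)\<^sup>2 - (\<sigma> d)\<^sup>2) \<longlonglongrightarrow> S\<^sup>2 / I - 0\<^sup>2" by (intro tendsto_intros n \<sigma>)
  moreover have "real (k d) * (\<sigma> d)\<^sup>2 - (\<sigma> d)\<^sup>2 = real (k d - 1) * (\<sigma> d)\<^sup>2" for d
    using k(1)[of d] by (simp add: of_nat_diff algebra_simps)
  ultimately have n1: "(\<lambda>d. real (k d - 1) * (\<sigma> d)\<^sup>2) \<longlonglongrightarrow> S\<^sup>2 / I" by simp
  note err = approx_err_limit[OF \<sigma> pos n1 S]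
  have msq_lim: "(\<lambda>d. real (k d) * (\<sigma> d)\<^sup>2 * (approx_err S (k d - 1) (\<sigma> d) + \<sigma> d * M3 * M1 + 2 * L * (\<sigma> d)\<^sup>2)
      + \<bar>real (k d) * (\<sigma> d)\<^sup>2 * (2 * Phi (- S / 2)) - h\<bar>)
    \<longlonglongrightarrow> S\<^sup>2 / I * (0 + 0 * M3 * M1 + 2 * L * 0\<^sup>2) + \<bar>S\<^sup>2 / I * (2 * Phi (- S / 2)) - h\<bar>"
    by (intro tendsto_intros n err \<sigma>)
  show "(\<lambda>d. real (D d) * (\<integral>x. \<bar>msq (D d) (k d) (\<sigma> d) x - h / real (D d)\<bar> \<partial>mu)) \<longlonglongrightarrow> 0"
  proof (rule tendsto_sandwich[OF always_eventually always_eventually tendsto_const])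
    show "\<forall>d. 0 \<le> real (D d) * (\<integral>x. \<bar>msq (D d) (k d) (\<sigma> d) x - h / real (D d)\<bar> \<partial>mu)"
      by (intro allI mult_nonneg_nonneg Bochner_Integration.integral_nonneg) auto
    show "\<forall>d. real (D d) * (\<integral>x. \<bar>msq (D d) (k d) (\<sigma> d) x - h / real (D d)\<bar> \<partial>mu)
      \<le> real (k d) * (\<sigma> d)\<^sup>2 * (approx_err S (k d - 1) (\<sigma> d) + \<sigma> d * M3 * M1 + 2 * L * (\<sigma> d)\<^sup>2)
      + \<bar>real (k d) * (\<sigma> d)\<^sup>2 * (2 * Phi (- S / 2)) - h\<bar>"
      using msq_bound[OF k pos S] by blast
  qed (use msq_lim in \<open>simp add: h\<close>)
  let ?D = "\<lambda>d. real (D d) * (\<integral>x. \<bar>drift (D d) (k d) (\<sigma> d) x - h / 2 * g1 (x 0) / real (D d)\<bar> \<partial>mu)"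
  show "?D \<longlonglongrightarrow> 0"
  \<comment> \<open>For fixed eta the bound tends to \<open>C * \<eta>\<close>, what is left of the
    term \<open>32 * \<eta> / S\<close>, and not to 0. So eta is chosen according to
    \<open>e\<close>.\<close>
  proof (rule tendstoI)
    fix e :: real assume e: "0 < e"
    define C where "C = S\<^sup>2 / I * M1 * (32 / S)"
    have C0: "0 \<le> C" using I_pos S M1_nonneg by (simp add: C_def)
    define \<eta> where "\<eta> = e / 2 / (C + 1)"
    have \<eta>: "0 < \<eta>" using e C0 by (simp add: \<eta>_def)
    let ?U = "\<lambda>d. real (k d) * (\<sigma> d)\<^sup>2 * (\<sigma> d * M3 * (L / 2 + I * (1 + 2 / \<eta>))
        + M1 * ((1 + 4 / \<eta>) * approx_err S (k d - 1) (\<sigma> d) + 32 * \<eta> / S))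
      + \<bar>real (k d) * (\<sigma> d)\<^sup>2 * Phi (- S / 2) - h / 2\<bar> * M1"
    have "?U \<longlonglongrightarrow> S\<^sup>2 / I * (0 * M3 * (L / 2 + I * (1 + 2 / \<eta>)) + M1 * ((1 + 4 / \<eta>) * 0 + 32 * \<eta> / S))
      + \<bar>S\<^sup>2 / I * Phi (- S / 2) - h / 2\<bar> * M1"
      by (intro tendsto_intros n err \<sigma>)
    also have "S\<^sup>2 / I * (0 * M3 * (L / 2 + I * (1 + 2 / \<eta>)) + M1 * ((1 + 4 / \<eta>) * 0 + 32 * \<eta> / S))
      + \<bar>S\<^sup>2 / I * Phi (- S / 2) - h / 2\<bar> * M1 = C * \<eta>"
      by (simp add: h C_def)
    finally have lim: "?U \<longlonglongrightarrow> C * \<eta>" .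
    have "C * \<eta> \<le> (C + 1) * \<eta>" using \<eta> by (intro mult_right_mono) auto
    also have "(C + 1) * \<eta> = e / 2" unfolding \<eta>_def using C0 by (intro nonzero_mult_div_cancel_left[of "C + 1" "e / 2", simplified times_divide_eq_right[symmetric]]) simp
    finally have "C * \<eta> < e" using e by linarith
    then have "\<forall>\<^sub>F d in sequentially. ?U d < e" using lim by (rule order_tendstoD(2)[rotated])
    then show "\<forall>\<^sub>F d in sequentially. dist (?D d) 0 < e"
    proof eventually_elim
      case (elim d)
      have "0 \<le> ?D d" by (intro mult_nonneg_nonneg Bochner_Integration.integral_nonneg) auto
      moreover have "?D d \<le> ?U d" by (rule drift_bound[OF k pos S \<eta>])
      ultimately show ?case using elim by (simp add: dist_real_def)
    qed
  qed
qed

end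

section \<open>The Euler scheme\<close>

lemma discrete_gronwall:
  fixes a b :: "nat \<Rightarrow> real"
  assumes "a 0 \<le> 0" and q: "0 \<le> q" and b: "\<And>j. 0 \<le> b j"
    and step: "\<And>j. j < J \<Longrightarrow> a (Suc j) \<le> (1 + q) * a j + b j"
  shows "j \<le> J \<Longrightarrow> a j \<le> exp (q * real j) * (\<Sum>i<j. b i)"
proof (induction j)
  case (Suc j)
  let ?s = "\<Sum>i<j. b i"
  have s: "0 \<le> ?s" by (intro sum_nonneg b)
  have e: "(1 + q) * exp (q * real j) \<le> exp (q * real (Suc j))"
  proof -
    have "(1 + q) * exp (q * real j) \<le> exp q * exp (q * real j)"
      by (intro mult_right_mono exp_ge_add_one_self) auto
    also have "\<dots> = exp (q * real (Suc j))" by (simp add: algebra_simps flip: exp_add)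
    finally show ?thesis .
  qed
  have "a (Suc j) \<le> (1 + q) * a j + b j" using Suc by (intro step) auto
  also have "\<dots> \<le> (1 + q) * (exp (q * real j) * ?s) + b j"
    using Suc q by (intro add_right_mono mult_left_mono) auto
  also have "\<dots> \<le> exp (q * real (Suc j)) * ?s + exp (q * real (Suc j)) * b j"
  proof (rule add_mono)
    show "(1 + q) * (exp (q * real j) * ?s) \<le> exp (q * real (Suc j)) * ?s"
      using mult_right_mono[OF e s] by (simp add: mult.assoc)
    have "1 * b j \<le> exp (q * real (Suc j)) * b j" using q b by (intro mult_right_mono) auto
    then show "b j \<le> exp (q * real (Suc j)) * b j" by simp
  qed
  also have "\<dots> = exp (q * real (Suc j)) * (\<Sum>i<Suc j. b i)" by (simp add: distrib_left)
  finally show ?case .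
qed (use assms in simp)

primrec eul :: "nat \<Rightarrow> (real \<Rightarrow> real) \<Rightarrow> real \<Rightarrow> (nat \<Rightarrow> real) \<Rightarrow> nat \<Rightarrow> real" where
  "eul n \<beta> x a 0 = x"
| "eul n \<beta> x a (Suc j) = eul n \<beta> x a j + a j + \<beta> (eul n \<beta> x a j) / real n"

lemma eul_measurable:
  assumes [measurable]: "\<beta> \<in> borel_measurable borel" "x \<in> borel_measurable M" "\<And>j. (\<lambda>w. a w j) \<in> borel_measurable M"
  shows "(\<lambda>w. eul n \<beta> (x w) (a w) j) \<in> borel_measurable M"
  by (induction j) auto

lemma eul_lipschitz:
  assumes Lb: "0 \<le> Lb" "\<And>x y. \<bar>\<beta> x - \<beta> y\<bar> \<le> Lb * \<bar>x - y\<bar>" and n: "0 < n"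
  shows "\<bar>eul n \<beta> x a j - eul n \<beta> x b j\<bar> \<le> exp (Lb / real n * real j) * (\<Sum>i<j. \<bar>a i - b i\<bar>)"
proof (rule discrete_gronwall[where J=j])
  fix i
  let ?a = "eul n \<beta> x a i" and ?b = "eul n \<beta> x b i"
  have "\<bar>eul n \<beta> x a (Suc i) - eul n \<beta> x b (Suc i)\<bar> = \<bar>(?a - ?b) + (a i - b i) + (\<beta> ?a - \<beta> ?b) / real n\<bar>"
    by (simp add: diff_divide_distrib)
  also have "\<dots> \<le> \<bar>?a - ?b\<bar> + \<bar>a i - b i\<bar> + \<bar>(\<beta> ?a - \<beta> ?b) / real n\<bar>" by linarith
  also have "\<bar>(\<beta> ?a - \<beta> ?b) / real n\<bar> \<le> Lb * \<bar>?a - ?b\<bar> / real n"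
    unfolding abs_divide using Lb(2)[of ?a ?b] by (simp add: divide_right_mono)
  finally show "\<bar>eul n \<beta> x a (Suc i) - eul n \<beta> x b (Suc i)\<bar> \<le> (1 + Lb / real n) * \<bar>?a - ?b\<bar> + \<bar>a i - b i\<bar>"
    by (simp add: algebra_simps)
qed (use assms in auto)

text \<open>The chain runs on a time grid of mesh \<open>1/D\<close>, the Euler scheme on one of mesh \<open>1/n\<close>;
  \<open>(D * j) div n\<close> is the index in the fine grid of the \<open>j\<close>-th point of the coarse one.\<close>

lemma grid_length:
  fixes D n j :: nat
  assumes "0 < n"
  defines "\<kappa> \<equiv> \<lambda>j. (D * j) div n"
  shows "\<kappa> j \<le> \<kappa> (Suc j)" and "\<bar>real (\<kappa> (Suc j) - \<kappa> j) - real D / real n\<bar> \<le> 1"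
proof -
  show le: "\<kappa> j \<le> \<kappa> (Suc j)" unfolding \<kappa>_def by (intro div_le_mono mult_le_mono2) simp
  have b: "real D * real j / real n - 1 < real (\<kappa> j)" "real (\<kappa> j) \<le> real D * real j / real n" for j
  proof -
    have "real (\<kappa> j) = of_int \<lfloor>real (D * j) / real n\<rfloor>" unfolding \<kappa>_def
      by (metis floor_divide_of_nat_eq of_int_of_nat_eq)
    then show "real D * real j / real n - 1 < real (\<kappa> j)" "real (\<kappa> j) \<le> real D * real j / real n" by (simp_all; linarith)+
  qed
  have "real D * real (Suc j) / real n = real D * real j / real n + real D / real n"
    by (simp add: algebra_simps add_divide_distrib)
  then show "\<bar>real (\<kappa> (Suc j) - \<kappa> j) - real D / real n\<bar> \<le> 1"
    using b[of j] b[of "Suc j"] le by (simp add: of_nat_diff)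
qed

text \<open>A deterministic statement about one path. Inside a block \<open>X\<close> moves by at
  most \<open>3 * \<theta>\<close>, one \<open>\<theta>\<close> each for the martingale, the drift
  and the error. A block has relative length at most 2/n, which gives
  \<open>6 * Lb * \<theta> / n\<close> per block in Gronwall's inequality; the further
  \<open>2 * \<theta>\<close> come from \<open>err\<close> and \<open>grid\<close>.\<close>

lemma euler_comparison:
  fixes X S e :: "nat \<Rightarrow> real" and D n J :: nat
  assumes n: "0 < n" "n \<le> D" and Lb: "0 \<le> Lb" "\<And>x y. \<bar>\<beta> x - \<beta> y\<bar> \<le> Lb * \<bar>x - y\<bar>"
    and X: "\<And>i. X (Suc i) = X i + (S (Suc i) - S i) + \<beta> (X i) / real D + e i"
  defines "\<kappa> \<equiv> \<lambda>j. (D * j) div n"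
  defines "E \<equiv> eul n \<beta> (X 0) (\<lambda>j. S (\<kappa> (Suc j)) - S (\<kappa> j))"
  assumes \<theta>: "0 \<le> \<theta>"
    and oscS: "\<And>j i. j < J \<Longrightarrow> \<kappa> j \<le> i \<Longrightarrow> i \<le> \<kappa> (Suc j) \<Longrightarrow> \<bar>S i - S (\<kappa> j)\<bar> \<le> \<theta>"
    and drift: "\<And>j. j < J \<Longrightarrow> (\<Sum>i\<in>{\<kappa> j..<\<kappa> (Suc j)}. \<bar>\<beta> (X i)\<bar> / real D) \<le> \<theta>"
    and err: "(\<Sum>i<\<kappa> J. \<bar>e i\<bar>) \<le> \<theta>" and grid: "(\<Sum>j<J. \<bar>\<beta> (X (\<kappa> j))\<bar> / real D) \<le> \<theta>"
    and T: "real J \<le> real n * T"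
  shows "j < J \<Longrightarrow> \<kappa> j \<le> i \<Longrightarrow> i \<le> \<kappa> (Suc j) \<Longrightarrow> \<bar>X i - E j\<bar> \<le> (3 + exp (Lb * T) * (6 * Lb * T + 2)) * \<theta>"
proof -
  have D: "0 < real D" "0 < real n" using n by auto
  have len: "\<kappa> j \<le> \<kappa> (Suc j)" "\<bar>real (\<kappa> (Suc j) - \<kappa> j) - real D / real n\<bar> \<le> 1" for j
    unfolding \<kappa>_def by (rule grid_length[OF n(1)])+
  have \<kappa>_mono: "\<kappa> j \<le> \<kappa> j'" if "j \<le> j'" for j j' using that
    unfolding \<kappa>_def by (intro div_le_mono mult_le_mono2)
  have X_diff: "X i = X i0 + (S i - S i0) + (\<Sum>k\<in>{i0..<i}. \<beta> (X k) / real D) + (\<Sum>k\<in>{i0..<i}. e k)" if "i0 \<le> i" for i0 i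
    using that
  proof (induction i rule: dec_induct)
    case (step i)
    then show ?case using X[of i] by simp
  qed simp
  have sub: "(\<Sum>k\<in>{\<kappa> j..<i}. \<bar>e k\<bar>) \<le> \<theta>" if "j < J" "i \<le> \<kappa> (Suc j)" for j i
  proof -
    have "(\<Sum>k\<in>{\<kappa> j..<i}. \<bar>e k\<bar>) \<le> (\<Sum>i<\<kappa> J. \<bar>e i\<bar>)"
      using that \<kappa>_mono[of "Suc j" J] by (intro sum_mono2) auto
    then show ?thesis using err by linarith
  qed
  have osc: "\<bar>X i - X (\<kappa> j)\<bar> \<le> 3 * \<theta>" if j: "j < J" and i: "\<kappa> j \<le> i" "i \<le> \<kappa> (Suc j)" for i j
  proof -
    have "\<bar>\<Sum>k\<in>{\<kappa> j..<i}. \<beta> (X k) / real D\<bar> \<le> (\<Sum>k\<in>{\<kappa> j..<i}. \<bar>\<beta> (X k)\<bar> / real D)"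
      by (rule order_trans[OF sum_abs]) (simp add: abs_divide)
    also have "\<dots> \<le> (\<Sum>i\<in>{\<kappa> j..<\<kappa> (Suc j)}. \<bar>\<beta> (X i)\<bar> / real D)"
      using i by (intro sum_mono2) auto
    also have "\<dots> \<le> \<theta>" by (rule drift[OF j])
    finally have 1: "\<bar>\<Sum>k\<in>{\<kappa> j..<i}. \<beta> (X k) / real D\<bar> \<le> \<theta>" .
    have "\<bar>\<Sum>k\<in>{\<kappa> j..<i}. e k\<bar> \<le> (\<Sum>k\<in>{\<kappa> j..<i}. \<bar>e k\<bar>)" by (rule sum_abs)
    also have "\<dots> \<le> \<theta>" by (rule sub[OF j i(2)])
    finally show ?thesis using 1 oscS[OF j i] X_diff[OF i(1)] by linarith
  qed
  have lenD: "real (\<kappa> (Suc j) - \<kappa> j) / real D \<le> 2 / real n" and lenD': "\<bar>real (\<kappa> (Suc j) - \<kappa> j) / real D - 1 / real n\<bar> \<le> 1 / real D" for j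
  proof -
    have "real (\<kappa> (Suc j) - \<kappa> j) / real D - 1 / real n = (real (\<kappa> (Suc j) - \<kappa> j) - real D / real n) / real D"
      using D by (simp add: diff_divide_distrib)
    then have "\<bar>real (\<kappa> (Suc j) - \<kappa> j) / real D - 1 / real n\<bar> = \<bar>real (\<kappa> (Suc j) - \<kappa> j) - real D / real n\<bar> / real D"
      by (simp add: abs_divide)
    then show l: "\<bar>real (\<kappa> (Suc j) - \<kappa> j) / real D - 1 / real n\<bar> \<le> 1 / real D"
      using divide_right_mono[OF len(2)[of j], of "real D"] D by linarith
    have "1 / real D \<le> 1 / real n" using n D by (intro divide_left_mono) auto
    then have "real (\<kappa> (Suc j) - \<kappa> j) / real D \<le> 1 / real n + 1 / real n" using l by linarith
    then show "real (\<kappa> (Suc j) - \<kappa> j) / real D \<le> 2 / real n" by simp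
  qed
  define a where "a j = \<bar>X (\<kappa> j) - E j\<bar>" for j
  define b where "b j = 6 * Lb * \<theta> / real n + \<bar>\<beta> (X (\<kappa> j))\<bar> / real D + (\<Sum>k\<in>{\<kappa> j..<\<kappa> (Suc j)}. \<bar>e k\<bar>)" for j
  have a_step: "a (Suc j) \<le> (1 + Lb / real n) * a j + b j" if j: "j < J" for j
  proof -
    let ?I = "{\<kappa> j..<\<kappa> (Suc j)}"
    \<comment> \<open>Three sources of error: the drift varies inside the block, the block length is
      rounded to an integer, and the scheme evaluates the drift at its own position.\<close>
    have split: "(\<Sum>k\<in>?I. \<beta> (X k) / real D) - \<beta> (E j) / real n = (\<Sum>k\<in>?I. (\<beta> (X k) - \<beta> (X (\<kappa> j))) / real D)
      + \<beta> (X (\<kappa> j)) * (real (\<kappa> (Suc j) - \<kappa> j) / real D - 1 / real n) + (\<beta> (X (\<kappa> j)) - \<beta> (E j)) / real n"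
      by (simp add: sum_subtractf diff_divide_distrib algebra_simps)
    have "\<bar>\<Sum>k\<in>?I. (\<beta> (X k) - \<beta> (X (\<kappa> j))) / real D\<bar> \<le> (\<Sum>k\<in>?I. Lb * (3 * \<theta>) / real D)"
    proof (rule order_trans[OF sum_abs sum_mono])
      fix k assume k: "k \<in> ?I"
      have "\<bar>\<beta> (X k) - \<beta> (X (\<kappa> j))\<bar> \<le> Lb * \<bar>X k - X (\<kappa> j)\<bar>" by (rule Lb(2))
      also have "\<dots> \<le> Lb * (3 * \<theta>)" using k by (intro mult_left_mono osc[OF j] Lb(1)) auto
      finally show "\<bar>(\<beta> (X k) - \<beta> (X (\<kappa> j))) / real D\<bar> \<le> Lb * (3 * \<theta>) / real D"
        by (simp add: abs_divide divide_right_mono)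
    qed
    also have "\<dots> = (real (\<kappa> (Suc j) - \<kappa> j) / real D) * (Lb * (3 * \<theta>))" by simp
    also have "\<dots> \<le> 2 / real n * (Lb * (3 * \<theta>))" using Lb(1) \<theta> by (intro mult_right_mono lenD) auto
    finally have t1: "\<bar>\<Sum>k\<in>?I. (\<beta> (X k) - \<beta> (X (\<kappa> j))) / real D\<bar> \<le> 6 * Lb * \<theta> / real n" by simp
    have "\<bar>\<beta> (X (\<kappa> j)) * (real (\<kappa> (Suc j) - \<kappa> j) / real D - 1 / real n)\<bar> \<le> \<bar>\<beta> (X (\<kappa> j))\<bar> * (1 / real D)"
      unfolding abs_mult by (intro mult_left_mono lenD') auto
    then have t2: "\<bar>\<beta> (X (\<kappa> j)) * (real (\<kappa> (Suc j) - \<kappa> j) / real D - 1 / real n)\<bar> \<le> \<bar>\<beta> (X (\<kappa> j))\<bar> / real D" by simp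
    have t3: "\<bar>(\<beta> (X (\<kappa> j)) - \<beta> (E j)) / real n\<bar> \<le> Lb / real n * a j"
      using Lb(2)[of "X (\<kappa> j)" "E j"] by (simp add: a_def abs_divide divide_right_mono)
    have t4: "\<bar>\<Sum>k\<in>?I. e k\<bar> \<le> (\<Sum>k\<in>?I. \<bar>e k\<bar>)" by (rule sum_abs)
    have "X (\<kappa> (Suc j)) - E (Suc j) = (X (\<kappa> j) - E j) + ((\<Sum>k\<in>?I. \<beta> (X k) / real D) - \<beta> (E j) / real n) + (\<Sum>k\<in>?I. e k)"
      using X_diff[OF len(1)[of j]] by (simp add: E_def)
    then have "a (Suc j) \<le> a j + \<bar>(\<Sum>k\<in>?I. \<beta> (X k) / real D) - \<beta> (E j) / real n\<bar> + \<bar>\<Sum>k\<in>?I. e k\<bar>"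
      unfolding a_def by linarith
    then have "a (Suc j) \<le> a j + (6 * Lb * \<theta> / real n + \<bar>\<beta> (X (\<kappa> j))\<bar> / real D + Lb / real n * a j) + (\<Sum>k\<in>?I. \<bar>e k\<bar>)"
      unfolding split using t1 t2 t3 t4 by linarith
    then show ?thesis by (simp add: b_def algebra_simps)
  qed
  have b0: "0 \<le> b j" for j using Lb \<theta> unfolding b_def by (intro add_nonneg_nonneg sum_nonneg) auto
  have a_bound: "a j \<le> exp (Lb * T) * (6 * Lb * T + 2) * \<theta>" if j: "j < J" for j
  proof -
    have "a j \<le> exp (Lb / real n * real j) * (\<Sum>i<j. b i)"
      by (rule discrete_gronwall[where J=J and a=a and b=b, OF _ _ b0 a_step]) (use Lb j in \<open>auto simp: a_def E_def \<kappa>_def\<close>)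
    also have "\<dots> \<le> exp (Lb * T) * ((6 * Lb * T + 2) * \<theta>)"
    proof (rule mult_mono)
      have "real j \<le> real n * T" using j T by linarith
      then have jT: "real j / real n \<le> T" using D by (simp add: pos_divide_le_eq mult.commute)
      have "Lb / real n * real j = Lb * (real j / real n)" by simp
      also have "\<dots> \<le> Lb * T" by (intro mult_left_mono jT Lb(1))
      finally show "exp (Lb / real n * real j) \<le> exp (Lb * T)" by simp
      have s1: "(\<Sum>i<j. 6 * Lb * \<theta> / real n) \<le> 6 * Lb * T * \<theta>"
      proof -
        have "(\<Sum>i<j. 6 * Lb * \<theta> / real n) = (6 * Lb * \<theta>) * (real j / real n)" by simp
        also have "\<dots> \<le> (6 * Lb * \<theta>) * T" using Lb \<theta> by (intro mult_left_mono jT) auto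
        finally show ?thesis by (simp add: mult_ac)
      qed
      have s2: "(\<Sum>i<j. \<bar>\<beta> (X (\<kappa> i))\<bar> / real D) \<le> \<theta>"
        by (rule order_trans[OF sum_mono2 grid]) (use j in auto)
      have "(\<Sum>i<j. \<Sum>k\<in>{\<kappa> i..<\<kappa> (Suc i)}. \<bar>e k\<bar>) = (\<Sum>k<\<kappa> j. \<bar>e k\<bar>)"
      proof (induction j)
        case 0 then show ?case by (simp add: \<kappa>_def)
      next
        case (Suc j)
        have "{..<\<kappa> (Suc j)} = {..<\<kappa> j} \<union> {\<kappa> j..<\<kappa> (Suc j)}" using len(1)[of j] by auto
        then have "(\<Sum>k<\<kappa> (Suc j). \<bar>e k\<bar>) = (\<Sum>k<\<kappa> j. \<bar>e k\<bar>) + (\<Sum>k\<in>{\<kappa> j..<\<kappa> (Suc j)}. \<bar>e k\<bar>)"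
          by (simp add: sum.union_disjoint[of "{..<\<kappa> j}" "{\<kappa> j..<\<kappa> (Suc j)}"] disjoint_iff)
        then show ?case using Suc by simp
      qed
      also have "\<dots> \<le> \<theta>" by (rule order_trans[OF sum_mono2 err]) (use j \<kappa>_mono[of j J] in auto)
      finally have s3: "(\<Sum>i<j. \<Sum>k\<in>{\<kappa> i..<\<kappa> (Suc i)}. \<bar>e k\<bar>) \<le> \<theta>" .
      have "(\<Sum>i<j. b i) = (\<Sum>i<j. 6 * Lb * \<theta> / real n) + (\<Sum>i<j. \<bar>\<beta> (X (\<kappa> i))\<bar> / real D) + (\<Sum>i<j. \<Sum>k\<in>{\<kappa> i..<\<kappa> (Suc i)}. \<bar>e k\<bar>)"
        by (simp add: b_def sum.distrib)
      then have "(\<Sum>i<j. b i) \<le> 6 * Lb * T * \<theta> + \<theta> + \<theta>" using s1 s2 s3 by linarith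
      then show "(\<Sum>i<j. b i) \<le> (6 * Lb * T + 2) * \<theta>" by (simp add: algebra_simps)
    qed (auto intro: sum_nonneg b0)
    finally show ?thesis by (simp add: mult.assoc)
  qed
  show "\<bar>X i - E j\<bar> \<le> (3 + exp (Lb * T) * (6 * Lb * T + 2)) * \<theta>" if "j < J" "\<kappa> j \<le> i" "i \<le> \<kappa> (Suc j)"
  proof -
    have "\<bar>X i - E j\<bar> \<le> 3 * \<theta> + exp (Lb * T) * (6 * Lb * T + 2) * \<theta>"
      using osc[OF that] a_bound[OF that(1)] unfolding a_def by linarith
    then show ?thesis by (simp add: algebra_simps)
  qed
qed

lemma grid_index:
  fixes D n T :: nat and t :: real
  assumes "0 < n" "t \<in> {0..real T}"
  defines "j \<equiv> nat \<lfloor>real n * t\<rfloor>" and "i \<equiv> nat \<lfloor>real D * t\<rfloor>"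
  shows "j < n * T + 1" "(D * j) div n \<le> i" "i \<le> (D * Suc j) div n"
proof -
  have t: "0 \<le> t" "t \<le> real T" using assms by auto
  have n: "0 < real n" using assms by simp
  have j: "real j \<le> real n * t" "real n * t < real j + 1"
    using t unfolding j_def by (auto simp: of_nat_nat)
  have "real n * t \<le> real n * real T" using t by (intro mult_left_mono) auto
  then have "real j \<le> real (n * T)" using j by simp
  then show "j < n * T + 1" by linarith
  have kap: "int ((D * j) div n) = \<lfloor>real (D * j) / real n\<rfloor>" for j
    by (metis floor_divide_of_nat_eq)
  have "real (D * j) / real n \<le> real D * t"
  proof -
    have "real D * real j \<le> real D * (real n * t)" using j by (intro mult_left_mono) auto
    then show ?thesis using n by (simp add: pos_divide_le_eq mult_ac)
  qed
  then have "\<lfloor>real (D * j) / real n\<rfloor> \<le> \<lfloor>real D * t\<rfloor>" by (rule floor_mono)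
  then show "(D * j) div n \<le> i" unfolding i_def using kap[of j] by linarith
  have "real D * t \<le> real (D * Suc j) / real n"
  proof -
    have "real D * (real n * t) \<le> real D * (real j + 1)" using j by (intro mult_left_mono) auto
    then show ?thesis using n by (simp add: pos_le_divide_eq algebra_simps)
  qed
  then have "\<lfloor>real D * t\<rfloor> \<le> \<lfloor>real (D * Suc j) / real n\<rfloor>" by (rule floor_mono)
  then show "i \<le> (D * Suc j) div n" unfolding i_def using kap[of "Suc j"] by linarith
qed

text \<open>The driving increments enter the equation and the scheme alike and cancel in the
  difference. What remains is controlled by the modulus of continuity of \<open>u\<close>, so the
  argument works for each path separately and needs no regularity of \<open>w\<close>.\<close>

lemma euler_converges:
  fixes u w :: "real \<Rightarrow> real"
  assumes Lb: "0 \<le> Lb" "\<And>x y. \<bar>\<beta> x - \<beta> y\<bar> \<le> Lb * \<bar>x - y\<bar>" and u: "continuous_on {0..} u"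
    and sol: "\<And>t. 0 \<le> t \<Longrightarrow> u t = x + w t + integral {0..t} (\<lambda>s. \<beta> (u s))" and w0: "w 0 = 0"
    and e: "0 < e"
  shows "\<forall>\<^sub>F n in sequentially. \<forall>t\<in>{0..real T}. \<bar>u t - pth n (eul n \<beta> x (\<lambda>j. w (real (Suc j) / real n) - w (real j / real n))) t\<bar> \<le> e"
proof -
  let ?T = "real T"
  \<comment> \<open>The total error is \<open>c * e'\<close>: one \<open>e'\<close> for the
    oscillation of \<open>u\<close> inside a grid cell, the rest from Gronwall's inequality.\<close>
  define c where "c = 1 + exp (Lb * ?T) * (?T * Lb)"
  have c: "0 < c" unfolding c_def using Lb by (intro add_pos_nonneg mult_nonneg_nonneg) auto
  define e' where "e' = e / c"
  have e': "0 < e'" using e c by (simp add: e'_def)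
  have "uniformly_continuous_on {0..?T + 1} u"
    by (rule compact_uniformly_continuous) (auto intro: continuous_on_subset[OF u])
  then obtain \<delta> where \<delta>: "\<delta> > 0" "\<And>s t. s \<in> {0..?T + 1} \<Longrightarrow> t \<in> {0..?T + 1} \<Longrightarrow> \<bar>s - t\<bar> < \<delta> \<Longrightarrow> \<bar>u s - u t\<bar> < e'"
    unfolding uniformly_continuous_on_def dist_real_def using e' by metis
  obtain N :: nat where N: "1 / \<delta> < real N" using reals_Archimedean2 by blast
  have \<beta>_cont: "continuous_on A \<beta>" for A
    unfolding continuous_on_iff dist_real_def
  proof (intro ballI allI impI)
    fix y \<epsilon> :: real assume "0 < \<epsilon>"
    show "\<exists>d>0. \<forall>z\<in>A. \<bar>z - y\<bar> < d \<longrightarrow> \<bar>\<beta> z - \<beta> y\<bar> < \<epsilon>"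
    proof (intro exI[of _ "\<epsilon> / (Lb + 1)"] conjI ballI impI)
      show "0 < \<epsilon> / (Lb + 1)" using \<open>0 < \<epsilon>\<close> Lb by simp
      fix z assume z: "\<bar>z - y\<bar> < \<epsilon> / (Lb + 1)"
      have "\<bar>\<beta> z - \<beta> y\<bar> \<le> (Lb + 1) * \<bar>z - y\<bar>" using Lb(2)[of z y] by (simp add: algebra_simps)
      also have "\<dots> < \<epsilon>" using z Lb(1) by (simp add: field_simps)
      finally show "\<bar>\<beta> z - \<beta> y\<bar> < \<epsilon>" .
    qed
  qed
  have \<beta>u: "continuous_on {a..b} (\<lambda>s. \<beta> (u s))" if "0 \<le> a" for a b
    by (rule continuous_on_compose2[OF \<beta>_cont[of UNIV] continuous_on_subset[OF u]]) (use that in auto)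
  have "\<forall>t\<in>{0..?T}. \<bar>u t - pth n (eul n \<beta> x (\<lambda>j. w (real (Suc j) / real n) - w (real j / real n))) t\<bar> \<le> e" if n: "n \<ge> max N 1" for n
  proof -
    have n0: "0 < real n" "0 < n" using n by auto
    have nd: "1 / real n < \<delta>"
    proof -
      have "1 / \<delta> < real n" using N n by linarith
      then show ?thesis using \<delta>(1) n0 by (simp add: field_simps)
    qed
    define E where "E = eul n \<beta> x (\<lambda>j. w (real (Suc j) / real n) - w (real j / real n))"
    define a where "a j = \<bar>u (real j / real n) - E j\<bar>" for j
    have step: "a (Suc j) \<le> (1 + Lb / real n) * a j + Lb * e' / real n" if j: "j < n * T" for j
    proof -
      let ?s = "real j / real n" and ?t = "real (Suc j) / real n"
      have st: "0 \<le> ?s" "?s \<le> ?t" "?t - ?s = 1 / real n" using n0 by (auto simp: field_simps)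
      have "real (Suc j) \<le> real (n * T)" using j by (simp only: of_nat_le_iff)
      then have tT: "?t \<le> ?T" using n0 by (simp add: pos_divide_le_eq mult.commute)
      have int: "(\<lambda>s. \<beta> (u s)) integrable_on {a..b}" if "0 \<le> a" for a b
        by (rule integrable_continuous_real[OF \<beta>u[OF that]])
      have "integral {0..?t} (\<lambda>s. \<beta> (u s)) = integral {0..?s} (\<lambda>s. \<beta> (u s)) + integral {?s..?t} (\<lambda>s. \<beta> (u s))"
        using Henstock_Kurzweil_Integration.integral_combine[where a=0 and c="?s" and b="?t" and f="\<lambda>s. \<beta> (u s)"] st int by simp
      then have "u ?t - u ?s = (w ?t - w ?s) + integral {?s..?t} (\<lambda>s. \<beta> (u s))"
        using sol[of ?t] sol[of ?s] st by simp
      moreover have "integral {?s..?t} (\<lambda>s. \<beta> (u s)) - \<beta> (u ?s) / real n = integral {?s..?t} (\<lambda>s. \<beta> (u s) - \<beta> (u ?s))"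
        using st int[OF st(1)] by (subst Henstock_Kurzweil_Integration.integral_diff) (auto simp: mult.commute)
      moreover have "norm (integral {?s..?t} (\<lambda>s. \<beta> (u s) - \<beta> (u ?s))) \<le> Lb * e' * (?t - ?s)"
      proof (rule integral_bound[OF st(2)])
        show "continuous_on {?s..?t} (\<lambda>s. \<beta> (u s) - \<beta> (u ?s))" by (intro continuous_intros \<beta>u st)
        fix r assume r: "r \<in> {?s..?t}"
        have "\<bar>u r - u ?s\<bar> < e'"
        proof (rule \<delta>(2))
          have "r - ?s \<le> 1 / real n" using r st by auto
          then show "\<bar>r - ?s\<bar> < \<delta>" using r nd by auto
          show "r \<in> {0..?T + 1}" "?s \<in> {0..?T + 1}" using r st tT order_trans[OF st(1), of r] by auto
        qed
        then have "Lb * \<bar>u r - u ?s\<bar> \<le> Lb * e'" using Lb by (intro mult_left_mono) auto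
        then show "norm (\<beta> (u r) - \<beta> (u ?s)) \<le> Lb * e'" using Lb(2)[of "u r" "u ?s"] by simp
      qed
      moreover have "\<bar>\<beta> (u ?s) / real n - \<beta> (E j) / real n\<bar> \<le> Lb / real n * a j"
        using Lb(2)[of "u ?s" "E j"] n0 by (simp add: a_def divide_right_mono flip: diff_divide_distrib)
      moreover have "u ?t - E (Suc j) = (u ?s - E j) + (u ?t - u ?s - (w ?t - w ?s)) - \<beta> (E j) / real n"
        by (simp add: E_def)
      ultimately have "a (Suc j) \<le> a j + Lb * e' * (?t - ?s) + Lb / real n * a j"
        unfolding a_def by (simp only: real_norm_def)
      then show ?thesis unfolding st(3) by (simp add: algebra_simps)
    qed
    have a_le: "a j \<le> (c - 1) * e'" if j: "j \<le> n * T" for j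
    proof -
      have "a j \<le> exp (Lb / real n * real j) * (\<Sum>i<j. Lb * e' / real n)"
      proof (rule discrete_gronwall[where J="n * T" and a=a and b="\<lambda>_. Lb * e' / real n", OF _ _ _ step j])
        show "a 0 \<le> 0" using sol[of 0] w0 by (simp add: a_def E_def)
      qed (use Lb e' in auto)
      also have "\<dots> \<le> exp (Lb * ?T) * (?T * Lb * e')"
      proof (rule mult_mono)
        have "real j \<le> real (n * T)" using j by (simp only: of_nat_le_iff)
        then have jT: "real j / real n \<le> ?T" using n0 by (simp add: pos_divide_le_eq mult.commute)
        have "Lb / real n * real j = Lb * (real j / real n)" by simp
        also have "\<dots> \<le> Lb * ?T" by (intro mult_left_mono jT Lb(1))
        finally show "exp (Lb / real n * real j) \<le> exp (Lb * ?T)" by simp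
        have "(\<Sum>i<j. Lb * e' / real n) = (real j / real n) * (Lb * e')" by simp
        also have "\<dots> \<le> ?T * (Lb * e')" using Lb e' by (intro mult_right_mono jT) auto
        finally show "(\<Sum>i<j. Lb * e' / real n) \<le> ?T * Lb * e'" by simp
        show "0 \<le> (\<Sum>i<j. Lb * e' / real n)" using Lb e' by (intro sum_nonneg) auto
      qed auto
      finally show ?thesis by (simp add: c_def mult_ac)
    qed
    show ?thesis
    proof
      fix t assume t: "t \<in> {0..?T}"
      let ?j = "nat \<lfloor>real n * t\<rfloor>"
      have j: "?j \<le> n * T" using grid_index(1)[OF n0(2) t] by simp
      have jt: "real ?j \<le> real n * t" "real n * t < real ?j + 1" using t n0 by (auto simp: of_nat_nat)
      have "\<bar>u t - u (real ?j / real n)\<bar> < e'"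
      proof (rule \<delta>(2))
        have "real ?j / real n \<le> t" "t < real ?j / real n + 1 / real n"
          using jt n0 by (simp_all add: field_simps)
        then show "\<bar>t - real ?j / real n\<bar> < \<delta>" "real ?j / real n \<in> {0..?T + 1}" using nd t by auto
      qed (use t in auto)
      then have "\<bar>u t - E ?j\<bar> \<le> e' + (c - 1) * e'" using a_le[OF j] unfolding a_def by linarith
      also have "\<dots> = e" using c by (simp add: e'_def field_simps)
      finally show "\<bar>u t - pth n (eul n \<beta> x (\<lambda>j. w (real (Suc j) / real n) - w (real j / real n))) t\<bar> \<le> e"
        by (simp add: pth_def E_def)
    qed
  qed
  then show ?thesis unfolding eventually_sequentially by blast
qed

section \<open>The chain against the Euler scheme\<close>

lemma (in pos_density) distr_step_noise_normal:
  "distr (step_noise d k) gauss_seq (\<lambda>n. snd (fst n)) = gauss_seq"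
proof (rule measure_eqI)
  let ?p = "measure_pmf (subset_pmf d k)"
  fix E assume "E \<in> sets (distr (step_noise d k) gauss_seq (\<lambda>n. snd (fst n)))"
  then have E[measurable]: "E \<in> sets gauss_seq" by simp
  have "distr (step_noise d k) gauss_seq (\<lambda>n. snd (fst n))
    = distr (distr (step_noise d k) (?p \<Otimes>\<^sub>M gauss_seq) fst) gauss_seq snd"
    by (subst distr_distr) (auto simp: step_noise_def comp_def)
  also have "\<dots> = distr (?p \<Otimes>\<^sub>M gauss_seq) gauss_seq snd" by (simp only: distr_step_noise_fst)
  finally have "emeasure (distr (step_noise d k) gauss_seq (\<lambda>n. snd (fst n))) E
    = emeasure (?p \<Otimes>\<^sub>M gauss_seq) (space ?p \<times> E)"
    using sets.sets_into_space[OF E]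
    by (simp only:, subst emeasure_distr) (auto simp: space_pair_measure intro!: arg_cong2[where f=emeasure])
  also have "\<dots> = emeasure gauss_seq E"
    by (subst gauss_seq.emeasure_pair_measure_Times) (auto simp: measure_pmf.emeasure_space_1)
  finally show "emeasure (distr (step_noise d k) gauss_seq (\<lambda>n. snd (fst n))) E = emeasure gauss_seq E" .
qed simp

lemma (in target) integral_step_noise_coord0:
  fixes p :: "real \<Rightarrow> real"
  assumes p: "integrable gauss p"
  shows "integrable (step_noise d k) (\<lambda>n. p (snd (fst n) 0))"
    "(\<integral>n. p (snd (fst n) 0) \<partial>step_noise d k) = (\<integral>z. p z \<partial>gauss)"
proof -
  have m: "(\<lambda>Z. p (Z 0)) \<in> borel_measurable gauss_seq"
    using integral_coord(1)[OF p] by (rule borel_measurable_integrable)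
  have "integrable (distr (step_noise d k) gauss_seq (\<lambda>n. snd (fst n))) (\<lambda>Z. p (Z 0))"
    unfolding distr_step_noise_normal by (rule integral_coord(1)[OF p])
  then show "integrable (step_noise d k) (\<lambda>n. p (snd (fst n) 0))"
    by (subst (asm) integrable_distr_eq) (use m in auto)
  have "(\<integral>Z. p (Z 0) \<partial>distr (step_noise d k) gauss_seq (\<lambda>n. snd (fst n))) = (\<integral>z. p z \<partial>gauss)"
    unfolding distr_step_noise_normal by (rule integral_coord(2)[OF p])
  then show "(\<integral>n. p (snd (fst n) 0) \<partial>step_noise d k) = (\<integral>z. p z \<partial>gauss)"
    by (subst (asm) integral_distr) (use m in auto)
qed

lemma std_normal_abs_shift_moment:
  assumes j: "j \<le> 4" shows "integrable gauss (\<lambda>z. (\<bar>z\<bar> + 1) ^ j)"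
proof (rule Bochner_Integration.integrable_bound)
  show "integrable gauss (\<lambda>z. \<bar>z\<bar>^4 + 4 * \<bar>z\<bar>^3 + 6 * \<bar>z\<bar>^2 + 4 * \<bar>z\<bar>^1 + 1)"
    by (intro Bochner_Integration.integrable_add integrable_mult_right integrable_std_normal_abs_moment) auto
  have "norm ((\<bar>z\<bar> + 1) ^ j) \<le> norm (\<bar>z\<bar>^4 + 4 * \<bar>z\<bar>^3 + 6 * \<bar>z\<bar>^2 + 4 * \<bar>z\<bar>^1 + 1)" for z :: real
  proof -
    have "(\<bar>z\<bar> + 1) ^ j \<le> (\<bar>z\<bar> + 1) ^ 4" using j by (intro power_increasing) auto
    also have "\<dots> = \<bar>z\<bar>^4 + 4 * \<bar>z\<bar>^3 + 6 * \<bar>z\<bar>^2 + 4 * \<bar>z\<bar>^1 + 1"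
      by (simp add: power4_eq_xxxx power3_eq_cube power2_eq_square algebra_simps)
    finally show ?thesis by simp
  qed
  then show "AE z in gauss. norm ((\<bar>z\<bar> + 1) ^ j) \<le> norm (\<bar>z\<bar>^4 + 4 * \<bar>z\<bar>^3 + 6 * \<bar>z\<bar>^2 + 4 * \<bar>z\<bar>^1 + 1)" by simp
qed simp

abbreviation gmom :: "nat \<Rightarrow> real" where "gmom j \<equiv> (\<integral>z. (\<bar>z\<bar> + 1)^j \<partial>gauss)"

locale rwg = target f f1 f2 f3 L for f f1 f2 f3 L +
  fixes D k :: nat and \<sigma> :: real
  assumes k: "1 \<le> k" "k \<le> D" and \<sigma>: "0 < \<sigma>"
begin

abbreviation noise :: "((nat set \<times> (nat \<Rightarrow> real)) \<times> real) measure" where "noise \<equiv> step_noise D k"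
abbreviation bias :: "(nat \<Rightarrow> real) \<Rightarrow> real" where "bias \<equiv> drift D k \<sigma>"

definition mart :: "(nat \<Rightarrow> real) \<Rightarrow> (nat set \<times> (nat \<Rightarrow> real)) \<times> real \<Rightarrow> real" where
  "mart x n = rwg_step f D \<sigma> x n 0 - x 0 - bias x"
text \<open>The summand 1 accounts for the bias, which is at most \<open>\<sigma>\<close> because
  |Bq| is at most 1.\<close>

definition env :: "(nat set \<times> (nat \<Rightarrow> real)) \<times> real \<Rightarrow> real" where
  "env n = \<sigma> * (\<bar>snd (fst n) 0\<bar> + 1)"

lemma abs_increment_le: "\<bar>rwg_step f D \<sigma> x n 0 - x 0\<bar> \<le> \<sigma> * \<bar>snd (fst n) 0\<bar>"
  using \<sigma> by (auto simp: rwg_step_def Let_def abs_mult)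

lemma bias_le: "\<bar>bias x\<bar> \<le> \<sigma>"
  unfolding drift_msq_eq(1)[OF k]
proof (rule measure_pmf.abs_integral_le)
  fix A show "\<bar>if 0 \<in> A then \<sigma> * Bq \<sigma> (A - {0}) x else 0\<bar> \<le> \<sigma>"
    using \<sigma> Vq_Bq_bounds(2)[of \<sigma> "A - {0}" x] by (simp add: abs_mult mult_left_le)
qed

sublocale chain: stationary_chain mu noise "rwg_step f D \<sigma>" by (rule stationary_chain_rwg[OF k(2)])

lemma increment_measurable[measurable]:
  "(\<lambda>w. rwg_step f D \<sigma> (fst w) (snd w) 0 - fst w 0) \<in> borel_measurable (mu \<Otimes>\<^sub>M noise)"
proof -
  have "(\<lambda>w. rwg_step f D \<sigma> (fst w) (snd w)) \<in> mu \<Otimes>\<^sub>M noise \<rightarrow>\<^sub>M mu"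
    using chain.step_measurable by (simp add: split_beta')
  note [measurable] = measurable_mu_component[OF this, of 0] measurable_mu_component[OF measurable_fst, where i=0]
  show ?thesis by measurable
qed

lemma bias_measurable[measurable]: "bias \<in> borel_measurable mu"
  unfolding drift_def[abs_def]
  by (rule chain.V.borel_measurable_lebesgue_integral) (simp add: split_beta' increment_measurable)

lemma increment_sect: "x \<in> space mu \<Longrightarrow> (\<lambda>n. rwg_step f D \<sigma> x n 0 - x 0) \<in> borel_measurable noise"
  using measurable_compose[OF _ increment_measurable, of "\<lambda>n. (x, n)" noise] by simp

lemma env_moments: "j \<le> 4 \<Longrightarrow> integrable noise (\<lambda>n. env n ^ j)"
  "j \<le> 4 \<Longrightarrow> (\<integral>n. env n ^ j \<partial>noise) = \<sigma>^j * gmom j"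
  using integral_step_noise_coord0[OF std_normal_abs_shift_moment[of j], of D k]
  by (simp_all add: env_def power_mult_distrib)

lemma abs_mart_le: "\<bar>mart x n\<bar> \<le> env n"
  using abs_increment_le[of x n] bias_le[of x] unfolding mart_def env_def distrib_left by linarith

lemma env_measurable[measurable]: "env \<in> borel_measurable noise"
  using borel_measurable_integrable[OF env_moments(1)[of 1]] by simp

lemma increment_integrable:
  assumes x: "x \<in> space mu"
  shows "integrable noise (\<lambda>n. rwg_step f D \<sigma> x n 0 - x 0)" "integrable noise (\<lambda>n. (rwg_step f D \<sigma> x n 0 - x 0)\<^sup>2)"
proof -
  note [measurable] = increment_sect[OF x]
  have le: "\<bar>rwg_step f D \<sigma> x n 0 - x 0\<bar> \<le> env n" for n
    using abs_increment_le[of x n] \<sigma> unfolding env_def distrib_left by linarith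
  have "\<bar>rwg_step f D \<sigma> x n 0 - x 0\<bar>\<^sup>2 \<le> (env n)\<^sup>2" for n by (rule power_mono[OF le abs_ge_zero])
  then show "integrable noise (\<lambda>n. (rwg_step f D \<sigma> x n 0 - x 0)\<^sup>2)"
    by (intro Bochner_Integration.integrable_bound[OF env_moments(1)[of 2]]) auto
  have "norm (rwg_step f D \<sigma> x n 0 - x 0) \<le> norm (env n ^ 1)" for n using le[of n] by simp
  then show "integrable noise (\<lambda>n. rwg_step f D \<sigma> x n 0 - x 0)"
    by (intro Bochner_Integration.integrable_bound[OF env_moments(1)[of 1]]) auto
qed

sublocale chain: stationary_martingale mu noise "rwg_step f D \<sigma>" mart env
proof
  show "(\<lambda>(x, n). mart x n) \<in> borel_measurable (mu \<Otimes>\<^sub>M noise)"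
    unfolding mart_def split_beta' by measurable
  show "\<bar>mart x n\<bar> \<le> env n" for x n by (rule abs_mart_le)
  show "integrable noise (\<lambda>n. env n ^ 4)" by (rule env_moments) simp
  show "(\<integral>n. mart x n \<partial>noise) = 0" if "x \<in> space mu" for x
    using increment_integrable(1)[OF that] by (simp add: mart_def drift_def chain.V.prob_space)
qed measurable

lemma v_eq: "x \<in> space mu \<Longrightarrow> chain.v x = msq D k \<sigma> x - (bias x)\<^sup>2"
proof -
  assume x: "x \<in> space mu"
  note i = increment_integrable[OF x]
  have "(mart x n)\<^sup>2 = (rwg_step f D \<sigma> x n 0 - x 0)\<^sup>2 - 2 * bias x * (rwg_step f D \<sigma> x n 0 - x 0) + (bias x)\<^sup>2" for n
    by (simp add: mart_def power2_eq_square algebra_simps)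
  then have "chain.v x = (\<integral>n. (rwg_step f D \<sigma> x n 0 - x 0)\<^sup>2 - 2 * bias x * (rwg_step f D \<sigma> x n 0 - x 0) + (bias x)\<^sup>2 \<partial>noise)"
    unfolding chain.v_def by simp
  also have "\<dots> = msq D k \<sigma> x - 2 * bias x * bias x + (bias x)\<^sup>2"
    using i unfolding msq_def drift_def by (simp add: chain.V.prob_space)
  finally show ?thesis by (simp add: power2_eq_square)
qed

lemma Q_eq: "chain.Q = rwg_space f D k" by (simp add: chain.Q_def rwg_space_def)

lemma X_eq: "chain.X \<omega> j = rwg_chain f D \<sigma> \<omega> j" by (induction j) simp_all

lemma U_proc_eq: "U_proc f D \<sigma> \<omega> = pth D (\<lambda>j. chain.X \<omega> j 0)"
  by (rule ext) (simp add: U_proc_def pth_def X_eq)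

lemma coord_X_measurable[measurable]: "(\<lambda>\<omega>. chain.X \<omega> j 0) \<in> borel_measurable chain.Q"
  by (rule measurable_mu_component[OF chain.measurable_X])

text \<open>Conditional variance and second moment differ by the square of the bias, and one of its
  two factors is at most \<open>\<sigma>\<close>.\<close>

lemma integral_v_le:
  "(\<integral>x. \<bar>chain.v x - c\<bar> \<partial>mu) \<le> (\<integral>x. \<bar>msq D k \<sigma> x - c\<bar> \<partial>mu) + \<sigma> * (\<integral>x. \<bar>bias x\<bar> \<partial>mu)"
proof -
  have msq_b: "\<bar>msq D k \<sigma> x\<bar> \<le> \<sigma>\<^sup>2" for x
    unfolding drift_msq_eq(2)[OF k]
  proof (rule measure_pmf.abs_integral_le)
    fix A show "\<bar>if 0 \<in> A then \<sigma>\<^sup>2 * Vq \<sigma> (A - {0}) x else 0\<bar> \<le> \<sigma>\<^sup>2"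
      using Vq_Bq_bounds(1)[of \<sigma> "A - {0}" x] by (simp add: abs_mult mult_left_le)
  qed
  have [measurable]: "(\<lambda>x. msq D k \<sigma> x) \<in> borel_measurable mu"
    unfolding msq_def[abs_def]
    by (rule chain.V.borel_measurable_lebesgue_integral) (simp add: split_beta' borel_measurable_power[OF increment_measurable])
  have i: "integrable mu (\<lambda>x. \<bar>msq D k \<sigma> x - c\<bar>)"
    by (intro integrable_abs Bochner_Integration.integrable_diff mu.integrable_const mu.integrable_const_bound[where B="\<sigma>\<^sup>2"]) (auto simp: msq_b)
  have j: "integrable mu (\<lambda>x. \<bar>bias x\<bar>)"
    by (rule mu.integrable_const_bound[where B="\<sigma>"]) (auto simp: bias_le)
  have le: "\<bar>chain.v x - c\<bar> \<le> \<bar>msq D k \<sigma> x - c\<bar> + \<sigma> * \<bar>bias x\<bar>" if "x \<in> space mu" for x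
  proof -
    have "(bias x)\<^sup>2 \<le> \<sigma> * \<bar>bias x\<bar>"
      using mult_right_mono[OF bias_le[of x] abs_ge_zero[of "bias x"]] by (simp add: power2_eq_square abs_mult_self_eq)
    moreover have "0 \<le> (bias x)\<^sup>2" by simp
    ultimately show ?thesis unfolding v_eq[OF that] by linarith
  qed
  have "(\<integral>x. \<bar>chain.v x - c\<bar> \<partial>mu) \<le> (\<integral>x. \<bar>msq D k \<sigma> x - c\<bar> + \<sigma> * \<bar>bias x\<bar> \<partial>mu)"
  proof (rule integral_mono')
    show "integrable mu (\<lambda>x. \<bar>msq D k \<sigma> x - c\<bar> + \<sigma> * \<bar>bias x\<bar>)" using i j by simp
  qed (use le \<sigma> in auto)
  then show ?thesis using i j by simp
qed

end

lemma lip_func_eul_measurable: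
  assumes G: "lip_func K C T G" and [measurable]: "\<beta> \<in> borel_measurable borel"
    "x \<in> borel_measurable M" "\<And>j. (\<lambda>w. a w j) \<in> borel_measurable M"
  shows "(\<lambda>w. G (pth n (eul n \<beta> (x w) (a w)))) \<in> borel_measurable M"
proof -
  have "(\<lambda>w. eul n \<beta> (x w) (a w)) \<in> M \<rightarrow>\<^sub>M PiM UNIV (\<lambda>_. borel)"
    by (intro measurable_to_PiM_UNIV eul_measurable) auto
  then show ?thesis by (rule measurable_compose[OF _ borel_measurable_lip_func_pth[OF G]])
qed

text \<open>By Gronwall's inequality the functional is Lipschitz in the driving increments with a
  constant that does not depend on \<open>n\<close>. This is the regularity that the replacement
  argument asks for.\<close>

lemma lip_func_eul_lipschitz:
  assumes G: "lip_func K C T G" and Lb: "0 \<le> Lb" "\<And>x y. \<bar>\<beta> x - \<beta> y\<bar> \<le> Lb * \<bar>x - y\<bar>" and n: "0 < n"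
  shows "\<bar>G (pth n (eul n \<beta> x a)) - G (pth n (eul n \<beta> x b))\<bar> \<le> C * exp (Lb * real T) * (\<Sum>j<n * T. \<bar>a j - b j\<bar>)"
proof -
  let ?r = "exp (Lb * real T) * (\<Sum>j<n * T. \<bar>a j - b j\<bar>)"
  have r: "0 \<le> ?r" by (intro mult_nonneg_nonneg sum_nonneg) auto
  have eul: "\<bar>eul n \<beta> x a i - eul n \<beta> x b i\<bar> \<le> ?r" if i: "i \<le> n * T" for i
  proof (rule order_trans[OF eul_lipschitz[OF Lb n]], rule mult_mono)
    have "real i \<le> real (n * T)" using i by (simp only: of_nat_le_iff)
    then have "real i / real n \<le> real T" using n by (simp add: pos_divide_le_eq mult.commute)
    then have "Lb * (real i / real n) \<le> Lb * real T" using Lb(1) by (rule mult_left_mono)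
    then show "exp (Lb / real n * real i) \<le> exp (Lb * real T)" by simp
    show "(\<Sum>j<i. \<bar>a j - b j\<bar>) \<le> (\<Sum>j<n * T. \<bar>a j - b j\<bar>)" using i by (intro sum_mono2) auto
  qed (auto intro: sum_nonneg)
  have "\<bar>G (pth n (eul n \<beta> x a)) - G (pth n (eul n \<beta> x b))\<bar> \<le> C * ?r"
    using G r pth_close[of n T "eul n \<beta> x a" "eul n \<beta> x b", OF eul] cadlag_pth unfolding lip_func_def by blast
  then show ?thesis by (simp add: mult.assoc)
qed

definition (in target) euler_law :: "((real \<Rightarrow> real) \<Rightarrow> real) \<Rightarrow> nat \<Rightarrow> (real \<Rightarrow> real) \<Rightarrow> (nat \<Rightarrow> real) \<Rightarrow> real" where
  "euler_law H n \<beta> s = (\<integral>x. \<integral>\<xi>. H (pth n (eul n \<beta> x (\<lambda>j. s j * \<xi> j))) \<partial>gauss_seq \<partial>fm)"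

lemma (in target) euler_law_measurable:
  assumes H: "lip_func K C T H" and [measurable]: "\<beta> \<in> borel_measurable borel"
  shows "(\<lambda>w. H (pth n (eul n \<beta> (fst w) (\<lambda>j. s j * snd w j)))) \<in> borel_measurable (fm \<Otimes>\<^sub>M gauss_seq)"
    and "integrable fm (\<lambda>x. \<integral>\<xi>. H (pth n (eul n \<beta> x (\<lambda>j. s j * \<xi> j))) \<partial>gauss_seq)" (is "integrable _ ?p")
proof -
  show m: "(\<lambda>w. H (pth n (eul n \<beta> (fst w) (\<lambda>j. s j * snd w j)))) \<in> borel_measurable (fm \<Otimes>\<^sub>M gauss_seq)"
  proof (rule lip_func_eul_measurable[OF H])
    show "(\<lambda>w. s j * snd w j) \<in> borel_measurable (fm \<Otimes>\<^sub>M gauss_seq)" for j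
      by (intro borel_measurable_times borel_measurable_const measurable_seq_component[OF measurable_snd])
    have "fst \<in> fm \<Otimes>\<^sub>M gauss_seq \<rightarrow>\<^sub>M fm" by simp
    then show "fst \<in> borel_measurable (fm \<Otimes>\<^sub>M gauss_seq)" by simp
  qed measurable
  show "integrable fm ?p"
  proof (rule fm.integrable_const_bound[where B=K])
    show "?p \<in> borel_measurable fm"
      using m by (intro gauss_seq.borel_measurable_lebesgue_integral) (simp add: split_beta')
    show "AE x in fm. norm (?p x) \<le> K"
      unfolding real_norm_def
      by (rule AE_I2, rule gauss_seq.abs_integral_le) (use H cadlag_pth in \<open>auto simp: lip_func_def\<close>)
  qed
qed

section \<open>Chain and Euler scheme on a good event\<close>

locale rwg_drift = rwg f f1 f2 f3 L D k \<sigma> for f f1 f2 f3 L D k \<sigma> +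
  fixes \<beta> :: "real \<Rightarrow> real" and Lb :: real
  assumes Lb: "0 \<le> Lb" "\<And>x y. \<bar>\<beta> x - \<beta> y\<bar> \<le> Lb * \<bar>x - y\<bar>"
    and beta_measurable[measurable]: "\<beta> \<in> borel_measurable borel" and beta2: "integrable fm (\<lambda>a. (\<beta> a)\<^sup>2)"
begin

definition err :: "(nat \<Rightarrow> real) \<Rightarrow> real" where "err x = bias x - \<beta> (x 0) / real D"

lemma D_pos: "0 < real D" using k by simp

lemma coord_stationary:
  fixes p :: "real \<Rightarrow> real"
  assumes p: "integrable fm p"
  shows "integrable chain.Q (\<lambda>\<omega>. p (chain.X \<omega> i 0))" "(\<integral>\<omega>. p (chain.X \<omega> i 0) \<partial>chain.Q) = (\<integral>a. p a \<partial>fm)"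
proof -
  note i = integral_mu_coord0[OF p]
  have m: "(\<lambda>x. p (x 0)) \<in> borel_measurable mu" by (rule borel_measurable_integrable[OF i(1)])
  show "integrable chain.Q (\<lambda>\<omega>. p (chain.X \<omega> i 0))" using chain.integrable_X[OF m, of i] i(1) by simp
  show "(\<integral>\<omega>. p (chain.X \<omega> i 0) \<partial>chain.Q) = (\<integral>a. p a \<partial>fm)" using chain.integral_X[OF m, of i] i(2) by simp
qed

lemma beta_integrable: "integrable fm \<beta>" by (rule fm.L1_le_L2(1)[OF _ beta2]) simp

lemma err_measurable[measurable]: "err \<in> borel_measurable mu"
  unfolding err_def[abs_def] by measurable

lemma err_integrable: "integrable mu (\<lambda>x. \<bar>err x\<bar>)"
proof -
  have "integrable mu bias" by (rule mu.integrable_const_bound[where B="\<sigma>"]) (auto simp: bias_le)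
  then show ?thesis unfolding err_def
    by (intro integrable_abs Bochner_Integration.integrable_diff integrable_divide integral_mu_coord0(1) beta_integrable)
qed

lemma X_recursion: "chain.X \<omega> (Suc i) 0
  = chain.X \<omega> i 0 + (chain.S \<omega> (Suc i) - chain.S \<omega> i) + \<beta> (chain.X \<omega> i 0) / real D + err (chain.X \<omega> i)"
  by (simp add: chain.S_def mart_def err_def)

text \<open>Cauchy-Schwarz bounds the square of the sum before Markov's inequality is used, so that
  the probability is quadratic in the block length, as in the maximal inequality.\<close>

lemma drift_block_prob:
  assumes r: "r \<le> r'" and \<theta>: "0 < \<theta>"
  shows "{\<omega> \<in> space chain.Q. \<theta> \<le> (\<Sum>i\<in>{r..<r'}. \<bar>\<beta> (chain.X \<omega> i 0)\<bar> / real D)} \<in> sets chain.Q"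
    and "chain.Q.prob {\<omega> \<in> space chain.Q. \<theta> \<le> (\<Sum>i\<in>{r..<r'}. \<bar>\<beta> (chain.X \<omega> i 0)\<bar> / real D)}
    \<le> (real (r' - r) / real D)\<^sup>2 * (\<integral>a. (\<beta> a)\<^sup>2 \<partial>fm) / \<theta>\<^sup>2"
proof -
  let ?Y = "\<lambda>\<omega>. \<Sum>i\<in>{r..<r'}. \<bar>\<beta> (chain.X \<omega> i 0)\<bar> / real D"
  let ?Z = "\<lambda>\<omega>. real (r' - r) / (real D)\<^sup>2 * (\<Sum>i\<in>{r..<r'}. (\<beta> (chain.X \<omega> i 0))\<^sup>2)"
  show "{\<omega> \<in> space chain.Q. \<theta> \<le> ?Y \<omega>} \<in> sets chain.Q" by measurable
  have le: "(?Y \<omega>)\<^sup>2 \<le> ?Z \<omega>" for \<omega>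
  proof -
    have "(\<Sum>i\<in>{r..<r'}. 1 * \<bar>\<beta> (chain.X \<omega> i 0)\<bar>)\<^sup>2 \<le> (\<Sum>i\<in>{r..<r'}. 1\<^sup>2) * (\<Sum>i\<in>{r..<r'}. \<bar>\<beta> (chain.X \<omega> i 0)\<bar>\<^sup>2)"
      by (rule Cauchy_Schwarz_ineq_sum)
    then have "(\<Sum>i\<in>{r..<r'}. \<bar>\<beta> (chain.X \<omega> i 0)\<bar>)\<^sup>2 / (real D)\<^sup>2
        \<le> (real (r' - r) * (\<Sum>i\<in>{r..<r'}. (\<beta> (chain.X \<omega> i 0))\<^sup>2)) / (real D)\<^sup>2"
      by (intro divide_right_mono) auto
    then show ?thesis by (simp add: power_divide flip: sum_divide_distrib)
  qed
  have Z: "integrable chain.Q ?Z"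
    by (intro integrable_mult_right Bochner_Integration.integrable_sum coord_stationary(1)[of "\<lambda>a. (\<beta> a)\<^sup>2"] beta2)
  have "chain.Q.prob {\<omega> \<in> space chain.Q. \<theta> \<le> ?Y \<omega>} \<le> chain.Q.prob {\<omega> \<in> space chain.Q. \<theta>\<^sup>2 \<le> ?Z \<omega>}"
  proof (rule chain.Q.finite_measure_mono)
    show "{\<omega> \<in> space chain.Q. \<theta> \<le> ?Y \<omega>} \<subseteq> {\<omega> \<in> space chain.Q. \<theta>\<^sup>2 \<le> ?Z \<omega>}"
    proof (rule Collect_mono, rule impI, elim conjE, rule conjI)
      fix \<omega> assume "\<theta> \<le> ?Y \<omega>"
      then have "\<theta>\<^sup>2 \<le> (?Y \<omega>)\<^sup>2" using \<theta> by (intro power_mono) auto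
      then show "\<theta>\<^sup>2 \<le> ?Z \<omega>" by (rule order_trans[OF _ le])
    qed
    show "{\<omega> \<in> space chain.Q. \<theta>\<^sup>2 \<le> ?Z \<omega>} \<in> sets chain.Q" by measurable
  qed
  also have "\<dots> \<le> (\<integral>\<omega>. ?Z \<omega> \<partial>chain.Q) / \<theta>\<^sup>2"
    using \<theta> by (intro integral_Markov_inequality_measure[where A="{}"] Z AE_I2 mult_nonneg_nonneg sum_nonneg) auto
  also have "(\<integral>\<omega>. ?Z \<omega> \<partial>chain.Q) = real (r' - r) / (real D)\<^sup>2 * (real (r' - r) * (\<integral>a. (\<beta> a)\<^sup>2 \<partial>fm))"
    using coord_stationary[OF beta2] by (simp add: Bochner_Integration.integral_sum)
  finally show "chain.Q.prob {\<omega> \<in> space chain.Q. \<theta> \<le> ?Y \<omega>} \<le> (real (r' - r) / real D)\<^sup>2 * (\<integral>a. (\<beta> a)\<^sup>2 \<partial>fm) / \<theta>\<^sup>2"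
    by (simp add: power2_eq_square)
qed

text \<open>The event off which \<open>euler_comparison\<close> applies. Its four parts violate in
  turn the bounds on the martingale within a block, on the drift within a block, on the accumulated
  drift error and on the drift at the block starts.\<close>

definition bad :: "nat \<Rightarrow> nat \<Rightarrow> real \<Rightarrow> ((nat \<Rightarrow> real) \<times> (nat \<Rightarrow> (nat set \<times> (nat \<Rightarrow> real)) \<times> real)) set" where
  "bad n J \<theta> =
     (\<Union>j<J. {\<omega> \<in> space chain.Q. \<exists>i. (D * j) div n \<le> i \<and> i \<le> (D * Suc j) div n \<and> \<theta> \<le> \<bar>chain.S \<omega> i - chain.S \<omega> ((D * j) div n)\<bar>})
   \<union> (\<Union>j<J. {\<omega> \<in> space chain.Q. \<theta> \<le> (\<Sum>i\<in>{(D * j) div n..<(D * Suc j) div n}. \<bar>\<beta> (chain.X \<omega> i 0)\<bar> / real D)})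
   \<union> {\<omega> \<in> space chain.Q. \<theta> \<le> (\<Sum>i<(D * J) div n. \<bar>err (chain.X \<omega> i)\<bar>)}
   \<union> {\<omega> \<in> space chain.Q. \<theta> \<le> (\<Sum>j<J. \<bar>\<beta> (chain.X \<omega> ((D * j) div n) 0)\<bar> / real D)}"

lemma bad_sets: "bad n J \<theta> \<in> sets chain.Q"
proof -
  have [measurable]: "(\<lambda>\<omega>. err (chain.X \<omega> i)) \<in> borel_measurable chain.Q" for i
    by (rule measurable_compose[OF chain.measurable_X err_measurable])
  show ?thesis unfolding bad_def by measurable
qed

text \<open>With \<open>J\<close> proportional to \<open>n\<close>, the first term is of order 1/n
  uniformly in the dimension; the other two vanish as \<open>D\<close> grows with \<open>n\<close>
  fixed. The constants 28 and 4 contain the factor 4 from squaring the relative block length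
  2/n.\<close>

lemma prob_bad_le:
  assumes n: "0 < n" "n \<le> D" and \<theta>: "0 < \<theta>" and T: "J \<le> n * T"
  shows "chain.Q.prob (bad n J \<theta>) \<le>
     real J / (real n)\<^sup>2 * (28 * (real D * \<sigma>\<^sup>2)\<^sup>2 * gmom 4 / \<theta>^4
        + 4 * (\<integral>a. (\<beta> a)\<^sup>2 \<partial>fm) / \<theta>\<^sup>2)
     + real T * (real D * (\<integral>x. \<bar>err x\<bar> \<partial>mu)) / \<theta> + real J * (\<integral>a. \<bar>\<beta> a\<bar> \<partial>fm) / (real D * \<theta>)"
proof -
  let ?\<kappa> = "\<lambda>j. (D * j) div n"
  let ?c4 = "gmom 4" and ?B2 = "\<integral>a. (\<beta> a)\<^sup>2 \<partial>fm"
  let ?A1 = "\<lambda>j. {\<omega> \<in> space chain.Q. \<exists>i. ?\<kappa> j \<le> i \<and> i \<le> ?\<kappa> (Suc j) \<and> \<theta> \<le> \<bar>chain.S \<omega> i - chain.S \<omega> (?\<kappa> j)\<bar>}"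
  let ?A2 = "\<lambda>j. {\<omega> \<in> space chain.Q. \<theta> \<le> (\<Sum>i\<in>{?\<kappa> j..<?\<kappa> (Suc j)}. \<bar>\<beta> (chain.X \<omega> i 0)\<bar> / real D)}"
  let ?A3 = "{\<omega> \<in> space chain.Q. \<theta> \<le> (\<Sum>i<?\<kappa> J. \<bar>err (chain.X \<omega> i)\<bar>)}"
  let ?A4 = "{\<omega> \<in> space chain.Q. \<theta> \<le> (\<Sum>j<J. \<bar>\<beta> (chain.X \<omega> (?\<kappa> j) 0)\<bar> / real D)}"
  have [measurable]: "(\<lambda>\<omega>. err (chain.X \<omega> i)) \<in> borel_measurable chain.Q" for i
    by (rule measurable_compose[OF chain.measurable_X err_measurable])
  have [measurable]: "?A1 j \<in> sets chain.Q" "?A2 j \<in> sets chain.Q" "?A3 \<in> sets chain.Q" "?A4 \<in> sets chain.Q" for j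
    by measurable
  have le: "?\<kappa> j \<le> ?\<kappa> (Suc j)" for j by (rule grid_length(1)[OF n(1)])
  have len: "real (?\<kappa> (Suc j) - ?\<kappa> j) / real D \<le> 2 / real n" for j
  proof -
    \<comment> \<open>As \<open>n\<close> is at most \<open>D\<close>, the rounding error 1 of a
      block length is no larger than the length D/n itself.\<close>
    have "1 \<le> real D / real n" using n by simp
    then have "real (?\<kappa> (Suc j) - ?\<kappa> j) \<le> 2 * (real D / real n)"
      using grid_length(2)[OF n(1), of D j] by linarith
    then have "real (?\<kappa> (Suc j) - ?\<kappa> j) / real D \<le> 2 * (real D / real n) / real D"
      using D_pos by (intro divide_right_mono) auto
    then show ?thesis using D_pos by simp
  qed
  then have len2: "(real (?\<kappa> (Suc j) - ?\<kappa> j) / real D)\<^sup>2 \<le> 4 / (real n)\<^sup>2" for j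
    using power_mono[OF len[of j], of 2] by (simp add: power_divide)
  have c4: "0 \<le> ?c4" "0 \<le> ?B2" by (intro Bochner_Integration.integral_nonneg; simp)+
  have p1: "chain.Q.prob (?A1 j) \<le> 28 / (real n)\<^sup>2 * ((real D * \<sigma>\<^sup>2)\<^sup>2 * ?c4 / \<theta>^4)" for j
  proof -
    have "chain.Q.prob (?A1 j) \<le> 7 * (real (?\<kappa> (Suc j) - ?\<kappa> j))\<^sup>2 * (\<integral>n. env n ^ 4 \<partial>noise) / \<theta>^4"
      by (rule chain.maximal[OF le \<theta>])
    also have "\<dots> = 7 * ((real (?\<kappa> (Suc j) - ?\<kappa> j) / real D)\<^sup>2 * ((real D * \<sigma>\<^sup>2)\<^sup>2 * ?c4 / \<theta>^4))"
      using D_pos by (simp add: env_moments(2) power_divide power_mult_distrib)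
    also have "\<dots> \<le> 7 * (4 / (real n)\<^sup>2 * ((real D * \<sigma>\<^sup>2)\<^sup>2 * ?c4 / \<theta>^4))"
      using \<theta> c4 by (intro mult_left_mono mult_right_mono len2) auto
    finally show ?thesis by simp
  qed
  have p2: "chain.Q.prob (?A2 j) \<le> 4 / (real n)\<^sup>2 * (?B2 / \<theta>\<^sup>2)" for j
  proof -
    have "chain.Q.prob (?A2 j) \<le> (real (?\<kappa> (Suc j) - ?\<kappa> j) / real D)\<^sup>2 * ?B2 / \<theta>\<^sup>2"
      by (rule drift_block_prob(2)[OF le \<theta>])
    also have "\<dots> = (real (?\<kappa> (Suc j) - ?\<kappa> j) / real D)\<^sup>2 * (?B2 / \<theta>\<^sup>2)" by simp
    also have "\<dots> \<le> 4 / (real n)\<^sup>2 * (?B2 / \<theta>\<^sup>2)" using c4 by (intro mult_right_mono len2) auto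
    finally show ?thesis .
  qed
  have p3: "chain.Q.prob ?A3 \<le> real T * (real D * (\<integral>x. \<bar>err x\<bar> \<partial>mu)) / \<theta>"
  proof -
    have i: "integrable chain.Q (\<lambda>\<omega>. \<bar>err (chain.X \<omega> i)\<bar>)" "(\<integral>\<omega>. \<bar>err (chain.X \<omega> i)\<bar> \<partial>chain.Q) = (\<integral>x. \<bar>err x\<bar> \<partial>mu)" for i
      using err_integrable by (subst chain.integrable_X chain.integral_X; simp)+
    have "chain.Q.prob ?A3 \<le> (\<integral>\<omega>. (\<Sum>i<?\<kappa> J. \<bar>err (chain.X \<omega> i)\<bar>) \<partial>chain.Q) / \<theta>"
      using \<theta> i(1) by (intro integral_Markov_inequality_measure[where A="{}"] Bochner_Integration.integrable_sum AE_I2 sum_nonneg) auto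
    also have "(\<integral>\<omega>. (\<Sum>i<?\<kappa> J. \<bar>err (chain.X \<omega> i)\<bar>) \<partial>chain.Q) = real (?\<kappa> J) * (\<integral>x. \<bar>err x\<bar> \<partial>mu)"
      using i by (simp add: Bochner_Integration.integral_sum)
    also have "\<dots> \<le> (real T * real D) * (\<integral>x. \<bar>err x\<bar> \<partial>mu)"
    proof (rule mult_right_mono)
      have "?\<kappa> J \<le> (D * (n * T)) div n" by (intro div_le_mono mult_le_mono2 T)
      also have "\<dots> = T * D" using n by (simp add: mult.left_commute mult.commute)
      finally show "real (?\<kappa> J) \<le> real T * real D" by (metis of_nat_mono of_nat_mult)
    qed (intro Bochner_Integration.integral_nonneg abs_ge_zero)
    finally show ?thesis using \<theta> by (simp add: divide_right_mono mult.assoc)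
  qed
  have p4: "chain.Q.prob ?A4 \<le> real J * (\<integral>a. \<bar>\<beta> a\<bar> \<partial>fm) / (real D * \<theta>)"
  proof -
    have i: "integrable chain.Q (\<lambda>\<omega>. \<bar>\<beta> (chain.X \<omega> i 0)\<bar>)" "(\<integral>\<omega>. \<bar>\<beta> (chain.X \<omega> i 0)\<bar> \<partial>chain.Q) = (\<integral>a. \<bar>\<beta> a\<bar> \<partial>fm)" for i
      using coord_stationary[OF integrable_abs[OF beta_integrable], of i] by auto
    have "chain.Q.prob ?A4 \<le> (\<integral>\<omega>. (\<Sum>j<J. \<bar>\<beta> (chain.X \<omega> (?\<kappa> j) 0)\<bar> / real D) \<partial>chain.Q) / \<theta>"
      using \<theta> i(1) by (intro integral_Markov_inequality_measure[where A="{}"] Bochner_Integration.integrable_sum integrable_divide AE_I2 sum_nonneg) auto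
    also have "(\<integral>\<omega>. (\<Sum>j<J. \<bar>\<beta> (chain.X \<omega> (?\<kappa> j) 0)\<bar> / real D) \<partial>chain.Q) = (\<Sum>j<J. (\<integral>a. \<bar>\<beta> a\<bar> \<partial>fm) / real D)"
      using i by (subst Bochner_Integration.integral_sum) auto
    finally show ?thesis by simp
  qed
  have u1: "chain.Q.prob (\<Union>j<J. ?A1 j) \<le> (\<Sum>j<J. 28 / (real n)\<^sup>2 * ((real D * \<sigma>\<^sup>2)\<^sup>2 * ?c4 / \<theta>^4))"
    by (rule order_trans[OF chain.Q.finite_measure_subadditive_finite sum_mono[OF p1]]) auto
  have u2: "chain.Q.prob (\<Union>j<J. ?A2 j) \<le> (\<Sum>j<J. 4 / (real n)\<^sup>2 * (?B2 / \<theta>\<^sup>2))"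
    by (rule order_trans[OF chain.Q.finite_measure_subadditive_finite sum_mono[OF p2]]) auto
  let ?U1 = "\<Union>j<J. ?A1 j" and ?U2 = "\<Union>j<J. ?A2 j"
  have "chain.Q.prob (bad n J \<theta>) \<le> chain.Q.prob (?U1 \<union> ?U2 \<union> ?A3) + chain.Q.prob ?A4"
    unfolding bad_def by (rule measure_Un_le) measurable
  moreover have "chain.Q.prob (?U1 \<union> ?U2 \<union> ?A3) \<le> chain.Q.prob (?U1 \<union> ?U2) + chain.Q.prob ?A3"
    by (rule measure_Un_le) measurable
  moreover have "chain.Q.prob (?U1 \<union> ?U2) \<le> chain.Q.prob ?U1 + chain.Q.prob ?U2"
    by (rule measure_Un_le) measurable
  moreover have "real J / (real n)\<^sup>2 * (28 * (real D * \<sigma>\<^sup>2)\<^sup>2 * ?c4 / \<theta>^4 + 4 * ?B2 / \<theta>\<^sup>2)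
    = (\<Sum>j<J. 28 / (real n)\<^sup>2 * ((real D * \<sigma>\<^sup>2)\<^sup>2 * ?c4 / \<theta>^4)) + (\<Sum>j<J. 4 / (real n)\<^sup>2 * (?B2 / \<theta>\<^sup>2))"
    by (simp add: distrib_left)
  ultimately show ?thesis using u1 u2 p3 p4 by linarith
qed

text \<open>The time t = T falls into the block with index n T, so n T + 1 blocks are needed; this
  is why \<open>T + 1\<close> appears in the constants.\<close>

lemma path_comparison:
  assumes n: "0 < n" "n \<le> D" and \<theta>: "0 < \<theta>" and \<omega>: "\<omega> \<in> space chain.Q" "\<omega> \<notin> bad n (n * T + 1) \<theta>" and t: "t \<in> {0..real T}"
  defines "E \<equiv> eul n \<beta> (fst \<omega> 0) (\<lambda>j. chain.S \<omega> ((D * Suc j) div n) - chain.S \<omega> ((D * j) div n))"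
  shows "\<bar>U_proc f D \<sigma> \<omega> t - pth n E t\<bar> \<le> (3 + exp (Lb * (real T + 1)) * (6 * Lb * (real T + 1) + 2)) * \<theta>"
proof -
  let ?j = "nat \<lfloor>real n * t\<rfloor>" and ?i = "nat \<lfloor>real D * t\<rfloor>"
  have "\<bar>chain.X \<omega> ?i 0 - eul n \<beta> (chain.X \<omega> 0 0) (\<lambda>j. chain.S \<omega> ((D * Suc j) div n) - chain.S \<omega> ((D * j) div n)) ?j\<bar>
    \<le> (3 + exp (Lb * (real T + 1)) * (6 * Lb * (real T + 1) + 2)) * \<theta>"
  proof (rule euler_comparison[where X="\<lambda>i. chain.X \<omega> i 0" and S="chain.S \<omega>" and e="\<lambda>i. err (chain.X \<omega> i)" and J="n * T + 1",
        OF n Lb X_recursion less_imp_le[OF \<theta>]])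
    have ge: "\<bar>chain.S \<omega> i - chain.S \<omega> ((D * j) div n)\<bar> < \<theta>"
      if "j < n * T + 1" "(D * j) div n \<le> i" "i \<le> (D * Suc j) div n" for i j
    proof (rule ccontr)
      assume "\<not> \<bar>chain.S \<omega> i - chain.S \<omega> ((D * j) div n)\<bar> < \<theta>"
      then have "\<omega> \<in> bad n (n * T + 1) \<theta>" unfolding bad_def using \<omega>(1) that
        by (intro UnI1 UN_I[of j]) auto
      then show False using \<omega>(2) by simp
    qed
    then show "\<bar>chain.S \<omega> i - chain.S \<omega> ((D * j) div n)\<bar> \<le> \<theta>"
      if "j < n * T + 1" "(D * j) div n \<le> i" "i \<le> (D * Suc j) div n" for i j
      using that less_imp_le by blast
    show "(\<Sum>i\<in>{(D * j) div n..<(D * Suc j) div n}. \<bar>\<beta> (chain.X \<omega> i 0)\<bar> / real D) \<le> \<theta>" if "j < n * T + 1" for j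
    proof (rule ccontr)
      assume "\<not> ?thesis"
      then have "\<omega> \<in> bad n (n * T + 1) \<theta>" unfolding bad_def using \<omega>(1) that
        by (intro UnI1[OF UnI1[OF UnI2]] UN_I[of j]) auto
      then show False using \<omega>(2) by simp
    qed
    show "(\<Sum>i<(D * (n * T + 1)) div n. \<bar>err (chain.X \<omega> i)\<bar>) \<le> \<theta>"
    proof (rule ccontr)
      assume "\<not> ?thesis"
      then have "\<omega> \<in> bad n (n * T + 1) \<theta>" unfolding bad_def using \<omega>(1)
        by (intro UnI1[OF UnI2]) (auto simp del: mult_Suc_right)
      then show False using \<omega>(2) by simp
    qed
    show "(\<Sum>j<n * T + 1. \<bar>\<beta> (chain.X \<omega> ((D * j) div n) 0)\<bar> / real D) \<le> \<theta>"
    proof (rule ccontr)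
      assume "\<not> ?thesis"
      then have "\<omega> \<in> bad n (n * T + 1) \<theta>" unfolding bad_def using \<omega>(1)
        by (intro UnI2) (auto simp del: sum.lessThan_Suc)
      then show False using \<omega>(2) by simp
    qed
    have "1 \<le> real n" using n by simp
    then show "real (n * T + 1) \<le> real n * (real T + 1)" by (simp add: algebra_simps)
  qed (use grid_index(1)[OF n(1) t] grid_index(2,3)[OF n(1) t, of D] in auto)
  then show ?thesis by (simp add: U_proc_eq pth_def E_def)
qed

lemma U_proc_measurable:
  assumes "(\<lambda>e. H (pth D e)) \<in> borel_measurable (PiM UNIV (\<lambda>_::nat. borel))"
  shows "(\<lambda>\<omega>. H (U_proc f D \<sigma> \<omega>)) \<in> borel_measurable chain.Q"
  unfolding U_proc_eq by (rule measurable_compose[OF _ assms]) (intro measurable_to_PiM_UNIV coord_X_measurable)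

lemma fst_coord_measurable[measurable]: "(\<lambda>\<omega>. fst \<omega> 0) \<in> borel_measurable chain.Q"
  by (rule measurable_mu_component[OF chain.measurable_fst_Q])

lemma comparison:
  assumes H: "lip_func K C T H" and n: "0 < n" "n \<le> D" and \<theta>: "0 < \<theta>"
  shows "\<bar>(\<integral>\<omega>. H (U_proc f D \<sigma> \<omega>) \<partial>chain.Q)
     - (\<integral>\<omega>. H (pth n (eul n \<beta> (fst \<omega> 0) (\<lambda>j. chain.S \<omega> ((D * Suc j) div n) - chain.S \<omega> ((D * j) div n)))) \<partial>chain.Q)\<bar>
   \<le> C * ((3 + exp (Lb * (real T + 1)) * (6 * Lb * (real T + 1) + 2)) * \<theta>) + 2 * K * chain.Q.prob (bad n (n * T + 1) \<theta>)"
proof -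
  let ?A = "(3 + exp (Lb * (real T + 1)) * (6 * Lb * (real T + 1) + 2)) * \<theta>"
  let ?E = "\<lambda>\<omega>. pth n (eul n \<beta> (fst \<omega> 0) (\<lambda>j. chain.S \<omega> ((D * Suc j) div n) - chain.S \<omega> ((D * j) div n)))"
  let ?h = "\<lambda>\<omega>. C * ?A + 2 * K * indicator (bad n (n * T + 1) \<theta>) \<omega>"
  have K: "0 \<le> K" "0 \<le> C" "\<And>x. cadlag x \<Longrightarrow> \<bar>H x\<bar> \<le> K" using H by (auto simp: lip_func_def)
  have cad: "cadlag (U_proc f D \<sigma> \<omega>)" for \<omega> unfolding U_proc_eq by (rule cadlag_pth)
  have A: "0 \<le> ?A" using Lb(1) \<theta> by (intro mult_nonneg_nonneg add_nonneg_nonneg) auto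
  have "\<bar>(\<integral>\<omega>. H (U_proc f D \<sigma> \<omega>) \<partial>chain.Q) - (\<integral>\<omega>. H (?E \<omega>) \<partial>chain.Q)\<bar> \<le> (\<integral>\<omega>. ?h \<omega> \<partial>chain.Q)"
  proof (rule chain.Q.abs_integral_diff_le)
    show "integrable chain.Q (\<lambda>\<omega>. H (U_proc f D \<sigma> \<omega>))"
      by (rule chain.Q.integrable_const_bound[where B=K])
        (use K(3) cad in \<open>auto intro: U_proc_measurable borel_measurable_lip_func_pth[OF H]\<close>)
    show "integrable chain.Q (\<lambda>\<omega>. H (?E \<omega>))"
    proof (rule chain.Q.integrable_const_bound[where B=K])
      show "(\<lambda>\<omega>. H (?E \<omega>)) \<in> borel_measurable chain.Q"
        by (rule lip_func_eul_measurable[OF H]) measurable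
    qed (use K(3) cadlag_pth in auto)
    show "integrable chain.Q ?h"
      using bad_sets chain.Q.integrable_const by (intro Bochner_Integration.integrable_add integrable_mult_right integrable_real_indicator) (auto simp: chain.Q.emeasure_eq_measure)
    fix \<omega> assume \<omega>: "\<omega> \<in> space chain.Q"
    show "\<bar>H (U_proc f D \<sigma> \<omega>) - H (?E \<omega>)\<bar> \<le> ?h \<omega>"
    proof (cases "\<omega> \<in> bad n (n * T + 1) \<theta>")
      case True
      have "\<bar>H (U_proc f D \<sigma> \<omega>) - H (?E \<omega>)\<bar> \<le> 2 * K"
        using K(3)[OF cad[of \<omega>]] K(3)[OF cadlag_pth[of n "eul n \<beta> (fst \<omega> 0) (\<lambda>j. chain.S \<omega> ((D * Suc j) div n) - chain.S \<omega> ((D * j) div n))"]]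
        by linarith
      moreover have "0 \<le> C * ?A" by (rule mult_nonneg_nonneg[OF K(2) A])
      ultimately show ?thesis using True by simp
    next
      case False
      have "\<forall>t\<in>{0..real T}. \<bar>U_proc f D \<sigma> \<omega> t - ?E \<omega> t\<bar> \<le> ?A"
        using path_comparison[OF n \<theta> \<omega> False] by blast
      then have "\<bar>H (U_proc f D \<sigma> \<omega>) - H (?E \<omega>)\<bar> \<le> C * ?A"
        using H A cad cadlag_pth unfolding lip_func_def by blast
      then show ?thesis using False by simp
    qed
  qed
  also have "(\<integral>\<omega>. ?h \<omega> \<partial>chain.Q) = C * ?A + 2 * K * chain.Q.prob (bad n (n * T + 1) \<theta>)"
    using bad_sets by (subst Bochner_Integration.integral_add) (auto simp: chain.Q.prob_space chain.Q.emeasure_eq_measure intro!: integrable_real_indicator)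
  finally show ?thesis .
qed

lemma lindeberg:
  assumes H: "lip_func K C T H" and n: "0 < n" and e: "0 < e" and h: "0 \<le> h"
  shows "\<bar>(\<integral>\<omega>. H (pth n (eul n \<beta> (fst \<omega> 0) (\<lambda>j. chain.S \<omega> ((D * Suc j) div n) - chain.S \<omega> ((D * j) div n)))) \<partial>chain.Q)
     - (\<integral>x. \<integral>\<xi>. H (pth n (eul n \<beta> x (\<lambda>j. sqrt (h * real ((D * Suc j) div n - (D * j) div n)) * \<xi> j))) \<partial>gauss_seq \<partial>fm)\<bar>
   \<le> real (n * T) * (2 * (C * exp (Lb * real T)) * e) + real T * (real D * chain.lindeberg_error K e h)"
proof -
  let ?\<kappa> = "\<lambda>j. (D * j) div n"
  let ?s = "\<lambda>j. sqrt (h * real (?\<kappa> (Suc j) - ?\<kappa> j))"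
  let ?p = "\<lambda>x. \<integral>\<xi>. H (pth n (eul n \<beta> x (\<lambda>j. ?s j * \<xi> j))) \<partial>gauss_seq"
  have K: "0 \<le> K" "0 \<le> C" "\<And>x. cadlag x \<Longrightarrow> \<bar>H x\<bar> \<le> K" using H by (auto simp: lip_func_def)
  have "\<bar>(\<integral>\<omega>. H (pth n (eul n \<beta> (fst \<omega> 0) (\<lambda>j. chain.S \<omega> (?\<kappa> (Suc j)) - chain.S \<omega> (?\<kappa> j)))) \<partial>chain.Q)
     - (\<integral>\<omega>. ?p (fst \<omega> 0) \<partial>chain.Q)\<bar>
   \<le> real (n * T) * (2 * (C * exp (Lb * real T)) * e) + real (?\<kappa> (n * T) - ?\<kappa> 0) * chain.lindeberg_error K e h"
  proof (rule chain.hybrid[where G="\<lambda>\<omega> a. H (pth n (eul n \<beta> (fst \<omega> 0) a))" and \<kappa>="?\<kappa>" and J="n * T"])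
    have [measurable]: "(\<lambda>w. fst (fst w) 0) \<in> borel_measurable (chain.Q \<Otimes>\<^sub>M PiM UNIV (\<lambda>_::nat. borel :: real measure))"
      by (rule measurable_compose[OF measurable_fst fst_coord_measurable])
    show "(\<lambda>(\<omega>, a). H (pth n (eul n \<beta> (fst \<omega> 0) a))) \<in> borel_measurable (chain.Q \<Otimes>\<^sub>M PiM UNIV (\<lambda>_. borel))"
      unfolding split_beta' by (rule lip_func_eul_measurable[OF H]) measurable
    show "\<bar>H (pth n (eul n \<beta> (fst \<omega> 0) a))\<bar> \<le> K" for \<omega> a by (rule K(3)[OF cadlag_pth])
    show "chain.adapted 0 (\<lambda>\<omega> a. H (pth n (eul n \<beta> (fst \<omega> 0) a)))" by (simp add: chain.adapted_def chain.upd_def)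
    show "\<bar>H (pth n (eul n \<beta> (fst \<omega> 0) a)) - H (pth n (eul n \<beta> (fst \<omega> 0) b))\<bar>
        \<le> C * exp (Lb * real T) * (\<Sum>j<n * T. \<bar>a j - b j\<bar>)" for \<omega> a b
      by (rule lip_func_eul_lipschitz[OF H Lb n])
    show "mono ?\<kappa>" by (intro monoI div_le_mono mult_le_mono2)
  qed (use K e h in auto)
  also have "(\<integral>\<omega>. ?p (fst \<omega> 0) \<partial>chain.Q) = (\<integral>x. ?p x \<partial>fm)"
  proof -
    have "integrable fm ?p" by (rule euler_law_measurable(2)[OF H beta_measurable])
    then show ?thesis using coord_stationary(2)[of ?p 0] by simp
  qed
  also have "real (?\<kappa> (n * T) - ?\<kappa> 0) = real T * real D"
    using n by (simp add: mult.left_commute[of D n T] mult.commute)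
  finally show ?thesis by (simp only: mult.assoc)
qed

end

text \<open>Serves to replace the block variances, uneven through the rounding of the grid, by
  \<open>h / n\<close>.\<close>

lemma (in target) euler_law_lipschitz:
  assumes H: "lip_func K C T H" and n: "0 < n" and [measurable]: "\<beta> \<in> borel_measurable borel"
    and Lb: "0 \<le> Lb" "\<And>x y. \<bar>\<beta> x - \<beta> y\<bar> \<le> Lb * \<bar>x - y\<bar>"
  shows "\<bar>euler_law H n \<beta> s - euler_law H n \<beta> s'\<bar>
    \<le> C * exp (Lb * real T) * (\<Sum>j<n * T. \<bar>s j - s' j\<bar> * (\<integral>z. \<bar>z\<bar> \<partial>gauss))"
proof -
  let ?p = "\<lambda>s x. \<integral>\<xi>. H (pth n (eul n \<beta> x (\<lambda>j. s j * \<xi> j))) \<partial>gauss_seq"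
  let ?R = "C * exp (Lb * real T) * (\<Sum>j<n * T. \<bar>s j - s' j\<bar> * (\<integral>z. \<bar>z\<bar> \<partial>gauss))"
  let ?h = "\<lambda>\<xi>. C * exp (Lb * real T) * (\<Sum>j<n * T. \<bar>s j - s' j\<bar> * \<bar>\<xi> j\<bar>)"
  have K: "0 \<le> K" "0 \<le> C" "\<And>x. cadlag x \<Longrightarrow> \<bar>H x\<bar> \<le> K" using H by (auto simp: lip_func_def)
  have Kp: "\<bar>H (pth n e)\<bar> \<le> K" for e by (rule K(3)[OF cadlag_pth])
  note m = euler_law_measurable[OF H \<open>\<beta> \<in> borel_measurable borel\<close>]
  have i2: "integrable gauss_seq (\<lambda>\<xi>. H (pth n (eul n \<beta> x (\<lambda>j. s j * \<xi> j))))" for s x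
  proof (rule gauss_seq.integrable_const_bound[where B=K])
    show "(\<lambda>\<xi>. H (pth n (eul n \<beta> x (\<lambda>j. s j * \<xi> j)))) \<in> borel_measurable gauss_seq"
      using measurable_compose[OF _ m(1), of "\<lambda>\<xi>. (x, \<xi>)" gauss_seq] by simp
  qed (simp add: Kp)
  note z = std_normal.integrable_const integral_coord[OF abs_pow_integrals(2)]
  have ih: "integrable gauss_seq ?h"
    by (intro integrable_mult_right Bochner_Integration.integrable_sum z(2))
  have eh: "(\<integral>\<xi>. ?h \<xi> \<partial>gauss_seq) = ?R"
    using z(2,3) by (simp add: Bochner_Integration.integral_sum)
  have "\<bar>?p s x - ?p s' x\<bar> \<le> ?R" for x
  proof -
    have "\<bar>?p s x - ?p s' x\<bar> \<le> (\<integral>\<xi>. ?h \<xi> \<partial>gauss_seq)"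
    proof (rule gauss_seq.abs_integral_diff_le[OF i2 i2 ih])
      fix \<xi> :: "nat \<Rightarrow> real"
      show "\<bar>H (pth n (eul n \<beta> x (\<lambda>j. s j * \<xi> j))) - H (pth n (eul n \<beta> x (\<lambda>j. s' j * \<xi> j)))\<bar> \<le> ?h \<xi>"
        using lip_func_eul_lipschitz[OF H Lb n, of x "\<lambda>j. s j * \<xi> j" "\<lambda>j. s' j * \<xi> j"]
        by (simp add: abs_mult flip: left_diff_distrib)
    qed
    then show ?thesis unfolding eh .
  qed
  then have "\<bar>(\<integral>x. ?p s x \<partial>fm) - (\<integral>x. ?p s' x \<partial>fm)\<bar> \<le> (\<integral>x. ?R \<partial>fm)"
    by (intro fm.abs_integral_diff_le m(2) fm.integrable_const) auto
  then show ?thesis unfolding euler_law_def using fm.prob_space by simp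
qed

context rwg_drift
begin

text \<open>There are of order \<open>D\<close> steps with third moments of order sigma^3; as D
  sigma^2 is bounded by \<open>B\<close>, this leaves one factor sigma. The bias in the variance
  defect is split into \<open>err\<close> and the drift itself.\<close>

lemma scaled_lindeberg_error_le:
  assumes K: "0 \<le> K" and e: "0 < e" and h: "0 \<le> h" and B: "real D * \<sigma>\<^sup>2 \<le> B"
  shows "real D * chain.lindeberg_error K e (h / real D) \<le>
    8 * exp 2 * K / e^3 * (B * \<sigma> * gmom 3 + h * sqrt (h / real D) * M3)
    + K / e\<^sup>2 * (real D * (\<integral>x. \<bar>msq D k \<sigma> x - h / real D\<bar> \<partial>mu)
        + \<sigma> * (real D * (\<integral>x. \<bar>err x\<bar> \<partial>mu) + (\<integral>a. \<bar>\<beta> a\<bar> \<partial>fm)))"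
proof -
  let ?c3 = "gmom 3"
  have c3: "0 \<le> ?c3" by (intro Bochner_Integration.integral_nonneg) simp
  have "real D * (\<sigma>^3 * ?c3) = (real D * \<sigma>\<^sup>2) * (\<sigma> * ?c3)" by (simp add: power2_eq_square power3_eq_cube)
  also have "\<dots> \<le> B * (\<sigma> * ?c3)" using \<sigma> c3 by (intro mult_right_mono B mult_nonneg_nonneg) auto
  finally have 1: "real D * (\<sigma>^3 * ?c3) \<le> B * \<sigma> * ?c3" by simp
  have "sqrt (h / real D) ^ 3 = h / real D * sqrt (h / real D)"
    using h by (simp add: power3_eq_cube)
  then have 2: "real D * (sqrt (h / real D) ^ 3 * M3) = h * sqrt (h / real D) * M3" using D_pos by simp
  have "(\<integral>x. \<bar>bias x\<bar> \<partial>mu) \<le> (\<integral>x. \<bar>err x\<bar> + \<bar>\<beta> (x 0)\<bar> / real D \<partial>mu)"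
  proof (rule integral_mono')
    show "integrable mu (\<lambda>x. \<bar>err x\<bar> + \<bar>\<beta> (x 0)\<bar> / real D)"
      by (intro Bochner_Integration.integrable_add err_integrable integrable_divide integral_mu_coord0(1)[OF integrable_abs[OF beta_integrable]])
    show "\<bar>bias x\<bar> \<le> \<bar>err x\<bar> + \<bar>\<beta> (x 0)\<bar> / real D" for x
      using abs_triangle_ineq[of "err x" "\<beta> (x 0) / real D"] by (simp add: err_def)
  qed auto
  also have "\<dots> = (\<integral>x. \<bar>err x\<bar> \<partial>mu) + (\<integral>a. \<bar>\<beta> a\<bar> \<partial>fm) / real D"
    using err_integrable integral_mu_coord0[OF integrable_abs[OF beta_integrable]] by simp
  finally have "real D * (\<integral>x. \<bar>bias x\<bar> \<partial>mu) \<le> real D * ((\<integral>x. \<bar>err x\<bar> \<partial>mu) + (\<integral>a. \<bar>\<beta> a\<bar> \<partial>fm) / real D)"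
    by (rule mult_left_mono) simp
  then have "real D * (\<integral>x. \<bar>bias x\<bar> \<partial>mu) \<le> real D * (\<integral>x. \<bar>err x\<bar> \<partial>mu) + (\<integral>a. \<bar>\<beta> a\<bar> \<partial>fm)"
    using D_pos by (simp add: distrib_left)
  then have 3: "\<sigma> * (real D * (\<integral>x. \<bar>bias x\<bar> \<partial>mu)) \<le> \<sigma> * (real D * (\<integral>x. \<bar>err x\<bar> \<partial>mu) + (\<integral>a. \<bar>\<beta> a\<bar> \<partial>fm))"
    using \<sigma> by (intro mult_left_mono) auto
  have "real D * (\<integral>x. \<bar>chain.v x - h / real D\<bar> \<partial>mu)
      \<le> real D * ((\<integral>x. \<bar>msq D k \<sigma> x - h / real D\<bar> \<partial>mu) + \<sigma> * (\<integral>x. \<bar>bias x\<bar> \<partial>mu))"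
    by (intro mult_left_mono integral_v_le) simp
  also have "\<dots> = real D * (\<integral>x. \<bar>msq D k \<sigma> x - h / real D\<bar> \<partial>mu) + \<sigma> * (real D * (\<integral>x. \<bar>bias x\<bar> \<partial>mu))"
    by (simp add: distrib_left mult.left_commute)
  finally have 4: "real D * (\<integral>x. \<bar>chain.v x - h / real D\<bar> \<partial>mu)
    \<le> real D * (\<integral>x. \<bar>msq D k \<sigma> x - h / real D\<bar> \<partial>mu) + \<sigma> * (real D * (\<integral>x. \<bar>err x\<bar> \<partial>mu) + (\<integral>a. \<bar>\<beta> a\<bar> \<partial>fm))"
    using 3 by linarith
  have "real D * chain.lindeberg_error K e (h / real D)
    = 8 * exp 2 * K / e^3 * (real D * (\<sigma>^3 * ?c3) + real D * (sqrt (h / real D) ^ 3 * M3))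
      + K / e\<^sup>2 * (real D * (\<integral>x. \<bar>chain.v x - h / real D\<bar> \<partial>mu))"
    unfolding chain.lindeberg_error_def by (simp add: env_moments(2) algebra_simps)
  also have "\<dots> \<le> 8 * exp 2 * K / e^3 * (B * \<sigma> * ?c3 + h * sqrt (h / real D) * M3)
      + K / e\<^sup>2 * (real D * (\<integral>x. \<bar>msq D k \<sigma> x - h / real D\<bar> \<partial>mu)
        + \<sigma> * (real D * (\<integral>x. \<bar>err x\<bar> \<partial>mu) + (\<integral>a. \<bar>\<beta> a\<bar> \<partial>fm)))"
    unfolding 2 using K e by (intro add_mono mult_left_mono 1 4 order_refl) auto
  finally show ?thesis .
qed

text \<open>Collects what vanishes as the dimension grows while \<open>n\<close>,
  \<open>\<theta>\<close> and \<open>e\<close> stay fixed.\<close>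

definition remainder :: "real \<Rightarrow> real \<Rightarrow> nat \<Rightarrow> nat \<Rightarrow> real \<Rightarrow> real \<Rightarrow> real \<Rightarrow> real \<Rightarrow> real" where
  "remainder K C T n \<theta> e h B =
    2 * K * (real (T + 1) * (real D * (\<integral>x. \<bar>err x\<bar> \<partial>mu)) / \<theta> + real (n * T + 1) * (\<integral>a. \<bar>\<beta> a\<bar> \<partial>fm) / (real D * \<theta>))
    + real T * (8 * exp 2 * K / e^3 * (B * \<sigma> * gmom 3 + h * sqrt (h / real D) * M3)
    + K / e\<^sup>2 * (real D * (\<integral>x. \<bar>msq D k \<sigma> x - h / real D\<bar> \<partial>mu)
        + \<sigma> * (real D * (\<integral>x. \<bar>err x\<bar> \<partial>mu) + (\<integral>a. \<bar>\<beta> a\<bar> \<partial>fm))))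
    + C * exp (Lb * real T) * (\<Sum>j<n * T. \<bar>sqrt (h / real D * real ((D * Suc j) div n - (D * j) div n)) - sqrt (h / real n)\<bar>
        * (\<integral>z. \<bar>z\<bar> \<partial>gauss))"

lemma total_bound:
  assumes H: "lip_func K C T H" and n: "0 < n" "n \<le> D" and \<theta>: "0 < \<theta>" and e: "0 < e" and h: "0 \<le> h"
    and B: "real D * \<sigma>\<^sup>2 \<le> B"
  shows "\<bar>(\<integral>\<omega>. H (U_proc f D \<sigma> \<omega>) \<partial>rwg_space f D k) - euler_law H n \<beta> (\<lambda>_. sqrt (h / real n))\<bar>
    \<le> C * ((3 + exp (Lb * (real T + 1)) * (6 * Lb * (real T + 1) + 2)) * \<theta>)
    + 2 * K * (real (n * T + 1) / (real n)\<^sup>2 * (28 * B\<^sup>2 * gmom 4 / \<theta>^4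
        + 4 * (\<integral>a. (\<beta> a)\<^sup>2 \<partial>fm) / \<theta>\<^sup>2))
    + real (n * T) * (2 * (C * exp (Lb * real T)) * e)
    + remainder K C T n \<theta> e h B"
proof -
  let ?J = "n * T + 1" and ?s = "\<lambda>j. sqrt (h / real D * real ((D * Suc j) div n - (D * j) div n))"
  let ?c4 = "gmom 4" and ?B2 = "\<integral>a. (\<beta> a)\<^sup>2 \<partial>fm"
  let ?Q = "2 * K * (real (T + 1) * (real D * (\<integral>x. \<bar>err x\<bar> \<partial>mu)) / \<theta> + real ?J * (\<integral>a. \<bar>\<beta> a\<bar> \<partial>fm) / (real D * \<theta>))"
  have K: "0 \<le> K" using H by (simp add: lip_func_def)
  have c4: "0 \<le> ?c4" "0 \<le> ?B2" by (intro Bochner_Integration.integral_nonneg; simp)+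
  have B2: "(real D * \<sigma>\<^sup>2)\<^sup>2 \<le> B\<^sup>2" using B by (intro power_mono) auto
  have "chain.Q.prob (bad n ?J \<theta>) \<le>
     real ?J / (real n)\<^sup>2 * (28 * (real D * \<sigma>\<^sup>2)\<^sup>2 * ?c4 / \<theta>^4 + 4 * ?B2 / \<theta>\<^sup>2)
     + real (T + 1) * (real D * (\<integral>x. \<bar>err x\<bar> \<partial>mu)) / \<theta> + real ?J * (\<integral>a. \<bar>\<beta> a\<bar> \<partial>fm) / (real D * \<theta>)"
    using n by (intro prob_bad_le n \<theta>) (simp add: Suc_leI)
  also have "\<dots> \<le> real ?J / (real n)\<^sup>2 * (28 * B\<^sup>2 * ?c4 / \<theta>^4 + 4 * ?B2 / \<theta>\<^sup>2)
     + real (T + 1) * (real D * (\<integral>x. \<bar>err x\<bar> \<partial>mu)) / \<theta> + real ?J * (\<integral>a. \<bar>\<beta> a\<bar> \<partial>fm) / (real D * \<theta>)"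
    using c4 \<theta> by (intro add_mono order_refl mult_left_mono divide_right_mono mult_right_mono B2) auto
  finally have "2 * K * chain.Q.prob (bad n ?J \<theta>) \<le> 2 * K * (real ?J / (real n)\<^sup>2 * (28 * B\<^sup>2 * ?c4 / \<theta>^4 + 4 * ?B2 / \<theta>\<^sup>2)
     + real (T + 1) * (real D * (\<integral>x. \<bar>err x\<bar> \<partial>mu)) / \<theta> + real ?J * (\<integral>a. \<bar>\<beta> a\<bar> \<partial>fm) / (real D * \<theta>))"
    using K by (intro mult_left_mono) auto
  then have p: "2 * K * chain.Q.prob (bad n ?J \<theta>)
      \<le> 2 * K * (real ?J / (real n)\<^sup>2 * (28 * B\<^sup>2 * ?c4 / \<theta>^4 + 4 * ?B2 / \<theta>\<^sup>2)) + ?Q"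
    by (simp only: add.assoc distrib_left)
  have "real T * (real D * chain.lindeberg_error K e (h / real D)) \<le> real T * (8 * exp 2 * K / e^3
      * (B * \<sigma> * gmom 3 + h * sqrt (h / real D) * M3)
    + K / e\<^sup>2 * (real D * (\<integral>x. \<bar>msq D k \<sigma> x - h / real D\<bar> \<partial>mu)
        + \<sigma> * (real D * (\<integral>x. \<bar>err x\<bar> \<partial>mu) + (\<integral>a. \<bar>\<beta> a\<bar> \<partial>fm))))"
    by (intro mult_left_mono scaled_lindeberg_error_le K e h B) simp
  moreover have "\<bar>(\<integral>\<omega>. H (pth n (eul n \<beta> (fst \<omega> 0) (\<lambda>j. chain.S \<omega> ((D * Suc j) div n) - chain.S \<omega> ((D * j) div n)))) \<partial>chain.Q)
     - euler_law H n \<beta> ?s\<bar> \<le> real (n * T) * (2 * (C * exp (Lb * real T)) * e) + real T * (real D * chain.lindeberg_error K e (h / real D))"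
    unfolding euler_law_def using h by (intro lindeberg[OF H n(1) e]) simp
  ultimately show ?thesis
    using p comparison[OF H n \<theta>] euler_law_lipschitz[OF H n(1) beta_measurable Lb, of ?s "\<lambda>_. sqrt (h / real n)"]
    unfolding Q_eq remainder_def by linarith
qed

end

lemma block_variance_limit:
  assumes D: "filterlim D at_top sequentially" and n: "0 < n"
  shows "(\<lambda>d. sqrt (h / real (D d) * real ((D d * Suc j) div n - (D d * j) div n))) \<longlonglongrightarrow> sqrt (h / real n)"
proof -
  have D': "filterlim (\<lambda>d. real (D d)) at_top sequentially"
    by (rule filterlim_compose[OF filterlim_real_sequentially D])
  have inv: "(\<lambda>d. 1 / real (D d)) \<longlonglongrightarrow> 0" by (rule real_tendsto_divide_at_top[OF tendsto_const D'])
  have "(\<lambda>d. real ((D d * Suc j) div n - (D d * j) div n) / real (D d) - 1 / real n) \<longlonglongrightarrow> 0"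
  proof (rule Lim_null_comparison[OF _ inv])
    show "\<forall>\<^sub>F d in sequentially. norm (real ((D d * Suc j) div n - (D d * j) div n) / real (D d) - 1 / real n) \<le> 1 / real (D d)"
      using filterlim_at_top_dense[THEN iffD1, OF D', rule_format, of 0]
    proof eventually_elim
      case (elim d)
      have "real ((D d * Suc j) div n - (D d * j) div n) / real (D d) - 1 / real n
        = (real ((D d * Suc j) div n - (D d * j) div n) - real (D d) / real n) / real (D d)"
        using elim by (simp add: diff_divide_distrib)
      then have "norm (real ((D d * Suc j) div n - (D d * j) div n) / real (D d) - 1 / real n)
        = \<bar>real ((D d * Suc j) div n - (D d * j) div n) - real (D d) / real n\<bar> / real (D d)"
        by (simp only: real_norm_def abs_divide abs_of_nat)
      also have "\<dots> \<le> 1 / real (D d)" by (intro divide_right_mono grid_length(2)[OF n]) simp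
      finally show ?case .
    qed
  qed
  then have "(\<lambda>d. real ((D d * Suc j) div n - (D d * j) div n) / real (D d)) \<longlonglongrightarrow> 1 / real n"
    by (simp only: LIM_zero_iff)
  from tendsto_real_sqrt[OF tendsto_mult[OF tendsto_const[of h] this]]
  show ?thesis by (simp add: mult.commute)
qed

context target
begin

text \<open>The smoothing error grows with the number of blocks, so \<open>e\<close> is chosen after
  \<open>n\<close>; with \<open>n\<close>, \<open>\<theta>\<close> and \<open>e\<close> fixed, the
  dimension can then go to infinity.\<close>

lemma euler_limit:
  fixes \<sigma> :: "nat \<Rightarrow> real" and k D :: "nat \<Rightarrow> nat"
  assumes kD: "\<And>d. 1 \<le> k d" "\<And>d. k d \<le> D d" and s0: "\<sigma> \<longlonglongrightarrow> 0" and pos: "\<And>d. \<sigma> d > 0"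
    and kS: "(\<lambda>d. real (k d) * (\<sigma> d)\<^sup>2) \<longlonglongrightarrow> S\<^sup>2 / I" and S: "0 < S"
    and h: "h = 2 * (S\<^sup>2 / I) * Phi (- S / 2)"
    and D: "filterlim D at_top sequentially" and B: "\<And>d. real (D d) * (\<sigma> d)\<^sup>2 \<le> B"
    and H: "lip_func K C T H" and n: "0 < n" and \<theta>: "0 < \<theta>" and \<epsilon>: "0 < \<epsilon>"
  defines "Lb \<equiv> h / 2 * L"
  shows "\<forall>\<^sub>F d in sequentially.
    \<bar>(\<integral>\<omega>. H (U_proc f (D d) (\<sigma> d) \<omega>) \<partial>rwg_space f (D d) (k d)) - euler_law H n (\<lambda>a. h / 2 * g1 a) (\<lambda>_. sqrt (h / real n))\<bar>
    \<le> C * ((3 + exp (Lb * (real T + 1)) * (6 * Lb * (real T + 1) + 2)) * \<theta>)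
    + 2 * K * (real (n * T + 1) / (real n)\<^sup>2 * (28 * B\<^sup>2 * gmom 4 / \<theta>^4
        + 4 * (\<integral>a. (h / 2 * g1 a)\<^sup>2 \<partial>fm) / \<theta>\<^sup>2)) + \<epsilon>"
proof -
  have K: "0 \<le> K" "0 \<le> C" using H by (auto simp: lip_func_def)
  have h0: "0 \<le> h" unfolding h using I_pos Phi_nonneg by simp
  let ?\<beta> = "\<lambda>a. h / 2 * g1 a"
  let ?C' = "C * exp (Lb * real T)"
  \<comment> \<open>Small enough for the smoothing error of all n T blocks to stay below
    \<open>\<epsilon> / 2\<close>; the added ones keep the denominator positive when
    \<open>C\<close> or \<open>T\<close> is 0.\<close>
  define e where "e = \<epsilon> / (4 * (?C' + 1) * (real (n * T) + 1))"
  have C': "0 \<le> ?C'" using K by simp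
  have e: "0 < e" unfolding e_def using \<epsilon> C' by (intro divide_pos_pos mult_pos_pos add_nonneg_pos) auto
  have e_le: "real (n * T) * (2 * ?C' * e) \<le> \<epsilon> / 2"
  proof -
    have "real (n * T) * (2 * ?C' * e) = (real (n * T) * ?C') * (2 * e)" by simp
    also have "\<dots> \<le> ((real (n * T) + 1) * (?C' + 1)) * (2 * e)"
      using e C' by (intro mult_right_mono mult_mono) auto
    also have "\<dots> = \<epsilon> / 2"
    proof -
      have "?C' + 1 \<noteq> 0" "real (n * T) + 1 \<noteq> 0" using C' by (auto simp: add_nonneg_eq_0_iff)
      then show ?thesis unfolding e_def by (simp add: divide_simps)
    qed
    finally show ?thesis .
  qed
  interpret rwg_drift f f1 f2 f3 L "D d" "k d" "\<sigma> d" ?\<beta> Lb for d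
  proof
    show "0 \<le> Lb" unfolding Lb_def using h0 L_nonneg by simp
    have "\<bar>h / 2 * g1 x - h / 2 * g1 y\<bar> = h / 2 * \<bar>g1 x - g1 y\<bar>" for x y
      unfolding right_diff_distrib[symmetric] abs_mult using h0 by simp
    then show "\<bar>h / 2 * g1 x - h / 2 * g1 y\<bar> \<le> Lb * \<bar>x - y\<bar>" for x y
      unfolding Lb_def using mult_left_mono[OF g1_lip[of x y], of "h / 2"] h0 by simp
    show "integrable fm (\<lambda>a. (h / 2 * g1 a)\<^sup>2)" unfolding power_mult_distrib by (intro integrable_mult_right integrable_g1(2))
  qed (use kD pos in auto)
  have dr: "(\<lambda>d. real (D d) * (\<integral>x. \<bar>err d x\<bar> \<partial>mu)) \<longlonglongrightarrow> 0"
    unfolding err_def by (rule drift_limit[OF kD s0 pos kS S h])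
  note ms = msq_limit[OF kD s0 pos kS S h]
  have D': "filterlim (\<lambda>d. real (D d)) at_top sequentially"
    by (rule filterlim_compose[OF filterlim_real_sequentially D])
  have inv: "(\<lambda>d. c / real (D d)) \<longlonglongrightarrow> 0" for c :: real by (rule real_tendsto_divide_at_top[OF tendsto_const D'])
  have sq: "(\<lambda>d. sqrt (h / real (D d))) \<longlonglongrightarrow> 0" using tendsto_real_sqrt[OF inv[of h]] by simp
  have inv\<theta>: "(\<lambda>d. c / (real (D d) * \<theta>)) \<longlonglongrightarrow> 0" for c :: real
    using tendsto_divide[OF inv[of c] tendsto_const[of \<theta>]] \<theta> by simp
  let ?r = "\<lambda>d. remainder d K C T n \<theta> e h B"
  have "?r \<longlonglongrightarrow> 2 * K * (real (T + 1) * 0 / \<theta> + 0)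
    + real T * (8 * exp 2 * K / e^3 * (B * 0 * gmom 3 + h * 0 * M3)
    + K / e\<^sup>2 * (0 + 0 * (0 + (\<integral>a. \<bar>?\<beta> a\<bar> \<partial>fm))))
    + ?C' * (\<Sum>j<n * T. \<bar>sqrt (h / real n) - sqrt (h / real n)\<bar> * (\<integral>z. \<bar>z\<bar> \<partial>gauss))"
    unfolding remainder_def by (intro tendsto_add tendsto_mult tendsto_const tendsto_divide tendsto_sum tendsto_rabs tendsto_diff dr ms sq s0 inv\<theta>
        block_variance_limit[OF D n]) (use \<theta> in auto)
  then have "?r \<longlonglongrightarrow> 0" by simp
  then have "\<forall>\<^sub>F d in sequentially. ?r d < \<epsilon> / 2" using \<epsilon> by (intro order_tendstoD(2)) auto
  moreover have "\<forall>\<^sub>F d in sequentially. n \<le> D d" using D by (simp add: filterlim_at_top)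
  ultimately show ?thesis
  proof eventually_elim
    case (elim d)
    show ?case using total_bound[OF H n elim(2) \<theta> e h0 B[of d]] elim(1) e_le by linarith
  qed
qed

end

section \<open>Brownian increments\<close>

text \<open>Independence of an infinite family concerns finite subfamilies, and each of these lies
  in an initial segment.\<close>

lemma (in prob_space) indep_vars_UNIV_nat:
  assumes "\<And>n. indep_vars (\<lambda>_. M') X {..<n::nat}"
  shows "indep_vars (\<lambda>_. M') X UNIV"
  unfolding indep_vars_def2
proof
  show "\<forall>i\<in>UNIV. random_variable M' (X i)"
    using assms[of "Suc i" for i] unfolding indep_vars_def2 by blast
  show "indep_sets (\<lambda>i. {X i -` A \<inter> space M |A. A \<in> sets M'}) UNIV"
    unfolding indep_sets_finite_index_sets[of _ UNIV]
  proof (intro allI impI)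
    fix J :: "nat set" assume "finite J"
    then have "J \<subseteq> {..<Suc (Max J)}" by (auto simp: less_Suc_eq_le)
    then show "indep_sets (\<lambda>i. {X i -` A \<inter> space M |A. A \<in> sets M'}) J"
      using assms[of "Suc (Max J)"] unfolding indep_vars_def2 by (blast intro: indep_sets_mono_index)
  qed
qed

lemma (in prob_space) distr_indep_vars_UNIV:
  assumes "indep_vars (\<lambda>_. M') X (UNIV :: nat set)"
  shows "distr M (PiM UNIV (\<lambda>_. M')) (\<lambda>x i. X i x) = PiM UNIV (\<lambda>i. distr M M' (X i))"
  using indep_vars_iff_distr_eq_PiM[where I=UNIV and M'="\<lambda>_. M'" and X=X, THEN iffD1, OF _ _ assms] assms
  by (auto simp: indep_vars_def2 restrict_UNIV)

lemma distr_std_normal_scale: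
  assumes s: "0 < s"
  shows "distr gauss borel (\<lambda>z. s * z) = density lborel (normal_density 0 s)"
proof -
  have "distributed gauss lborel (\<lambda>z. 0 + s * z) (normal_density (0 + s * 0) (\<bar>s\<bar> * 1))"
  proof (rule std_normal.normal_density_affine)
    show "distributed gauss lborel (\<lambda>z. z) std_normal_density"
      by (auto simp: distributed_def distr_id2 intro!: measure_eqI)
  qed (use s in auto)
  then have "distr gauss lborel (\<lambda>z. s * z) = density lborel (normal_density 0 s)"
    using s by (simp add: distributed_distr_eq_density)
  then show ?thesis by (subst distr_cong[OF refl sets_lborel[symmetric] refl]) simp
qed

lemma distr_std_normal_seq_scale:
  assumes s: "0 < s"
  shows "distr gauss_seq (PiM UNIV (\<lambda>_. borel)) (\<lambda>\<xi> j. s * \<xi> j) = PiM UNIV (\<lambda>_::nat. density lborel (normal_density 0 s))"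
proof -
  have "gauss_seq.indep_vars (\<lambda>_. gauss) (\<lambda>j \<xi>. \<xi> j) (UNIV :: nat set)"
  proof (subst gauss_seq.indep_vars_iff_distr_eq_PiM)
    show "distr gauss_seq gauss_seq (\<lambda>x. \<lambda>i\<in>UNIV. x i)
        = PiM UNIV (\<lambda>i::nat. distr gauss_seq gauss (\<lambda>\<xi>. \<xi> i))"
      by (subst distr_PiM_component) (auto simp: std_normal.prob_space_axioms restrict_UNIV distr_id2)
  qed auto
  then have "gauss_seq.indep_vars (\<lambda>_. borel) (\<lambda>j \<xi>. s * \<xi> j) (UNIV :: nat set)"
    by (rule gauss_seq.indep_vars_compose2) simp
  note gauss_seq.distr_indep_vars_UNIV[OF this]
  moreover have "distr gauss_seq borel (\<lambda>\<xi>. s * \<xi> j) = density lborel (normal_density 0 s)" for j :: nat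
  proof -
    have "distr gauss_seq gauss (\<lambda>\<xi>. \<xi> j) = gauss"
      by (rule distr_PiM_component) (auto simp: std_normal.prob_space_axioms)
    then have "distr gauss borel (\<lambda>z. s * z) = distr (distr gauss_seq gauss (\<lambda>\<xi>. \<xi> j)) borel (\<lambda>z. s * z)"
      by simp
    also have "\<dots> = distr gauss_seq borel (\<lambda>\<xi>. s * \<xi> j)" by (subst distr_distr) (auto simp: comp_def)
    finally show ?thesis using distr_std_normal_scale[OF s] by simp
  qed
  ultimately show ?thesis by simp
qed

lemma std_BM_increments:
  assumes N: "prob_space N" and B: "std_BM N B" and n: "0 < n"
  shows "distr N (PiM UNIV (\<lambda>_. borel)) (\<lambda>\<omega> j. B \<omega> (real (Suc j) / real n) - B \<omega> (real j / real n))
    = distr gauss_seq (PiM UNIV (\<lambda>_. borel)) (\<lambda>\<xi> j. sqrt (1 / real n) * \<xi> j)"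
proof -
  interpret N: prob_space N by (rule N)
  have n0: "0 < real n" using n by simp
  let ?t = "\<lambda>j. real j / real n"
  have "strict_mono ?t" using n0 by (auto simp: strict_mono_def divide_strict_right_mono)
  moreover have "\<forall>(n::nat) (ts::nat \<Rightarrow> real). 0 \<le> ts 0 \<longrightarrow> strict_mono ts \<longrightarrow>
      N.indep_vars (\<lambda>_. borel) (\<lambda>k \<omega>. B \<omega> (ts (Suc k)) - B \<omega> (ts k)) {..<n}"
    using B unfolding std_BM_def by blast
  note this[rule_format, of ?t]
  ultimately have "N.indep_vars (\<lambda>_. borel) (\<lambda>j \<omega>. B \<omega> (?t (Suc j)) - B \<omega> (?t j)) {..<m}" for m
    by simp
  then have "N.indep_vars (\<lambda>_. borel) (\<lambda>j \<omega>. B \<omega> (?t (Suc j)) - B \<omega> (?t j)) UNIV"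
    by (rule N.indep_vars_UNIV_nat)
  note N.distr_indep_vars_UNIV[OF this]
  moreover have "distr N borel (\<lambda>\<omega>. B \<omega> (?t (Suc j)) - B \<omega> (?t j)) = density lborel (normal_density 0 (sqrt (1 / real n)))" for j
  proof -
    have "?t (Suc j) - ?t j = 1 / real n" by (simp add: diff_divide_distrib[symmetric])
    moreover have "0 \<le> ?t j" "?t j < ?t (Suc j)" using n0 by (auto simp: divide_strict_right_mono)
    ultimately have "distributed N lborel (\<lambda>\<omega>. B \<omega> (?t (Suc j)) - B \<omega> (?t j)) (normal_density 0 (sqrt (1 / real n)))"
      using B unfolding std_BM_def by metis
    then have "distr N lborel (\<lambda>\<omega>. B \<omega> (?t (Suc j)) - B \<omega> (?t j)) = density lborel (normal_density 0 (sqrt (1 / real n)))"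
      by (rule distributed_distr_eq_density)
    then show ?thesis by (subst distr_cong[OF refl sets_lborel[symmetric] refl])
  qed
  ultimately show ?thesis using n0 by (simp add: distr_std_normal_seq_scale)
qed

text \<open>Independence is available between path-valued variables, so the start value travels as a
  constant sequence and is read off at index 0.\<close>

lemma law_start_increments:
  fixes u0 :: "'b \<Rightarrow> real" and \<Phi> :: "real \<times> (nat \<Rightarrow> real) \<Rightarrow> real"
  assumes N: "prob_space N" and B: "std_BM N B" and n: "0 < n"
    and u0: "distributed N lborel u0 f"
    and ind: "prob_space.indep_var N (PiM UNIV (\<lambda>_::real. borel)) (\<lambda>\<omega> (_::real). u0 \<omega>) (PiM UNIV (\<lambda>_::real. borel)) B"
    and \<Phi>[measurable]: "\<Phi> \<in> borel_measurable (borel \<Otimes>\<^sub>M PiM UNIV (\<lambda>_. borel))" and K: "\<And>w. \<bar>\<Phi> w\<bar> \<le> K"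
  shows "(\<lambda>\<omega>. \<Phi> (u0 \<omega>, \<lambda>j. B \<omega> (real (Suc j) / real n) - B \<omega> (real j / real n))) \<in> borel_measurable N"
    and "(\<integral>\<omega>. \<Phi> (u0 \<omega>, \<lambda>j. B \<omega> (real (Suc j) / real n) - B \<omega> (real j / real n)) \<partial>N)
      = (\<integral>x. \<integral>\<xi>. \<Phi> (x, \<lambda>j. sqrt (1 / real n) * \<xi> j) \<partial>gauss_seq \<partial>density lborel f)"
proof -
  interpret N: prob_space N by (rule N)
  let ?R = "PiM UNIV (\<lambda>_::nat. borel :: real measure)"
  let ?D = "\<lambda>\<omega> j. B \<omega> (real (Suc j) / real n) - B \<omega> (real j / real n)"
  let ?s = "\<lambda>\<xi> j. sqrt (1 / real n) * \<xi> j"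
  let ?U = "\<lambda>\<omega> (_::nat). u0 \<omega>"
  have "N.indep_var ?R ((\<lambda>p _. p 0) \<circ> (\<lambda>\<omega> (_::real). u0 \<omega>)) ?R ((\<lambda>b j. b (real (Suc j) / real n) - b (real j / real n)) \<circ> B)"
    by (rule N.indep_var_compose[OF ind]; intro measurable_to_PiM_UNIV; measurable)
  then have i: "N.indep_var ?R ?U ?R ?D" by (simp add: comp_def)
  have [measurable]: "?U \<in> N \<rightarrow>\<^sub>M ?R" "?D \<in> N \<rightarrow>\<^sub>M ?R"
    using i unfolding N.indep_var_distribution_eq by auto
  have [measurable]: "u0 \<in> borel_measurable N" using u0 by (simp add: distributed_def)
  show "(\<lambda>\<omega>. \<Phi> (u0 \<omega>, ?D \<omega>)) \<in> borel_measurable N" by measurable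
  have s[measurable]: "?s \<in> gauss_seq \<rightarrow>\<^sub>M ?R" by (intro measurable_to_PiM_UNIV) measurable
  have "distr N lborel u0 = density lborel f" using u0 by (rule distributed_distr_eq_density)
  then have d0: "distr N borel u0 = density lborel f" by (subst distr_cong[OF refl sets_lborel[symmetric] refl])
  have "prob_space (distr N ?R ?U)" by (rule N.prob_space_distr) simp
  then interpret F: prob_space "distr N ?R ?U" .
  have "prob_space (distr gauss_seq ?R ?s)" by (rule gauss_seq.prob_space_distr) simp
  then interpret S: prob_space "distr gauss_seq ?R ?s" .
  interpret FS: pair_prob_space "distr N ?R ?U" "distr gauss_seq ?R ?s" ..
  have \<Phi>'[measurable]: "(\<lambda>w. \<Phi> (fst w 0, snd w)) \<in> borel_measurable (?R \<Otimes>\<^sub>M ?R)" by measurable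
  have "distr N (?R \<Otimes>\<^sub>M ?R) (\<lambda>\<omega>. (?U \<omega>, ?D \<omega>)) = distr N ?R ?U \<Otimes>\<^sub>M distr gauss_seq ?R ?s"
    using i unfolding N.indep_var_distribution_eq std_BM_increments[OF N B n] by auto
  moreover have mm: "(\<lambda>\<omega>. (?U \<omega>, ?D \<omega>)) \<in> N \<rightarrow>\<^sub>M ?R \<Otimes>\<^sub>M ?R" by measurable
  ultimately have "(\<integral>\<omega>. \<Phi> (u0 \<omega>, ?D \<omega>) \<partial>N) = (\<integral>w. \<Phi> (fst w 0, snd w) \<partial>(distr N ?R ?U \<Otimes>\<^sub>M distr gauss_seq ?R ?s))"
    using integral_distr[OF mm \<Phi>'] by simp
  also have "\<dots> = (\<integral>p. \<integral>a. \<Phi> (p 0, a) \<partial>distr gauss_seq ?R ?s \<partial>distr N ?R ?U)"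
  proof -
    have m: "(\<lambda>w. \<Phi> (fst w 0, snd w)) \<in> borel_measurable (distr N ?R ?U \<Otimes>\<^sub>M distr gauss_seq ?R ?s)"
      by (subst measurable_cong_sets[OF sets_pair_measure_cong[of _ ?R _ ?R] refl]) auto
    have "integrable (distr N ?R ?U \<Otimes>\<^sub>M distr gauss_seq ?R ?s) (\<lambda>w. \<Phi> (fst w 0, snd w))"
      by (rule FS.integrable_const_bound[where B=K, OF _ m]) (simp add: K)
    from FS.integral_fst'[OF this] show ?thesis by simp
  qed
  also have "\<dots> = (\<integral>p. \<integral>\<xi>. \<Phi> (p 0, ?s \<xi>) \<partial>gauss_seq \<partial>distr N ?R ?U)"
  proof (rule Bochner_Integration.integral_cong[OF refl])
    fix p :: "nat \<Rightarrow> real"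
    show "(\<integral>a. \<Phi> (p 0, a) \<partial>distr gauss_seq ?R ?s) = (\<integral>\<xi>. \<Phi> (p 0, ?s \<xi>) \<partial>gauss_seq)"
      by (rule integral_distr) measurable
  qed
  also have "\<dots> = (\<integral>x. \<integral>\<xi>. \<Phi> (x, ?s \<xi>) \<partial>gauss_seq \<partial>density lborel f)"
  proof -
    have m: "(\<lambda>x. \<integral>\<xi>. \<Phi> (x, ?s \<xi>) \<partial>gauss_seq) \<in> borel_measurable borel"
      by (rule gauss_seq.borel_measurable_lebesgue_integral) measurable
    have "(\<lambda>p. \<integral>\<xi>. \<Phi> (p 0, ?s \<xi>) \<partial>gauss_seq) \<in> borel_measurable ?R"
      by (rule measurable_compose[OF _ m]) measurable
    then have "(\<integral>p. \<integral>\<xi>. \<Phi> (p 0, ?s \<xi>) \<partial>gauss_seq \<partial>distr N ?R ?U) = (\<integral>\<omega>. \<integral>\<xi>. \<Phi> (u0 \<omega>, ?s \<xi>) \<partial>gauss_seq \<partial>N)"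
      by (subst integral_distr) auto
    also have "\<dots> = (\<integral>x. \<integral>\<xi>. \<Phi> (x, ?s \<xi>) \<partial>gauss_seq \<partial>density lborel f)"
      unfolding d0[symmetric] by (subst integral_distr[OF _ m]) auto
    finally show ?thesis .
  qed
  finally show "(\<integral>\<omega>. \<Phi> (u0 \<omega>, ?D \<omega>) \<partial>N) = (\<integral>x. \<integral>\<xi>. \<Phi> (x, ?s \<xi>) \<partial>gauss_seq \<partial>density lborel f)" .
qed

section \<open>The diffusion limit\<close>

text \<open>Measurability of \<open>H (U \<omega>)\<close> is not assumed; it results from the
  pointwise convergence of the schemes, which are measurable functions of the start value and the
  Brownian increments.\<close>

lemma euler_scheme_limit:
  fixes N :: "'b measure" and B U :: "'b \<Rightarrow> real \<Rightarrow> real"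
  assumes N: "prob_space N" and BM: "std_BM N B"
    and u0: "distributed N lborel (\<lambda>\<omega>. U \<omega> 0) f"
    and ind: "prob_space.indep_var N (PiM UNIV (\<lambda>_::real. borel)) (\<lambda>\<omega> (_::real). U \<omega> 0) (PiM UNIV (\<lambda>_::real. borel)) B"
    and U: "\<And>\<omega>. continuous_on {0..} (U \<omega>)"
    and sol: "\<And>\<omega> t. 0 \<le> t \<Longrightarrow> U \<omega> t = U \<omega> 0 + sqrt h * B \<omega> t + integral {0..t} (\<lambda>s. \<beta> (U \<omega> s))"
    and Lb: "0 \<le> Lb" "\<And>x y. \<bar>\<beta> x - \<beta> y\<bar> \<le> Lb * \<bar>x - y\<bar>" and \<beta>[measurable]: "\<beta> \<in> borel_measurable borel"
    and H: "lip_func K C T H" and h: "0 \<le> h"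
  shows "(\<lambda>\<omega>. H (U \<omega>)) \<in> borel_measurable N"
    and "(\<lambda>n. \<integral>x. \<integral>\<xi>. H (pth n (eul n \<beta> x (\<lambda>j. sqrt (h / real n) * \<xi> j))) \<partial>gauss_seq \<partial>density lborel f)
      \<longlonglongrightarrow> (\<integral>\<omega>. H (U \<omega>) \<partial>N)"
proof -
  interpret N: prob_space N by (rule N)
  have K: "0 \<le> K" "0 \<le> C" "\<And>x. cadlag x \<Longrightarrow> \<bar>H x\<bar> \<le> K" using H by (auto simp: lip_func_def)
  define Y where "Y n \<omega> = pth n (eul n \<beta> (U \<omega> 0) (\<lambda>j. sqrt h * B \<omega> (real (Suc j) / real n) - sqrt h * B \<omega> (real j / real n)))" for n \<omega>
  have lim: "(\<lambda>n. H (Y n \<omega>)) \<longlonglongrightarrow> H (U \<omega>)" for \<omega>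
  proof (rule tendstoI)
    fix e :: real assume e: "0 < e"
    define r where "r = e / (C + 1)"
    have r: "0 < r" "C * r < e" using e K(2) unfolding r_def by (auto simp: field_simps)
    have "B \<omega> 0 = 0" using BM by (simp add: std_BM_def)
    then have "\<forall>\<^sub>F n in sequentially. \<forall>t\<in>{0..real T}. \<bar>U \<omega> t - Y n \<omega> t\<bar> \<le> r"
      unfolding Y_def by (intro euler_converges[OF Lb U sol _ r(1)]) auto
    then show "\<forall>\<^sub>F n in sequentially. dist (H (Y n \<omega>)) (H (U \<omega>)) < e"
    proof eventually_elim
      case (elim n)
      have "\<bar>H (U \<omega>) - H (Y n \<omega>)\<bar> \<le> C * r"
        using H elim r(1) cadlag_continuous_on[OF U[of \<omega>]] cadlag_pth unfolding lip_func_def Y_def by (meson less_imp_le)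
      then show ?case using r(2) by (simp add: dist_real_def abs_minus_commute)
    qed
  qed
  have cad: "cadlag (Y n \<omega>)" for n \<omega> unfolding Y_def by (rule cadlag_pth)
  have law: "(\<lambda>\<omega>. H (Y n \<omega>)) \<in> borel_measurable N"
    "(\<integral>\<omega>. H (Y n \<omega>) \<partial>N) = (\<integral>x. \<integral>\<xi>. H (pth n (eul n \<beta> x (\<lambda>j. sqrt (h / real n) * \<xi> j))) \<partial>gauss_seq \<partial>density lborel f)"
    if n: "0 < n" for n
  proof -
    let ?\<Phi> = "\<lambda>w. H (pth n (eul n \<beta> (fst w) (\<lambda>j. sqrt h * snd w j)))"
    have "?\<Phi> \<in> borel_measurable (borel \<Otimes>\<^sub>M PiM UNIV (\<lambda>_. borel))"
      by (rule lip_func_eul_measurable[OF H]) measurable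
    note l = law_start_increments[OF N BM n u0 ind this, of K]
    show "(\<lambda>\<omega>. H (Y n \<omega>)) \<in> borel_measurable N"
      using l(1) K(3)[OF cadlag_pth] by (simp add: Y_def right_diff_distrib)
    show "(\<integral>\<omega>. H (Y n \<omega>) \<partial>N) = (\<integral>x. \<integral>\<xi>. H (pth n (eul n \<beta> x (\<lambda>j. sqrt (h / real n) * \<xi> j))) \<partial>gauss_seq \<partial>density lborel f)"
      using l(2) K(3)[OF cadlag_pth] by (simp add: Y_def right_diff_distrib real_sqrt_divide)
  qed
  have m: "(\<lambda>\<omega>. H (Y (Suc n) \<omega>)) \<in> borel_measurable N" for n by (rule law(1)) simp
  have lim': "(\<lambda>n. H (Y (Suc n) \<omega>)) \<longlonglongrightarrow> H (U \<omega>)" for \<omega> by (rule LIMSEQ_Suc[OF lim])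
  show mU: "(\<lambda>\<omega>. H (U \<omega>)) \<in> borel_measurable N"
    by (rule borel_measurable_LIMSEQ_real[OF lim' m])
  have "(\<lambda>n. \<integral>\<omega>. H (Y (Suc n) \<omega>) \<partial>N) \<longlonglongrightarrow> (\<integral>\<omega>. H (U \<omega>) \<partial>N)"
    by (rule integral_dominated_convergence[where w="\<lambda>_. K"]) (use m mU lim' K(3)[OF cad] in auto)
  then have "(\<lambda>n. \<integral>x. \<integral>\<xi>. H (pth (Suc n) (eul (Suc n) \<beta> x (\<lambda>j. sqrt (h / real (Suc n)) * \<xi> j))) \<partial>gauss_seq \<partial>density lborel f)
      \<longlonglongrightarrow> (\<integral>\<omega>. H (U \<omega>) \<partial>N)"
    by (simp only: law(2)[OF zero_less_Suc])
  then show "(\<lambda>n. \<integral>x. \<integral>\<xi>. H (pth n (eul n \<beta> x (\<lambda>j. sqrt (h / real n) * \<xi> j))) \<partial>gauss_seq \<partial>density lborel f)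
      \<longlonglongrightarrow> (\<integral>\<omega>. H (U \<omega>) \<partial>N)"
    by (rule LIMSEQ_imp_Suc)
qed

context target
begin

text \<open>Four errors of size \<open>e / 5\<close>: \<open>\<theta>\<close> settles the pathwise
  distance, then \<open>n\<close> settles both the bad event and the distance of the Gaussian Euler
  scheme from its limit, and the dimension settles the rest.\<close>

lemma chain_functional_limit:
  fixes \<sigma> :: "nat \<Rightarrow> real" and k D :: "nat \<Rightarrow> nat" and a :: real
  assumes kD: "\<And>d. 1 \<le> k d" "\<And>d. k d \<le> D d" and s0: "\<sigma> \<longlonglongrightarrow> 0" and pos: "\<And>d. \<sigma> d > 0"
    and kS: "(\<lambda>d. real (k d) * (\<sigma> d)\<^sup>2) \<longlonglongrightarrow> S\<^sup>2 / I" and S: "0 < S"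
    and h: "h = 2 * (S\<^sup>2 / I) * Phi (- S / 2)"
    and D: "filterlim D at_top sequentially" and B: "\<And>d. real (D d) * (\<sigma> d)\<^sup>2 \<le> B"
    and H: "lip_func K C T H"
    and a: "(\<lambda>n. euler_law H n (\<lambda>a. h / 2 * g1 a) (\<lambda>_. sqrt (h / real n))) \<longlonglongrightarrow> a"
  shows "(\<lambda>d. \<integral>\<omega>. H (U_proc f (D d) (\<sigma> d) \<omega>) \<partial>rwg_space f (D d) (k d)) \<longlonglongrightarrow> a"
proof (rule tendstoI)
  fix e :: real assume e: "0 < e"
  define Lb where "Lb = h / 2 * L"
  define A where "A = 3 + exp (Lb * (real T + 1)) * (6 * Lb * (real T + 1) + 2)"
  define c4 where "c4 = gmom 4"
  define B2 where "B2 = (\<integral>a. (h / 2 * g1 a)\<^sup>2 \<partial>fm)"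
  have K: "0 \<le> K" "0 \<le> C" using H by (auto simp: lip_func_def)
  have h0: "0 \<le> h" unfolding h using I_pos Phi_nonneg by simp
  have A: "0 < A" unfolding A_def Lb_def using h0 L_nonneg by (intro add_pos_nonneg mult_nonneg_nonneg add_nonneg_nonneg) auto
  define \<theta> where "\<theta> = e / (5 * (C + 1) * A)"
  have \<theta>: "0 < \<theta>" unfolding \<theta>_def using e K A by (intro divide_pos_pos mult_pos_pos) auto
  have t1: "C * (A * \<theta>) \<le> e / 5"
  proof -
    have "C * (A * \<theta>) \<le> (C + 1) * (A * \<theta>)" using A \<theta> by (intro mult_right_mono) auto
    also have "\<dots> = e / 5" using A K by (simp add: \<theta>_def divide_simps)
    finally show ?thesis .
  qed
  define R where "R = 28 * B\<^sup>2 * c4 / \<theta>^4 + 4 * B2 / \<theta>\<^sup>2"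
  have inv: "(\<lambda>n. 1 / real n) \<longlonglongrightarrow> 0" by (rule lim_const_over_n)
  have "(\<lambda>n. 2 * K * ((real T * (1 / real n) + 1 / real n * (1 / real n)) * R)) \<longlonglongrightarrow> 2 * K * ((real T * 0 + 0 * 0) * R)"
    by (intro tendsto_intros inv)
  then have "\<forall>\<^sub>F n in sequentially. 2 * K * ((real T * (1 / real n) + 1 / real n * (1 / real n)) * R) < e / 5"
    using e by (intro order_tendstoD(2)) auto
  moreover have "\<forall>\<^sub>F n in sequentially. dist (euler_law H n (\<lambda>a. h / 2 * g1 a) (\<lambda>_. sqrt (h / real n))) a < e / 5"
    using e by (intro tendstoD[OF a]) simp
  moreover have "\<forall>\<^sub>F n in sequentially. 0 < n" by (rule eventually_gt_at_top)
  ultimately have "\<forall>\<^sub>F n in sequentially. 2 * K * ((real T * (1 / real n) + 1 / real n * (1 / real n)) * R) < e / 5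
      \<and> dist (euler_law H n (\<lambda>a. h / 2 * g1 a) (\<lambda>_. sqrt (h / real n))) a < e / 5 \<and> 0 < n"
    by eventually_elim blast
  then obtain n where n: "2 * K * ((real T * (1 / real n) + 1 / real n * (1 / real n)) * R) < e / 5"
      "dist (euler_law H n (\<lambda>a. h / 2 * g1 a) (\<lambda>_. sqrt (h / real n))) a < e / 5" "0 < n"
    using eventually_happens'[OF sequentially_bot] by blast
  have "real (n * T + 1) / (real n)\<^sup>2 = real T * (1 / real n) + 1 / real n * (1 / real n)"
    using n(3) by (simp add: power2_eq_square field_simps)
  then have t2: "2 * K * (real (n * T + 1) / (real n)\<^sup>2 * R) < e / 5" using n(1) by simp
  have e5: "0 < e / 5" using e by simp
  have "\<forall>\<^sub>F d in sequentially.
    \<bar>(\<integral>\<omega>. H (U_proc f (D d) (\<sigma> d) \<omega>) \<partial>rwg_space f (D d) (k d)) - euler_law H n (\<lambda>a. h / 2 * g1 a) (\<lambda>_. sqrt (h / real n))\<bar>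
    \<le> C * (A * \<theta>) + 2 * K * (real (n * T + 1) / (real n)\<^sup>2 * R) + e / 5"
    using euler_limit[OF kD s0 pos kS S h D B H n(3) \<theta> e5] unfolding A_def Lb_def R_def c4_def B2_def .
  then show "\<forall>\<^sub>F d in sequentially. dist (\<integral>\<omega>. H (U_proc f (D d) (\<sigma> d) \<omega>) \<partial>rwg_space f (D d) (k d)) a < e"
  proof eventually_elim
    case (elim d)
    then show ?case using t1 t2 n(2) e unfolding dist_real_def by linarith
  qed
qed

end

theorem theorem3p1:
  fixes f f1 f2 f3 :: "real \<Rightarrow> real"
    and c :: "nat \<Rightarrow> real" and c0 l :: real
    and N :: "'b measure" and B U :: "'b \<Rightarrow> real \<Rightarrow> real"
    and F :: "(real \<Rightarrow> real) \<Rightarrow> real"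
  assumes f_pos: "\<forall>x. f x > 0"
    and f_int: "integrable lborel f" "integral\<^sup>L lborel f = 1"
    and f_C3: "\<forall>x. (f has_real_derivative f1 x) (at x)"
              "\<forall>x. (f1 has_real_derivative f2 x) (at x)"
              "\<forall>x. (f2 has_real_derivative f3 x) (at x)"
              "continuous_on UNIV f3"
    and g'_lip: "\<exists>L. \<forall>x y. \<bar>f1 x / f x - f1 y / f y\<bar> \<le> L * \<bar>x - y\<bar>"
    and mom8: "integrable lborel (\<lambda>x. (f1 x / f x) ^ 8 * f x)"
    and mom4: "integrable lborel (\<lambda>x. (f2 x / f x) ^ 4 * f x)"
    and c_range: "\<forall>d\<ge>1. 0 < c d \<and> c d \<le> 1 \<and> (\<exists>k::nat. real d * c d = real k)"
    and c_lim: "c \<longlonglongrightarrow> c0" and c0_range: "0 < c0" "c0 \<le> 1"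
    and l_pos: "l > 0"
    and N_prob: "prob_space N"
    and B_BM: "std_BM N B"
    and U0_dist: "distributed N lborel (\<lambda>\<omega>. U \<omega> 0) f"
    and U0_indep: "prob_space.indep_var N (PiM UNIV (\<lambda>_::real. borel)) (\<lambda>\<omega> (_::real). U \<omega> 0)
                               (PiM UNIV (\<lambda>_::real. borel)) B"
    and U_cont: "\<forall>\<omega>. continuous_on {0..} (U \<omega>)"
    and U_sde: "\<forall>\<omega> t. t \<ge> 0 \<longrightarrow>
        U \<omega> t = U \<omega> 0
          + sqrt (2 * c0 * l\<^sup>2 * Phi (- l * sqrt (c0 * (LINT x|lborel. (f1 x / f x)\<^sup>2 * f x)) / 2))
              * B \<omega> t
          + (2 * c0 * l\<^sup>2 * Phi (- l * sqrt (c0 * (LINT x|lborel. (f1 x / f x)\<^sup>2 * f x)) / 2)) / 2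
              * integral {0..t} (\<lambda>s. f1 (U \<omega> s) / f (U \<omega> s))"
    and F_bc: "skor_bounded_continuous F"
  shows "(\<lambda>d. \<integral>\<omega>. F (U_proc f d (l / sqrt (real d - 1)) \<omega>)
                  \<partial>(rwg_space f d (nat \<lfloor>real d * c d\<rfloor>)))
         \<longlonglongrightarrow> (\<integral>\<omega>. F (U \<omega>) \<partial>N)"
proof -
  obtain L where L: "\<And>x y. \<bar>f1 x / f x - f1 y / f y\<bar> \<le> L * \<bar>x - y\<bar>" using g'_lip by blast
  have "continuous_on UNIV f" using f_C3(1) by (meson DERIV_isCont continuous_at_imp_continuous_on)
  then have "f \<in> borel_measurable borel" by (rule borel_measurable_continuous_onI)
  then interpret target f f1 f2 f3 L
    using f_pos f_int f_C3 L mom8 by unfold_locales auto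
  have I_eq: "(LINT x|lborel. (f1 x / f x)\<^sup>2 * f x) = I"
    unfolding I_def by (subst integrable_fm_iff(2)) (simp_all add: g1_def)
  \<comment> \<open>The limiting standard deviation of the log acceptance ratio: about c d
    coordinates move, each contributing a variance of about l^2 I / d.\<close>
  define S where "S = l * sqrt (c0 * I)"
  define h where "h = 2 * c0 * l\<^sup>2 * Phi (- l * sqrt (c0 * I) / 2)"
  have S: "0 < S" unfolding S_def using l_pos c0_range I_pos by simp
  have S2: "S\<^sup>2 / I = c0 * l\<^sup>2" unfolding S_def using c0_range I_pos by (simp add: power_mult_distrib)
  have h: "h = 2 * (S\<^sup>2 / I) * Phi (- S / 2)" unfolding S2 by (simp add: h_def S_def mult.assoc)
  have h0: "0 \<le> h" unfolding h_def using c0_range Phi_nonneg by simp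
  let ?\<beta> = "\<lambda>a. h / 2 * g1 a"
  have \<beta>: "0 \<le> h / 2 * L" "\<bar>?\<beta> x - ?\<beta> y\<bar> \<le> h / 2 * L * \<bar>x - y\<bar>" for x y
  proof -
    show "0 \<le> h / 2 * L" using h0 L_nonneg by simp
    have "\<bar>?\<beta> x - ?\<beta> y\<bar> = h / 2 * \<bar>g1 x - g1 y\<bar>" unfolding right_diff_distrib[symmetric] abs_mult using h0 by simp
    then show "\<bar>?\<beta> x - ?\<beta> y\<bar> \<le> h / 2 * L * \<bar>x - y\<bar>" using mult_left_mono[OF g1_lip[of x y], of "h / 2"] h0 by simp
  qed
  have sol: "U \<omega> t = U \<omega> 0 + sqrt h * B \<omega> t + integral {0..t} (\<lambda>s. ?\<beta> (U \<omega> s))" if "0 \<le> t" for \<omega> t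
  proof -
    have "integral {0..t} (\<lambda>s. ?\<beta> (U \<omega> s)) = h / 2 * integral {0..t} (\<lambda>s. f1 (U \<omega> s) / f (U \<omega> s))"
      unfolding g1_def by (rule Henstock_Kurzweil_Integration.integral_mult_right)
    then show ?thesis using U_sde[unfolded I_eq, folded h_def] that by metis
  qed
  have U_lim: "(\<lambda>\<omega>. H (U \<omega>)) \<in> borel_measurable N"
      "(\<lambda>n. euler_law H n ?\<beta> (\<lambda>_. sqrt (h / real n))) \<longlonglongrightarrow> (\<integral>\<omega>. H (U \<omega>) \<partial>N)"
    if H: "lip_func K C T H" for K C T H
    unfolding euler_law_def
    by (rule euler_scheme_limit[where U=U and \<beta>="?\<beta>",
          OF N_prob B_BM U0_dist U0_indep U_cont[rule_format] sol \<beta> _ H h0]; measurable)+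

  \<comment> \<open>Starting at dimension 2 makes \<open>d - 1\<close> positive and all conditions
    valid for every index; the shift is undone at the end.\<close>
  let ?D = "\<lambda>d. d + 2" and ?k = "\<lambda>d. nat \<lfloor>real (d + 2) * c (d + 2)\<rfloor>" and ?\<sigma> = "\<lambda>d. l / sqrt (real (d + 2) - 1)"
  have k: "1 \<le> ?k d" "?k d \<le> ?D d" "real (?k d) = real (d + 2) * c (d + 2)" for d
  proof -
    have "(1::nat) \<le> d + 2" by simp
    from c_range[rule_format, OF this] obtain m :: nat where m: "0 < c (d + 2)" "c (d + 2) \<le> 1" "real (d + 2) * c (d + 2) = real m"
      by blast
    \<comment> \<open>The product d c_d is an integer by hypothesis, so taking the floor loses
      nothing.\<close>
    have km: "?k d = m" unfolding m(3) by simp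
    then show "real (?k d) = real (d + 2) * c (d + 2)" using m(3) by simp
    have "0 < real m" "real m \<le> real (d + 2)" unfolding m(3)[symmetric] using m(1,2) by (simp_all add: mult_left_le)
    then show "1 \<le> ?k d" "?k d \<le> ?D d" unfolding km by linarith+
  qed
  have inv: "(\<lambda>d. 1 / (real d + 1)) \<longlonglongrightarrow> 0" using LIMSEQ_inverse_real_of_nat by (simp add: inverse_eq_divide add.commute)
  from tendsto_mult[OF tendsto_const[of l] tendsto_real_sqrt[OF inv]]
  have \<sigma>: "?\<sigma> \<longlonglongrightarrow> 0" by (simp add: real_sqrt_divide add.commute)
  have pos: "0 < ?\<sigma> d" for d using l_pos by simp
  have sq: "(?\<sigma> d)\<^sup>2 = l\<^sup>2 / (real d + 1)" for d by (simp add: power_divide)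
  have "(real d + 2) / (real d + 1) = 1 + 1 / (real d + 1)" for d by (simp add: field_simps)
  then have "(\<lambda>d. (real d + 2) / (real d + 1)) \<longlonglongrightarrow> 1" using tendsto_add[OF tendsto_const[of 1] inv] by simp
  moreover have "(\<lambda>d. c (d + 2)) \<longlonglongrightarrow> c0" using c_lim by (rule LIMSEQ_ignore_initial_segment)
  ultimately have "(\<lambda>d. (real d + 2) / (real d + 1) * c (d + 2) * l\<^sup>2) \<longlonglongrightarrow> 1 * c0 * l\<^sup>2"
    by (intro tendsto_intros)
  moreover have "(real d + 2) / (real d + 1) * c (d + 2) * l\<^sup>2 = real (?k d) * (?\<sigma> d)\<^sup>2" for d
    unfolding k(3) sq by simp
  ultimately have kS: "(\<lambda>d. real (?k d) * (?\<sigma> d)\<^sup>2) \<longlonglongrightarrow> S\<^sup>2 / I" unfolding S2 by simp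
  have D: "filterlim ?D at_top sequentially" by (rule filterlim_add_const_nat_at_top)
  have Bd: "real (?D d) * (?\<sigma> d)\<^sup>2 \<le> 2 * l\<^sup>2" for d
  proof -
    have "real (?D d) * (?\<sigma> d)\<^sup>2 = (real d + 2) / (real d + 1) * l\<^sup>2" unfolding sq by simp
    also have "\<dots> \<le> 2 * l\<^sup>2" by (intro mult_right_mono) (auto simp: pos_divide_le_eq)
    finally show ?thesis .
  qed
  have chain: "rwg f f1 f2 f3 L (?D d) (?k d) (?\<sigma> d)" for d
    by unfold_locales (use k pos in auto)
  have "(\<lambda>d. \<integral>\<omega>. F (U_proc f (?D d) (?\<sigma> d) \<omega>) \<partial>rwg_space f (?D d) (?k d)) \<longlonglongrightarrow> (\<integral>\<omega>. F (U \<omega>) \<partial>N)"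
  proof (rule weak_convergence_lip_func[where Y="\<lambda>d. U_proc f (?D d) (?\<sigma> d)" and U=U, OF _ N_prob])
    show "\<forall>\<^sub>F d in sequentially. prob_space (rwg_space f (?D d) (?k d))"
    proof (rule always_eventually, rule allI)
      fix d
      interpret rwg f f1 f2 f3 L "?D d" "?k d" "?\<sigma> d" by (rule chain)
      show "prob_space (rwg_space f (?D d) (?k d))" unfolding Q_eq[symmetric] by (rule chain.Q.prob_space_axioms)
    qed
    show "cadlag (U_proc f (?D d) (?\<sigma> d) \<omega>)" for d \<omega>
    proof -
      interpret rwg f f1 f2 f3 L "?D d" "?k d" "?\<sigma> d" by (rule chain)
      show ?thesis unfolding U_proc_eq by (rule cadlag_pth)
    qed
    show "cadlag (U \<omega>)" for \<omega> by (rule cadlag_continuous_on[OF U_cont[rule_format]])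
    have meas: "(\<lambda>\<omega>. H (U_proc f (?D d) (?\<sigma> d) \<omega>)) \<in> borel_measurable (rwg_space f (?D d) (?k d))"
      if "\<And>n. (\<lambda>e. H (pth n e)) \<in> borel_measurable (PiM UNIV (\<lambda>_::nat. borel))" for d and H :: "(real \<Rightarrow> real) \<Rightarrow> real"
    proof -
      interpret rwg f f1 f2 f3 L "?D d" "?k d" "?\<sigma> d" by (rule chain)
      show ?thesis unfolding Q_eq[symmetric] U_proc_eq
        by (rule measurable_compose[OF _ that]) (intro measurable_to_PiM_UNIV coord_X_measurable)
    qed
    show "\<forall>\<^sub>F d in sequentially. (\<lambda>\<omega>. H (U_proc f (?D d) (?\<sigma> d) \<omega>)) \<in> borel_measurable (rwg_space f (?D d) (?k d))"
      if "lip_func K C T H" for K C T H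
      by (intro always_eventually allI meas borel_measurable_lip_func_pth[OF that])
    show "\<forall>\<^sub>F d in sequentially. (\<lambda>\<omega>. H (U_proc f (?D d) (?\<sigma> d) \<omega>)) \<in> borel_measurable (rwg_space f (?D d) (?k d))"
      if "skor_bounded_continuous H" for H
      by (intro always_eventually allI meas borel_measurable_skor_pth[OF that])
    show "(\<lambda>\<omega>. H (U \<omega>)) \<in> borel_measurable N" if "lip_func K C T H" for K C T H by (rule U_lim(1)[OF that])
    show "(\<lambda>d. \<integral>\<omega>. H (U_proc f (?D d) (?\<sigma> d) \<omega>) \<partial>rwg_space f (?D d) (?k d)) \<longlonglongrightarrow> (\<integral>\<omega>. H (U \<omega>) \<partial>N)"
      if "lip_func K C T H" for K C T H
      by (rule chain_functional_limit[OF k(1,2) \<sigma> pos kS S h D Bd that U_lim(2)[OF that]])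
    show "skor_bounded_continuous F" by (rule F_bc)
  qed
  then show ?thesis by (rule LIMSEQ_offset)
qed

end
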